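(* Let $p\ge q\ge1$, $n=p+q$, and let $D_\alpha$ be the open $SU(p,q)$-orbit in the manifold $Z$ of complete flags in $\mathbb{C}^n$ parametrized by the sequence $\alpha$ of $q$ signs $-$ and $p$ signs $+$. Then the following algorithm gives all the Schubert varieties (with respect to $B_I$) that intersect $D_\alpha$ and are of dimension $pq$, as well as their points of intersection with the base cycle of $D_\alpha$: (1) Take two copies $e$ and $w$ of $\alpha$. Step by step, for $i=1,\dots,q$ in this order, replace a $-$ and a $+$ in $e$ by the pair $e_i,e_{2q-i+1}$ and, in parallel, the signs in the same two places of $w$ by the pair $n-i+1,i$. (2) At each step, in $e$ the vector $e_i$ replaces a $-$ and $e_{2q-i+1}$ replaces a $+$, where the $-$ and the $+$ to be replaced must be adjacent, i.e. consecutive as $-+$ or $+-$, after ignoring the places already filled by previously introduced pairs. In $w$ the number $n-i+1$ is placed in the left one of the two places and $i$ in the right one (so if $e_i$ sits before $e_{2q-i+1}$ in $e$, then $n-i+1$ is placed at the spot of $e_i$ and $i$ at the spot of $e_{2q-i+1}$; otherwise $n-i+1$ is placed at the spot of $e_{2q-i+1}$ and $i$ at that of $e_i$). (3) The remaining single elements, $e_i$ for $2q+1\le i\le n$ in $e$ and $i$ for $q+1\le i\le p$ in $w$, are placed in the remaining spots in increasing order of their indices. Each $w$ obtained from this algorithm parametrizes an Iwasawa–Schubert variety $S_w$ that intersects the open orbit (its base cycle) in exactly one point, its corresponding $e$ (the complete coordinate flag of the ordered basis $e$). If $T_\alpha$ denotes the set of intersection points associated in this way with $D_\alpha$ and $\mathcal{D}$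 denotes the set of all open orbits $D_\alpha$, then the map $f:\mathcal{D}\to\mathcal{P}(\mathrm{Fix}(T))$, $D_\alpha\mapsto T_\alpha$, is injective.
   Context: $G=SL(n,\mathbb{C})$; $G_0=SU(p,q)$ is the isometry group (of determinant 1) of $h(v,w)=-\sum_{i=1}^qv_i\bar w_i+\sum_{i=1}^pv_{q+i}\bar w_{q+i}$; $K_0=S(U(q)\times U(p))$ is block diagonal. For a sequence $\alpha=\alpha_1\dots\alpha_n$ of signs with $q$ minus and $p$ plus signs, $D_\alpha$ is the open $G_0$-orbit of complete flags such that for each $k$ the restriction of $h$ to $V_k$ is non-degenerate with as many negative (positive) directions as there are $-$ ($+$) among $\alpha_1,\dots,\alpha_k$. These are all the open orbits. The base cycle of $D_\alpha$ is the unique $K_0$-orbit in $D_\alpha$ that is a complex submanifold. $T$ is the torus of diagonal matrices in $G$, $\mathrm{Fix}(T)\subset Z$ its fixed points (coordinate flags of the standard basis), $\mathcal{P}$ the power set. Let $(u_1,\dots,u_n)=(e_1+e_{2q},\dots,e_q+e_{q+1},e_{2q+1},\dots,e_n,e_q-e_{q+1},\dots,e_1-e_{2q})$ and let $B_I$ be the (Iwasawa–)Borel subgroup stabilizing the complete flag of this ordered basis. For $w\in\Sigma_n$ in one-line notation, the Iwasawa–Schubert variety $S_w$ is the closure of the $B_I$-orbit of the complete flag with $k$-th subspace $\langle u_{w(1)},\dots,u_{w(k)}\rangle$. "Intersection points" of $S_w$ associated with an open orbit are its points of intersection with the base cycle of that orbit. *)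

theory Defs
  imports "HOL-Analysis.Analysis" "HOL-Combinatorics.Multiset_Permutations"
begin

text \<open>
  The space \<open>\<complex>\<^sup>n\<close> is \<^typ>\<open>complex^'n\<close> for a finite, linearly ordered index type \<open>'n\<close>
  with \<open>CARD('n) = n = p + q\<close>; the coordinates are numbered \<open>1, \<dots>, n\<close> along the order of \<open>'n\<close>.
  Multiplication of a matrix \<open>A\<close> by a complex scalar \<open>c\<close> is written \<open>mat c ** A\<close>.
\<close>

type_synonym 'n cvec = "complex^'n"
type_synonym 'n cmat = "complex^'n^'n"

definition coord :: "nat \<Rightarrow> 'n::{finite,wellorder}" where
  "coord i = sorted_list_of_set UNIV ! (i - 1)"

definition e_vec :: "nat \<Rightarrow> 'n::{finite,wellorder} cvec" where
  "e_vec i = axis (coord i) 1"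


section \<open>The flag manifold\<close>

type_synonym 'n flag = "nat \<Rightarrow> 'n cvec set"

text \<open>
  A flag is the sequence \<open>V\<^sub>0 \<subseteq> V\<^sub>1 \<subseteq> \<dots>\<close>. The condition for \<open>k > n\<close> forces \<open>V\<^sub>k = \<complex>\<^sup>n\<close>, so that
  a flag is represented by exactly one function.
\<close>

definition complete_flags :: "'n::{finite,wellorder} flag set" where
  "complete_flags =
     {V. mono V \<and> (\<forall>k. vec.subspace (V k) \<and> vec.dim (V k) = min k CARD('n))}"

definition basis_flag :: "'n::{finite,wellorder} cvec list \<Rightarrow> 'n flag" where
  "basis_flag vs = (\<lambda>k. vec.span (set (take k vs)))"

definition act :: "'n::{finite,wellorder} cmat \<Rightarrow> 'n flag \<Rightarrow> 'n flag" where
  "act g V = (\<lambda>k. (\<lambda>v. g *v v) ` V k)"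

definition orbit :: "'n::{finite,wellorder} cmat set \<Rightarrow> 'n flag \<Rightarrow> 'n flag set" where
  "orbit H V = {act g V | g. g \<in> H}"

definition std_flag :: "'n::{finite,wellorder} flag" where
  "std_flag = basis_flag (map e_vec [1..<CARD('n) + 1])"

text \<open>The quotient topology of the surjection \<open>g \<mapsto> g \<cdot> std_flag\<close> from \<open>GL(n,\<complex>)\<close> to the flags.\<close>

definition flag_topology :: "'n::{finite,wellorder} flag topology" where
  "flag_topology =
     topology (\<lambda>U. U \<subseteq> complete_flags \<and> open {g. invertible g \<and> act g std_flag \<in> U})"

lemma openin_flag_topology:
  fixes U :: "'n::{finite,wellorder} flag set"
  shows "openin flag_topology U \<longleftrightarrow>
     U \<subseteq> complete_flags \<and> open {g. invertible g \<and> act g std_flag \<in> U}"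
proof -
  have "istopology (\<lambda>U. U \<subseteq> complete_flags \<and>
          open {g::'n cmat. invertible g \<and> act g std_flag \<in> U})"
    unfolding istopology_def
  proof (intro conjI allI impI)
    fix S T :: "'n flag set"
    assume "S \<subseteq> complete_flags \<and> open {g::'n cmat. invertible g \<and> act g std_flag \<in> S}"
      and "T \<subseteq> complete_flags \<and> open {g::'n cmat. invertible g \<and> act g std_flag \<in> T}"
    moreover have "{g::'n cmat. invertible g \<and> act g std_flag \<in> S \<inter> T} =
        {g. invertible g \<and> act g std_flag \<in> S} \<inter> {g. invertible g \<and> act g std_flag \<in> T}"
      by auto
    ultimately show "S \<inter> T \<subseteq> complete_flags"
      and "open {g::'n cmat. invertible g \<and> act g std_flag \<in> S \<inter> T}"
      by auto
  next
    fix K :: "'n flag set set"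
    assume K: "\<forall>S\<in>K. S \<subseteq> complete_flags \<and>
        open {g::'n cmat. invertible g \<and> act g std_flag \<in> S}"
    have "{g::'n cmat. invertible g \<and> act g std_flag \<in> \<Union>K} =
        (\<Union>S\<in>K. {g. invertible g \<and> act g std_flag \<in> S})"
      by auto
    with K show "\<Union>K \<subseteq> complete_flags"
      and "open {g::'n cmat. invertible g \<and> act g std_flag \<in> \<Union>K}"
      by auto
  qed
  then show ?thesis
    by (simp add: flag_topology_def topology_inverse')
qed


section \<open>Complex submanifolds and dimension\<close>

definition holomorphic_map ::
  "('n::{finite,wellorder} cmat \<Rightarrow> 'n cmat) \<Rightarrow> 'n cmat set \<Rightarrow> bool" where
  "holomorphic_map f U \<longleftrightarrow>
     (\<forall>x\<in>U. \<exists>f'. (f has_derivative f') (at x) \<and> (\<forall>c A. f' (mat c ** A) = mat c ** f' A))"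

definition biholomorphic_maps ::
  "'n::{finite,wellorder} cmat set \<Rightarrow> 'n cmat set \<Rightarrow>
   ('n cmat \<Rightarrow> 'n cmat) \<Rightarrow> ('n cmat \<Rightarrow> 'n cmat) \<Rightarrow> bool" where
  "biholomorphic_maps U V \<phi> \<psi> \<longleftrightarrow>
     open U \<and> open V \<and> homeomorphism U V \<phi> \<psi> \<and> holomorphic_map \<phi> U \<and> holomorphic_map \<psi> V"

text \<open>
  Near \<open>x\<close>, the set \<open>M\<close> is a complex submanifold of dimension \<open>d\<close> of the space of matrices:
  some holomorphic coordinate system turns it into a complex-linear subspace.
  \<^term>\<open>dim L\<close> is the real dimension, hence the factor 2.
\<close>

definition matrix_submanifold_at ::
  "nat \<Rightarrow> 'n::{finite,wellorder} cmat set \<Rightarrow> 'n cmat \<Rightarrow> bool" where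
  "matrix_submanifold_at d M x \<longleftrightarrow>
     (\<exists>U V \<phi> \<psi> L. x \<in> U \<and> biholomorphic_maps U V \<phi> \<psi> \<and>
        subspace L \<and> (\<forall>c. \<forall>A\<in>L. mat c ** A \<in> L) \<and> dim L = 2 * d \<and>
        \<phi> ` (M \<inter> U) = V \<inter> L)"

definition strictly_lower :: "'n::{finite,wellorder} cmat set" where
  "strictly_lower = {X. \<forall>i j. i \<le> j \<longrightarrow> X $ i $ j = 0}"

text \<open>
  For invertible \<open>g\<close>, the map \<open>X \<mapsto> flag_chart g X\<close> identifies the vector space of strictly lower
  triangular matrices with the translate by \<open>g\<close> of the big cell; the inverses of these maps form
  the holomorphic atlas of the flag manifold. A subset of that vector space is a submanifold of it
  iff it is a submanifold of the space of all matrices.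
\<close>

definition flag_chart ::
  "'n::{finite,wellorder} cmat \<Rightarrow> 'n cmat \<Rightarrow> 'n flag" where
  "flag_chart g X = act (g ** (mat 1 + X)) std_flag"

definition complex_submanifold :: "nat \<Rightarrow> 'n::{finite,wellorder} flag set \<Rightarrow> bool" where
  "complex_submanifold d M \<longleftrightarrow> M \<subseteq> complete_flags \<and>
     (\<forall>V\<in>M. \<exists>g X. invertible g \<and> X \<in> strictly_lower \<and> flag_chart g X = V \<and>
        matrix_submanifold_at d {Y \<in> strictly_lower. flag_chart g Y \<in> M} X)"

text \<open>
  A (possibly singular) subvariety has dimension \<open>d\<close> when a dense, relatively open part of it is a
  complex submanifold of dimension \<open>d\<close>.
\<close>

definition has_complex_dim :: "'n::{finite,wellorder} flag set \<Rightarrow> nat \<Rightarrow> bool" where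
  "has_complex_dim S d \<longleftrightarrow>
     (\<exists>M. openin (subtopology flag_topology S) M \<and> S \<subseteq> flag_topology closure_of M \<and>
        complex_submanifold d M)"


section \<open>Open orbits of \<open>SU(p,q)\<close> and their base cycles\<close>

definition herm_form ::
  "nat \<Rightarrow> nat \<Rightarrow> 'n::{finite,wellorder} cvec \<Rightarrow> 'n cvec \<Rightarrow> complex" where
  "herm_form p q v w =
     - (\<Sum>i=1..q. v $ coord i * cnj (w $ coord i)) +
     (\<Sum>i=1..p. v $ coord (q + i) * cnj (w $ coord (q + i)))"

definition SU :: "nat \<Rightarrow> nat \<Rightarrow> 'n::{finite,wellorder} cmat set" where
  "SU p q = {g. det g = 1 \<and> (\<forall>v w. herm_form p q (g *v v) (g *v w) = herm_form p q v w)}"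

definition open_orbits :: "nat \<Rightarrow> nat \<Rightarrow> 'n::{finite,wellorder} flag set set" where
  "open_orbits p q =
     {D. (\<exists>V\<in>complete_flags. D = orbit (SU p q) V) \<and> openin flag_topology D}"

definition nondegenerate_on ::
  "nat \<Rightarrow> nat \<Rightarrow> 'n::{finite,wellorder} cvec set \<Rightarrow> bool" where
  "nondegenerate_on p q W \<longleftrightarrow> (\<forall>v\<in>W. (\<forall>w\<in>W. herm_form p q v w = 0) \<longrightarrow> v = 0)"

definition negative_index :: "nat \<Rightarrow> nat \<Rightarrow> 'n::{finite,wellorder} cvec set \<Rightarrow> nat" where
  "negative_index p q W =
     Max {vec.dim N | N. vec.subspace N \<and> N \<subseteq> W \<and> (\<forall>v\<in>N. v \<noteq> 0 \<longrightarrow> Re (herm_form p q v v) < 0)}"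

definition positive_index :: "nat \<Rightarrow> nat \<Rightarrow> 'n::{finite,wellorder} cvec set \<Rightarrow> nat" where
  "positive_index p q W =
     Max {vec.dim N | N. vec.subspace N \<and> N \<subseteq> W \<and> (\<forall>v\<in>N. v \<noteq> 0 \<longrightarrow> Re (herm_form p q v v) > 0)}"

datatype sign = Minus | Plus

text \<open>
  The open orbit \<open>D\<^sub>\<alpha>\<close>: by Witt's theorem the flags with these prescribed signatures form a single
  \<open>SU(p,q)\<close>-orbit.
\<close>

definition sign_orbit :: "nat \<Rightarrow> nat \<Rightarrow> sign list \<Rightarrow> 'n::{finite,wellorder} flag set" where
  "sign_orbit p q \<alpha> =
     {V \<in> complete_flags. \<forall>k\<in>{1..p + q}. nondegenerate_on p q (V k) \<and>
        negative_index p q (V k) = count_list (take k \<alpha>) Minus \<and>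
        positive_index p q (V k) = count_list (take k \<alpha>) Plus}"

definition conj_transpose ::
  "'n::{finite,wellorder} cmat \<Rightarrow> 'n cmat" where
  "conj_transpose g = (\<chi> i j. cnj (g $ j $ i))"

text \<open>\<open>S(U(q) \<times> U(p))\<close>, block diagonal\<close>

definition K0 :: "nat \<Rightarrow> nat \<Rightarrow> 'n::{finite,wellorder} cmat set" where
  "K0 p q =
     {g. det g = 1 \<and> conj_transpose g ** g = mat 1 \<and>
        (\<forall>i\<in>{1..q}. \<forall>j\<in>{q + 1..p + q}. g $ coord i $ coord j = 0 \<and> g $ coord j $ coord i = 0)}"

definition base_cycle ::
  "nat \<Rightarrow> nat \<Rightarrow> 'n::{finite,wellorder} flag set \<Rightarrow> 'n flag set" where
  "base_cycle p q D =
     (THE C. (\<exists>V\<in>complete_flags. C = orbit (K0 p q) V) \<and> C \<subseteq> D \<and> (\<exists>d. complex_submanifold d C))"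

definition diagonal_torus :: "'n::{finite,wellorder} cmat set" where
  "diagonal_torus = {t. det t = 1 \<and> (\<forall>i j. i \<noteq> j \<longrightarrow> t $ i $ j = 0)}"

definition torus_fixed_points :: "'n::{finite,wellorder} flag set" where
  "torus_fixed_points = {V \<in> complete_flags. \<forall>t\<in>diagonal_torus. act t V = V}"


section \<open>Iwasawa--Schubert varieties\<close>

definition iwasawa_basis :: "nat \<Rightarrow> nat \<Rightarrow> 'n::{finite,wellorder} cvec list" where
  "iwasawa_basis p q =
     map (\<lambda>i. e_vec i + e_vec (2 * q + 1 - i)) [1..<q + 1] @
     map e_vec [2 * q + 1..<p + q + 1] @
     map (\<lambda>i. e_vec i - e_vec (2 * q + 1 - i)) (rev [1..<q + 1])"

definition iwasawa_borel :: "nat \<Rightarrow> nat \<Rightarrow> 'n::{finite,wellorder} cmat set" where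
  "iwasawa_borel p q =
     {g. det g = 1 \<and> act g (basis_flag (iwasawa_basis p q)) = basis_flag (iwasawa_basis p q)}"

text \<open>Here \<open>w\<close> is a permutation of \<open>{1..n}\<close> as the list \<open>[w(1), \<dots>, w(n)]\<close>.\<close>

definition schubert_variety ::
  "nat \<Rightarrow> nat \<Rightarrow> nat list \<Rightarrow> 'n::{finite,wellorder} flag set" where
  "schubert_variety p q w =
     flag_topology closure_of
       orbit (iwasawa_borel p q) (basis_flag (map (\<lambda>i. iwasawa_basis p q ! (i - 1)) w))"

text \<open>
  The intersection points with the base cycle of \<open>D\<close> of all Iwasawa--Schubert varieties of dimension
  \<open>pq\<close> that intersect \<open>D\<close>
\<close>

definition intersection_points ::
  "nat \<Rightarrow> nat \<Rightarrow> 'n::{finite,wellorder} flag set \<Rightarrow> 'n flag set" where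
  "intersection_points p q D =
     (\<Union>w \<in> {w \<in> permutations_of_set {1..p + q}.
              has_complex_dim (schubert_variety p q w :: 'n flag set) (p * q) \<and>
              schubert_variety p q w \<inter> D \<noteq> {}}.
        schubert_variety p q w \<inter> base_cycle p q D)"


section \<open>The algorithm\<close>

text \<open>
  The lists \<open>e\<close> and \<open>w\<close> contain signs (\<open>Inl\<close>) and numbers that have already been placed (\<open>Inr\<close>);
  in \<open>e\<close>, the number \<open>i\<close> stands for the vector \<open>e\<^sub>i\<close>. Places are counted from 0.
  \<^term>\<open>adjacent_signs e j k\<close> says that the places \<open>j < k\<close> are consecutive among those that still
  carry a sign.
\<close>

definition adjacent_signs :: "(sign + nat) list \<Rightarrow> nat \<Rightarrow> nat \<Rightarrow> bool" where
  "adjacent_signs e j k \<longleftrightarrow>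
     j < k \<and> k < length e \<and> isl (e ! j) \<and> isl (e ! k) \<and> (\<forall>l. j < l \<and> l < k \<longrightarrow> \<not> isl (e ! l))"

inductive algorithm_steps ::
  "nat \<Rightarrow> nat \<Rightarrow> sign list \<Rightarrow> nat \<Rightarrow> (sign + nat) list \<Rightarrow> (sign + nat) list \<Rightarrow> bool"
  for p q :: nat and \<alpha> :: "sign list"
where
  start: "algorithm_steps p q \<alpha> 0 (map Inl \<alpha>) (map Inl \<alpha>)"
| minus_plus:
    "\<lbrakk>algorithm_steps p q \<alpha> (i - 1) e w; 1 \<le> i; i \<le> q;
      adjacent_signs e j k; e ! j = Inl Minus; e ! k = Inl Plus\<rbrakk> \<Longrightarrow>
     algorithm_steps p q \<alpha> i
       (e[j := Inr i, k := Inr (2 * q - i + 1)])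
       (w[j := Inr (p + q - i + 1), k := Inr i])"
| plus_minus:
    "\<lbrakk>algorithm_steps p q \<alpha> (i - 1) e w; 1 \<le> i; i \<le> q;
      adjacent_signs e j k; e ! j = Inl Plus; e ! k = Inl Minus\<rbrakk> \<Longrightarrow>
     algorithm_steps p q \<alpha> i
       (e[j := Inr (2 * q - i + 1), k := Inr i])
       (w[j := Inr (p + q - i + 1), k := Inr i])"

fun fill_signs :: "nat \<Rightarrow> (sign + nat) list \<Rightarrow> nat list" where
  "fill_signs m [] = []"
| "fill_signs m (Inl s # xs) = m # fill_signs (Suc m) xs"
| "fill_signs m (Inr i # xs) = i # fill_signs m xs"

definition algorithm_output ::
  "nat \<Rightarrow> nat \<Rightarrow> sign list \<Rightarrow> nat list \<Rightarrow> nat list \<Rightarrow> bool" where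
  "algorithm_output p q \<alpha> \<epsilon> \<omega> \<longleftrightarrow>
     (\<exists>e w. algorithm_steps p q \<alpha> q e w \<and>
        \<epsilon> = fill_signs (2 * q + 1) e \<and> \<omega> = fill_signs (q + 1) w)"

end

theory Submission
  imports Defs
begin

text \<open>
Everything is expressed through matrices: a flag is \<open>act A std_flag\<close>, and the orbit of \<open>B\<^sub>I\<close> through
  the flag of \<open>u\<^bsub>w(1)\<^esub>, \<dots>, u\<^bsub>w(n)\<^esub>\<close> is the Bruhat cell \<open>U\<^sup>-\<^sup>1 A \<in> B w B\<close> for the upper triangular group \<open>B\<close> and the
  matrix \<open>U\<close> of the Iwasawa basis; its dimension is the number of inversions of \<open>w\<close>.

  Let \<open>J = diag(-1, \<dots>, -1, 1, \<dots>, 1)\<close>. The base cycle of \<open>D\<^sub>\<alpha>\<close> consists of its \<open>J\<close>-stable flags. By the Iwasawa decomposition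
  a cell that meets \<open>D\<^sub>\<alpha>\<close> meets the base cycle. For a point \<open>V\<close> of the base cycle in the cell of \<open>w\<close>, the map \<open>X \<mapsto> X + J X J\<close> is injective
  on the nilpotent matrices that lower both the Iwasawa flag and \<open>V\<close>, and its values lower \<open>V\<close> and commute with \<open>J\<close>.
  Comparing dimensions, \<open>w\<close> has at least \<open>p q\<close> inversions, and in the case of equality \<open>V\<close> is stable under
  the diagonal matrices that are symmetric under \<open>e\<^sub>i \<leftrightarrow> e\<^bsub>2q+1-i\<^esub>\<close>; hence \<open>V\<close> is a coordinate flag. For a coordinate flag
  the permutation \<open>w\<close> is explicit, and its number of inversions exceeds \<open>p q\<close> by a sum of counts that vanish exactly for the
  outputs of the algorithm. A boundary point of a cell lies in a cell with fewer inversions, so a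
  Schubert variety of dimension \<open>p q\<close> meets the base cycle only in its open cell.
\<close>

subsection \<open>Coordinates, matrices and flags\<close>

text \<open>Why \<open>X + J X J\<close> determines \<open>X\<close>: in the Iwasawa basis
  \<open>u\<close> the involution is, up to signs, the reversal of the outer coordinates. It throws
  strictly upper triangular entries below the diagonal except inside the middle block, where it is
  the identity and \<open>J X J = - X\<close> reads \<open>X = - X\<close>. The constant
  \<open>p * q\<close>: of the \<open>N = n(n-1)/2\<close> pairs of places, those with opposite
  signs in \<alpha> number \<open>p * q\<close>, so the target has dimension
  \<open>N - p * q\<close>, while the source has dimension \<open>N\<close> minus the inversions of
  \<open>w\<close>. In the case of equality the map is onto, and the trace form, under which upper
  triangular matrices annihilate strictly upper triangular ones, carries the stability under a
  diagonal \<open>t\<close> from the Iwasawa flag over to \<open>V\<close>. Two definitions force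
  some analysis. A dimension given by a dense relatively open submanifold is unambiguous only
  through invariance of dimension. And the base cycle is a definite description: a complex
  \<open>K0\<close>-orbit must be shown to consist of \<open>J\<close>-stable flags, by comparing
  the velocity of the circle generated by \<open>J\<close> with \<open>-i\<close> times that
  velocity, which is again tangent to the orbit.\<close>

definition idx :: "'n::{finite,wellorder} \<Rightarrow> nat" where
  "idx = the_inv_into {1..CARD('n)} coord"

lemma coord_strict_mono:
  assumes "1 \<le> i" "i < j" "j \<le> CARD('n)"
  shows "(coord i :: 'n::{finite,wellorder}) < coord j"
proof -
  have "sorted_wrt (<) (sorted_list_of_set (UNIV :: 'n set))" by simp
  then show ?thesis
    unfolding coord_def by (rule sorted_wrt_nth_less) (use assms in auto)
qed

lemma coord_bij: "bij_betw coord {1..CARD('n)} (UNIV :: 'n::{finite,wellorder} set)"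
proof -
  have inj: "inj_on (coord :: nat \<Rightarrow> 'n) {1..CARD('n)}"
    by (rule linorder_inj_onI) (use coord_strict_mono in \<open>fastforce+\<close>)
  then have "card (coord ` {1..CARD('n)} :: 'n set) = CARD('n)" by (simp add: card_image)
  then have "coord ` {1..CARD('n)} = (UNIV :: 'n set)" by (intro card_subset_eq) auto
  with inj show ?thesis by (simp add: bij_betw_def)
qed

lemma coord_idx [simp]: "coord (idx a) = (a :: 'n::{finite,wellorder})"
  unfolding idx_def by (intro f_the_inv_into_f_bij_betw[OF coord_bij]) auto

lemma idx_range: "idx (a :: 'n::{finite,wellorder}) \<in> {1..CARD('n)}"
  unfolding idx_def using coord_bij the_inv_into_into[of coord "{1..CARD('n)}" a "{1..CARD('n)}"]
  by (auto simp: bij_betw_def)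

lemma idx_ge [simp]: "Suc 0 \<le> idx (a :: 'n::{finite,wellorder})"
  and idx_le [simp]: "idx (a :: 'n::{finite,wellorder}) \<le> CARD('n)"
  using idx_range[of a] by auto

lemma idx_coord: "1 \<le> i \<Longrightarrow> i \<le> CARD('n) \<Longrightarrow> idx (coord i :: 'n::{finite,wellorder}) = i"
  unfolding idx_def by (intro the_inv_into_f_f) (use coord_bij in \<open>auto simp: bij_betw_def\<close>)

lemma idx_eq_iff [simp]: "idx a = idx b \<longleftrightarrow> a = b"
  by (metis coord_idx)

lemma idx_less_iff [simp]: "idx a < idx b \<longleftrightarrow> a < b" for a b :: "'n::{finite,wellorder}"
proof -
  have "idx a < idx b \<Longrightarrow> a < b" for a b :: 'n
    using coord_strict_mono[where 'n='n, of "idx a" "idx b"] by simp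
  from this[of a b] this[of b a] show ?thesis
    by (metis idx_eq_iff linorder_less_linear order_less_asym)
qed

lemma idx_le_iff [simp]: "idx a \<le> idx b \<longleftrightarrow> a \<le> b"
  by (metis idx_less_iff not_le)

lemma idx_bij: "bij_betw idx (UNIV :: 'n::{finite,wellorder} set) {1..CARD('n)}"
  by (rule bij_betw_byWitness[of _ coord]) (auto simp: idx_coord)

lemma e_vec_nth: "1 \<le> i \<Longrightarrow> i \<le> CARD('n) \<Longrightarrow>
    e_vec i $ (a :: 'n::{finite,wellorder}) = (if idx a = i then 1 else 0)"
  unfolding e_vec_def axis_def by (auto simp: idx_coord)

lemma e_vec_idx [simp]: "e_vec (idx a) = axis (a :: 'n::{finite,wellorder}) 1"
  by (simp add: e_vec_def)

section \<open>Matrices given by their columns, and the standard flag\<close>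

definition colmat :: "(nat \<Rightarrow> 'n::{finite,wellorder} cvec) \<Rightarrow> 'n cmat" where
  "colmat y = (\<chi> i j. y (idx j) $ i)"

lemma diagonal_mult:
  fixes D :: "'a::semiring_1^'n^'n"
  assumes "\<And>i j. i \<noteq> j \<Longrightarrow> D $ i $ j = 0"
  shows "(D *v x) $ i = D $ i $ i * x $ i"
proof -
  have "(D *v x) $ i = (\<Sum>j\<in>UNIV. if j = i then D $ i $ i * x $ i else 0)"
    unfolding matrix_vector_mult_def vec_lambda_beta by (intro sum.cong) (auto simp: assms)
  then show ?thesis by simp
qed

lemma mult_axis: "A *v axis k 1 = column k A" for A :: "'a::comm_ring_1^'n^'m"
  by (simp add: vec_eq_iff matrix_vector_mult_def column_def axis_def if_distrib cong: if_cong)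

lemma mult_e_vec: "1 \<le> i \<Longrightarrow> i \<le> CARD('n) \<Longrightarrow>
    A *v e_vec i = (\<chi> a. A $ a $ coord i)" for A :: "'n::{finite,wellorder} cmat"
  by (simp add: e_vec_def mult_axis column_def)

lemma colmat_e_vec [simp]: "1 \<le> i \<Longrightarrow> i \<le> CARD('n) \<Longrightarrow>
    colmat y *v e_vec i = (y i :: 'n::{finite,wellorder} cvec)"
  by (simp add: mult_e_vec colmat_def vec_eq_iff idx_coord)

lemma colmat_mult: "A *v x = (\<Sum>i=1..CARD('n). x $ coord i *s (A *v e_vec i))"
  for A :: "'n::{finite,wellorder} cmat"
proof -
  have "A *v x = (\<Sum>a\<in>UNIV. x $ a *s (A *v axis a 1))"
    unfolding mult_axis by (rule matrix_mult_sum)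
  also have "\<dots> = (\<Sum>i=1..CARD('n). x $ coord i *s (A *v e_vec i))"
    unfolding e_vec_def using sum.reindex_bij_betw[OF coord_bij, of "\<lambda>a. x $ a *s (A *v axis a 1)"] by simp
  finally show ?thesis .
qed

lemma mat_eqI:
  fixes A B :: "'n::{finite,wellorder} cmat"
  assumes "\<And>i. 1 \<le> i \<Longrightarrow> i \<le> CARD('n) \<Longrightarrow> A *v e_vec i = B *v e_vec i"
  shows "A = B"
  unfolding matrix_eq
proof
  fix x show "A *v x = B *v x"
    unfolding colmat_mult[of A x] colmat_mult[of B x] using assms by (intro sum.cong) auto
qed

lemma std_flag_alt: "std_flag k = vec.span (e_vec ` {1..min k CARD('n)} :: 'n::{finite,wellorder} cvec set)"
proof -
  have "set (take k (map e_vec [1..<CARD('n) + 1])) = (e_vec ` {1..min k CARD('n)} :: 'n cvec set)"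
    by (cases "k \<le> CARD('n)") (auto simp: take_map min_def image_iff simp del: upt_Suc)
  then show ?thesis by (simp add: std_flag_def basis_flag_def)
qed

lemma span_e_vec:
  assumes "S \<subseteq> {1..CARD('n)}"
  shows "vec.span (e_vec ` S) = {x :: 'n::{finite,wellorder} cvec. \<forall>a. idx a \<notin> S \<longrightarrow> x $ a = 0}" (is "?L = ?R")
proof -
  have sub: "vec.subspace ?R" by (auto simp: vec.subspace_def)
  have "e_vec ` S \<subseteq> ?R" using assms by (auto simp: e_vec_nth subset_iff)
  then have "?L \<subseteq> ?R" by (rule vec.span_minimal[OF _ sub])
  moreover have "x \<in> ?L" if "x \<in> ?R" for x :: "'n cvec"
  proof -
    have "x = (\<Sum>a\<in>UNIV. x $ a *s axis a 1)" by (simp add: basis_expansion)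
    also have "\<dots> = (\<Sum>a\<in>UNIV. if idx a \<in> S then x $ a *s e_vec (idx a) else 0)"
      using that by (intro sum.cong) auto
    also have "\<dots> \<in> ?L"
      by (intro vec.span_sum)
        (auto intro!: vec.span_scale vec.span_base[OF imageI] vec.span_zero simp del: e_vec_idx)
    finally show ?thesis .
  qed
  ultimately show ?thesis by blast
qed

lemma dim_span_e_vec:
  assumes "S \<subseteq> {1..CARD('n)}"
  shows "vec.dim {x :: 'n::{finite,wellorder} cvec. \<forall>a. idx a \<notin> S \<longrightarrow> x $ a = 0} = card S"
proof -
  have "bij_betw idx {a :: 'n. idx a \<in> S} S"
    using assms by (intro bij_betw_byWitness[of _ coord]) (auto simp: idx_coord subset_iff)
  then show ?thesis
    using dim_substandard_cart[of "{a :: 'n. idx a \<in> S}"] by (simp add: bij_betw_same_card)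
qed

lemma std_flag_eq: "std_flag k = {x :: 'n::{finite,wellorder} cvec. \<forall>a. k < idx a \<longrightarrow> x $ a = 0}"
  unfolding std_flag_alt by (subst span_e_vec) (auto simp: not_le)

lemma std_flag_subspace [simp]: "vec.subspace (std_flag k)"
  by (simp add: std_flag_alt)

lemma std_flag_dim: "vec.dim (std_flag k :: 'n::{finite,wellorder} cvec set) = min k CARD('n)"
proof -
  have "std_flag k = {x :: 'n cvec. \<forall>a. idx a \<notin> {1..min k CARD('n)} \<longrightarrow> x $ a = 0}"
    by (auto simp: std_flag_eq not_le)
  then have "vec.dim (std_flag k :: 'n cvec set) = card {1..min k CARD('n)}"
    by (simp only:) (rule dim_span_e_vec, auto)
  then show ?thesis by simp
qed

lemma std_flag_mono: "k \<le> l \<Longrightarrow> std_flag k \<subseteq> std_flag l"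
  by (auto simp: std_flag_eq)

lemma std_flag_full: "CARD('n) \<le> k \<Longrightarrow> std_flag k = (UNIV :: 'n::{finite,wellorder} cvec set)"
  by (auto simp: std_flag_eq dest: order.strict_trans2[OF _ idx_le])

section \<open>Matrices acting on flags\<close>

lemma act_mult: "act (g ** h) V = act g (act h V)"
  by (simp add: act_def image_image matrix_vector_mul_assoc)

lemma act_one [simp]: "act (mat 1) V = V"
  by (simp add: act_def)

lemma invertible_mat_1 [simp]: "invertible (mat 1 :: 'a::semiring_1^'n^'n)"
  unfolding invertible_def by (rule exI[of _ "mat 1"]) simp

lemma matrix_inv_right' [simp]: "invertible A \<Longrightarrow> A ** matrix_inv A = mat 1"
  and matrix_inv_left' [simp]: "invertible A \<Longrightarrow> matrix_inv A ** A = mat 1" for A :: "'a::semiring_1^'n^'n"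
  unfolding invertible_def matrix_inv_def by (metis (mono_tags, lifting) someI_ex)+

lemma invertible_matrix_inv [simp]: "invertible A \<Longrightarrow> invertible (matrix_inv A)" for A :: "'a::semiring_1^'n^'n"
  unfolding invertible_def using matrix_inv_left' matrix_inv_right' unfolding invertible_def by metis

lemma inv_mult_vec [simp]: "invertible A \<Longrightarrow> matrix_inv A *v (A *v x) = x"
  "invertible A \<Longrightarrow> A *v (matrix_inv A *v x) = x" for A :: "'a::comm_semiring_1^'n^'n"
  by (simp_all add: matrix_vector_mul_assoc)

lemma inv_mult_mat [simp]: "invertible A \<Longrightarrow> matrix_inv A ** (A ** B) = B"
  "invertible A \<Longrightarrow> A ** (matrix_inv A ** B) = B" for A :: "'a::comm_semiring_1^'n^'n"
  by (simp_all add: matrix_mul_assoc)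

lemma invertible_inj: "invertible A \<Longrightarrow> inj ((*v) A)" for A :: "'a::comm_semiring_1^'n^'n"
  by (metis inj_on_inverseI inv_mult_vec(1))

lemma act_std_flag: "act g std_flag k = vec.span ((\<lambda>i. g *v e_vec i) ` {1..min k CARD('n)})"
  for g :: "'n::{finite,wellorder} cmat"
  by (simp add: act_def std_flag_alt image_image flip: vec.span_image)

lemma act_std_flag_iff: "invertible g \<Longrightarrow> v \<in> act g std_flag k \<longleftrightarrow> matrix_inv g *v v \<in> std_flag k"
  for g :: "'n::{finite,wellorder} cmat"
  by (auto simp: act_def) (metis image_eqI inv_mult_vec(2))

lemma act_complete_flags: "invertible g \<Longrightarrow> V \<in> complete_flags \<Longrightarrow> act g V \<in> complete_flags"
  by (auto simp: complete_flags_def act_def mono_def vec.subspace_image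
      vec.dim_image_eq[OF matrix_vector_mul_linear_gen inj_on_subset[OF invertible_inj]]
      simp: le_fun_def intro: image_eqI)

lemma std_flag_in_complete_flags [simp]: "std_flag \<in> complete_flags"
  by (auto simp: complete_flags_def std_flag_dim mono_def dest: std_flag_mono)

lemma act_std_flag_complete [simp]: "invertible g \<Longrightarrow> act g std_flag \<in> complete_flags"
  by (simp add: act_complete_flags)

lemma invertible_iff_surj: "invertible A \<longleftrightarrow> surj ((*v) A)" for A :: "'a::field^'n^'n"
  by (metis (no_types, lifting) invertible_right_inverse matrix_right_invertible_surjective)

lemma invertible_iff_inj: "invertible A \<longleftrightarrow> (\<forall>x. A *v x = 0 \<longrightarrow> x = 0)" for A :: "'a::field^'n^'n"
  by (metis (no_types, lifting) invertible_left_inverse matrix_left_invertible_ker)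

section \<open>Complete flags and adapted bases\<close>

lemma complete_flagsD:
  fixes V :: "'n::{finite,wellorder} flag"
  assumes "V \<in> complete_flags"
  shows "mono V" "vec.subspace (V k)" "vec.dim (V k) = min k CARD('n)"
    "V 0 = {0}" "CARD('n) \<le> k \<Longrightarrow> V k = UNIV"
proof -
  show "mono V" "vec.subspace (V k)" and d: "vec.dim (V k) = min k CARD('n)" for k
    using assms by (auto simp: complete_flags_def)
  have "vec.subspace (V 0)" "vec.dim (V 0) = 0" using assms by (auto simp: complete_flags_def)
  then show "V 0 = {0}" using vec.subspace_0 by (auto simp: vec.dim_eq_0)
  assume "CARD('n) \<le> k"
  then have "vec.dim (V k) = vec.dim (UNIV :: 'n cvec set)" by (simp only: d vec.dim_UNIV vec_dim_card min_absorb2 card_cart_basis)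
  with \<open>vec.subspace (V k)\<close> show "V k = UNIV"
    by (intro vec.subspace_dim_equal) auto
qed

lemma complete_flag_eqI:
  assumes "V \<in> complete_flags" "W \<in> complete_flags" "\<And>k. V k \<subseteq> W k"
  shows "V = W"
proof
  fix k show "V k = W k"
    by (rule vec.subspace_dim_equal) (use assms in \<open>auto simp: complete_flagsD\<close>)
qed

text \<open>Each \<open>y k\<close> lies outside the preceding step and so raises the dimension of
  the span by one; the span is contained in \<open>V k\<close> and has its dimension.\<close>

lemma adapted_span:
  fixes V :: "'n::{finite,wellorder} flag"
  assumes V: "V \<in> complete_flags"
    and y: "\<And>k. 1 \<le> k \<Longrightarrow> k \<le> m \<Longrightarrow> y k \<in> V k \<and> y k \<notin> V (k - 1)"
    and m: "m \<le> CARD('n)" "k \<le> m"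
  shows "V k = vec.span (y ` {1..k})"
  using m(2)
proof (induction k)
  case 0 then show ?case using complete_flagsD[OF V] by simp
next
  case (Suc k)
  have IH: "V k = vec.span (y ` {1..k})" using Suc by simp
  have yk: "y (Suc k) \<in> V (Suc k)" "y (Suc k) \<notin> V k" using y[of "Suc k"] Suc by auto
  have "V k \<subseteq> V (Suc k)" using complete_flagsD(1)[OF V] by (simp add: monoD)
  then have sub: "vec.span (y ` {1..Suc k}) \<subseteq> V (Suc k)"
    using IH yk complete_flagsD(2)[OF V] vec.span_superset[of "y ` {1..k}"]
    by (intro vec.span_minimal) (auto simp: atLeastAtMostSuc_conv)
  have "vec.dim (vec.span (y ` {1..Suc k})) = Suc (vec.dim (vec.span (y ` {1..k})))"
    using yk(2) by (simp add: IH vec.dim_insert atLeastAtMostSuc_conv)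
  also have "\<dots> = vec.dim (V (Suc k))" using Suc.prems m by (simp only: IH[symmetric] complete_flagsD[OF V])
  finally show ?case
    using sub complete_flagsD(2)[OF V] by (intro vec.subspace_dim_equal[symmetric]) auto
qed

text \<open>The columns span the last step of the flag, which is the whole space; this is what makes
  the frame invertible.\<close>

lemma flag_of_adapted_basis:
  fixes V :: "'n::{finite,wellorder} flag"
  assumes V: "V \<in> complete_flags"
    and y: "\<And>k. 1 \<le> k \<Longrightarrow> k \<le> CARD('n) \<Longrightarrow> y k \<in> V k \<and> y k \<notin> V (k - 1)"
  shows "invertible (colmat y)" "V = act (colmat y) std_flag"
proof -
  note * = adapted_span[OF V y order_refl]
  have im: "(\<lambda>i. colmat y *v e_vec i) ` {1..min k CARD('n)} = y ` {1..min k CARD('n)}" for k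
    by (auto intro!: image_cong)
  show eq: "V = act (colmat y) std_flag"
  proof
    fix k show "V k = act (colmat y) std_flag k"
      using *[of "min k CARD('n)"] complete_flagsD(5)[OF V]
      by (cases "k \<le> CARD('n)") (auto simp: act_std_flag im min_def)
  qed
  have "act (colmat y) std_flag CARD('n) = UNIV" using complete_flagsD(5)[OF V] eq by simp
  then have "surj ((*v) (colmat y))" by (auto simp: act_def std_flag_full)
  then show "invertible (colmat y)" by (simp add: invertible_iff_surj)
qed

lemma complete_flagsE:
  fixes V :: "'n::{finite,wellorder} flag"
  assumes V: "V \<in> complete_flags"
  obtains g where "invertible g" "V = act g std_flag"
proof -
  have "\<exists>v. v \<in> V k \<and> v \<notin> V (k - 1)" if "1 \<le> k" "k \<le> CARD('n)" for k
  proof (rule ccontr)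
    assume "\<not> ?thesis"
    then have "V k \<subseteq> V (k - 1)" by auto
    then have "vec.dim (V k) \<le> vec.dim (V (k - 1))" by (rule vec.dim_subset)
    with that show False by (simp add: complete_flagsD[OF V])
  qed
  then obtain y where "\<And>k. 1 \<le> k \<Longrightarrow> k \<le> CARD('n) \<Longrightarrow> y k \<in> V k \<and> y k \<notin> V (k - 1)" by metis
  from flag_of_adapted_basis[OF V this] show ?thesis using that by blast
qed

lemma basis_flag_map:
  "length w = CARD('n) \<Longrightarrow>
    basis_flag (map y w) = act (colmat (\<lambda>k. y (w ! (k - 1)) :: 'n::{finite,wellorder} cvec)) std_flag"
proof (rule ext)
  fix k assume w: "length w = CARD('n)"
  have "set (take k (map y w)) = (\<lambda>i. y (w ! i)) ` {..<min k CARD('n)}"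
    using w by (auto simp: set_conv_nth image_iff intro!: exI)
  also have "\<dots> = (\<lambda>k. y (w ! (k - 1))) ` Suc ` {..<min k CARD('n)}"
    by (simp only: image_image diff_Suc_1)
  also have "\<dots> = (\<lambda>k. y (w ! (k - 1))) ` {1..min k CARD('n)}"
    by (simp only: image_Suc_lessThan)
  also have "\<dots> = (\<lambda>i. colmat (\<lambda>k. y (w ! (k - 1))) *v e_vec i) ` {1..min k CARD('n)}"
    by (auto intro!: image_cong)
  finally show "basis_flag (map y w) k = act (colmat (\<lambda>k. y (w ! (k - 1)))) std_flag k"
    by (simp add: basis_flag_def act_std_flag)
qed

section \<open>The stabilizer of the standard flag in the general linear group\<close>

definition upper_borel :: "'n::{finite,wellorder} cmat set" where
  "upper_borel = {b. invertible b \<and> act b std_flag = std_flag}"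

lemma upper_borelI_subset:
  assumes "invertible b" "\<And>k. k \<le> CARD('n) \<Longrightarrow> (*v) b ` std_flag k \<subseteq> std_flag k"
  shows "(b :: 'n::{finite,wellorder} cmat) \<in> upper_borel"
proof -
  have "act b std_flag k \<subseteq> std_flag k" for k
    using assms(2)[of k] by (cases "k \<le> CARD('n)") (auto simp: act_def std_flag_full)
  then have "act b std_flag = std_flag"
    using assms by (intro complete_flag_eqI) auto
  with assms show ?thesis by (simp add: upper_borel_def)
qed

lemma upper_borel_mult: "a \<in> upper_borel \<Longrightarrow> b \<in> upper_borel \<Longrightarrow> a ** b \<in> upper_borel"
  by (auto simp: upper_borel_def act_mult invertible_mult)

lemma upper_borel_one [simp]: "mat 1 \<in> upper_borel"
  by (simp add: upper_borel_def)

lemma upper_borel_inv: "a \<in> upper_borel \<Longrightarrow> matrix_inv a \<in> upper_borel"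
  by (auto simp: upper_borel_def) (metis act_mult act_one matrix_inv_left')

lemma upper_borel_mem: "b \<in> upper_borel \<Longrightarrow> b *v x \<in> std_flag k \<longleftrightarrow> x \<in> std_flag k"
proof -
  assume b: "b \<in> upper_borel"
  then have "std_flag k = (*v) b ` std_flag k" by (simp add: upper_borel_def act_def fun_eq_iff)
  moreover have "inj ((*v) b)" using b by (simp add: upper_borel_def invertible_inj)
  ultimately show ?thesis by (metis inj_image_mem_iff)
qed

lemma upper_borel_invertible: "b \<in> upper_borel \<Longrightarrow> invertible b"
  by (simp add: upper_borel_def)

lemma act_upper_borel: "b \<in> upper_borel \<Longrightarrow> act (g ** b) std_flag = act g std_flag"
  unfolding act_mult by (simp add: upper_borel_def)

text \<open>The flag manifold as the quotient of the general linear group by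
  \<open>upper_borel\<close>. Working with all invertible matrices postpones the condition on the
  determinant: a scalar factor does not move a flag.\<close>

lemma act_eq_iff:
  assumes "invertible g" "invertible h"
  shows "act g std_flag = act h std_flag \<longleftrightarrow> matrix_inv h ** g \<in> upper_borel"
proof
  assume "act g std_flag = act h std_flag"
  then show "matrix_inv h ** g \<in> upper_borel"
    using assms by (simp add: upper_borel_def invertible_mult act_mult) (simp flip: act_mult)
next
  assume "matrix_inv h ** g \<in> upper_borel"
  then have "act h (act (matrix_inv h ** g) std_flag) = act h std_flag" by (simp add: upper_borel_def)
  then show "act g std_flag = act h std_flag" using assms by (simp flip: act_mult)
qed

lemma upper_borelI_upper:
  assumes "invertible b" "\<And>i j. j < i \<Longrightarrow> b $ i $ j = 0"
  shows "(b :: 'n::{finite,wellorder} cmat) \<in> upper_borel"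
proof (rule upper_borelI_subset[OF assms(1)], safe)
  fix k and x :: "'n cvec" assume x: "x \<in> std_flag k"
  have "b $ a $ c * x $ c = 0" if "k < idx a" for a c
  proof (cases "c < a")
    case False
    then have "k < idx c" using that by (meson idx_le_iff less_le_trans not_less)
    with x show ?thesis by (simp add: std_flag_eq)
  qed (simp add: assms)
  then show "b *v x \<in> std_flag k" by (auto simp: std_flag_eq matrix_vector_mult_def intro!: sum.neutral)
qed

lemma upper_borel_upper:
  assumes "(b :: 'n::{finite,wellorder} cmat) \<in> upper_borel" "j < i"
  shows "b $ i $ j = 0"
proof -
  have "b *v e_vec (idx j) \<in> std_flag (idx j)" using assms(1) by (simp only: upper_borel_mem) (simp add: std_flag_eq axis_def)
  with assms(2) have "(b *v e_vec (idx j)) $ i = 0" by (simp add: std_flag_eq)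
  then show ?thesis by (simp add: mult_e_vec del: e_vec_idx)
qed

subsection \<open>Topology\<close>

lemma continuous_on_matrix_mult [continuous_intros]:
  fixes f g :: "'x::topological_space \<Rightarrow> 'n::{finite,wellorder} cmat"
  shows "continuous_on S f \<Longrightarrow> continuous_on S g \<Longrightarrow> continuous_on S (\<lambda>x. f x ** g x)"
  unfolding matrix_matrix_mult_def by (intro continuous_intros)

lemma continuous_on_det_complex [continuous_intros]:
  fixes f :: "'x::topological_space \<Rightarrow> 'n::{finite,wellorder} cmat"
  shows "continuous_on S f \<Longrightarrow> continuous_on S (\<lambda>x. det (f x))"
  unfolding det_def by (intro continuous_intros)

lemma open_invertible: "open {g :: 'n::{finite,wellorder} cmat. invertible g}"
proof -
  have "open {g :: 'n cmat. det g \<noteq> 0}"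
    by (intro open_Collect_neq continuous_intros)
  then show ?thesis by (simp add: invertible_det_nz)
qed

lemma topspace_flag_topology [simp]: "topspace flag_topology = complete_flags"
proof -
  have "{g :: 'a cmat. invertible g \<and> act g std_flag \<in> complete_flags} = {g. invertible g}" by auto
  then have "openin flag_topology (complete_flags :: 'a flag set)"
    using open_invertible[where 'n='a] by (simp only: openin_flag_topology subset_refl simp_thms)
  then show ?thesis
    using openin_subset by (fastforce simp: topspace_def openin_flag_topology)
qed

lemma open_flag_preimage:
  assumes "openin flag_topology T"
  shows "open {g :: 'n::{finite,wellorder} cmat. invertible g \<and> act g std_flag \<in> T}"
  using assms by (simp add: openin_flag_topology)

subsection \<open>Inversions and the rank order on permutations\<close>

text \<open>The set of places is a parameter because pairs of places are removed one after the other
  in \<open>inv_on_pairing\<close>.\<close>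

definition inv_on :: "nat set \<Rightarrow> (nat \<Rightarrow> nat) \<Rightarrow> nat" where
  "inv_on R w = card {(s, t). s \<in> R \<and> t \<in> R \<and> s < t \<and> w s > w t}"

text \<open>The rank matrix of a permutation. By \<open>bruhat_dim\<close> its entries are
  dimensions of intersections of flags, and this is where the order on permutations meets the
  topology.\<close>

definition rank_fun :: "(nat \<Rightarrow> nat) \<Rightarrow> nat \<Rightarrow> nat \<Rightarrow> nat" where
  "rank_fun w k j = card {i \<in> {1..k}. w i \<le> j}"

lemma rank_fun_Suc: "rank_fun w (Suc k) j = rank_fun w k j + (if w (Suc k) \<le> j then 1 else 0)"
proof -
  have "{i \<in> {1..Suc k}. w i \<le> j} = {i \<in> {1..k}. w i \<le> j} \<union> (if w (Suc k) \<le> j then {Suc k} else {})"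
    by (auto simp: le_Suc_eq)
  then show ?thesis by (simp add: rank_fun_def)
qed

text \<open>Two consecutive ranks at \<open>j\<close> differ by one exactly if the new value is at
  most \<open>j\<close>; letting \<open>j\<close> vary recovers the value.\<close>

lemma rank_fun_inject:
  assumes "\<And>k j. k \<le> n \<Longrightarrow> j \<le> n \<Longrightarrow> rank_fun x k j = rank_fun w k j"
    and "bij_betw x {1..n} {1..n}" "bij_betw w {1..n} {1..n}" "i \<in> {1..n}"
  shows "x i = w i"
proof -
  obtain k where k: "i = Suc k" "k < n" using assms(4) by (cases i) auto
  have "(x i \<le> j) = (w i \<le> j)" if "j \<le> n" for j
    using assms(1)[of i j] assms(1)[of k j] k that by (auto simp: rank_fun_Suc split: if_splits)
  moreover have "x i \<le> n" "w i \<le> n" using assms(2-4) by (auto simp: bij_betw_def)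
  ultimately show ?thesis by (metis order.antisym order_refl)
qed

lemma inv_on_finite [simp]: "finite R \<Longrightarrow> finite {(s, t). s \<in> R \<and> t \<in> R \<and> s < t \<and> w s > (w t::nat)}"
  by (rule finite_subset[of _ "R \<times> R"]) auto

text \<open>The inversions of \<open>x\<close> inject into those of the swapped function: a pair is
  moved by the transposition if its places stay in order, and kept otherwise. The new inversion
  \<open>(a, b)\<close> is missed.\<close>

lemma inv_on_swap:
  assumes ab: "a \<in> R" "b \<in> R" "a < b" "x a < x b" and "finite R"
  shows "inv_on R x < inv_on R (x \<circ> Transposition.transpose a b)"
proof -
  let ?t = "Transposition.transpose a b"
  let ?I = "{(s, t). s \<in> R \<and> t \<in> R \<and> s < t \<and> x s > x t}"
  let ?J = "{(s, t). s \<in> R \<and> t \<in> R \<and> s < t \<and> (x \<circ> ?t) s > (x \<circ> ?t) t}"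
  let ?f = "\<lambda>(s, t). if ?t s < ?t t then (?t s, ?t t) else (s, t)"
  have tR: "?t s \<in> R" if "s \<in> R" for s using that ab by (auto simp: Transposition.transpose_def)
  have "?f ` ?I \<subseteq> ?J - {(a, b)}"
    using ab by (auto simp: tR Transposition.transpose_def split: if_splits)
  moreover have "inj_on ?f ?I"
  proof (rule inj_onI)
    fix P Q assume PQ: "P \<in> ?I" "Q \<in> ?I" "?f P = ?f Q"
    obtain s t s' t' where st: "P = (s, t)" "Q = (s', t')" by fastforce
    have "s < t" "s' < t'" using PQ by (auto simp: st)
    moreover have "?f (s, t) = ?f (s', t')" using PQ by (simp only: st)
    moreover have "?t (?t u) = u" for u by simp
    ultimately have "s = s' \<and> t = t'" by (smt (verit) case_prod_conv prod.inject)
    then show "P = Q" by (simp add: st)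
  qed
  moreover have J: "finite ?J" using assms by (intro inv_on_finite)
  ultimately have "card ?I \<le> card (?J - {(a, b)})"
    by (intro card_inj_on_le[of ?f]) auto
  moreover have "(a, b) \<in> ?J" using ab by auto
  then have "card (?J - {(a, b)}) < card ?J" using J by (intro card_Diff1_less)
  ultimately show ?thesis unfolding inv_on_def by (rule order.strict_trans1)
qed

lemma rank_fun_split:
  assumes "j \<le> m"
  shows "rank_fun w k m = rank_fun w k j + card {i \<in> {1..k}. j < w i \<and> w i \<le> m}"
proof -
  have "{i \<in> {1..k}. w i \<le> m} = {i \<in> {1..k}. w i \<le> j} \<union> {i \<in> {1..k}. j < w i \<and> w i \<le> m}"
    using assms by auto
  moreover have "{i \<in> {1..k}. w i \<le> j} \<inter> {i \<in> {1..k}. j < w i \<and> w i \<le> m} = {}" by auto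
  ultimately show ?thesis unfolding rank_fun_def by (simp add: card_Un_disjoint)
qed

text \<open>
  If \<open>x\<close> and \<open>w\<close> first differ at \<open>a\<close>, swapping \<open>x a\<close> with the next later value in \<open>{x a<..w a}\<close>
  creates an inversion and does not leave the rank order.
\<close>

lemma rank_order_inv_on:
  assumes "bij_betw x {1..n} {1..n}" "bij_betw w {1..n} {1..n}"
    and "\<And>k j. k \<le> n \<Longrightarrow> j \<le> n \<Longrightarrow> rank_fun w k j \<le> rank_fun x k j"
    and "\<exists>i\<in>{1..n}. x i \<noteq> w i"
  shows "inv_on {1..n} x < inv_on {1..n} w"
  using assms
\<comment> \<open>Each swap adds an inversion and \<open>n * n\<close> bounds their number, so the
  measure decreases.\<close>
proof (induction "n * n - inv_on {1..n} x" arbitrary: x rule: less_induct)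
  case less
  define a where "a = (LEAST i. i \<in> {1..n} \<and> x i \<noteq> w i)"
  have "\<exists>i. i \<in> {1..n} \<and> x i \<noteq> w i" using less.prems(4) by blast
  from LeastI_ex[OF this] have a: "a \<in> {1..n}" "x a \<noteq> w a" unfolding a_def by blast+
  have before: "x i = w i" if "1 \<le> i" "i < a" for i
    using not_less_Least[of i "\<lambda>i. i \<in> {1..n} \<and> x i \<noteq> w i"] that a by (auto simp: a_def)
  obtain a' where a': "a = Suc a'" using a by (cases a) auto
  have rng: "x i \<in> {1..n}" "w i \<in> {1..n}" if "i \<in> {1..n}" for i
    using less.prems(1,2) that by (auto simp: bij_betw_def)
  have eq: "rank_fun x a' j = rank_fun w a' j" for j
    unfolding rank_fun_def by (rule arg_cong[of _ _ card]) (auto simp: a' before)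
  have xw: "x a < w a"
    using less.prems(3)[of a "w a"] eq[of "w a"] a rng[of a] by (auto simp: a' rank_fun_Suc split: if_splits)
  define P where "P b \<longleftrightarrow> b \<in> {1..n} \<and> a < b \<and> x a < x b \<and> x b \<le> w a" for b
  have "\<exists>b. P b"
  proof -
    have "w a \<in> x ` {1..n}" using less.prems(1) rng(2)[OF a(1)] by (simp only: bij_betw_def)
    then obtain b where b: "b \<in> {1..n}" "x b = w a" by (auto simp del: atLeastAtMost_iff)
    moreover have "\<not> b < a"
    proof
      assume "b < a"
      then have "w b = w a" using before[of b] b by simp
      then have "b = a" using less.prems(2) a(1) b(1) by (auto simp only: bij_betw_def dest: inj_onD)
      with \<open>b < a\<close> show False by simp
    qed
    moreover have "b \<noteq> a" using b a by auto
    ultimately have "P b" using xw by (simp add: P_def)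
    then show ?thesis ..
  qed
  define b where "b = (LEAST b. P b)"
  have b: "b \<in> {1..n}" "a < b" "x a < x b" "x b \<le> w a"
    using LeastI_ex[OF \<open>\<exists>b. P b\<close>] unfolding b_def[symmetric] by (simp_all add: P_def)
  have between: "x i < x a \<or> w a < x i" if "a < i" "i < b" for i
  proof -
    have "\<not> P i" using not_less_Least[of i P] that by (simp add: b_def)
    moreover have "x i \<noteq> x a"
    proof
      assume "x i = x a"
      moreover have "i \<in> {1..n}" using that a b by auto
      ultimately have "i = a" using less.prems(1) a(1) by (auto simp only: bij_betw_def dest: inj_onD)
      with that show False by simp
    qed
    ultimately show ?thesis using that a b by (auto simp: P_def)
  qed
  define y where "y = x \<circ> Transposition.transpose a b"
  have bij: "bij_betw y {1..n} {1..n}"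
    unfolding y_def using less.prems(1) a(1) b(1)
    by (intro bij_betw_trans[of _ _ "{1..n}"] bij_betw_transpose_iff) auto
  have inv: "inv_on {1..n} x < inv_on {1..n} y"
    unfolding y_def using a b by (intro inv_on_swap) auto
  have bound: "inv_on {1..n} f \<le> n * n" for f
  proof -
    have "inv_on {1..n} f \<le> card ({1..n} \<times> {1..n})"
      unfolding inv_on_def by (intro card_mono) auto
    then show ?thesis by simp
  qed
  have rank: "rank_fun w k j \<le> rank_fun y k j" if kj: "k \<le> n" "j \<le> n" for k j
  \<comment> \<open>The swap lowers the rank only on this rectangle, and there by one. So a strict
    inequality has to be found for the ranks of \<open>x\<close> and \<open>w\<close>.\<close>
  proof (cases "a \<le> k \<and> k < b \<and> x a \<le> j \<and> j < x b")
    case True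
    have "rank_fun w k j + card {i \<in> {1..k}. j < w i \<and> w i \<le> w a} \<le>
        rank_fun x k j + card {i \<in> {1..k}. j < x i \<and> x i \<le> w a}"
      using less.prems(3)[of k "w a"] rng(2)[OF a(1)] kj True b
      by (subst (1 2) rank_fun_split[symmetric]) auto
    \<comment> \<open>By \<open>between\<close>, the values of \<open>x\<close> above
      \<open>j\<close> and up to \<open>w a\<close> occur only before \<open>a\<close>, where
      \<open>x\<close> and \<open>w\<close> agree; but \<open>w\<close> also takes the value
      \<open>w a\<close> at \<open>a\<close>. Compared with the ranks at \<open>w a\<close>, this
      leaves a gap at \<open>j\<close>.\<close>
    moreover have "{i \<in> {1..k}. j < x i \<and> x i \<le> w a} = {i \<in> {1..a'}. j < w i \<and> w i \<le> w a}" (is "?A = ?B")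
    proof -
      have "i \<le> a'" if "i \<in> ?A" for i
        using that between[of i] True xw by (cases i a rule: linorder_cases) (auto simp: a')
      then show ?thesis using True by (fastforce simp: a' before)
    qed
    moreover have "card ?B < card {i \<in> {1..k}. j < w i \<and> w i \<le> w a}"
    proof (rule psubset_card_mono)
      have "a \<in> {i \<in> {1..k}. j < w i \<and> w i \<le> w a}" using True a b by auto
      moreover have "a \<notin> ?B" by (simp add: a')
      moreover have "?B \<subseteq> {i \<in> {1..k}. j < w i \<and> w i \<le> w a}" using True by (auto simp: a')
      ultimately show "?B \<subset> {i \<in> {1..k}. j < w i \<and> w i \<le> w a}" by blast
    qed auto
    ultimately have lt: "rank_fun w k j < rank_fun x k j" by simp
    have "{i \<in> {1..k}. x i \<le> j} = insert a {i \<in> {1..k}. y i \<le> j}"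
      "a \<notin> {i \<in> {1..k}. y i \<le> j}"
      using True a b by (auto simp: y_def Transposition.transpose_def)
    then have "rank_fun x k j = Suc (rank_fun y k j)" by (simp add: rank_fun_def)
    with lt show ?thesis by simp
  next
    case False
    have "rank_fun x k j \<le> rank_fun y k j"
    proof (cases "a \<le> k \<and> k < b")
      case ka: True
      have "{i \<in> {1..k}. x i \<le> j} \<subseteq> {i \<in> {1..k}. y i \<le> j}"
        using False ka a b by (auto simp: y_def Transposition.transpose_def)
      then show ?thesis unfolding rank_fun_def by (intro card_mono) auto
    next
      case ka: False
      have "bij_betw (Transposition.transpose a b) {i \<in> {1..k}. y i \<le> j} {i \<in> {1..k}. x i \<le> j}"
        using ka a b
        by (intro bij_betw_byWitness[of _ "Transposition.transpose a b"])
          (auto simp: y_def Transposition.transpose_def)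
      then show ?thesis unfolding rank_fun_def by (simp add: bij_betw_same_card)
    qed
    with less.prems(3)[OF kj] show ?thesis by simp
  qed
  show ?case
  proof (cases "\<exists>i\<in>{1..n}. y i \<noteq> w i")
    case True
    have "n * n - inv_on {1..n} y < n * n - inv_on {1..n} x" using inv bound[of y] by linarith
    from less.hyps[OF this bij less.prems(2) rank True] inv show ?thesis by simp
  next
    case False
    then have "inv_on {1..n} y = inv_on {1..n} w" unfolding inv_on_def by (intro arg_cong[of _ _ card]) auto
    with inv show ?thesis by simp
  qed
qed

subsection \<open>Bruhat cells\<close>

definition perm_mat :: "(nat \<Rightarrow> nat) \<Rightarrow> 'n::{finite,wellorder} cmat" where
  "perm_mat w = colmat (\<lambda>k. e_vec (w k))"

definition bruhat :: "(nat \<Rightarrow> nat) \<Rightarrow> 'n::{finite,wellorder} cmat set" where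
  "bruhat w = {a ** perm_mat w ** b | a b. a \<in> upper_borel \<and> b \<in> upper_borel}"

lemma perm_mat_e_vec [simp]:
  "1 \<le> k \<Longrightarrow> k \<le> CARD('n) \<Longrightarrow> perm_mat w *v e_vec k = (e_vec (w k) :: 'n::{finite,wellorder} cvec)"
  by (simp add: perm_mat_def)

lemma perm_mat_mult:
  assumes "v ` {1..CARD('n)} \<subseteq> {1..CARD('n)}"
  shows "perm_mat w ** perm_mat v = (perm_mat (w \<circ> v) :: 'n::{finite,wellorder} cmat)"
  using assms by (intro mat_eqI) (auto simp: image_subset_iff simp flip: matrix_vector_mul_assoc)

lemma perm_mat_inverse:
  assumes "bij_betw w {1..CARD('n)} {1..CARD('n)}"
  defines "v \<equiv> inv_into {1..CARD('n)} w"
  shows "perm_mat w ** perm_mat v = (mat 1 :: 'n::{finite,wellorder} cmat)"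
    and "perm_mat v ** perm_mat w = (mat 1 :: 'n::{finite,wellorder} cmat)"
proof -
  have v: "v ` {1..CARD('n)} \<subseteq> {1..CARD('n)}" and w: "w ` {1..CARD('n)} \<subseteq> {1..CARD('n)}"
    using bij_betw_inv_into[OF assms(1)] assms(1) by (auto simp: v_def bij_betw_def simp del: atLeastAtMost_iff)
  have "w (v i) = i" "v (w i) = i" if "1 \<le> i" "i \<le> CARD('n)" for i
    using bij_betw_inv_into_right[OF assms(1), of i] bij_betw_inv_into_left[OF assms(1), of i] that
    by (auto simp: v_def)
  then show "perm_mat w ** perm_mat v = (mat 1 :: 'n cmat)" "perm_mat v ** perm_mat w = (mat 1 :: 'n cmat)"
    unfolding perm_mat_mult[OF v] perm_mat_mult[OF w] by (auto intro!: mat_eqI)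
qed

lemma invertible_perm_mat:
  "bij_betw w {1..CARD('n)} {1..CARD('n)} \<Longrightarrow> invertible (perm_mat w :: 'n::{finite,wellorder} cmat)"
  using perm_mat_inverse[where 'n='n] unfolding invertible_def by blast

lemma perm_mat_nth:
  assumes "bij_betw w {1..CARD('n)} {1..CARD('n)}"
  shows "(perm_mat w *v x) $ coord (w (idx m)) = x $ (m :: 'n::{finite,wellorder})"
proof -
  have "w (idx m) \<in> {1..CARD('n)}" using assms idx_range[of m] bij_betwE by blast
  then have w: "idx (coord (w (idx m)) :: 'n) = w (idx m)" by (simp add: idx_coord)
  have P: "perm_mat w $ coord (w (idx m)) $ j = (if j = m then 1 else 0 :: complex)" for j :: 'n
  proof -
    have "w (idx j) \<in> {1..CARD('n)}" using assms idx_range[of j] bij_betwE by blast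
    moreover have "w (idx m) = w (idx j) \<longleftrightarrow> m = j"
      using assms by (metis bij_betw_def idx_eq_iff idx_range inj_on_eq_iff)
    ultimately show ?thesis by (auto simp: perm_mat_def colmat_def e_vec_nth w)
  qed
  have "(perm_mat w *v x) $ coord (w (idx m)) = (\<Sum>j\<in>UNIV. if j = m then x $ j else 0)"
    unfolding matrix_vector_mult_def vec_lambda_beta by (intro sum.cong) (auto simp: P)
  then show ?thesis by simp
qed

lemma bruhat_mult:
  assumes "C \<in> bruhat w" "a \<in> upper_borel" "b \<in> upper_borel"
  shows "a ** C ** b \<in> bruhat w"
proof -
  from assms(1) obtain a' b' where "C = a' ** perm_mat w ** b'" "a' \<in> upper_borel" "b' \<in> upper_borel"
    unfolding bruhat_def by blast
  then have "a ** C ** b = (a ** a') ** perm_mat w ** (b' ** b)" "a ** a' \<in> upper_borel" "b' ** b \<in> upper_borel"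
    using assms by (auto simp: matrix_mul_assoc upper_borel_mult)
  then show ?thesis unfolding bruhat_def by blast
qed

lemma bruhat_mult_iff:
  assumes "a \<in> upper_borel" "b \<in> upper_borel"
  shows "a ** C ** b \<in> bruhat w \<longleftrightarrow> C \<in> bruhat w"
proof
  assume "a ** C ** b \<in> bruhat w"
  then have "matrix_inv a ** (a ** C ** b) ** matrix_inv b \<in> bruhat w"
    by (rule bruhat_mult) (use assms in \<open>auto intro: upper_borel_inv\<close>)
  moreover have "matrix_inv a ** (a ** C ** b) ** matrix_inv b = (matrix_inv a ** a) ** C ** (b ** matrix_inv b)"
    by (simp only: matrix_mul_assoc)
  ultimately show "C \<in> bruhat w"
    using upper_borel_invertible[OF assms(1)] upper_borel_invertible[OF assms(2)] by simp
next
  assume "C \<in> bruhat w"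
  then show "a ** C ** b \<in> bruhat w" using assms by (rule bruhat_mult)
qed

lemma perm_mat_bruhat: "perm_mat w \<in> bruhat w"
  unfolding bruhat_def by (rule CollectI, rule exI[of _ "mat 1"], rule exI[of _ "mat 1"]) simp

lemma act_perm_mat:
  "act (perm_mat w) std_flag k =
    vec.span (e_vec ` w ` {1..min k CARD('n)} :: 'n::{finite,wellorder} cvec set)"
  unfolding act_std_flag by (rule arg_cong[of _ _ vec.span]) (auto simp: image_image intro!: image_cong)

text \<open>The right upper triangular factor does not change the flag and the left one preserves
  every \<open>std_flag j\<close>; what remains is an intersection of coordinate subspaces.\<close>

lemma bruhat_dim:
  fixes C :: "'n::{finite,wellorder} cmat"
  assumes w: "bij_betw w {1..CARD('n)} {1..CARD('n)}" and C: "C \<in> bruhat w" and k: "k \<le> CARD('n)"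
  shows "vec.dim (act C std_flag k \<inter> std_flag j) = rank_fun w k j"
proof -
  obtain a b where ab: "C = a ** perm_mat w ** b" "a \<in> upper_borel" "b \<in> upper_borel"
    using C by (auto simp: bruhat_def)
  let ?V = "act (perm_mat w) std_flag k :: 'n cvec set"
  have "act C std_flag k = (*v) a ` ?V"
    unfolding ab(1) act_upper_borel[OF ab(3)] act_mult[of a] by (simp add: act_def[of a])
  moreover have "std_flag j = (*v) a ` std_flag j"
    using ab(2) by (simp add: upper_borel_def act_def fun_eq_iff)
  ultimately have "act C std_flag k \<inter> std_flag j = (*v) a ` (?V \<inter> std_flag j)"
    using invertible_inj[OF upper_borel_invertible[OF ab(2)]] by (metis image_Int)
  then have "vec.dim (act C std_flag k \<inter> std_flag j) = vec.dim (?V \<inter> std_flag j)"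
    using invertible_inj[OF upper_borel_invertible[OF ab(2)]]
    by (simp add: vec.dim_image_eq inj_on_subset)
  also have "?V \<inter> std_flag j = {x. \<forall>a. idx a \<notin> {i \<in> w ` {1..k}. i \<le> j} \<longrightarrow> x $ a = 0}"
  proof -
    have "w ` {1..min k CARD('n)} \<subseteq> w ` {1..CARD('n)}" by (intro image_mono) auto
    then have "w ` {1..min k CARD('n)} \<subseteq> {1..CARD('n)}" using w by (simp only: bij_betw_def)
    from span_e_vec[OF this] show ?thesis
      unfolding act_perm_mat using k by (auto simp: std_flag_eq min_absorb1 simp del: atLeastAtMost_iff)
  qed
  also have "vec.dim \<dots> = card {i \<in> w ` {1..k}. i \<le> j}"
  proof (rule dim_span_e_vec)
    have "w ` {1..k} \<subseteq> w ` {1..CARD('n)}" using k by (intro image_mono) auto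
    then show "{i \<in> w ` {1..k}. i \<le> j} \<subseteq> {1..CARD('n)}" using w unfolding bij_betw_def by blast
  qed
  also have "{i \<in> w ` {1..k}. i \<le> j} = w ` {i \<in> {1..k}. w i \<le> j}" by auto
  also have "card \<dots> = rank_fun w k j"
    unfolding rank_fun_def using w k
    by (intro card_image inj_on_subset[OF bij_betw_imp_inj_on[OF w]]) auto
  finally show ?thesis .
qed

lemma bruhat_unique:
  fixes C :: "'n::{finite,wellorder} cmat"
  assumes "bij_betw w {1..CARD('n)} {1..CARD('n)}" "bij_betw x {1..CARD('n)} {1..CARD('n)}"
    and "C \<in> bruhat w" "C \<in> bruhat x" "i \<in> {1..CARD('n)}"
  shows "x i = w i"
proof (rule rank_fun_inject[OF _ assms(2,1,5)])
  fix k j assume "k \<le> CARD('n)"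
  then show "rank_fun x k j = rank_fun w k j" using assms bruhat_dim by metis
qed

lemma bruhat_cong:
  assumes "\<And>i. i \<in> {1..CARD('n)} \<Longrightarrow> x i = w i"
  shows "bruhat x = (bruhat w :: 'n::{finite,wellorder} cmat set)"
proof -
  have "perm_mat x = (perm_mat w :: 'n cmat)" by (rule mat_eqI) (simp add: assms)
  then show ?thesis by (simp add: bruhat_def)
qed

text \<open>The existence half of the Bruhat decomposition, by choosing pivots. The pivot vectors
  form a frame of the flag, and sorted by their pivots they form an upper triangular matrix.\<close>

lemma bruhat_exists:
  fixes C :: "'n::{finite,wellorder} cmat"
  assumes C: "invertible C"
  obtains w where "bij_betw w {1..CARD('n)} {1..CARD('n)}" "C \<in> bruhat w"
proof -
  let ?n = "CARD('n)"
  define V where "V = act C std_flag"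
  have V: "V \<in> complete_flags" using C by (simp add: V_def)
  \<comment> \<open>The least such \<open>j\<close> is the pivot of step \<open>k\<close>: the first
    step of the standard flag in which \<open>V k\<close> has a vector that is new compared with
    \<open>V (k - 1)\<close>.\<close>
  define P where "P k j \<longleftrightarrow> \<not> V k \<inter> std_flag j \<subseteq> V (k - 1)" for k j
  define x where "x k = (LEAST j. P k j)" for k
  have "P k ?n" if "k \<in> {1..?n}" for k
    unfolding P_def
  proof
    assume "V k \<inter> std_flag ?n \<subseteq> V (k - 1)"
    then have "vec.dim (V k) \<le> vec.dim (V (k - 1))" by (simp add: std_flag_full vec.dim_subset)
    with that show False by (auto simp: complete_flagsD[OF V])
  qed
  then have Px: "P k (x k)" and xn: "x k \<le> ?n" if "k \<in> {1..?n}" for k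
    using that unfolding x_def by (auto intro: LeastI Least_le)
  have "\<exists>v. v \<in> V k \<inter> std_flag (x k) \<and> v \<notin> V (k - 1)" if "k \<in> {1..?n}" for k
    using Px[OF that] by (auto simp: P_def)
  then obtain y where y: "\<And>k. k \<in> {1..?n} \<Longrightarrow> y k \<in> V k \<and> y k \<in> std_flag (x k) \<and> y k \<notin> V (k - 1)"
    by (metis IntE)
  have least: "v \<in> V (k - 1)" if "v \<in> V k" "v \<in> std_flag j" "j < x k" for v k j
    using not_less_Least[of j "P k"] that by (auto simp: P_def x_def)
  have x1: "1 \<le> x k" if "k \<in> {1..?n}" for k
  proof (rule ccontr)
    assume "\<not> 1 \<le> x k"
    then have "x k = 0" by simp
    then have "y k = 0" using y[OF that] by (auto simp: complete_flagsD(4)[OF std_flag_in_complete_flags])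
    with y[OF that] show False using complete_flagsD(2)[OF V] vec.subspace_0 by metis
  qed
  have "x k \<noteq> x l" if kl: "k \<in> {1..?n}" "l \<in> {1..?n}" "k < l" for k l
  proof
    assume eq: "x k = x l"
    define a :: 'n where "a = coord (x l)"
    have idxa: "idx a = x l" using x1[OF kl(2)] xn[OF kl(2)] by (simp add: a_def idx_coord)
    have *: "v \<in> std_flag (x l - 1)" if "v \<in> std_flag (x l)" "v $ a = 0" for v
    proof -
      have "v $ b = 0" if "x l - 1 < idx b" for b
      proof (cases "b = a")
        case False
        then have "idx b \<noteq> x l" using idxa by (metis idx_eq_iff)
        then have "x l < idx b" using that by linarith
        then show ?thesis using \<open>v \<in> std_flag (x l)\<close> by (simp add: std_flag_eq)
      qed (simp add: \<open>v $ a = 0\<close>)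
      then show ?thesis by (simp add: std_flag_eq)
    qed
    have "V k \<subseteq> V (l - 1)" using kl by (intro monoD[OF complete_flagsD(1)[OF V]]) simp
    then have ky: "y k \<in> V (l - 1)" using y[OF kl(1)] by blast
    have "y k $ a \<noteq> 0"
    proof
      assume "y k $ a = 0"
      then have "y k \<in> std_flag (x l - 1)" using *[of "y k"] y[OF kl(1)] by (simp only: eq)
      then have "y k \<in> V (k - 1)"
        using least[of "y k" k "x l - 1"] y[OF kl(1)] x1[OF kl(2)] by (simp add: eq)
      then show False using y[OF kl(1)] by blast
    qed
    \<comment> \<open>If two steps shared a pivot, cancelling the coordinate \<open>a\<close> of
      \<open>y l\<close> against \<open>y k\<close> would lower the pivot, so that
      \<open>y l\<close> would already lie in \<open>V (l - 1)\<close>.\<close>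
    define v where "v = y l - (y l $ a / y k $ a) *s y k"
    have "V (l - 1) \<subseteq> V l" by (intro monoD[OF complete_flagsD(1)[OF V]]) simp
    then have "v \<in> V l" "v \<in> std_flag (x l)"
      unfolding v_def using y[OF kl(1)] y[OF kl(2)] ky eq complete_flagsD(2)[OF V]
      by (auto intro!: vec.subspace_diff vec.subspace_scale)
    moreover have "v $ a = 0" using \<open>y k $ a \<noteq> 0\<close> by (simp add: v_def)
    ultimately have "v \<in> V (l - 1)" using *[of v] least[of v l "x l - 1"] x1[OF kl(2)] by auto
    then have "v + (y l $ a / y k $ a) *s y k \<in> V (l - 1)"
      using ky complete_flagsD(2)[OF V] by (intro vec.subspace_add vec.subspace_scale)
    then show False using y[OF kl(2)] by (simp add: v_def)
  qed
  then have "inj_on x {1..?n}" by (intro linorder_inj_onI) auto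
  moreover have "x ` {1..?n} \<subseteq> {1..?n}" using x1 xn by auto
  ultimately have bij: "bij_betw x {1..?n} {1..?n}"
    unfolding bij_betw_def by (simp add: endo_inj_surj)
  \<comment> \<open>The pivot vectors indexed by their pivots; in this order they are adapted to the
    standard flag.\<close>
  define z where "z j = y (inv_into {1..?n} x j)" for j
  have "z j \<in> std_flag j \<and> z j \<notin> std_flag (j - 1)" if "1 \<le> j" "j \<le> ?n" for j
  proof -
    define k where "k = inv_into {1..?n} x j"
    have "j \<in> {1..?n}" using that by simp
    then have k: "k \<in> {1..?n}" "x k = j"
      unfolding k_def
      by (rule bij_betwE[OF bij_betw_inv_into[OF bij], rule_format], rule bij_betw_inv_into_right[OF bij])
    have "z j = y k" by (simp only: z_def k_def)
    then show ?thesis using y[OF k(1)] least[of "y k" k "j - 1"] that k by auto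
  qed
  from flag_of_adapted_basis[OF std_flag_in_complete_flags this]
  have z: "colmat z \<in> upper_borel" by (simp add: upper_borel_def)
  have "colmat z ** perm_mat x = colmat y"
  proof (rule mat_eqI)
    fix i assume i: "1 \<le> i" "i \<le> ?n"
    then have "x i \<in> {1..?n}" using x1 xn by auto
    moreover have "z (x i) = y i"
      unfolding z_def using i bij_betw_inv_into_left[OF bij, of i] by simp
    ultimately show "(colmat z ** perm_mat x) *v e_vec i = colmat y *v e_vec i"
      using i by (simp flip: matrix_vector_mul_assoc)
  qed
  moreover have y': "invertible (colmat y)" "V = act (colmat y) std_flag"
    using flag_of_adapted_basis[OF V, of y] y by auto
  then have "matrix_inv (colmat y) ** C \<in> upper_borel"
    using act_eq_iff[OF C y'(1)] by (simp add: V_def)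
  ultimately have "C = colmat z ** perm_mat x ** (matrix_inv (colmat y) ** C)"
    using y' by simp
  then have "C \<in> bruhat x" unfolding bruhat_def
    using z \<open>matrix_inv (colmat y) ** C \<in> upper_borel\<close> by blast
  with bij show ?thesis by (rule that)
qed

subsection \<open>Coordinates on a Bruhat cell\<close>

lemma strictly_lower_mult:
  fixes Y :: "'n::{finite,wellorder} cmat"
  assumes "Y \<in> strictly_lower"
  shows "((mat 1 + Y) *v c) $ m = c $ m + (\<Sum>l | l < m. Y $ m $ l * c $ l)"
proof -
  have "(\<Sum>l\<in>UNIV. Y $ m $ l * c $ l) = (\<Sum>l | l < m. Y $ m $ l * c $ l)"
    using assms by (intro sum.mono_neutral_right) (auto simp: strictly_lower_def)
  then show ?thesis by (simp add: matrix_vector_mult_add_rdistrib) (simp add: matrix_vector_mult_def)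
qed

lemma invertible_unipotent:
  fixes Y :: "'n::{finite,wellorder} cmat"
  assumes "Y \<in> strictly_lower"
  shows "invertible (mat 1 + Y)"
  unfolding invertible_iff_inj
proof (intro allI impI)
  fix c assume c: "(mat 1 + Y) *v c = 0"
  have "c $ m = 0" for m
  proof (induction m rule: less_induct)
    case (less m)
    then show ?case using arg_cong[OF c, of "\<lambda>v. v $ m"] by (simp add: strictly_lower_mult[OF assms])
  qed
  then show "c = 0" by (simp add: vec_eq_iff)
qed

lemma upper_borelI_e_vec:
  fixes u :: "'n::{finite,wellorder} cmat"
  assumes "invertible u" "\<And>j. 1 \<le> j \<Longrightarrow> j \<le> CARD('n) \<Longrightarrow> u *v e_vec j \<in> std_flag j"
  shows "u \<in> upper_borel"
proof (rule upper_borelI_subset[OF assms(1)])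
  fix k assume "k \<le> CARD('n)"
  have "vec.span ((\<lambda>i. u *v e_vec i) ` {1..min k CARD('n)}) \<subseteq> std_flag k"
    using assms(2) std_flag_mono[where 'a='n] by (intro vec.span_minimal) (fastforce, simp)
  then show "(*v) u ` std_flag k \<subseteq> std_flag k"
    unfolding act_std_flag[symmetric] act_def .
qed

text \<open>The entries below the diagonal that conjugation by \<open>perm_mat w\<close> moves above
  it. There is one for each inversion of \<open>w\<close>, whence the dimension of the cell.\<close>

definition cell_coords :: "(nat \<Rightarrow> nat) \<Rightarrow> 'n::{finite,wellorder} cmat set" where
  "cell_coords w = {Y. \<forall>i j. \<not> (j < i \<and> w (idx i) < w (idx j)) \<longrightarrow> Y $ i $ j = 0}"

lemma cell_coords_strictly_lower: "cell_coords w \<subseteq> strictly_lower"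
  by (auto simp: cell_coords_def strictly_lower_def dest: leD)

text \<open>In the chart centred at its coordinate flag a cell is a coordinate subspace. For one
  direction conjugation by the permutation gives the upper triangular left factor; for the other the
  rank conditions kill the forbidden entries column by column.\<close>

lemma bruhat_chart:
  fixes Y :: "'n::{finite,wellorder} cmat"
  assumes w: "bij_betw w {1..CARD('n)} {1..CARD('n)}" and Y: "Y \<in> strictly_lower"
  shows "perm_mat w ** (mat 1 + Y) \<in> bruhat w \<longleftrightarrow> Y \<in> cell_coords w"
proof
  assume pat: "Y \<in> cell_coords w"
  define v where "v = inv_into {1..CARD('n)} w"
  let ?u = "perm_mat w ** (mat 1 + Y) ** perm_mat v"
  have v: "bij_betw v {1..CARD('n)} {1..CARD('n)}" unfolding v_def by (rule bij_betw_inv_into[OF w])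
  have "?u \<in> upper_borel"
  proof (rule upper_borelI_e_vec)
    show "invertible ?u" using w v Y by (simp add: invertible_mult invertible_perm_mat invertible_unipotent)
    fix j assume j: "1 \<le> j" "j \<le> CARD('n)"
    have vj: "v j \<in> {1..CARD('n)}" "w (v j) = j"
      using j v bij_betw_inv_into_right[OF w, of j] by (auto simp: v_def dest: bij_betwE)
    define k where "k = (coord (v j) :: 'n)"
    have k: "idx k = v j" "w (idx k) = j" using vj by (auto simp: k_def idx_coord)
    have u: "?u *v e_vec j = perm_mat w *v ((mat 1 + Y) *v e_vec (idx k))"
      using j by (simp add: k flip: matrix_vector_mul_assoc del: e_vec_idx)
    show "?u *v e_vec j \<in> std_flag j"
      unfolding std_flag_eq
    proof (intro CollectI allI impI)
      fix a :: 'n assume "j < idx a"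
      have "idx a \<in> w ` {1..CARD('n)}" using w idx_range[of a] by (simp add: bij_betw_def)
      then obtain i where i: "i \<in> {1..CARD('n)}" "w i = idx a" by auto
      then have a: "a = coord (w (idx (coord i :: 'n)))" by (simp add: idx_coord)
      have "w (idx (coord i :: 'n)) = idx a" using i by (simp add: idx_coord)
      then have "Y $ coord i $ k = 0" "coord i \<noteq> k" using pat \<open>j < idx a\<close> k by (auto simp: cell_coords_def)
      moreover have "((mat 1 + Y) *v e_vec (idx k)) $ coord i = axis k 1 $ coord i + Y $ coord i $ k"
        by (simp add: matrix_vector_mult_add_rdistrib mult_axis column_def) (simp add: mat_def axis_def)
      ultimately show "(?u *v e_vec j) $ a = 0"
        unfolding u by (subst a, subst perm_mat_nth[OF w]) (simp add: axis_def)
    qed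
  qed
  moreover have "perm_mat w ** (mat 1 + Y) = ?u ** perm_mat w ** mat 1"
    using perm_mat_inverse(2)[OF w] by (simp add: v_def flip: matrix_mul_assoc)
  ultimately show "perm_mat w ** (mat 1 + Y) \<in> bruhat w"
    unfolding bruhat_def using upper_borel_one by blast
next
  let ?C = "perm_mat w ** (mat 1 + Y)"
  assume C: "?C \<in> bruhat w"
  have inj: "w (idx a) = w (idx b) \<longleftrightarrow> a = b" for a b :: 'n
    using w by (metis bij_betw_def idx_eq_iff idx_range inj_on_eq_iff)
  have "Y $ m $ k = 0" if "k < m" "w (idx k) < w (idx m)" for k m
    using that
  proof (induction k arbitrary: m rule: less_induct)
    case (less k)
    obtain k' where k': "idx k = Suc k'" "Suc k' \<le> CARD('n)" using idx_range[of k] by (cases "idx k") auto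
    let ?V = "act ?C std_flag" and ?F = "std_flag (w (idx k)) :: 'n cvec set"
    \<comment> \<open>The rank at level \<open>w (idx k)\<close> jumps at step \<open>idx k\<close>,
      which yields a vector of that step inside \<open>?F\<close> whose coordinate vector
      \<open>c\<close> has a nonzero entry at \<open>k\<close>.\<close>
    have "vec.dim (?V (Suc k') \<inter> ?F) = Suc (vec.dim (?V k' \<inter> ?F))"
      using k' by (simp add: bruhat_dim[OF w C] rank_fun_Suc)
    then have "\<not> ?V (Suc k') \<inter> ?F \<subseteq> ?V k' \<inter> ?F"
      using vec.dim_subset[of "?V (Suc k') \<inter> ?F" "?V k' \<inter> ?F"] by auto
    then obtain v where v: "v \<in> ?V (Suc k')" "v \<in> ?F" "v \<notin> ?V k'" by auto
    then obtain c where c: "v = ?C *v c" "c \<in> std_flag (idx k)" by (auto simp: act_def k')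
    have "c \<notin> std_flag k'" using v c by (auto simp: act_def)
    moreover have "c $ a = 0" if "c $ k = 0" "k' < idx a" for a
    proof (cases "a = k")
      case False
      then have "idx a \<noteq> Suc k'" using k' by (metis idx_eq_iff)
      then have "Suc k' < idx a" using that by linarith
      then show ?thesis using c(2) by (simp add: std_flag_eq k')
    qed (simp add: that)
    ultimately have ck: "c $ k \<noteq> 0" by (auto simp: std_flag_eq)
    have c0: "c $ a = 0" if "k < a" for a using c(2) that by (simp add: std_flag_eq)
    have eq: "c $ m + (\<Sum>l | l < m. Y $ m $ l * c $ l) = 0" if "w (idx k) < w (idx m)" for m
    proof -
      have "w (idx m) \<in> {1..CARD('n)}" using w idx_range[of m] by (auto dest: bij_betwE)
      then have "v $ coord (w (idx m)) = 0" using v(2) that by (auto simp: std_flag_eq idx_coord)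
      then show ?thesis
        by (simp add: c(1) perm_mat_nth[OF w] strictly_lower_mult[OF Y] flip: matrix_vector_mul_assoc)
    qed
    \<comment> \<open>The row equation \<open>eq\<close> expresses \<open>c $ l\<close> by earlier
      terms; each of them vanishes, by the inner induction if its row is also too high for
      \<open>?F\<close>, and by the outer one otherwise.\<close>
    have small: "c $ l = 0" if "l < k" "w (idx k) < w (idx l)" for l
      using that
    proof (induction l rule: less_induct)
      case (less l)
      have "Y $ l $ a * c $ a = 0" if "a < l" for a
      proof (cases "w (idx k) < w (idx a)")
        case True
        then show ?thesis using less that by auto
      next
        case False
        then have "w (idx a) < w (idx l)" using less.prems by simp
        then show ?thesis using less.prems that \<open>\<And>y m. y < k \<Longrightarrow> y < m \<Longrightarrow> w (idx y) < w (idx m) \<Longrightarrow> Y $ m $ y = 0\<close>[of a l] by auto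
      qed
      then have "(\<Sum>a | a < l. Y $ l $ a * c $ a) = 0" by (intro sum.neutral) auto
      then show ?case using eq[OF less.prems(2)] by simp
    qed
    \<comment> \<open>Thus the row equation of \<open>m\<close> reduces to its single term at
      \<open>k\<close>.\<close>
    have "Y $ m $ l * c $ l = 0" if "l < m" "l \<noteq> k" for l
    proof (cases "l < k")
      case True
      then show ?thesis
        using small[of l] less.IH[of l m] less.prems that inj[of l k] by (cases "w (idx k) < w (idx l)") auto
    next
      case False
      then show ?thesis using c0[of l] that by simp
    qed
    then have "(\<Sum>l | l < m. Y $ m $ l * c $ l) = (\<Sum>l\<in>{k}. Y $ m $ l * c $ l)"
      using less.prems by (intro sum.mono_neutral_right) auto
    then show ?case using eq[OF less.prems(2)] c0[OF less.prems(1)] ck by simp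
  qed
  then have "Y $ i $ j = 0" if "\<not> (j < i \<and> w (idx i) < w (idx j))" for i j
    using that Y inj[of i j] by (cases "j < i"; cases "i = j") (auto simp: strictly_lower_def not_less order.order_iff_strict)
  then show "Y \<in> cell_coords w" by (auto simp: cell_coords_def)
qed

subsection \<open>Semicontinuity\<close>

lemma vec_subspace_imp_subspace: "vec.subspace S \<Longrightarrow> subspace (S :: (complex^'n) set)"
proof -
  assume S: "vec.subspace S"
  have "r *\<^sub>R x = complex_of_real r *s x" for r and x :: "complex^'n"
    unfolding vec_eq_iff vector_scaleR_component vector_smult_component by (simp add: scaleR_conv_of_real)
  with S show ?thesis by (auto simp: subspace_def vec.subspace_def)
qed

lemma closed_vec_subspace: "vec.subspace S \<Longrightarrow> closed (S :: (complex^'n) set)"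
  by (simp add: closed_subspace vec_subspace_imp_subspace)

text \<open>Upper semicontinuity of the dimension of a preimage. Let \<open>D\<close> be a
  complement in \<open>E\<close> of the preimage at \<open>A0\<close>: no unit vector of
  \<open>D\<close> is sent into \<open>F\<close>, this persists for nearby matrices, and a preimage
  that meets \<open>D\<close> only in zero is no larger than the original one.\<close>

lemma open_dim_preimage_le:
  fixes E F :: "'n::{finite,wellorder} cvec set"
  assumes E: "vec.subspace E" and F: "vec.subspace F"
  shows "open {A :: 'n cmat. vec.dim {c \<in> E. A *v c \<in> F} \<le> r}"
proof (subst open_subopen, safe)
  fix A0 :: "'n cmat"
  define K where "K A = {c \<in> E. A *v c \<in> F}" for A :: "'n cmat"
  assume "vec.dim {c \<in> E. A0 *v c \<in> F} \<le> r"
  then have r: "vec.dim (K A0) \<le> r" by (simp add: K_def)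
  have K: "vec.subspace (K A)" for A
    using E F by (auto simp: K_def vec.subspace_def matrix_vector_right_distrib vector_scalar_commute)
  obtain B where B0: "B \<subseteq> K A0" "vec.independent B" "K A0 \<subseteq> vec.span B"
    by (rule vec.basis_exists[of "K A0"])
  then have B: "B \<subseteq> K A0" "vec.independent B" "vec.span B = K A0"
    using vec.span_minimal[OF B0(1) K] by auto
  have "B \<subseteq> E" using B by (auto simp: K_def)
  then obtain B' where B': "B \<subseteq> B'" "B' \<subseteq> E" "vec.independent B'" "E \<subseteq> vec.span B'"
    using vec.maximal_independent_subset_extend B(2) by metis
  define D where "D = vec.span (B' - B)"
  have fin: "finite B'" using B' vec.finiteI_independent by blast
  have "vec.independent (B' - B)" using B' vec.independent_mono by blast
  then have dimD: "vec.dim D = card B' - card B"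
    unfolding D_def using B' fin by (simp add: vec.dim_eq_card_independent card_Diff_subset finite_subset)
  have dimE: "vec.dim E = card B'"
    using B' E vec.basis_card_eq_dim by metis
  have dimK: "vec.dim (K A0) = card B" using B vec.dim_span_eq_card_independent by metis
  have DE: "D \<subseteq> E" unfolding D_def using B' E by (intro vec.span_minimal) auto
  have "vec.span B \<inter> D \<subseteq> {0}"
  proof -
    let ?S = "{x + y | x y. x \<in> vec.span B \<and> y \<in> D}"
    have "b \<in> ?S" if "b \<in> B'" for b
    proof (cases "b \<in> B")
      case True
      then show ?thesis
        by (intro CollectI exI[of _ b] exI[of _ 0]) (simp add: D_def vec.span_base vec.span_zero)
    next
      case False
      with that show ?thesis
        by (intro CollectI exI[of _ 0] exI[of _ b]) (simp add: D_def vec.span_base vec.span_zero)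
    qed
    then have "card B' \<le> vec.dim ?S"
      using B' vec.independent_card_le_dim by blast
    moreover have "vec.dim ?S + vec.dim (vec.span B \<inter> D) = vec.dim (vec.span B) + vec.dim D"
      by (intro vec.dim_sums_Int) (auto simp: D_def)
    moreover have "card B \<le> card B'" using B' fin by (simp add: card_mono)
    moreover have "vec.dim (vec.span B) = card B" using B vec.dim_span_eq_card_independent by metis
    ultimately have "vec.dim (vec.span B \<inter> D) = 0" using dimD by linarith
    then show ?thesis by (simp only: vec.dim_eq_0)
  qed
  define S where "S = {c \<in> D. norm c = 1}"
  have "compact S"
  proof -
    have "S = D \<inter> sphere 0 1" by (auto simp: S_def)
    then show ?thesis using closed_vec_subspace[of D] by (simp add: D_def closed_Int_compact)
  qed
  define Bad where "Bad = {A :: 'n cmat. \<exists>c\<in>S. A *v c \<in> F}"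
  \<comment> \<open>Compactness of the unit sphere of \<open>D\<close> supplies a limit of the
    offending vectors.\<close>
  have "closed Bad"
    unfolding closed_sequential_limits
  proof (intro allI impI, elim conjE)
    fix X and A :: "'n cmat" assume X: "\<forall>m. X m \<in> Bad" "X \<longlonglongrightarrow> A"
    from X(1) have "\<forall>m. \<exists>c. c \<in> S \<and> X m *v c \<in> F" unfolding Bad_def by blast
    from choice[OF this] obtain c where c: "\<And>m. c m \<in> S" "\<And>m. X m *v c m \<in> F" by blast
    have "\<forall>m. c m \<in> S" using c by blast
    with \<open>compact S\<close> obtain l \<rho> where l: "l \<in> S" "strict_mono \<rho>" "(c \<circ> \<rho>) \<longlonglongrightarrow> l"
      unfolding compact_def by blast
    have "(\<lambda>m. X (\<rho> m)) \<longlonglongrightarrow> A" using LIMSEQ_subseq_LIMSEQ[OF X(2) l(2)] by (simp add: o_def)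
    then have "(\<lambda>m. X (\<rho> m) *v c (\<rho> m)) \<longlonglongrightarrow> A *v l"
      using l(3) unfolding matrix_vector_mult_def o_def
      by (intro vec_tendstoI) (auto intro!: tendsto_intros)
    then have "A *v l \<in> F"
      by (rule closed_sequentially[OF closed_vec_subspace[OF F], rotated]) (simp add: c(2))
    then show "A \<in> Bad" using l(1) by (auto simp: Bad_def)
  qed
  have "A0 \<notin> Bad"
  proof
    assume "A0 \<in> Bad"
    then obtain c where "c \<in> D" "norm c = 1" "A0 *v c \<in> F" by (auto simp: Bad_def S_def)
    then have "c \<in> vec.span B \<inter> D" using DE B by (auto simp: K_def)
    then show False using \<open>vec.span B \<inter> D \<subseteq> {0}\<close> \<open>norm c = 1\<close> by auto
  qed
  moreover have "- Bad \<subseteq> {A. vec.dim {c \<in> E. A *v c \<in> F} \<le> r}"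
  proof safe
    fix A assume A: "A \<notin> Bad"
    have "K A \<inter> D \<subseteq> {0}"
    proof safe
      fix c assume c: "c \<in> K A" "c \<in> D"
      show "c = 0"
      proof (rule ccontr)
        assume "c \<noteq> 0"
        define d where "d = complex_of_real (1 / norm c) *s c"
        have "d = (1 / norm c) *\<^sub>R c" unfolding d_def vec_eq_iff vector_scaleR_component vector_smult_component
          by (simp add: scaleR_conv_of_real)
        then have "norm d = 1" using \<open>c \<noteq> 0\<close> by simp
        moreover have "d \<in> D" "d \<in> K A"
          unfolding d_def using c K by (auto simp: D_def vec.span_scale intro: vec.subspace_scale)
        ultimately show False using A by (auto simp: Bad_def S_def K_def)
      qed
    qed
    then have "vec.dim (K A \<inter> D) = 0" by (simp only: vec.dim_eq_0)
    moreover have "vec.dim {x + y | x y. x \<in> K A \<and> y \<in> D} + vec.dim (K A \<inter> D) = vec.dim (K A) + vec.dim D"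
      using K by (intro vec.dim_sums_Int) (auto simp: D_def)
    moreover have "vec.dim {x + y | x y. x \<in> K A \<and> y \<in> D} \<le> vec.dim E"
      using DE E by (intro vec.dim_subset) (auto simp: K_def intro: vec.subspace_add)
    moreover have "card B \<le> card B'" using B' fin by (simp add: card_mono)
    ultimately show "vec.dim {c \<in> E. A *v c \<in> F} \<le> r"
      using r dimK dimE dimD unfolding K_def[symmetric] by linarith
  qed
  ultimately show "\<exists>T. open T \<and> A0 \<in> T \<and> T \<subseteq> {A. vec.dim {c \<in> E. A *v c \<in> F} \<le> r}"
    using \<open>closed Bad\<close> by (intro exI[of _ "- Bad"]) auto
qed

lemma dim_act_Int:
  fixes A :: "'n::{finite,wellorder} cmat"
  assumes "invertible A"
  shows "vec.dim (act A std_flag k \<inter> W) = vec.dim {c \<in> std_flag k. A *v c \<in> W}"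
proof -
  have "act A std_flag k \<inter> W = (*v) A ` {c \<in> std_flag k. A *v c \<in> W}" by (auto simp: act_def)
  then show ?thesis using invertible_inj[OF assms] by (simp add: vec.dim_image_eq inj_on_subset)
qed

subsection \<open>The big cell as a chart\<close>

definition low_part :: "'n::{finite,wellorder} cmat \<Rightarrow> 'n cmat" where
  "low_part M = (\<chi> i j. if j < i then M $ i $ j else 0)"

definition up_part :: "'n::{finite,wellorder} cmat \<Rightarrow> 'n cmat" where
  "up_part M = (\<chi> i j. if j < i then 0 else M $ i $ j)"

text \<open>Both factors of an LU decomposition are packed into one matrix. Source and target are
  then the same vector space, and invariance of domain yields the open image and the continuous
  inverse without explicit formulas for the factors.\<close>

definition lu_map :: "'n::{finite,wellorder} cmat \<Rightarrow> 'n cmat" where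
  "lu_map M = (mat 1 + low_part M) ** up_part M"

definition lu_dom :: "'n::{finite,wellorder} cmat set" where
  "lu_dom = {M. invertible (up_part M)}"

definition big_cell :: "'n::{finite,wellorder} cmat set" where
  "big_cell = lu_map ` lu_dom"

definition lu_inv :: "'n::{finite,wellorder} cmat \<Rightarrow> 'n cmat" where
  "lu_inv = inv_into lu_dom lu_map"

definition chart_low :: "'n::{finite,wellorder} cmat \<Rightarrow> 'n cmat" where
  "chart_low N = low_part (lu_inv N)"

definition chart_up :: "'n::{finite,wellorder} cmat \<Rightarrow> 'n cmat" where
  "chart_up N = up_part (lu_inv N)"

lemma low_part_strictly_lower [simp]: "low_part M \<in> strictly_lower"
  by (auto simp: low_part_def strictly_lower_def dest: leD)

lemma low_up_sum: "low_part M + up_part M = M"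
  by (simp add: low_part_def up_part_def vec_eq_iff)

lemma up_part_borel: "M \<in> lu_dom \<Longrightarrow> up_part M \<in> upper_borel"
  by (rule upper_borelI_upper) (auto simp: lu_dom_def up_part_def)

lemma low_part_add:
  assumes "Y \<in> strictly_lower" "b \<in> upper_borel"
  shows "low_part (Y + b) = Y" "up_part (Y + b) = b"
  using assms by (auto simp: low_part_def up_part_def strictly_lower_def vec_eq_iff upper_borel_upper not_less)

text \<open>The quotient \<open>c\<close> of the upper factors satisfies
  \<open>(1 + L) c = 1 + L'\<close> and is again upper triangular; reading this equation row by row
  forces \<open>c\<close> to be the identity.\<close>

lemma lu_unique:
  fixes L L' :: "'n::{finite,wellorder} cmat"
  assumes L: "L \<in> strictly_lower" "L' \<in> strictly_lower" and b: "b \<in> upper_borel" "b' \<in> upper_borel"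
    and eq: "(mat 1 + L) ** b = (mat 1 + L') ** b'"
  shows "L = L'" "b = b'"
proof -
  define c where "c = b ** matrix_inv b'"
  have c: "c \<in> upper_borel" using b by (simp add: c_def upper_borel_mult upper_borel_inv)
  have "(mat 1 + L) ** c = (mat 1 + L') ** (b' ** matrix_inv b')"
    using eq by (simp add: c_def matrix_mul_assoc)
  then have eq': "(mat 1 + L) ** c = mat 1 + L'" using upper_borel_invertible[OF b(2)] by simp
  have "\<forall>j. c $ i $ j = mat 1 $ i $ j \<and> L $ i $ j = L' $ i $ j" for i
  proof (induction i rule: less_induct)
    case (less i)
    show ?case
    proof
      fix j
      have "((mat 1 + L) ** c) $ i $ j = ((mat 1 + L) *v column j c) $ i"
        by (simp add: matrix_matrix_mult_def matrix_vector_mult_def column_def)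
      also have "\<dots> = c $ i $ j + (\<Sum>l | l < i. L $ i $ l * c $ l $ j)"
        by (simp add: strictly_lower_mult[OF L(1)]) (simp add: column_def)
      also have "(\<Sum>l | l < i. L $ i $ l * c $ l $ j) = (\<Sum>l | l < i. if l = j then L $ i $ j else 0)"
        using less.IH by (intro sum.cong) (auto simp: mat_def)
      also have "\<dots> = (if j < i then L $ i $ j else 0)" by simp
      finally have *: "c $ i $ j + (if j < i then L $ i $ j else 0) = mat 1 $ i $ j + L' $ i $ j"
        using eq' by simp
      show "c $ i $ j = mat 1 $ i $ j \<and> L $ i $ j = L' $ i $ j"
      proof (cases "j < i")
        case True
        then have "c $ i $ j = 0" "mat 1 $ i $ j = (0 :: complex)" using upper_borel_upper[OF c] by (auto simp: mat_def)
        with * True show ?thesis by simp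
      next
        case False
        then have "L $ i $ j = 0" "L' $ i $ j = 0" using L by (auto simp: strictly_lower_def not_less)
        with * False show ?thesis by simp
      qed
    qed
  qed
  then have "c = mat 1" and "L = L'" by (simp_all add: vec_eq_iff)
  then show "L = L'" by simp
  have "c ** b' = b ** (matrix_inv b' ** b')" by (simp only: c_def matrix_mul_assoc)
  then show "b = b'" using \<open>c = mat 1\<close> upper_borel_invertible[OF b(2)] by simp
qed

lemma lu_map_inj: "inj_on lu_map lu_dom"
proof (rule inj_onI)
  fix M M' :: "'a cmat" assume "M \<in> lu_dom" "M' \<in> lu_dom" "lu_map M = lu_map M'"
  then have "low_part M = low_part M'" "up_part M = up_part M'"
    using lu_unique[OF low_part_strictly_lower low_part_strictly_lower up_part_borel up_part_borel]
    unfolding lu_map_def by blast+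
  then show "M = M'" by (metis low_up_sum)
qed

lemma continuous_on_low_part [continuous_intros]:
  "continuous_on S f \<Longrightarrow> continuous_on S (\<lambda>x. low_part (f x))"
  unfolding low_part_def
  by (intro continuous_on_vec_lambda, rename_tac i j, case_tac "j < i") (auto intro!: continuous_intros)

lemma continuous_on_up_part [continuous_intros]:
  "continuous_on S f \<Longrightarrow> continuous_on S (\<lambda>x. up_part (f x))"
  unfolding up_part_def
  by (intro continuous_on_vec_lambda, rename_tac i j, case_tac "j < i") (auto intro!: continuous_intros)

lemma open_lu_dom: "open lu_dom"
proof -
  have "open (up_part -` {g :: 'a cmat. invertible g})"
    by (intro continuous_open_vimage[OF open_invertible] continuous_on_eq_continuous_at[THEN iffD1, rule_format, OF open_UNIV]
        continuous_on_up_part continuous_on_id) simp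
  moreover have "up_part -` {g :: 'a cmat. invertible g} = lu_dom" by (auto simp: lu_dom_def)
  ultimately show ?thesis by simp
qed

lemma continuous_on_lu_map: "continuous_on S lu_map"
  unfolding lu_map_def by (intro continuous_intros)

lemma open_big_cell: "open big_cell"
  unfolding big_cell_def by (rule invariance_of_domain[OF continuous_on_lu_map open_lu_dom lu_map_inj])

lemma continuous_on_lu_inv: "continuous_on big_cell lu_inv"
  unfolding big_cell_def
  by (rule continuous_on_inverse_open[OF open_lu_dom continuous_on_lu_map])
    (auto simp: lu_inv_def inv_into_f_f[OF lu_map_inj])

lemma continuous_on_chart_low: "continuous_on big_cell chart_low"
  unfolding chart_low_def by (intro continuous_intros continuous_on_lu_inv)

lemma big_cell_decomp:
  assumes "N \<in> big_cell"
  shows "(mat 1 + chart_low N) ** chart_up N = N" "chart_low N \<in> strictly_lower" "chart_up N \<in> upper_borel"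
    "invertible N" "act N std_flag = act (mat 1 + chart_low N) std_flag"
proof -
  have "lu_inv N \<in> lu_dom" "lu_map (lu_inv N) = N"
    using assms by (auto simp: big_cell_def lu_inv_def inv_into_into f_inv_into_f)
  then show *: "(mat 1 + chart_low N) ** chart_up N = N" "chart_low N \<in> strictly_lower" "chart_up N \<in> upper_borel"
    by (auto simp: chart_low_def chart_up_def lu_map_def up_part_borel)
  show "invertible N" "act N std_flag = act (mat 1 + chart_low N) std_flag"
    using * invertible_unipotent[OF *(2)] upper_borel_invertible[OF *(3)] act_upper_borel[OF *(3)]
    by (metis invertible_mult)+
qed

lemma big_cellI:
  assumes "Y \<in> strictly_lower" "b \<in> upper_borel"
  shows "(mat 1 + Y) ** b \<in> big_cell" "chart_low ((mat 1 + Y) ** b) = Y" "chart_up ((mat 1 + Y) ** b) = b"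
proof -
  have "Y + b \<in> lu_dom" "lu_map (Y + b) = (mat 1 + Y) ** b"
    using assms by (auto simp: lu_dom_def lu_map_def low_part_add upper_borel_invertible)
  then show *: "(mat 1 + Y) ** b \<in> big_cell" unfolding big_cell_def by force
  show "chart_low ((mat 1 + Y) ** b) = Y" "chart_up ((mat 1 + Y) ** b) = b"
    using lu_unique[OF _ assms(1) _ assms(2)] big_cell_decomp[OF *] by auto
qed

text \<open>The chart coordinates of a flag can thus be read off from any of its frames, which makes
  changes of charts and moving frames accessible through \<open>chart_low\<close>.\<close>

lemma big_cellI_flag:
  assumes "Y \<in> strictly_lower" "invertible N" "act N std_flag = act (mat 1 + Y) std_flag"
  shows "N \<in> big_cell" "chart_low N = Y"
proof -
  have inv: "invertible (mat 1 + Y)" using assms by (simp add: invertible_unipotent)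
  then have "matrix_inv (mat 1 + Y) ** N \<in> upper_borel" using act_eq_iff assms by blast
  from big_cellI[OF assms(1) this] inv show "N \<in> big_cell" "chart_low N = Y" by simp_all
qed

lemma flag_chart_act: "flag_chart g Y = act g (act (mat 1 + Y) std_flag)"
  by (simp add: flag_chart_def act_mult)

lemma act_cancel:
  assumes "invertible g" "act g V = act g W"
  shows "V = W"
  using assms by (metis act_mult act_one matrix_inv_left')

lemma flag_chart_inj:
  assumes "invertible g" "Y \<in> strictly_lower" "Y' \<in> strictly_lower" "flag_chart g Y = flag_chart g Y'"
  shows "Y = Y'"
proof -
  have "act (mat 1 + Y) std_flag = act (mat 1 + Y') std_flag"
    using assms act_cancel by (auto simp: flag_chart_act)
  then show ?thesis
    using big_cellI_flag(2)[of Y "mat 1 + Y"] big_cellI_flag(2)[of Y' "mat 1 + Y"] assms invertible_unipotent by metis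
qed

subsection \<open>Uniqueness of the dimension\<close>

text \<open>At a common point the transition between the two straightening coordinate systems maps
  an open piece of \<open>L\<close> continuously and injectively into \<open>L'\<close>, so
  invariance of dimension applies.\<close>

lemma submanifold_dim_le:
  fixes M N S :: "'n::{finite,wellorder} flag set"
  assumes M: "complex_submanifold d M" and N: "complex_submanifold d' N"
    and oM: "openin (subtopology flag_topology S) M" and oN: "openin (subtopology flag_topology S) N"
    and V: "V \<in> M" "V \<in> N"
  shows "d \<le> d'"
proof -
  obtain g X where g: "invertible g" "X \<in> strictly_lower" "flag_chart g X = V"
    and sub: "matrix_submanifold_at d {Y \<in> strictly_lower. flag_chart g Y \<in> M} X"
    using M V unfolding complex_submanifold_def by blast
  obtain g' X' where g': "invertible g'" "X' \<in> strictly_lower" "flag_chart g' X' = V"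
    and sub': "matrix_submanifold_at d' {Y \<in> strictly_lower. flag_chart g' Y \<in> N} X'"
    using N V unfolding complex_submanifold_def by blast
  define E where "E = {Y \<in> strictly_lower. flag_chart g Y \<in> M}"
  define E' where "E' = {Y \<in> strictly_lower. flag_chart g' Y \<in> N}"
  obtain U W \<phi> \<psi> L where U: "X \<in> U" "biholomorphic_maps U W \<phi> \<psi>" "subspace L" "dim L = 2 * d" "\<phi> ` (E \<inter> U) = W \<inter> L"
    using sub unfolding matrix_submanifold_at_def E_def by blast
  obtain U' W' \<phi>' \<psi>' L' where U': "X' \<in> U'" "biholomorphic_maps U' W' \<phi>' \<psi>'" "subspace L'" "dim L' = 2 * d'"
      "\<phi>' ` (E' \<inter> U') = W' \<inter> L'"
    using sub' unfolding matrix_submanifold_at_def E'_def by blast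
  have hom: "open U" "open W" "homeomorphism U W \<phi> \<psi>" and hom': "open U'" "open W'" "homeomorphism U' W' \<phi>' \<psi>'"
    using U(2) U'(2) by (auto simp: biholomorphic_maps_def)
  obtain T where T: "openin flag_topology T" "N = T \<inter> S" using oN by (auto simp: openin_subtopology)
  have MS: "M \<subseteq> S" using oM by (auto simp: openin_subtopology)
  \<comment> \<open>A frame, seen from \<open>g'\<close>, of the flag with straightened coordinates
    \<open>A\<close>; its lower part is the coordinate of that flag in the second chart.\<close>
  define f where "f A = matrix_inv g' ** (g ** (mat 1 + \<psi> A))" for A
  have contg: "continuous_on W (\<lambda>A. g ** (mat 1 + \<psi> A))" and contf: "continuous_on W f"
    unfolding f_def by (intro continuous_intros homeomorphism_cont2[OF hom(3)])+
  \<comment> \<open>On \<open>O1\<close> the flag lies in the open set that cuts \<open>N\<close>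
    out of \<open>S\<close>; on \<open>O2\<close> it lies in the second chart and in the domain of
    \<open>\<phi>'\<close>.\<close>
  define O1 where "O1 = {A \<in> W. g ** (mat 1 + \<psi> A) \<in> {h. invertible h \<and> act h std_flag \<in> T}}"
  define O2 where "O2 = {A \<in> W. f A \<in> {P \<in> big_cell. chart_low P \<in> U'}}"
  define Q where "Q = L \<inter> (O1 \<inter> O2)"
  have "open O1" unfolding O1_def
    using continuous_open_preimage[OF contg hom(2) open_flag_preimage[OF T(1)]] by (simp add: vimage_def Int_def)
  moreover have "open {P \<in> big_cell. chart_low P \<in> U'}"
    using continuous_open_preimage[OF continuous_on_chart_low open_big_cell hom'(1)] by (simp add: vimage_def Int_def)
  from continuous_open_preimage[OF contf hom(2) this] have "open O2"
    unfolding O2_def by (simp add: vimage_def Int_def)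
  ultimately have openQ: "openin (top_of_set L) Q" unfolding Q_def by (intro openin_open_Int open_Int)
  define F where "F A = \<phi>' (chart_low (f A))" for A
  have QW: "A \<in> W" if "A \<in> Q" for A using that by (auto simp: Q_def O1_def)
  have Q1: "\<psi> A \<in> E \<and> \<psi> A \<in> U \<and> \<phi> (\<psi> A) = A" if "A \<in> Q" for A
  proof -
    have "A \<in> \<phi> ` (E \<inter> U)" using that QW[OF that] U(5) by (auto simp: Q_def)
    then show ?thesis using homeomorphism_apply1[OF hom(3)] by auto
  qed
  have fchart: "flag_chart g' (chart_low (f A)) = flag_chart g (\<psi> A)" "f A \<in> big_cell" "chart_low (f A) \<in> U'"
    if "A \<in> Q" for A
  proof -
    show *: "f A \<in> big_cell" "chart_low (f A) \<in> U'" using that by (auto simp: Q_def O2_def)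
    have "flag_chart g' (chart_low (f A)) = act g' (act (f A) std_flag)"
      using big_cell_decomp(5)[OF *(1)] by (simp add: flag_chart_act)
    also have "\<dots> = flag_chart g (\<psi> A)" using g'(1) by (simp add: f_def flag_chart_def flip: act_mult)
    finally show "flag_chart g' (chart_low (f A)) = flag_chart g (\<psi> A)" .
  qed
  have Q2: "chart_low (f A) \<in> E'" if "A \<in> Q" for A
  proof -
    have "flag_chart g (\<psi> A) \<in> M" using Q1[OF that] by (simp add: E_def)
    moreover have "flag_chart g (\<psi> A) \<in> T" using that by (auto simp: Q_def O1_def flag_chart_def)
    ultimately have "flag_chart g (\<psi> A) \<in> N" using MS T by auto
    then show ?thesis using fchart[OF that] big_cell_decomp(2)[OF fchart(2)[OF that]] by (simp add: E'_def)
  qed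
  have "continuous_on Q F"
    unfolding F_def
  proof (rule continuous_on_compose2[OF homeomorphism_cont1[OF hom'(3)]])
    show "continuous_on Q (\<lambda>A. chart_low (f A))"
      using continuous_on_subset[OF contf, of Q] QW fchart(2)
      by (intro continuous_on_compose2[OF continuous_on_chart_low]) auto
  qed (use fchart in auto)
  moreover have "F \<in> Q \<rightarrow> L'"
    using U'(5) Q2 fchart(3) by (auto simp: F_def)
  moreover have "inj_on F Q"
  proof (rule inj_onI)
    fix A B assume AB: "A \<in> Q" "B \<in> Q" "F A = F B"
    then have "chart_low (f A) = chart_low (f B)"
      unfolding F_def using homeomorphism_apply1[OF hom'(3)] fchart(3) by metis
    then have "flag_chart g (\<psi> A) = flag_chart g (\<psi> B)" using fchart(1) AB by metis
    then have "\<psi> A = \<psi> B" using flag_chart_inj[OF g(1)] Q1 AB by (auto simp: E_def)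
    then show "A = B" using Q1 AB by metis
  qed
  moreover have "\<phi> X \<in> Q"
  proof -
    have XE: "X \<in> E" using g V by (simp add: E_def)
    then have X: "\<phi> X \<in> W" "\<phi> X \<in> L" "\<psi> (\<phi> X) = X"
      using U(1,5) homeomorphism_apply1[OF hom(3)] by auto
    have "act (f (\<phi> X)) std_flag = act (matrix_inv g') V"
      using g(3) by (simp add: f_def X flag_chart_def act_mult)
    also have "\<dots> = act (mat 1 + X') std_flag"
      using g' by (metis act_mult act_one flag_chart_act matrix_inv_left')
    finally have "f (\<phi> X) \<in> big_cell" "chart_low (f (\<phi> X)) = X'"
      using big_cellI_flag[OF g'(2)] g g' by (auto simp: f_def X invertible_mult invertible_unipotent)
    then have "\<phi> X \<in> O2" using X U'(1) by (simp add: O2_def)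
    moreover have "\<phi> X \<in> O1"
      using X V(2) T g by (auto simp: O1_def invertible_mult invertible_unipotent flag_chart_def)
    ultimately show ?thesis using X by (simp add: Q_def)
  qed
  ultimately have "dim L \<le> dim L'"
    using invariance_of_dimension_subspaces[OF openQ U(3) U'(3)] by blast
  then show ?thesis using U(4) U'(4) by simp
qed

text \<open>A dense and a relatively open part of \<open>S\<close> always share a point, and at that
  point the two dimensions agree by \<open>submanifold_dim_le\<close> in both directions.\<close>

lemma has_complex_dim_iff:
  fixes S R :: "'n::{finite,wellorder} flag set"
  assumes R: "openin (subtopology flag_topology S) R" "S \<subseteq> flag_topology closure_of R"
    "complex_submanifold e R" "R \<noteq> {}"
  shows "has_complex_dim S d \<longleftrightarrow> d = e"
proof
  assume "has_complex_dim S d"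
  then obtain M where M: "openin (subtopology flag_topology S) M" "S \<subseteq> flag_topology closure_of M" "complex_submanifold d M"
    by (auto simp: has_complex_dim_def)
  obtain T where T: "openin flag_topology T" "R = T \<inter> S" using R(1) by (auto simp: openin_subtopology)
  obtain V0 where "V0 \<in> R" using R(4) by blast
  then have "V0 \<in> flag_topology closure_of M" "V0 \<in> T" using M(2) T(2) by auto
  then obtain V where V: "V \<in> M" "V \<in> T" using T(1) by (auto simp: in_closure_of)
  then have "V \<in> R" using M(1) T by (auto simp: openin_subtopology)
  then show "d = e"
    using submanifold_dim_le[OF M(3) R(3) M(1) R(1)] submanifold_dim_le[OF R(3) M(3) R(1) M(1)] V by fastforce
next
  assume "d = e"
  then show "has_complex_dim S d" using R by (auto simp: has_complex_dim_def)
qed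

lemma dim_pattern:
  fixes S :: "('n::{finite,wellorder} \<times> 'n) set"
  shows "dim {X :: 'n cmat. \<forall>i j. (i, j) \<notin> S \<longrightarrow> X $ i $ j = 0} = 2 * card S"
proof -
  let ?a = "\<lambda>((i, j), b). axis i (axis j b) :: 'n cmat"
  let ?d = "?a ` (S \<times> {1, \<i>})"
  have "?d \<subseteq> Basis" by (auto simp: Basis_vec_def Basis_complex_def)
  from dim_substandard[OF this] have "dim {X :: 'n cmat. \<forall>b\<in>Basis. b \<notin> ?d \<longrightarrow> X \<bullet> b = 0} = card ?d" .
  moreover have "card ?d = 2 * card S"
  proof -
    have "inj_on ?a (S \<times> {1, \<i>})" by (auto simp: inj_on_def axis_eq_axis)
    then have "card ?d = card (S \<times> {1, \<i>})" by (rule card_image)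
    then show ?thesis by (simp add: card_cartesian_product)
  qed
  moreover have "{X :: 'n cmat. \<forall>b\<in>Basis. b \<notin> ?d \<longrightarrow> X \<bullet> b = 0} = {X. \<forall>i j. (i, j) \<notin> S \<longrightarrow> X $ i $ j = 0}"
  proof (intro Collect_cong iffI allI impI ballI)
    fix X :: "'n cmat" and i j assume X: "\<forall>b\<in>Basis. b \<notin> ?d \<longrightarrow> X \<bullet> b = 0" and ij: "(i, j) \<notin> S"
    have "X \<bullet> axis i (axis j b) = 0" if "b \<in> {1, \<i>}" for b
    proof -
      have "axis i (axis j b) \<notin> ?d" using ij that by (auto simp: axis_eq_axis)
      moreover have "axis i (axis j b) \<in> (Basis :: 'n cmat set)" using that by (auto simp: Basis_vec_def Basis_complex_def)
      ultimately show ?thesis using X by blast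
    qed
    from this[of 1] this[of \<i>] show "X $ i $ j = 0"
      by (simp add: inner_axis complex_eq_iff inner_complex_def)
  next
    fix X b :: "'n cmat" assume X: "\<forall>i j. (i, j) \<notin> S \<longrightarrow> X $ i $ j = 0" and b: "b \<in> Basis" "b \<notin> ?d"
    then obtain i j c where "b = axis i (axis j c)" "c \<in> {1, \<i>}" by (auto simp: Basis_vec_def Basis_complex_def)
    moreover have "(i, j) \<notin> S" using b(2) calculation by force
    ultimately show "X \<bullet> b = 0" using X by (simp add: inner_axis)
  qed
  ultimately show ?thesis by simp
qed

lemma matrix_submanifold_at_subspace:
  assumes "subspace L" "\<forall>c. \<forall>A\<in>L. mat c ** A \<in> L" "dim L = 2 * d"
  shows "matrix_submanifold_at d L X"
proof -
  have "biholomorphic_maps UNIV UNIV (\<lambda>X :: 'a cmat. X) (\<lambda>X. X)"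
    unfolding biholomorphic_maps_def holomorphic_map_def
    by (auto intro!: homeomorphism_ident exI[of _ "\<lambda>X. X"] has_derivative_ident)
  then show ?thesis unfolding matrix_submanifold_at_def using assms
    by (intro exI[of _ UNIV] exI[of _ "\<lambda>X. X"] exI[of _ L]) auto
qed

lemma mat_mult_nth: "(mat c ** A) $ i $ j = c * A $ i $ j" for A :: "'n::{finite,wellorder} cmat"
  by (simp add: matrix_matrix_mult_def mat_def if_distrib[of "\<lambda>x. x * _"] cong: if_cong)

lemma matrix_submanifold_at_pattern:
  fixes S :: "('n::{finite,wellorder} \<times> 'n) set"
  shows "matrix_submanifold_at (card S) {X :: 'n cmat. \<forall>i j. (i, j) \<notin> S \<longrightarrow> X $ i $ j = 0} X"
  by (rule matrix_submanifold_at_subspace[OF _ _ dim_pattern]) (auto simp: subspace_def mat_mult_nth)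

subsection \<open>Schubert cells relative to a frame\<close>

definition cell :: "'n::{finite,wellorder} cmat \<Rightarrow> (nat \<Rightarrow> nat) \<Rightarrow> 'n flag set" where
  "cell U w = {act A std_flag | A. invertible A \<and> matrix_inv U ** A \<in> bruhat w}"

text \<open>Two frames of a flag differ by an upper triangular right factor, which the double coset
  absorbs. Membership in a cell is therefore a condition on the flag.\<close>

lemma act_mem_cell:
  assumes "invertible A"
  shows "act A std_flag \<in> cell U w \<longleftrightarrow> matrix_inv U ** A \<in> bruhat w"
proof
  assume "act A std_flag \<in> cell U w"
  then obtain A' where A': "act A std_flag = act A' std_flag" "invertible A'" "matrix_inv U ** A' \<in> bruhat w"
    by (auto simp: cell_def)
  then have b: "matrix_inv A' ** A \<in> upper_borel" using act_eq_iff assms by blast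
  have "mat 1 ** (matrix_inv U ** A') ** (matrix_inv A' ** A) \<in> bruhat w"
    using A'(3) b by (intro bruhat_mult) auto
  moreover have "mat 1 ** (matrix_inv U ** A') ** (matrix_inv A' ** A) = matrix_inv U ** A"
    using A'(2) by (simp flip: matrix_mul_assoc)
  ultimately show "matrix_inv U ** A \<in> bruhat w" by simp
qed (use assms in \<open>auto simp: cell_def\<close>)

lemma cell_complete_flags: "cell U w \<subseteq> complete_flags"
  by (auto simp: cell_def)

lemma cell_dim:
  fixes U :: "'n::{finite,wellorder} cmat"
  assumes U: "invertible U" and w: "bij_betw w {1..CARD('n)} {1..CARD('n)}" and V: "V \<in> cell U w" and k: "k \<le> CARD('n)"
  shows "vec.dim (V k \<inter> act U std_flag j) = rank_fun w k j"
proof -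
  obtain A where A: "V = act A std_flag" "invertible A" "matrix_inv U ** A \<in> bruhat w"
    using V by (auto simp: cell_def)
  have "V = act U (act (matrix_inv U ** A) std_flag)" using U by (simp add: A(1) flip: act_mult)
  then have "V k \<inter> act U std_flag j = (*v) U ` (act (matrix_inv U ** A) std_flag k \<inter> std_flag j)"
    using invertible_inj[OF U] by (simp add: act_def[of U] image_Int)
  then have "vec.dim (V k \<inter> act U std_flag j) = vec.dim (act (matrix_inv U ** A) std_flag k \<inter> std_flag j)"
    using invertible_inj[OF U] by (simp add: vec.dim_image_eq inj_on_subset)
  then show ?thesis using bruhat_dim[OF w A(3) k] by simp
qed

lemma cell_exists:
  fixes U :: "'n::{finite,wellorder} cmat"
  assumes "invertible U" "V \<in> complete_flags"
  obtains x where "bij_betw x {1..CARD('n)} {1..CARD('n)}" "V \<in> cell U x"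
proof -
  obtain A where A: "invertible A" "V = act A std_flag" using complete_flagsE[OF assms(2)] .
  obtain x where "bij_betw x {1..CARD('n)} {1..CARD('n)}" "matrix_inv U ** A \<in> bruhat x"
    using bruhat_exists[of "matrix_inv U ** A"] A assms by (metis invertible_matrix_inv invertible_mult)
  then show ?thesis using that A by (auto simp: act_mem_cell)
qed

lemma cell_unique:
  fixes U :: "'n::{finite,wellorder} cmat"
  assumes "bij_betw w {1..CARD('n)} {1..CARD('n)}" "bij_betw x {1..CARD('n)} {1..CARD('n)}"
    and "V \<in> cell U w" "V \<in> cell U x" "i \<in> {1..CARD('n)}"
  shows "x i = w i"
proof -
  obtain A where A: "V = act A std_flag" "invertible A" "matrix_inv U ** A \<in> bruhat w"
    using assms(3) by (auto simp: cell_def)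
  with assms(4) have "matrix_inv U ** A \<in> bruhat x" by (simp add: act_mem_cell)
  with A assms show ?thesis using bruhat_unique by blast
qed

lemma open_dim_Int_le:
  fixes U :: "'n::{finite,wellorder} cmat"
  shows "openin flag_topology {V \<in> complete_flags. vec.dim (V k \<inter> act U std_flag j) \<le> r}"
proof -
  have sub: "vec.subspace (act U std_flag j)" by (simp add: act_std_flag)
  have "{g. invertible g \<and> act g std_flag \<in> {V \<in> complete_flags. vec.dim (V k \<inter> act U std_flag j) \<le> r}} =
      {g. invertible g} \<inter> {g. vec.dim {c \<in> std_flag k. g *v c \<in> act U std_flag j} \<le> r}"
    by (auto simp: dim_act_Int)
  then show ?thesis unfolding openin_flag_topology
    using open_dim_preimage_le[OF std_flag_subspace sub] open_invertible by auto
qed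

text \<open>Intersection dimensions can only grow in a limit: where they are smaller than the rank
  is an open set, and it would contain a point of the cell.\<close>

lemma closure_cell_rank:
  fixes U :: "'n::{finite,wellorder} cmat"
  assumes U: "invertible U" and w: "bij_betw w {1..CARD('n)} {1..CARD('n)}"
    and V: "V \<in> flag_topology closure_of cell U w" and k: "k \<le> CARD('n)"
  shows "rank_fun w k j \<le> vec.dim (V k \<inter> act U std_flag j)"
proof (rule ccontr)
  assume "\<not> ?thesis"
  then have lt: "vec.dim (V k \<inter> act U std_flag j) < rank_fun w k j" by simp
  let ?T = "{V \<in> complete_flags. vec.dim (V k \<inter> act U std_flag j) \<le> rank_fun w k j - 1}"
  have "V \<in> ?T" using V lt in_closure_of[of V] by auto
  have "\<exists>W. W \<in> cell U w \<and> W \<in> T" if "openin flag_topology T" "V \<in> T" for T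
    using V that by (auto simp: in_closure_of)
  from this[OF open_dim_Int_le \<open>V \<in> ?T\<close>] obtain W where "W \<in> cell U w" "W \<in> ?T" by blast
  then show False using cell_dim[OF U w _ k] lt by fastforce
qed

text \<open>On the closure all ranks are at least those of \<open>w\<close>. The finitely many open
  conditions in \<open>?T\<close> bound them from above, and equal ranks mean the same cell.\<close>

lemma openin_closure_cell:
  fixes U :: "'n::{finite,wellorder} cmat"
  assumes U: "invertible U" and w: "bij_betw w {1..CARD('n)} {1..CARD('n)}"
  shows "openin (subtopology flag_topology (flag_topology closure_of cell U w)) (cell U w)"
proof -
  let ?S = "flag_topology closure_of cell U w"
  let ?T = "\<Inter>k\<in>{..CARD('n)}. \<Inter>j\<in>{..CARD('n)}.
      {V \<in> complete_flags. vec.dim (V k \<inter> act U std_flag j) \<le> rank_fun w k j}"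
  have "openin flag_topology ?T"
    by (intro openin_INT2 open_dim_Int_le) auto
  moreover have "cell U w = ?T \<inter> ?S"
  proof (intro equalityI subsetI)
    fix V assume V: "V \<in> cell U w"
    then have "V \<in> ?S" using closure_of_subset[of "cell U w" flag_topology] cell_complete_flags by auto
    then show "V \<in> ?T \<inter> ?S"
      using cell_dim[OF U w V] subsetD[OF cell_complete_flags V] by auto
  next
    fix V assume V: "V \<in> ?T \<inter> ?S"
    then have "V \<in> complete_flags" by (auto simp: in_closure_of)
    then obtain x where x: "bij_betw x {1..CARD('n)} {1..CARD('n)}" "V \<in> cell U x" using cell_exists[OF U] by blast
    have "rank_fun x k j = rank_fun w k j" if kj: "k \<le> CARD('n)" "j \<le> CARD('n)" for k j
    proof -
      have "rank_fun w k j \<le> rank_fun x k j"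
        using closure_cell_rank[OF U w _ kj(1), of V j] cell_dim[OF U x kj(1), of j] V by auto
      moreover have "rank_fun x k j \<le> rank_fun w k j"
      proof -
        have "vec.dim (V k \<inter> act U std_flag j) \<le> rank_fun w k j" using V kj by auto
        then show ?thesis using cell_dim[OF U x kj(1), of j] by simp
      qed
      ultimately show ?thesis by simp
    qed
    then have "x i = w i" if "i \<in> {1..CARD('n)}" for i using rank_fun_inject[OF _ x(1) w that] by blast
    then have "bruhat x = (bruhat w :: 'n cmat set)" by (rule bruhat_cong)
    then show "V \<in> cell U w" using x(2) by (simp add: cell_def)
  qed
  ultimately show ?thesis by (auto simp: openin_subtopology)
qed

lemma card_cell_coords:
  assumes "bij_betw w {1..CARD('n)} {1..CARD('n)}"
  shows "card {(i, j :: 'n::{finite,wellorder}). j < i \<and> w (idx i) < w (idx j)} = inv_on {1..CARD('n)} w"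
  unfolding inv_on_def
proof (rule bij_betw_same_card)
  show "bij_betw (\<lambda>(i, j). (idx j, idx i)) {(i, j :: 'n). j < i \<and> w (idx i) < w (idx j)}
      {(s, t). s \<in> {1..CARD('n)} \<and> t \<in> {1..CARD('n)} \<and> s < t \<and> w s > w t}"
    by (rule bij_betw_byWitness[of _ "\<lambda>(s, t). (coord t, coord s)"])
      (auto simp: idx_coord coord_strict_mono)
qed

lemma complex_submanifold_cell:
  fixes U :: "'n::{finite,wellorder} cmat"
  assumes U: "invertible U" and w: "bij_betw w {1..CARD('n)} {1..CARD('n)}"
  shows "complex_submanifold (inv_on {1..CARD('n)} w) (cell U w)"
  unfolding complex_submanifold_def
proof (intro conjI ballI cell_complete_flags)
  fix V assume "V \<in> cell U w"
  then obtain A where A: "V = act A std_flag" "invertible A" "matrix_inv U ** A \<in> bruhat w"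
    by (auto simp: cell_def)
  then obtain a b where ab: "matrix_inv U ** A = a ** perm_mat w ** b" "a \<in> upper_borel" "b \<in> upper_borel"
    by (auto simp: bruhat_def)
  \<comment> \<open>With this frame \<open>V\<close> is the centre of the chart. The remaining
    factor \<open>a\<close> does not affect membership in \<open>bruhat w\<close>, so that
    \<open>bruhat_chart\<close> describes the cell.\<close>
  define g where "g = U ** a ** perm_mat w"
  have g: "invertible g"
    using U w ab by (simp add: g_def invertible_mult invertible_perm_mat upper_borel_invertible)
  have "A = g ** b"
    using ab(1) U by (metis g_def inv_mult_mat(2) matrix_mul_assoc)
  then have V: "flag_chart g 0 = V" using A ab by (simp add: flag_chart_def act_upper_borel)
  have "{Y \<in> strictly_lower. flag_chart g Y \<in> cell U w} = cell_coords w"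
  proof -
    have "flag_chart g Y \<in> cell U w \<longleftrightarrow> Y \<in> cell_coords w" if Y: "Y \<in> strictly_lower" for Y
    proof -
      have "matrix_inv U ** (g ** (mat 1 + Y)) = a ** (perm_mat w ** (mat 1 + Y)) ** mat 1"
        using U by (simp add: g_def matrix_mul_assoc) 
      then have "flag_chart g Y \<in> cell U w \<longleftrightarrow> a ** (perm_mat w ** (mat 1 + Y)) ** mat 1 \<in> bruhat w"
        using g Y by (simp only: flag_chart_def act_mem_cell invertible_mult invertible_unipotent)
      then show ?thesis using bruhat_mult_iff[OF ab(2) upper_borel_one] bruhat_chart[OF w Y] by simp
    qed
    then show ?thesis using cell_coords_strictly_lower by auto
  qed
  also have "\<dots> = {Y. \<forall>i j. (i, j) \<notin> {(i, j). j < i \<and> w (idx i) < w (idx j)} \<longrightarrow> Y $ i $ j = 0}"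
    by (auto simp: cell_coords_def)
  finally have "matrix_submanifold_at (inv_on {1..CARD('n)} w) {Y \<in> strictly_lower. flag_chart g Y \<in> cell U w} 0"
    using matrix_submanifold_at_pattern[of "{(i, j :: 'n). j < i \<and> w (idx i) < w (idx j)}" 0]
    by (simp only: card_cell_coords[OF w])
  moreover have "(0 :: 'n cmat) \<in> strictly_lower" by (simp add: strictly_lower_def)
  ultimately show "\<exists>g X. invertible g \<and> X \<in> strictly_lower \<and> flag_chart g X = V \<and>
      matrix_submanifold_at (inv_on {1..CARD('n)} w) {Y \<in> strictly_lower. flag_chart g Y \<in> cell U w} X"
    using g V by blast
qed

lemma has_complex_dim_closure_cell:
  fixes U :: "'n::{finite,wellorder} cmat"
  assumes U: "invertible U" and w: "bij_betw w {1..CARD('n)} {1..CARD('n)}"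
  shows "has_complex_dim (flag_topology closure_of cell U w) d \<longleftrightarrow> d = inv_on {1..CARD('n)} w"
proof (rule has_complex_dim_iff[OF openin_closure_cell[OF U w] order_refl complex_submanifold_cell[OF U w]])
  have "act (U ** perm_mat w) std_flag \<in> cell U w"
    using U w by (simp add: act_mem_cell invertible_mult invertible_perm_mat perm_mat_bruhat)
  then show "cell U w \<noteq> {}" by blast
qed

lemma closure_cell_inv_on:
  fixes U :: "'n::{finite,wellorder} cmat"
  assumes U: "invertible U" and w: "bij_betw w {1..CARD('n)} {1..CARD('n)}"
    and V: "V \<in> flag_topology closure_of cell U w" "V \<notin> cell U w"
    and x: "bij_betw x {1..CARD('n)} {1..CARD('n)}" "V \<in> cell U x"
  shows "inv_on {1..CARD('n)} x < inv_on {1..CARD('n)} w"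
proof (rule rank_order_inv_on[OF x(1) w])
  show "rank_fun w k j \<le> rank_fun x k j" if "k \<le> CARD('n)" for k j
    using closure_cell_rank[OF U w V(1) that] cell_dim[OF U x that] by simp
  show "\<exists>i\<in>{1..CARD('n)}. x i \<noteq> w i"
  proof (rule ccontr)
    assume "\<not> ?thesis"
    then have "bruhat x = (bruhat w :: 'n cmat set)" by (intro bruhat_cong) auto
    then have "cell U x = cell U w" unfolding cell_def by (simp only:)
    then show False using V(2) x(2) by simp
  qed
qed

subsection \<open>Hermitian forms\<close>

text \<open>Instantiated by the positive definite \<open>sip\<close> and by the indefinite
  \<open>herm_form\<close>, so that one orthogonalization serves both.\<close>

locale hermitian =
  fixes B :: "'n::{finite,wellorder} cvec \<Rightarrow> 'n cvec \<Rightarrow> complex"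
  assumes add_left: "B (u + v) w = B u w + B v w"
    and scale_left: "B (c *s v) w = c * B v w"
    and cnj_swap: "cnj (B v w) = B w v"
begin

lemma add_right: "B v (u + w) = B v u + B v w"
  by (metis add_left cnj_swap complex_cnj_add)

lemma scale_right: "B v (c *s w) = cnj c * B v w"
  by (metis scale_left cnj_swap complex_cnj_mult)

lemma zero_left [simp]: "B 0 w = 0" and zero_right [simp]: "B w 0 = 0"
  using scale_left[of 0 0 w] scale_right[of w 0 0] by simp_all

lemma minus_left: "B (- v) w = - B v w"
  using scale_left[of "-1" v w] by (simp flip: vector_sneg_minus1)

lemma diff_left: "B (u - v) w = B u w - B v w"
  using add_left[of u "- v" w] by (simp add: minus_left)

lemma sum_left: "B (\<Sum>i\<in>I. f i) w = (\<Sum>i\<in>I. B (f i) w)"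
  by (induction I rule: infinite_finite_induct) (auto simp: add_left)

lemma sum_right: "B w (\<Sum>i\<in>I. f i) = (\<Sum>i\<in>I. B w (f i))"
  by (induction I rule: infinite_finite_induct) (auto simp: add_right)

lemma zero_sym: "B v w = 0 \<longleftrightarrow> B w v = 0"
  by (metis cnj_swap complex_cnj_zero)

lemma self_real: "Im (B v v) = 0"
  using cnj_swap[of v v] by (simp add: complex_eq_iff)

lemma self_of_real: "B v v = of_real (Re (B v v))"
  by (simp add: complex_eq_iff self_real)

lemma orth_span:
  assumes "\<And>x. x \<in> S \<Longrightarrow> B v x = 0" "w \<in> vec.span S"
  shows "B v w = 0"
proof -
  have "vec.subspace {w. B v w = 0}" by (auto simp: vec.subspace_def add_right scale_right)
  then have "vec.span S \<subseteq> {w. B v w = 0}" using assms(1) by (intro vec.span_minimal) auto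
  then show ?thesis using assms(2) by auto
qed

text \<open>Nondegeneracy of the steps takes the place of positivity. The component \<open>z\<close>
  of a new vector orthogonal to \<open>V m\<close> cannot be isotropic, for then it would be
  orthogonal to all of \<open>V (Suc m)\<close>; so it can be scaled to length 1 or -1.\<close>

lemma gram_schmidt:
  fixes V :: "'n flag"
  assumes V: "V \<in> complete_flags" and m: "m \<le> CARD('n)"
    and nd: "\<And>k v. 1 \<le> k \<Longrightarrow> k \<le> m \<Longrightarrow> v \<in> V k \<Longrightarrow> (\<forall>w\<in>V k. B v w = 0) \<Longrightarrow> v = 0"
  shows "\<exists>y. \<forall>k. 1 \<le> k \<and> k \<le> m \<longrightarrow> y k \<in> V k \<and> y k \<notin> V (k - 1) \<and>
    (B (y k) (y k) = 1 \<or> B (y k) (y k) = -1) \<and> (\<forall>v\<in>V (k - 1). B (y k) v = 0)"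
  using m nd
proof (induction m)
  case 0 then show ?case by auto
next
  case (Suc m)
  have "\<exists>y. \<forall>k. 1 \<le> k \<and> k \<le> m \<longrightarrow> y k \<in> V k \<and> y k \<notin> V (k - 1) \<and>
    (B (y k) (y k) = 1 \<or> B (y k) (y k) = -1) \<and> (\<forall>v\<in>V (k - 1). B (y k) v = 0)"
    by (rule Suc.IH) (use Suc.prems in auto)
  then obtain y where y: "\<And>k. 1 \<le> k \<Longrightarrow> k \<le> m \<Longrightarrow> y k \<in> V k \<and> y k \<notin> V (k - 1) \<and>
    (B (y k) (y k) = 1 \<or> B (y k) (y k) = -1) \<and> (\<forall>v\<in>V (k - 1). B (y k) v = 0)"
    by blast
  have span: "V m = vec.span (y ` {1..m})"
    by (rule adapted_span[OF V, of m]) (use y Suc.prems in auto)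
  have V_le: "V k \<subseteq> V l" if "k \<le> l" for k l by (rule monoD[OF complete_flagsD(1)[OF V] that])
  have orth: "B (y i) (y j) = 0" if "i \<in> {1..m}" "j \<in> {1..m}" "i \<noteq> j" for i j
    using that
  proof (induction i j rule: linorder_wlog)
    case (le i j)
    then have "i \<le> j - 1" by auto
    then have "y i \<in> V (j - 1)" using y[of i] V_le le by force
    then have "B (y j) (y i) = 0" using y[of j] le by auto
    then show ?case using zero_sym by blast
  next
    case (sym i j) then show ?case using zero_sym by blast
  qed
  have "\<exists>x. x \<in> V (Suc m) \<and> x \<notin> V m"
  proof (rule ccontr)
    assume "\<not> ?thesis"
    then have "vec.dim (V (Suc m)) \<le> vec.dim (V m)" by (intro vec.dim_subset) auto
    with Suc.prems show False by (simp add: complete_flagsD[OF V])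
  qed
  then obtain x where x: "x \<in> V (Suc m)" "x \<notin> V m" by blast
  define u where "u = (\<Sum>i=1..m. (B x (y i) / B (y i) (y i)) *s y i)"
  have u: "u \<in> V m" unfolding u_def span by (intro vec.span_sum vec.span_scale vec.span_base) auto
  define z where "z = x - u"
  have zV: "z \<in> V (Suc m)" "z \<notin> V m"
  proof -
    show "z \<in> V (Suc m)"
      unfolding z_def using x u V_le[of m "Suc m"] by (intro vec.subspace_diff complete_flagsD(2)[OF V]) auto
    show "z \<notin> V m"
    proof
      assume "z \<in> V m"
      then have "z + u \<in> V m" using u by (intro vec.subspace_add complete_flagsD(2)[OF V])
      then show False using x by (simp add: z_def)
    qed
  qed
  have zy: "B z (y j) = 0" if j: "j \<in> {1..m}" for j
  proof -
    have "B u (y j) = (\<Sum>i=1..m. if i = j then B x (y j) else 0)"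
      unfolding u_def sum_left scale_left
    proof (rule sum.cong[OF refl])
      fix i assume "i \<in> {1..m}"
      moreover have "B (y j) (y j) \<noteq> 0" using y[of j] j by force
      ultimately show "B x (y i) / B (y i) (y i) * B (y i) (y j) = (if i = j then B x (y j) else 0)"
        using orth[of i j] j by auto
    qed
    then show ?thesis using j by (simp add: z_def diff_left)
  qed
  have zorth: "B z v = 0" if "v \<in> V m" for v
  proof (rule orth_span)
    show "v \<in> vec.span (y ` {1..m})" using that span by simp
    show "B z x = 0" if "x \<in> y ` {1..m}" for x
      using that zy by auto
  qed
  have "B z z \<noteq> 0"
  proof
    assume zz: "B z z = 0"
    have "B z w = 0" if "w \<in> V (Suc m)" for w
    proof (rule orth_span)
      show "w \<in> vec.span (insert z (y ` {1..m}))"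
      proof -
        have "V (Suc m) = vec.span ((y(Suc m := z)) ` {1..Suc m})"
          by (rule adapted_span[OF V, of "Suc m"]) (use y zV Suc.prems in \<open>auto simp: le_Suc_eq\<close>)
        also have "(y(Suc m := z)) ` {1..Suc m} = insert z (y ` {1..m})"
          by (auto simp: atLeastAtMostSuc_conv)
        finally show ?thesis using that by simp
      qed
      show "B z x = 0" if "x \<in> insert z (y ` {1..m})" for x
        using that zz zy by auto
    qed
    then have "z = 0" using Suc.prems(2)[of "Suc m" z] zV by auto
    then show False using zV(2) vec.subspace_0[OF complete_flagsD(2)[OF V]] by simp
  qed
  then have r: "Re (B z z) \<noteq> 0" by (simp add: complex_eq_iff self_real)
  define r where "r = 1 / sqrt \<bar>Re (B z z)\<bar>"
  define c where "c = complex_of_real r"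
  have c0: "c \<noteq> 0" using r by (simp add: c_def r_def)
  have "B (c *s z) (c *s z) = of_real (r\<^sup>2 * Re (B z z))"
    unfolding scale_left scale_right c_def
    by (subst self_of_real) (simp add: power2_eq_square mult.assoc)
  also have "r\<^sup>2 * Re (B z z) = sgn (Re (B z z))"
    using r by (simp add: r_def power_divide sgn_if)
  finally have one: "B (c *s z) (c *s z) = 1 \<or> B (c *s z) (c *s z) = -1"
    using r by (auto simp: sgn_if)
  have cz: "c *s z \<in> V (Suc m)" "c *s z \<notin> V m"
  proof -
    show "c *s z \<in> V (Suc m)" using zV by (intro vec.subspace_scale complete_flagsD(2)[OF V])
    show "c *s z \<notin> V m"
    proof
      assume "c *s z \<in> V m"
      then have "inverse c *s (c *s z) \<in> V m" by (rule vec.subspace_scale[OF complete_flagsD(2)[OF V]])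
      moreover have "inverse c *s (c *s z) = z" using c0 by (simp add: vector_smult_assoc)
      ultimately show False using zV by simp
    qed
  qed
  show ?case
    by (rule exI[of _ "y(Suc m := c *s z)"])
      (use y one cz zorth in \<open>auto simp: le_Suc_eq scale_left\<close>)
qed

end

section \<open>The standard inner product and the signature matrix\<close>

definition sip :: "'n::{finite,wellorder} cvec \<Rightarrow> 'n cvec \<Rightarrow> complex" where
  "sip v w = (\<Sum>a\<in>UNIV. v $ a * cnj (w $ a))"

definition Jmat :: "nat \<Rightarrow> 'n::{finite,wellorder} cmat" where
  "Jmat q = (\<chi> i j. if i = j then (if idx i \<le> q then -1 else 1) else 0)"

lemma Jmat_mult: "Jmat q *v x = (\<chi> i. if idx i \<le> q then - x $ i else x $ i)"
  by (simp add: Jmat_def matrix_vector_mult_def vec_eq_iff if_distrib[of "\<lambda>c. c * _"] cong: if_cong)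

lemma Jmat_involution [simp]: "Jmat q *v (Jmat q *v x) = x"
  by (simp add: Jmat_mult vec_eq_iff)

lemma Jmat_square [simp]: "Jmat q ** Jmat q = mat 1"
  by (simp add: matrix_eq flip: matrix_vector_mul_assoc)

lemma invertible_Jmat [simp]: "invertible (Jmat q)"
  unfolding invertible_def using Jmat_square by blast

interpretation sip: hermitian sip
  by unfold_locales (simp_all add: sip_def sum.distrib algebra_simps sum_distrib_left)

lemma sip_self: "sip v v = of_real (\<Sum>a\<in>UNIV. (cmod (v $ a))\<^sup>2)"
  unfolding sip_def of_real_sum complex_norm_square ..

lemma sip_self_eq_0 [simp]: "sip v v = 0 \<longleftrightarrow> v = 0"
  by (simp add: sip_self sum_nonneg_eq_0_iff vec_eq_iff del: of_real_sum)

lemma sip_self_nonneg: "Re (sip v v) \<ge> 0"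
  by (simp add: sip_self sum_nonneg del: of_real_sum)

lemma sip_mult: "sip (A *v v) w = sip v (conj_transpose A *v w)"
proof -
  have "sip (A *v v) w = (\<Sum>a\<in>UNIV. \<Sum>b\<in>UNIV. A $ a $ b * v $ b * cnj (w $ a))"
    by (simp add: sip_def matrix_vector_mult_def sum_distrib_right)
  also have "\<dots> = (\<Sum>b\<in>UNIV. \<Sum>a\<in>UNIV. A $ a $ b * v $ b * cnj (w $ a))" by (rule sum.swap)
  also have "\<dots> = sip v (conj_transpose A *v w)"
    by (simp add: sip_def matrix_vector_mult_def conj_transpose_def sum_distrib_left algebra_simps)
  finally show ?thesis .
qed

lemma sip_eqI: "(\<And>w. sip v w = sip v' w) \<Longrightarrow> v = v'"
  using sip_self_eq_0[of "v - v'"] by (simp add: sip.diff_left)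

lemma Jmat_conj_transpose [simp]: "conj_transpose (Jmat q) = Jmat q"
  by (simp add: conj_transpose_def Jmat_def vec_eq_iff)

lemma sip_Jmat: "sip (Jmat q *v v) w = sip v (Jmat q *v w)"
  by (simp add: sip_mult)

lemma det_conj_transpose: "det (conj_transpose g) = cnj (det g)"
proof -
  have "conj_transpose g = transpose (\<chi> i j. cnj (g $ i $ j))"
    by (simp add: conj_transpose_def transpose_def)
  then have "det (conj_transpose g) = det (\<chi> i j. cnj (g $ i $ j))" by simp
  then show ?thesis by (simp add: det_def)
qed

lemma herm_form_eq:
  fixes v w :: "'n::{finite,wellorder} cvec"
  assumes n: "CARD('n) = p + q"
  shows "herm_form p q v w = sip (Jmat q *v v) w"
proof -
  define f where "f i = v $ coord i * cnj (w $ coord i)" for i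
  have "sip (Jmat q *v v) w = (\<Sum>a\<in>(UNIV :: 'n set). if idx a \<le> q then - f (idx a) else f (idx a))"
    unfolding sip_def Jmat_mult by (intro sum.cong) (auto simp: f_def)
  also have "\<dots> = (\<Sum>i=1..p + q. if i \<le> q then - f i else f i)"
    using sum.reindex_bij_betw[OF idx_bij[where 'n='n], of "\<lambda>i. if i \<le> q then - f i else f i"] by (simp add: n)
  also have "{1..p + q} = {1..q} \<union> {q + 1..q + p}" by auto
  also have "(\<Sum>i\<in>{1..q} \<union> {q + 1..q + p}. if i \<le> q then - f i else f i) =
      (\<Sum>i=1..q. - f i) + (\<Sum>i=q + 1..q + p. f i)"
    by (subst sum.union_disjoint) auto
  also have "(\<Sum>i=q + 1..q + p. f i) = (\<Sum>i=1..p. f (q + i))"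
    by (rule sum.reindex_bij_witness[of _ "\<lambda>i. q + i" "\<lambda>i. i - q"]) auto
  finally show ?thesis by (simp add: herm_form_def f_def sum_negf)
qed

lemma det_mat: "det (mat c :: 'n::{finite,wellorder} cmat) = c ^ CARD('n)"
proof -
  have "det (mat c :: 'n cmat) = (\<Prod>i\<in>UNIV. (mat c :: 'n cmat) $ i $ i)" by (rule det_diagonal) (simp add: mat_def)
  then show ?thesis by (simp add: mat_def)
qed

lemma mat_mult_vec: "mat c *v x = c *s x"
  by (simp add: matrix_vector_mult_def mat_def vec_eq_iff if_distrib[of "\<lambda>c. c * _"] cong: if_cong)

lemma act_mat:
  assumes "c \<noteq> 0" "V \<in> complete_flags"
  shows "act (mat c) V = V"
proof
  fix k
  have sub: "vec.subspace (V k)" by (rule complete_flagsD(2)[OF assms(2)])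
  show "act (mat c) V k = V k"
    unfolding act_def mat_mult_vec
  proof safe
    fix x assume x: "x \<in> V k"
    have "x = c *s (inverse c *s x)" using assms by (simp add: vector_smult_assoc)
    then show "x \<in> (*s) c ` V k" by (rule image_eqI) (rule vec.subspace_scale[OF sub x])
  qed (rule vec.subspace_scale[OF sub])
qed

text \<open>The scalar is an \<open>n\<close>-th root of the inverse determinant. It has modulus one
  if the determinant has, and so it turns isometries into isometries of determinant one.\<close>

lemma normalize_det:
  fixes g :: "'n::{finite,wellorder} cmat"
  assumes "invertible g"
  obtains c where "c \<noteq> 0" "det (mat c ** g) = 1" "cmod (det g) = 1 \<longrightarrow> cmod c = 1"
proof
  let ?n = "CARD('n)"
  let ?c = "exp (- Ln (det g) / of_nat ?n)"
  have d: "det g \<noteq> 0" using assms by (simp add: invertible_det_nz)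
  show "?c \<noteq> 0" by simp
  have "?c ^ ?n = exp (of_nat ?n * (- Ln (det g) / of_nat ?n))" by (simp only: exp_of_nat_mult)
  also have "\<dots> = inverse (det g)" using d by (simp add: exp_minus)
  finally show "det (mat ?c ** g) = 1" using d by (simp add: det_mul det_mat)
  show "cmod (det g) = 1 \<longrightarrow> cmod ?c = 1" using d by (simp add: norm_exp_eq_Re)
qed

subsection \<open>Signatures\<close>

lemma count_list_take:
  "k \<le> length xs \<Longrightarrow> count_list (take k xs) s = card {i \<in> {1..k}. xs ! (i - 1) = s}"
proof (induction k)
  case (Suc k)
  have "{i \<in> {1..Suc k}. xs ! (i - 1) = s} = {i \<in> {1..k}. xs ! (i - 1) = s} \<union> (if xs ! k = s then {Suc k} else {})"
    by (auto simp: le_Suc_eq)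
  with Suc show ?case by (simp add: take_Suc_conv_app_nth)
qed simp

lemma sign_list_eqI:
  assumes "length \<alpha> = length \<beta>"
    "\<And>k. k \<in> {1..length \<alpha>} \<Longrightarrow> count_list (take k \<alpha>) Minus = count_list (take k \<beta>) Minus"
  shows "\<alpha> = \<beta>"
proof (rule nth_equalityI[OF assms(1)])
  fix i assume i: "i < length \<alpha>"
  have "count_list (take i \<alpha>) Minus = count_list (take i \<beta>) Minus"
    using assms(2)[of i] i by (cases i) auto
  then have "\<alpha> ! i = Minus \<longleftrightarrow> \<beta> ! i = Minus"
    using assms(2)[of "Suc i"] assms(1) i by (auto simp: take_Suc_conv_app_nth split: if_splits)
  then show "\<alpha> ! i = \<beta> ! i" by (metis sign.exhaust)
qed

definition sgn_of :: "sign \<Rightarrow> real" where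
  "sgn_of s = (case s of Minus \<Rightarrow> -1 | Plus \<Rightarrow> 1)"

lemma sgn_of_simps [simp]: "sgn_of Minus = -1" "sgn_of Plus = 1"
  by (simp_all add: sgn_of_def)

locale signature =
  fixes p q :: nat and tp :: "'n::{finite,wellorder} itself"
  assumes card_n: "CARD('n) = p + q"
begin

abbreviation h :: "'n cvec \<Rightarrow> 'n cvec \<Rightarrow> complex" where "h \<equiv> herm_form p q"

lemma h_eq: "h v w = sip (Jmat q *v v) w"
  by (rule herm_form_eq[OF card_n])

sublocale h: hermitian h
proof
  show "cnj (h v w) = h w v" for v w :: "'n cvec"
    unfolding h_eq sip.cnj_swap by (simp add: sip_Jmat)
qed (simp_all add: h_eq matrix_vector_right_distrib sip.add_left vector_scalar_commute sip.scale_left)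

lemma h_nondegenerate: "(\<And>w. h v w = 0) \<Longrightarrow> v = 0"
proof -
  assume "\<And>w. h v w = 0"
  then have "Jmat q *v v = 0" by (simp add: h_eq flip: sip_self_eq_0)
  then show "v = 0" by (metis Jmat_involution matrix_vector_mult_0_right)
qed

text \<open>The two subspaces meet only in zero. The weak inequality on \<open>N\<close> is for
  \<open>index_eqI\<close>, where a negative subspace is enlarged by an isotropic vector.\<close>

lemma definite_Int:
  assumes "\<forall>v\<in>N. v \<noteq> 0 \<longrightarrow> Re (h v v) \<le> 0" "\<forall>v\<in>P. v \<noteq> 0 \<longrightarrow> Re (h v v) > 0"
    "vec.subspace N" "vec.subspace P" "N \<subseteq> W" "P \<subseteq> W" "vec.subspace W"
  shows "vec.dim N + vec.dim P \<le> vec.dim W"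
proof -
  have "N \<inter> P \<subseteq> {0}" using assms(1,2) by fastforce
  then have "vec.dim (N \<inter> P) = 0" by (simp only: vec.dim_eq_0)
  moreover have "vec.dim {x + y | x y. x \<in> N \<and> y \<in> P} + vec.dim (N \<inter> P) = vec.dim N + vec.dim P"
    by (rule vec.dim_sums_Int) fact+
  moreover have "vec.dim {x + y | x y. x \<in> N \<and> y \<in> P} \<le> vec.dim W"
    using assms by (intro vec.dim_subset) (auto intro: vec.subspace_add)
  ultimately show ?thesis by linarith
qed

lemma definite_Int':
  assumes "\<forall>v\<in>N. v \<noteq> 0 \<longrightarrow> Re (h v v) < 0" "\<forall>v\<in>P. v \<noteq> 0 \<longrightarrow> Re (h v v) > 0"
    "vec.subspace N" "vec.subspace P" "N \<subseteq> W" "P \<subseteq> W" "vec.subspace W"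
  shows "vec.dim N + vec.dim P \<le> vec.dim W"
  using assms by (intro definite_Int) (auto intro: less_imp_le)

text \<open>A negative and a positive subspace of complementary dimensions settle everything at
  once: a larger definite subspace would meet the one of opposite sign, and a vector of the radical
  could be added to \<open>N\<close> without destroying semidefiniteness.\<close>

lemma index_eqI:
  assumes N: "vec.subspace N" "N \<subseteq> W" "\<forall>v\<in>N. v \<noteq> 0 \<longrightarrow> Re (h v v) < 0"
    and P: "vec.subspace P" "P \<subseteq> W" "\<forall>v\<in>P. v \<noteq> 0 \<longrightarrow> Re (h v v) > 0"
    and W: "vec.subspace W" and dim: "vec.dim N + vec.dim P = vec.dim W"
  shows "nondegenerate_on p q W" "negative_index p q W = vec.dim N" "positive_index p q W = vec.dim P"
proof -
  have fin: "finite {vec.dim N | N :: 'n cvec set. Q N}" for Q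
    by (rule finite_subset[of _ "{..CARD('n)}"]) (auto intro: dim_subset_UNIV_cart_gen)
  show "negative_index p q W = vec.dim N"
    unfolding negative_index_def
  proof (rule Max_eqI[OF fin])
    fix d assume "d \<in> {vec.dim N | N. vec.subspace N \<and> N \<subseteq> W \<and> (\<forall>v\<in>N. v \<noteq> 0 \<longrightarrow> Re (h v v) < 0)}"
    then obtain N' where N': "d = vec.dim N'" "vec.subspace N'" "N' \<subseteq> W" "\<forall>v\<in>N'. v \<noteq> 0 \<longrightarrow> Re (h v v) < 0" by auto
    then show "d \<le> vec.dim N" using definite_Int'[OF N'(4) P(3) N'(2) P(1) N'(3) P(2) W] dim by linarith
  qed (use N in auto)
  show "positive_index p q W = vec.dim P"
    unfolding positive_index_def
  proof (rule Max_eqI[OF fin])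
    fix d assume "d \<in> {vec.dim N | N. vec.subspace N \<and> N \<subseteq> W \<and> (\<forall>v\<in>N. v \<noteq> 0 \<longrightarrow> Re (h v v) > 0)}"
    then obtain N' where N': "d = vec.dim N'" "vec.subspace N'" "N' \<subseteq> W" "\<forall>v\<in>N'. v \<noteq> 0 \<longrightarrow> Re (h v v) > 0" by auto
    then show "d \<le> vec.dim P" using definite_Int'[OF N(3) N'(4) N(1) N'(2) N(2) N'(3) W] dim by linarith
  qed (use P in auto)
  show "nondegenerate_on p q W"
    unfolding nondegenerate_on_def
  proof (intro ballI impI, rule ccontr)
    fix v assume v: "v \<in> W" "\<forall>w\<in>W. h v w = 0" "v \<noteq> 0"
    have "v \<notin> N" using N(3) v by auto
    have "Re (h x x) \<le> 0" if "x \<in> vec.span (insert v N)" for x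
    proof -
      obtain c where "x - c *s v \<in> vec.span N"
        using \<open>x \<in> vec.span (insert v N)\<close> unfolding vec.span_insert by blast
      then have u: "x - c *s v \<in> N" using N(1) by (simp add: vec.span_eq_iff[THEN iffD2])
      define u where "u = x - c *s v"
      have "h v u = 0" "h u v = 0" "h v v = 0" using v u N(2) h.zero_sym by (auto simp: u_def)
      moreover have "x = u + c *s v" by (simp add: u_def)
      ultimately have "h x x = h u u" by (simp add: h.add_left h.add_right h.scale_left h.scale_right)
      then show ?thesis using N(3) u by (cases "u = 0") (auto simp: u_def less_imp_le)
    qed
    then have "vec.dim (vec.span (insert v N)) + vec.dim P \<le> vec.dim W"
    proof (intro definite_Int[OF _ P(3) vec.subspace_span P(1) _ P(2) W])
      show "vec.span (insert v N) \<subseteq> W" using N(2) v(1) W by (intro vec.span_minimal) auto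
    qed blast
    moreover have "vec.dim (vec.span (insert v N)) = Suc (vec.dim N)"
      using \<open>v \<notin> N\<close> N(1) by (simp add: vec.dim_insert vec.span_eq_iff[THEN iffD2])
    ultimately show False using dim by linarith
  qed
qed

lemma h_expand:
  "h (A *v c) (A *v d) = (\<Sum>a\<in>UNIV. \<Sum>b\<in>UNIV. c $ a * cnj (d $ b) * h (A *v axis a 1) (A *v axis b 1))"
  for A :: "'n cmat"
proof -
  have *: "A *v x = (\<Sum>a\<in>UNIV. x $ a *s (A *v axis a 1))" for x :: "'n cvec"
    unfolding mult_axis by (rule matrix_mult_sum)
  show ?thesis
    unfolding *[of c] *[of d] h.sum_left h.scale_left
    unfolding h.sum_right h.scale_right by (simp add: sum_distrib_left mult.assoc)
qed

text \<open>Frames whose Gram matrix is close to a diagonal sign matrix: exactly such frames describe an open orbit,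
  and the approximate version shows that the orbit is open.\<close>

definition near_frame :: "sign list \<Rightarrow> 'n cmat \<Rightarrow> bool" where
  "near_frame \<alpha> A \<longleftrightarrow> (\<forall>a b. cmod (h (A *v axis a 1) (A *v axis b 1) -
      (if a = b then of_real (sgn_of (\<alpha> ! (idx a - 1))) else 0)) < 1 / (2 * real CARD('n)))"

text \<open>The constant in \<open>near_frame\<close>: by the Cauchy-Schwarz inequality the
  \<open>n * n\<close> error terms, each of size at most \<open>1 / (2 * n)\<close>, add up to at
  most half of the squared length of \<open>c\<close>. This cannot change the sign of a combination
  of columns of equal sign.\<close>

lemma near_frame_estimate:
  assumes "near_frame \<alpha> A"
  shows "\<bar>Re (h (A *v c) (A *v c)) - (\<Sum>a\<in>UNIV. sgn_of (\<alpha> ! (idx a - 1)) * (cmod (c $ a))\<^sup>2)\<bar> \<le>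
    (\<Sum>a\<in>UNIV. (cmod (c $ a))\<^sup>2) / 2"
proof -
  let ?n = "real CARD('n)"
  define D where "D a b = (if a = b then complex_of_real (sgn_of (\<alpha> ! (idx a - 1))) else 0)" for a b :: 'n
  define G where "G a b = h (A *v axis a 1) (A *v axis b 1)" for a b :: 'n
  have "(\<Sum>a\<in>UNIV. \<Sum>b\<in>UNIV. c $ a * cnj (c $ b) * D a b) =
      (\<Sum>a\<in>UNIV. of_real (sgn_of (\<alpha> ! (idx a - 1)) * (cmod (c $ a))\<^sup>2))"
  proof (rule sum.cong[OF refl])
    fix a :: 'n
    have "(\<Sum>b\<in>UNIV. c $ a * cnj (c $ b) * D a b) =
        (\<Sum>b\<in>UNIV. if b = a then c $ a * cnj (c $ a) * of_real (sgn_of (\<alpha> ! (idx a - 1))) else 0)"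
      by (intro sum.cong) (auto simp: D_def)
    then have "(\<Sum>b\<in>UNIV. c $ a * cnj (c $ b) * D a b) = c $ a * cnj (c $ a) * of_real (sgn_of (\<alpha> ! (idx a - 1)))"
      by simp
    then show "(\<Sum>b\<in>UNIV. c $ a * cnj (c $ b) * D a b) = of_real (sgn_of (\<alpha> ! (idx a - 1)) * (cmod (c $ a))\<^sup>2)"
      unfolding of_real_mult complex_norm_square by (simp only: mult.commute)
  qed
  then have "Re (\<Sum>a\<in>UNIV. \<Sum>b\<in>UNIV. c $ a * cnj (c $ b) * D a b) =
      (\<Sum>a\<in>UNIV. sgn_of (\<alpha> ! (idx a - 1)) * (cmod (c $ a))\<^sup>2)"
    by simp
  then have "Re (h (A *v c) (A *v c)) - (\<Sum>a\<in>UNIV. sgn_of (\<alpha> ! (idx a - 1)) * (cmod (c $ a))\<^sup>2) =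
      Re (\<Sum>a\<in>UNIV. \<Sum>b\<in>UNIV. c $ a * cnj (c $ b) * (G a b - D a b))"
    unfolding h_expand[of A c c] G_def by (simp add: right_diff_distrib sum_subtractf)
  also have "\<bar>\<dots>\<bar> \<le> cmod (\<Sum>a\<in>UNIV. \<Sum>b\<in>UNIV. c $ a * cnj (c $ b) * (G a b - D a b))"
    by (rule abs_Re_le_cmod)
  also have "\<dots> \<le> (\<Sum>a\<in>UNIV. \<Sum>b\<in>UNIV. cmod (c $ a) * cmod (c $ b) * (1 / (2 * ?n)))"
  proof (intro sum_norm_le)
    fix a b :: 'n
    have "cmod (G a b - D a b) \<le> 1 / (2 * ?n)"
      using assms unfolding near_frame_def G_def D_def by (intro less_imp_le) blast
    then show "cmod (c $ a * cnj (c $ b) * (G a b - D a b)) \<le> cmod (c $ a) * cmod (c $ b) * (1 / (2 * ?n))"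
      unfolding norm_mult complex_mod_cnj by (intro mult_left_mono) auto
  qed
  also have "\<dots> = (\<Sum>a\<in>UNIV. cmod (c $ a))\<^sup>2 / (2 * ?n)"
    by (simp add: power2_eq_square sum_product sum_divide_distrib)
  also have "\<dots> \<le> (?n * (\<Sum>a\<in>UNIV. (cmod (c $ a))\<^sup>2)) / (2 * ?n)"
    using sum_squared_le_sum_of_squares[of "\<lambda>a. cmod (c $ a)" "UNIV :: 'n set"]
    by (intro divide_right_mono) (auto simp: mult.commute)
  also have "\<dots> = (\<Sum>a\<in>UNIV. (cmod (c $ a))\<^sup>2) / 2" by simp
  finally show ?thesis .
qed

text \<open>The columns of sign \<open>s\<close> among the first \<open>k\<close> span a definite
  subspace \<open>N s\<close>, and the two dimensions add up to \<open>k\<close>. Definiteness is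
  the hypothesis, rather than a Gram matrix, because it is also available for the eigenframes of
  \<open>Jmat q\<close>.\<close>

lemma definite_frame_sign_orbit:
  assumes A: "invertible A" and len: "length \<alpha> = p + q"
    and definite: "\<And>c s. c \<noteq> 0 \<Longrightarrow> (\<And>a. c $ a \<noteq> 0 \<Longrightarrow> \<alpha> ! (idx a - 1) = s) \<Longrightarrow>
      Re (h (A *v c) (A *v c)) * sgn_of s > 0"
  shows "act A std_flag \<in> sign_orbit p q \<alpha>"
proof -
  have main: "nondegenerate_on p q (act A std_flag k) \<and>
      negative_index p q (act A std_flag k) = count_list (take k \<alpha>) Minus \<and>
      positive_index p q (act A std_flag k) = count_list (take k \<alpha>) Plus" if k: "k \<in> {1..p + q}" for k
  proof -
    define I where "I s = {a :: 'n. idx a \<le> k \<and> \<alpha> ! (idx a - 1) = s}" for s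
    define C where "C s = {c :: 'n cvec. \<forall>a. a \<notin> I s \<longrightarrow> c $ a = 0}" for s
    define N where "N s = (*v) A ` C s" for s
    have subC: "vec.subspace (C s)" for s by (auto simp: C_def vec.subspace_def)
    have subN: "vec.subspace (N s)" for s unfolding N_def by (intro vec.subspace_image subC)
    have cardI: "card (I s) = count_list (take k \<alpha>) s" for s
    proof -
      have "bij_betw idx (I s) {i \<in> {1..k}. \<alpha> ! (i - 1) = s}"
        using k by (intro bij_betw_byWitness[of _ coord]) (auto simp: I_def idx_coord card_n)
      then show ?thesis using k by (simp add: bij_betw_same_card count_list_take len)
    qed
    have dimN: "vec.dim (N s) = count_list (take k \<alpha>) s" for s
    proof -
      have "vec.dim (N s) = vec.dim (C s)"
        unfolding N_def using invertible_inj[OF A] by (intro vec.dim_image_eq) (auto intro: inj_on_subset)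
      then show ?thesis unfolding C_def dim_substandard_cart by (simp add: cardI)
    qed
    have NV: "N s \<subseteq> act A std_flag k" for s
      unfolding N_def act_def C_def I_def std_flag_eq by (intro image_mono) auto
    have est: "Re (h v v) * sgn_of s > 0" if vN: "v \<in> N s" "v \<noteq> 0" for v s
    proof -
      obtain c where c: "v = A *v c" "c \<in> C s" using vN(1) unfolding N_def by blast
      have "c \<noteq> 0" using vN(2) c(1) by auto
      moreover have "\<alpha> ! (idx a - 1) = s" if "c $ a \<noteq> 0" for a using c(2) that by (auto simp: C_def I_def)
      ultimately show ?thesis unfolding c(1) by (rule definite)
    qed
    have neg: "\<forall>v\<in>N Minus. v \<noteq> 0 \<longrightarrow> Re (h v v) < 0" and ps: "\<forall>v\<in>N Plus. v \<noteq> 0 \<longrightarrow> Re (h v v) > 0"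
      using est[of _ Minus] est[of _ Plus] by auto
    have "count_list (take k \<alpha>) Minus + count_list (take k \<alpha>) Plus = k"
    proof -
      have "count_list xs Minus + count_list xs Plus = length xs" for xs
      proof (induction xs)
        case (Cons a xs)
        then show ?case by (cases a) auto
      qed simp
      then show ?thesis using k len by simp
    qed
    moreover have "vec.dim (act A std_flag k) = k"
      using complete_flagsD(3)[OF act_std_flag_complete[OF A]] k by (simp add: card_n)
    ultimately have "vec.dim (N Minus) + vec.dim (N Plus) = vec.dim (act A std_flag k)" by (simp add: dimN)
    from index_eqI[OF subN NV neg subN NV ps _ this] show ?thesis
      by (simp add: dimN act_std_flag)
  qed
  then show ?thesis unfolding sign_orbit_def using A by simp
qed

lemma near_frame_sign_orbit:
  assumes A: "invertible A" "near_frame \<alpha> A" and len: "length \<alpha> = p + q"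
  shows "act A std_flag \<in> sign_orbit p q \<alpha>"
proof (rule definite_frame_sign_orbit[OF A(1) len])
  fix c :: "'n cvec" and s assume c: "c \<noteq> 0" "\<And>a. c $ a \<noteq> 0 \<Longrightarrow> \<alpha> ! (idx a - 1) = s"
  obtain a0 where "c $ a0 \<noteq> 0" using c(1) by (auto simp: vec_eq_iff)
  then have pos: "(\<Sum>a\<in>UNIV. (cmod (c $ a))\<^sup>2) > 0" by (intro sum_pos2[of _ a0]) auto
  have "(\<Sum>a\<in>UNIV. sgn_of (\<alpha> ! (idx a - 1)) * (cmod (c $ a))\<^sup>2) = (\<Sum>a\<in>UNIV. sgn_of s * (cmod (c $ a))\<^sup>2)"
  proof (rule sum.cong[OF refl])
    fix a show "sgn_of (\<alpha> ! (idx a - 1)) * (cmod (c $ a))\<^sup>2 = sgn_of s * (cmod (c $ a))\<^sup>2"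
      using c(2)[of a] by (cases "c $ a = 0") auto
  qed
  also have "\<dots> = sgn_of s * (\<Sum>a\<in>UNIV. (cmod (c $ a))\<^sup>2)" by (simp add: sum_distrib_left)
  finally have *: "\<bar>Re (h (A *v c) (A *v c)) - sgn_of s * (\<Sum>a\<in>UNIV. (cmod (c $ a))\<^sup>2)\<bar> \<le>
      (\<Sum>a\<in>UNIV. (cmod (c $ a))\<^sup>2) / 2"
    using near_frame_estimate[OF A(2), of c] by simp
  show "Re (h (A *v c) (A *v c)) * sgn_of s > 0"
    using abs_le_D1[OF *] abs_le_D2[OF *] pos by (cases s) auto
qed

definition sign_frame :: "sign list \<Rightarrow> 'n cmat \<Rightarrow> bool" where
  "sign_frame \<alpha> A \<longleftrightarrow> (\<forall>a b. h (A *v axis a 1) (A *v axis b 1) =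
      (if a = b then of_real (sgn_of (\<alpha> ! (idx a - 1))) else 0))"

lemma sign_frame_near: "sign_frame \<alpha> A \<Longrightarrow> near_frame \<alpha> A"
  by (simp add: sign_frame_def near_frame_def)

lemma sign_frame_of_flag:
  assumes V: "V \<in> complete_flags" and nd: "\<And>k. k \<in> {1..p + q} \<Longrightarrow> nondegenerate_on p q (V k)"
  obtains \<alpha> A where "length \<alpha> = p + q" "invertible A" "sign_frame \<alpha> A" "V = act A std_flag"
proof -
  have "\<exists>y. \<forall>k. 1 \<le> k \<and> k \<le> CARD('n) \<longrightarrow> y k \<in> V k \<and> y k \<notin> V (k - 1) \<and>
    (h (y k) (y k) = 1 \<or> h (y k) (y k) = -1) \<and> (\<forall>v\<in>V (k - 1). h (y k) v = 0)"
    using nd by (intro h.gram_schmidt[OF V order_refl]) (auto simp: nondegenerate_on_def card_n)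
  then obtain y where y: "\<And>k. 1 \<le> k \<Longrightarrow> k \<le> CARD('n) \<Longrightarrow> y k \<in> V k \<and> y k \<notin> V (k - 1) \<and>
    (h (y k) (y k) = 1 \<or> h (y k) (y k) = -1) \<and> (\<forall>v\<in>V (k - 1). h (y k) v = 0)"
    by blast
  define \<alpha> where "\<alpha> = map (\<lambda>k. if h (y (Suc k)) (y (Suc k)) = 1 then Plus else Minus) [0..<p + q]"
  have col: "colmat y *v axis a 1 = y (idx a)" for a :: 'n
    using colmat_e_vec[of "idx a" y] by simp
  have orth: "h (y (idx a)) (y (idx b)) = 0" if "a < b" for a b :: 'n
  proof -
    have "idx a \<le> idx b - 1" using that by (metis idx_less_iff less_Suc_eq_le Suc_pred' idx_ge less_le_trans zero_less_Suc)
    then have "V (idx a) \<subseteq> V (idx b - 1)" by (intro monoD[OF complete_flagsD(1)[OF V]])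
    then have "y (idx a) \<in> V (idx b - 1)" using y[of "idx a"] by auto
    then have "h (y (idx b)) (y (idx a)) = 0" using y[of "idx b"] by simp
    then show ?thesis using h.zero_sym by blast
  qed
  have "h (y (idx a)) (y (idx a)) = of_real (sgn_of (\<alpha> ! (idx a - 1)))" for a :: 'n
  proof -
    have "idx a - 1 < p + q" "Suc (idx a - 1) = idx a"
      using idx_ge[of a] idx_le[of a] unfolding card_n by linarith+
    then have "\<alpha> ! (idx a - 1) = (if h (y (idx a)) (y (idx a)) = 1 then Plus else Minus)"
      by (simp add: \<alpha>_def del: One_nat_def)
    then show ?thesis using y[of "idx a"] by auto
  qed
  moreover have "h (y (idx a)) (y (idx b)) = 0" if "a \<noteq> b" for a b :: 'n
    using orth[of a b] orth[of b a] that h.zero_sym by (metis linorder_neqE)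
  ultimately have "sign_frame \<alpha> (colmat y)" by (simp add: sign_frame_def col)
  moreover have "invertible (colmat y)" "V = act (colmat y) std_flag"
    using flag_of_adapted_basis[OF V, of y] y by auto
  moreover have "length \<alpha> = p + q" by (simp add: \<alpha>_def)
  ultimately show ?thesis using that by blast
qed

lemma sign_orbit_unique:
  assumes "V \<in> sign_orbit p q \<alpha>" "V \<in> sign_orbit p q \<beta>" "length \<alpha> = p + q" "length \<beta> = p + q"
  shows "\<alpha> = \<beta>"
  using assms by (intro sign_list_eqI) (auto simp: sign_orbit_def)

lemma sign_orbit_iff:
  assumes "length \<alpha> = p + q"
  shows "V \<in> sign_orbit p q \<alpha> \<longleftrightarrow> (\<exists>A. invertible A \<and> sign_frame \<alpha> A \<and> V = act A std_flag)"
proof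
  assume V: "V \<in> sign_orbit p q \<alpha>"
  then have "V \<in> complete_flags" "\<And>k. k \<in> {1..p + q} \<Longrightarrow> nondegenerate_on p q (V k)"
    by (auto simp: sign_orbit_def)
  then obtain \<beta> A where A: "length \<beta> = p + q" "invertible A" "sign_frame \<beta> A" "V = act A std_flag"
    by (rule sign_frame_of_flag)
  then have "V \<in> sign_orbit p q \<beta>" using near_frame_sign_orbit sign_frame_near by blast
  then have "\<beta> = \<alpha>" using sign_orbit_unique V A(1) assms by blast
  with A show "\<exists>A. invertible A \<and> sign_frame \<alpha> A \<and> V = act A std_flag" by blast
next
  assume "\<exists>A. invertible A \<and> sign_frame \<alpha> A \<and> V = act A std_flag"
  then show "V \<in> sign_orbit p q \<alpha>" using near_frame_sign_orbit[OF _ _ assms] sign_frame_near by blast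
qed

lemma continuous_on_h [continuous_intros]:
  "continuous_on S f \<Longrightarrow> continuous_on S g \<Longrightarrow> continuous_on S (\<lambda>x. h (f x) (g x))"
  unfolding h_eq sip_def matrix_vector_mult_def by (intro continuous_intros)

lemma continuous_on_matrix_vector [continuous_intros]:
  fixes f :: "'x::topological_space \<Rightarrow> 'n cmat"
  shows "continuous_on S f \<Longrightarrow> continuous_on S g \<Longrightarrow> continuous_on S (\<lambda>x. f x *v g x)"
  unfolding matrix_vector_mult_def by (intro continuous_intros)

lemma open_near_frame: "open {A. near_frame \<alpha> A}"
proof -
  have "{A. near_frame \<alpha> A} = (\<Inter>a\<in>UNIV. \<Inter>b\<in>UNIV. {A. cmod (h (A *v axis a 1) (A *v axis b 1) -
      (if a = b then of_real (sgn_of (\<alpha> ! (idx a - 1))) else 0)) < 1 / (2 * real CARD('n))})"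
    unfolding near_frame_def by blast
  moreover have "open \<dots>"
    by (intro open_INT finite_class.finite_UNIV ballI open_Collect_less continuous_intros)
  ultimately show ?thesis by simp
qed

lemma open_sign_orbit:
  assumes "length \<alpha> = p + q"
  shows "openin flag_topology (sign_orbit p q \<alpha> :: 'n flag set)"
  unfolding openin_flag_topology
proof
  show "sign_orbit p q \<alpha> \<subseteq> (complete_flags :: 'n flag set)" by (auto simp: sign_orbit_def)
  show "open {g :: 'n cmat. invertible g \<and> act g std_flag \<in> sign_orbit p q \<alpha>}"
  proof (subst open_subopen, safe)
    fix g :: "'n cmat" assume g: "invertible g" "act g std_flag \<in> sign_orbit p q \<alpha>"
    then obtain A where A: "invertible A" "sign_frame \<alpha> A" "act g std_flag = act A std_flag"
      using sign_orbit_iff[OF assms] by blast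
    \<comment> \<open>A sign frame of the flag is \<open>g\<close> times a fixed upper triangular
      \<open>b\<close>. For \<open>x\<close> near \<open>g\<close> the frame \<open>x ** b\<close>
      describes the same flag as \<open>x\<close> and has nearly the same Gram matrix.\<close>
    define b where "b = matrix_inv g ** A"
    have b: "b \<in> upper_borel" "g ** b = A" using act_eq_iff[OF A(1) g(1)] A(3) g(1) by (auto simp: b_def)
    have "open ((\<lambda>x :: 'n cmat. x ** b) -` {A. near_frame \<alpha> A})"
      by (rule continuous_open_vimage[OF open_near_frame])
        (intro continuous_on_eq_continuous_at[THEN iffD1, rule_format, OF open_UNIV] continuous_intros UNIV_I)
    moreover have "act x std_flag \<in> sign_orbit p q \<alpha>" if "invertible x" "near_frame \<alpha> (x ** b)" for x
      using near_frame_sign_orbit[OF _ that(2) assms] that(1) b upper_borel_invertible[OF b(1)]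
      by (simp add: act_upper_borel invertible_mult)
    ultimately show "\<exists>T. open T \<and> g \<in> T \<and> T \<subseteq> {g. invertible g \<and> act g std_flag \<in> sign_orbit p q \<alpha>}"
      using g(1) sign_frame_near[OF A(2)] b(2) open_invertible
      by (intro exI[of _ "((\<lambda>x. x ** b) -` {A. near_frame \<alpha> A}) \<inter> {g. invertible g}"]) auto
  qed
qed

end

subsection \<open>Open orbits\<close>

lemma orbit_eqI:
  assumes mult: "\<And>a b. a \<in> H \<Longrightarrow> b \<in> H \<Longrightarrow> a ** b \<in> H"
    and inv: "\<And>a. a \<in> H \<Longrightarrow> invertible a \<and> matrix_inv a \<in> H"
    and W: "W \<in> orbit H V"
  shows "orbit H V = orbit H W"
proof -
  obtain g where g: "g \<in> H" "W = act g V" using W by (auto simp: orbit_def)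
  then have V: "V = act (matrix_inv g) W" using inv by (simp flip: act_mult)
  have "act a V \<in> orbit H W" if "a \<in> H" for a
    using mult[OF that] inv[OF g(1)] by (subst V) (auto simp: orbit_def simp flip: act_mult)
  moreover have "act a W \<in> orbit H V" if "a \<in> H" for a
    using mult[OF that g(1)] by (auto simp: orbit_def g(2) simp flip: act_mult)
  ultimately show ?thesis by (auto simp: orbit_def[of H])
qed

section \<open>Unitary matrices\<close>

lemma conj_transpose_involution [simp]: "conj_transpose (conj_transpose g) = g"
  by (simp add: conj_transpose_def vec_eq_iff)

lemma sip_mult_right: "sip v (A *v w) = sip (conj_transpose A *v v) w"
  by (simp add: sip_mult)

lemma conj_transpose_mult: "conj_transpose (A ** B) = conj_transpose B ** conj_transpose A"
  by (simp add: conj_transpose_def matrix_matrix_mult_def vec_eq_iff mult.commute)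

lemma unitary_iff: "conj_transpose A ** A = mat 1 \<longleftrightarrow> (\<forall>v w. sip (A *v v) (A *v w) = sip v w)"
proof
  assume "conj_transpose A ** A = mat 1"
  then have "conj_transpose A *v (A *v v) = v" for v by (simp add: matrix_vector_mul_assoc)
  then show "\<forall>v w. sip (A *v v) (A *v w) = sip v w" by (simp add: sip_mult_right)
next
  assume *: "\<forall>v w. sip (A *v v) (A *v w) = sip v w"
  have "conj_transpose A *v (A *v v) = v" for v
    by (rule sip_eqI) (use * in \<open>simp add: sip_mult_right\<close>)
  then show "conj_transpose A ** A = mat 1" by (simp add: matrix_eq flip: matrix_vector_mul_assoc)
qed

lemma unitary_colmat:
  fixes y :: "nat \<Rightarrow> 'n::{finite,wellorder} cvec"
  assumes gram: "\<And>a b :: 'n. sip (y (idx a)) (y (idx b)) = (if a = b then 1 else 0)"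
  shows "conj_transpose (colmat y) ** colmat y = mat 1"
  unfolding unitary_iff
proof (intro allI)
  fix v w :: "'n cvec"
  have "column a (colmat y) = y (idx a)" for a :: 'n by (simp add: column_def colmat_def)
  then have *: "colmat y *v x = (\<Sum>a\<in>UNIV. x $ a *s y (idx a))" for x
    using matrix_mult_sum[of "colmat y" x] by (simp only:)
  have "(\<Sum>b\<in>UNIV. v $ a * (cnj (w $ b) * (if a = b then 1 else 0))) = v $ a * cnj (w $ a)" for a
  proof -
    have "(\<Sum>b\<in>UNIV. v $ a * (cnj (w $ b) * (if a = b then 1 else 0))) = (\<Sum>b\<in>UNIV. if b = a then v $ a * cnj (w $ a) else 0)"
      by (intro sum.cong) auto
    then show ?thesis by simp
  qed
  then show "sip (colmat y *v v) (colmat y *v w) = sip v w"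
    unfolding * sip.sum_left sip.scale_left
    unfolding sip.sum_right sip.scale_right gram by (simp add: sum_distrib_left sip_def)
qed

lemma unitary_det: "conj_transpose A ** A = mat 1 \<Longrightarrow> cmod (det A) = 1 \<and> invertible A"
proof -
  assume A: "conj_transpose A ** A = mat 1"
  then have "det (conj_transpose A ** A) = 1" by simp
  then have "cnj (det A) * det A = 1" by (simp add: det_mul det_conj_transpose)
  then have "complex_of_real ((cmod (det A))\<^sup>2) = 1" unfolding complex_norm_square by (simp add: mult.commute)
  then have "(cmod (det A))\<^sup>2 = 1" using of_real_eq_1_iff by blast
  moreover have "invertible A" using A by (auto simp: invertible_left_inverse)
  ultimately show ?thesis using norm_ge_zero[of "det A"] by (auto simp: power2_eq_1_iff)
qed

context signature
begin

section \<open>Isometries of the hermitian form\<close>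

lemma h_isometry_det:
  assumes "\<And>v w. h (g *v v) (g *v w) = h v w"
  shows "cmod (det g) = 1" "invertible g"
proof -
  have "conj_transpose g *v (Jmat q *v (g *v v)) = Jmat q *v v" for v
    by (rule sip_eqI) (use assms in \<open>simp add: h_eq sip_mult_right\<close>)
  then have "conj_transpose g ** (Jmat q ** g) = Jmat q" by (simp add: matrix_eq flip: matrix_vector_mul_assoc)
  then have "cnj (det g) * (det (Jmat q :: 'n cmat) * det g) = det (Jmat q :: 'n cmat)"
    by (metis det_conj_transpose det_mul)
  moreover have "det (Jmat q :: 'n cmat) \<noteq> 0" using invertible_Jmat invertible_det_nz by blast
  ultimately have "cnj (det g) * det g = 1" by (simp add: field_simps)
  then have "complex_of_real ((cmod (det g))\<^sup>2) = 1" unfolding complex_norm_square by (simp add: mult.commute)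
  then have "(cmod (det g))\<^sup>2 = 1" using of_real_eq_1_iff by blast
  then show "cmod (det g) = 1" using norm_ge_zero[of "det g"] by (auto simp: power2_eq_1_iff)
  then show "invertible g" by (auto simp: invertible_det_nz)
qed

lemma SU_mult: "a \<in> SU p q \<Longrightarrow> b \<in> SU p q \<Longrightarrow> a ** b \<in> (SU p q :: 'n cmat set)"
  by (simp add: SU_def det_mul flip: matrix_vector_mul_assoc)

lemma SU_inv: "a \<in> SU p q \<Longrightarrow> invertible a \<and> matrix_inv a \<in> (SU p q :: 'n cmat set)"
proof -
  assume a: "a \<in> SU p q"
  then have inv: "invertible a" by (simp add: SU_def invertible_det_nz)
  have "det a * det (matrix_inv a) = det (a ** matrix_inv a)" by (simp add: det_mul)
  then have "det (matrix_inv a) = 1" using inv a by (simp add: SU_def)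
  moreover have "h (matrix_inv a *v v) (matrix_inv a *v w) = h (a *v (matrix_inv a *v v)) (a *v (matrix_inv a *v w))" for v w
    using a by (simp add: SU_def)
  ultimately show ?thesis using inv by (simp add: SU_def)
qed

lemma SU_one: "mat 1 \<in> (SU p q :: 'n cmat set)"
  by (simp add: SU_def)

lemma sign_frame_gram:
  assumes "sign_frame \<alpha> A" "sign_frame \<alpha> A'"
  shows "h (A *v c) (A *v d) = h (A' *v c) (A' *v d)"
  using assms unfolding h_expand[of A c d] h_expand[of A' c d] by (simp add: sign_frame_def)

lemma sign_frame_transfer:
  assumes "\<And>v w. h (g *v v) (g *v w) = h v w" "sign_frame \<alpha> A"
  shows "sign_frame \<alpha> (g ** A)"
  using assms by (simp add: sign_frame_def flip: matrix_vector_mul_assoc)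

lemma isometry_sign_orbit:
  assumes "\<And>v w. h (g *v v) (g *v w) = h v w" "V \<in> sign_orbit p q \<alpha>" "length \<alpha> = p + q"
  shows "act g V \<in> sign_orbit p q \<alpha>"
proof -
  obtain A where "invertible A" "sign_frame \<alpha> A" "V = act A std_flag"
    using assms(2) sign_orbit_iff[OF assms(3)] by blast
  then have "invertible (g ** A)" "sign_frame \<alpha> (g ** A)" "act g V = act (g ** A) std_flag"
    using sign_frame_transfer[OF assms(1)] h_isometry_det(2)[OF assms(1)] by (auto simp: invertible_mult act_mult)
  then show ?thesis using sign_orbit_iff[OF assms(3)] by blast
qed

lemma unit_scalar_isometry: "cmod c = 1 \<Longrightarrow> h ((mat c ** g) *v v) ((mat c ** g) *v w) = h (g *v v) (g *v w)"
proof -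
  assume "cmod c = 1"
  then have "cnj c * c = 1" by (simp add: mult.commute[of "cnj c"] flip: complex_norm_square)
  then show ?thesis
    by (simp add: mat_mult_vec h.scale_left h.scale_right flip: matrix_vector_mul_assoc)
qed

text \<open>Two sign frames for the same \<alpha> have the same Gram matrix, so the matrix that
  carries one to the other is an isometry; a unimodular scalar then corrects its
  determinant.\<close>

lemma sign_orbit_eq_orbit:
  assumes V: "V \<in> sign_orbit p q \<alpha>" and len: "length \<alpha> = p + q"
  shows "sign_orbit p q \<alpha> = orbit (SU p q) (V :: 'n flag)"
proof (intro equalityI subsetI)
  obtain A where A: "invertible A" "sign_frame \<alpha> A" "V = act A std_flag" using V sign_orbit_iff[OF len] by blast
  fix W :: "'n flag" assume "W \<in> sign_orbit p q \<alpha>"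
  then obtain A' where A': "invertible A'" "sign_frame \<alpha> A'" "W = act A' std_flag" using sign_orbit_iff[OF len] by blast
  define g where "g = A' ** matrix_inv A"
  have iso: "h (g *v v) (g *v w) = h v w" for v w
    using sign_frame_gram[OF A'(2) A(2), of "matrix_inv A *v v" "matrix_inv A *v w"] A(1)
    by (simp add: g_def flip: matrix_vector_mul_assoc)
  obtain c where c: "c \<noteq> 0" "det (mat c ** g) = 1" "cmod (det g) = 1 \<longrightarrow> cmod c = 1"
    using normalize_det[OF h_isometry_det(2)[OF iso]] .
  then have "mat c ** g \<in> SU p q"
    using h_isometry_det(1)[OF iso] unit_scalar_isometry[of c g] iso by (simp add: SU_def)
  moreover have "act (mat c ** g) V = W"
  proof -
    have "act g V = W" using A A' by (simp add: g_def flip: act_mult matrix_mul_assoc)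
    then show ?thesis using A' c by (simp add: act_mult act_mat)
  qed
  ultimately show "W \<in> orbit (SU p q) V" by (auto simp: orbit_def)
next
  fix W :: "'n flag" assume "W \<in> orbit (SU p q) V"
  then obtain g where "g \<in> SU p q" "W = act g V" by (auto simp: orbit_def)
  then show "W \<in> sign_orbit p q \<alpha>" using isometry_sign_orbit[OF _ V len] by (auto simp: SU_def)
qed

lemma h_e_vec:
  assumes "i \<in> {1..p + q}" "j \<in> {1..p + q}"
  shows "h (e_vec i) (e_vec j) = (if i = j then (if i \<le> q then -1 else 1) else 0)"
proof -
  have "h (e_vec i) (e_vec j) = (\<Sum>a\<in>(UNIV :: 'n set). if a = coord i then (if i = j then (if i \<le> q then -1 else 1) else 0) else 0)"
    unfolding h_eq sip_def using assms
    by (intro sum.cong) (auto simp: Jmat_mult e_vec_nth card_n idx_coord)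
  then show ?thesis by simp
qed

lemma coordinate_sign_frame:
  assumes "bij_betw \<epsilon> {1..p + q} {1..p + q}"
  shows "sign_frame (map (\<lambda>k. if \<epsilon> (Suc k) \<le> q then Minus else Plus) [0..<p + q])
    (colmat (\<lambda>k. e_vec (\<epsilon> k)))"
  unfolding sign_frame_def
proof (intro allI)
  fix a b :: 'n
  have r: "idx a \<in> {1..p + q}" "idx b \<in> {1..p + q}" using idx_range[where 'n='n] by (auto simp: card_n)
  then have e: "\<epsilon> (idx a) \<in> {1..p + q}" "\<epsilon> (idx b) \<in> {1..p + q}" "\<epsilon> (idx a) = \<epsilon> (idx b) \<longleftrightarrow> a = b"
    using assms by (auto simp only: bij_betw_def inj_on_eq_iff idx_eq_iff)
  have s: "idx a - 1 < p + q" "Suc (idx a - 1) = idx a"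
    using idx_ge[of a] idx_le[of a] unfolding card_n by linarith+
  have c: "colmat (\<lambda>k. e_vec (\<epsilon> k)) *v axis d 1 = (e_vec (\<epsilon> (idx d)) :: 'n cvec)" for d :: 'n
    using colmat_e_vec[of "idx d" "\<lambda>k. e_vec (\<epsilon> k) :: 'n cvec"] by simp
  show "h (colmat (\<lambda>k. e_vec (\<epsilon> k)) *v axis a 1) (colmat (\<lambda>k. e_vec (\<epsilon> k)) *v axis b 1) =
      (if a = b then of_real (sgn_of (map (\<lambda>k. if \<epsilon> (Suc k) \<le> q then Minus else Plus) [0..<p + q] ! (idx a - 1))) else 0)"
  proof -
    have "map (\<lambda>k. if \<epsilon> (Suc k) \<le> q then Minus else Plus) [0..<p + q] ! (idx a - 1) =
        (if \<epsilon> (idx a) \<le> q then Minus else Plus)"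
      using s by (simp del: One_nat_def)
    then show ?thesis unfolding c using h_e_vec[OF e(1,2)] e(3) by (cases "a = b") (simp_all del: One_nat_def)
  qed
qed

text \<open>The last step of every flag is the whole space, so the total numbers of signs are its
  signature; they are computed on the standard flag.\<close>

lemma sign_orbit_count:
  assumes V: "(V :: 'n flag) \<in> sign_orbit p q \<alpha>" and len: "length \<alpha> = p + q"
  shows "count_list \<alpha> Minus = q" "count_list \<alpha> Plus = p"
proof -
  let ?\<beta> = "map (\<lambda>k. if id (Suc k) \<le> q then Minus else Plus) [0..<p + q]"
  have "colmat (\<lambda>k. e_vec (id k)) = (mat 1 :: 'n cmat)" by (rule mat_eqI) simp
  then have "sign_frame ?\<beta> (mat 1)"
    using coordinate_sign_frame[of id] by (simp del: id_apply)
  then have std: "std_flag \<in> (sign_orbit p q ?\<beta> :: 'n flag set)"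
    using sign_orbit_iff[of ?\<beta> "std_flag :: 'n flag"] by (intro iffD2[OF sign_orbit_iff]) (auto intro!: exI[of _ "mat 1"])
  have full: "V (p + q) = std_flag (p + q)"
    using V complete_flagsD(5)[of V "p + q"] by (simp add: sign_orbit_def std_flag_full card_n)
  have "count_list ?\<beta> s = card {i \<in> {1..p + q}. (i \<le> q) = (s = Minus)}" for s
    using count_list_take[of "p + q" ?\<beta> s]
    by (simp, intro arg_cong[of _ _ card] Collect_cong) (cases s; auto split: if_splits)
  moreover have "{i \<in> {1..p + q}. (i \<le> q) = (Minus = Minus)} = {1..q}" "{i \<in> {1..p + q}. (i \<le> q) = (Plus = Minus)} = {q + 1..p + q}"
    by auto
  ultimately have cnt: "count_list ?\<beta> Minus = q" "count_list ?\<beta> Plus = p" by simp_all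
  have "count_list \<alpha> Minus = q \<and> count_list \<alpha> Plus = p"
  proof (cases "p + q = 0")
    case True
    then show ?thesis using len by auto
  next
    case False
    then have n: "p + q \<in> {1..p + q}" by auto
    have "negative_index p q (W (p + q)) = count_list (take (p + q) \<gamma>) Minus \<and>
        positive_index p q (W (p + q)) = count_list (take (p + q) \<gamma>) Plus"
      if "W \<in> sign_orbit p q \<gamma>" for W :: "'n flag" and \<gamma>
      using that n unfolding sign_orbit_def by blast
    from this[OF V] this[OF std] show ?thesis using cnt len by (simp add: full)
  qed
  then show "count_list \<alpha> Minus = q" "count_list \<alpha> Plus = p" by simp_all
qed

lemma nondegenerate_on_iff: "nondegenerate_on p q W \<longleftrightarrow> (\<forall>v\<in>W. (\<forall>w\<in>W. h v w = 0) \<longrightarrow> v = 0)" for W :: "'n cvec set"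
  by (simp add: nondegenerate_on_def)

text \<open>Nondegenerate flags are dense: make the subspaces nondegenerate one after the other by moving one column of the
  frame by a small multiple of a non-isotropic vector orthogonal to the preceding subspace.\<close>

lemma open_contains_nondegenerate:
  fixes D :: "'n flag set"
  assumes D: "openin flag_topology D" "D \<noteq> {}" and m: "m \<le> p + q"
  shows "\<exists>g. invertible g \<and> act g std_flag \<in> D \<and> (\<forall>k\<in>{1..m}. nondegenerate_on p q (act g std_flag k))"
  using m
proof (induction m)
  case 0
  obtain V where V: "V \<in> D" using D(2) by blast
  then have "V \<in> complete_flags" using D(1) openin_subset by fastforce
  then show ?case using V complete_flagsE[of V] by auto
next
  case (Suc m)
  then obtain g where g: "invertible g" "act g std_flag \<in> D" "\<And>k. k \<in> {1..m} \<Longrightarrow> nondegenerate_on p q (act g std_flag k)"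
    by auto
  define V where "V = act g std_flag"
  have V: "V \<in> complete_flags" using g by (simp add: V_def)
  have "\<exists>y. \<forall>k. 1 \<le> k \<and> k \<le> m \<longrightarrow> y k \<in> V k \<and> y k \<notin> V (k - 1) \<and>
    (h (y k) (y k) = 1 \<or> h (y k) (y k) = -1) \<and> (\<forall>v\<in>V (k - 1). h (y k) v = 0)"
    using g(3) Suc.prems by (intro h.gram_schmidt[OF V]) (auto simp: nondegenerate_on_def card_n V_def)
  then obtain y where y: "\<And>k. 1 \<le> k \<Longrightarrow> k \<le> m \<Longrightarrow> y k \<in> V k \<and> y k \<notin> V (k - 1) \<and>
    (h (y k) (y k) = 1 \<or> h (y k) (y k) = -1) \<and> (\<forall>v\<in>V (k - 1). h (y k) v = 0)"
    by blast
  have span: "V m = vec.span (y ` {1..m})"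
    by (rule adapted_span[OF V, of m]) (use y Suc.prems card_n in auto)
  have V_le: "V k \<subseteq> V l" if "k \<le> l" for k l by (rule monoD[OF complete_flagsD(1)[OF V] that])
  have lt: "h (y j) (y i) = 0" if "1 \<le> i" "i < j" "j \<le> m" for i j
  proof -
    have "V i \<subseteq> V (j - 1)" using that by (intro V_le) simp
    moreover have "y i \<in> V i" using y[of i] that by simp
    ultimately have "y i \<in> V (j - 1)" by blast
    then show ?thesis using y[of j] that by auto
  qed
  have orth: "h (y i) (y j) = 0" if "i \<in> {1..m}" "j \<in> {1..m}" "i \<noteq> j" for i j
    using lt[of i j] lt[of j i] that h.zero_sym[of "y i" "y j"] by (cases "i < j") auto
  have proj: "\<exists>u\<in>V m. \<forall>v\<in>V m. h (x - u) v = 0" for x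
  proof -
    define u where "u = (\<Sum>i=1..m. (h x (y i) / h (y i) (y i)) *s y i)"
    have "u \<in> V m" unfolding u_def span by (intro vec.span_sum vec.span_scale vec.span_base) auto
    moreover have 0: "h (x - u) (y j) = 0" if j: "j \<in> {1..m}" for j
    proof -
      have "h u (y j) = (\<Sum>i=1..m. if i = j then h x (y j) else 0)"
        unfolding u_def h.sum_left h.scale_left
      proof (rule sum.cong[OF refl])
        fix i assume "i \<in> {1..m}"
        moreover have "h (y j) (y j) \<noteq> 0" using y[of j] j by force
        ultimately show "h x (y i) / h (y i) (y i) * h (y i) (y j) = (if i = j then h x (y j) else 0)"
          using orth[of i j] j by auto
      qed
      then show ?thesis using j by (simp add: h.diff_left)
    qed
    have "h (x - u) v = 0" if "v \<in> V m" for v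
    proof (rule h.orth_span)
      show "v \<in> vec.span (y ` {1..m})" using that span by simp
    qed (use 0 in auto)
    with \<open>u \<in> V m\<close> show ?thesis by blast
  qed
  \<comment> \<open>Otherwise every vector orthogonal to \<open>V m\<close> is isotropic. By
    polarization the form then vanishes on the orthogonal complement; since \<open>V m\<close> and
    its complement span the space, the complement is zero and \<open>V m\<close> is everything,
    although \<open>m < n\<close>.\<close>
  have "\<exists>z. (\<forall>v\<in>V m. h z v = 0) \<and> h z z \<noteq> 0"
  proof (rule ccontr)
    assume "\<not> ?thesis"
    then have iso: "h z z = 0" if "\<forall>v\<in>V m. h z v = 0" for z using that by blast
    have iso2: "h z z' = 0" if z: "\<forall>v\<in>V m. h z v = 0" "\<forall>v\<in>V m. h z' v = 0" for z z'
    proof -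
      \<comment> \<open>Both isotropy relations are needed over the complex numbers: the first gives
        the vanishing of the real part of \<open>h z z'\<close>, the one with the factor
        \<open>\<i>\<close> that of the imaginary part.\<close>
      have "h (z + z') (z + z') = 0" "h (z + \<i> *s z') (z + \<i> *s z') = 0"
        by (intro iso; use z in \<open>simp add: h.add_left h.scale_left\<close>)+
      then have "h z z' + h z' z = 0" "- \<i> * h z z' + \<i> * h z' z = 0"
        using iso[OF z(1)] iso[OF z(2)] by (simp_all add: h.add_left h.add_right h.scale_left h.scale_right)
      then have "\<i> * (h z z' + h z' z) - (- \<i> * h z z' + \<i> * h z' z) = 0" by simp
      then show ?thesis by (simp add: algebra_simps)
    qed
    have "z = 0" if z: "\<forall>v\<in>V m. h z v = 0" for z
    proof (rule h_nondegenerate)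
      fix w
      obtain u where u: "u \<in> V m" "\<forall>v\<in>V m. h (w - u) v = 0" using proj by blast
      have "h z w = h z u + h z (w - u)" by (simp flip: h.add_right)
      then show "h z w = 0" using z u iso2[OF z u(2)] by simp
    qed
    then have "w \<in> V m" for w using proj[of w] by force
    then have "V m = UNIV" by auto
    then have "vec.dim (V m) = CARD('n)" by (simp only: vec.dim_UNIV card_cart_basis)
    then show False using Suc.prems by (simp add: complete_flagsD[OF V] card_n)
  qed
  then obtain z where z: "\<forall>v\<in>V m. h z v = 0" "h z z \<noteq> 0" by blast
  define c where "c = (coord (Suc m) :: 'n)"
  have idxc: "idx c = Suc m" using Suc.prems by (simp add: c_def idx_coord card_n)
  \<comment> \<open>Adding a multiple of \<open>E\<close> changes only the column of number
    \<open>m + 1\<close>, so the steps up to \<open>m\<close>, already nondegenerate, stay as they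
    are.\<close>
  define E where "E = (\<chi> i j. if j = c then z $ i else (0 :: complex))"
  define gt where "gt t = g + t *\<^sub>R E" for t :: real
  have gt_mult: "gt t *v x = g *v x + (of_real t * x $ c) *s z" for t x
  proof -
    have "(E *v x) $ i = x $ c * z $ i" for i
    proof -
      have "(E *v x) $ i = (\<Sum>j\<in>UNIV. if j = c then z $ i * x $ j else 0)"
        unfolding E_def matrix_vector_mult_def vec_lambda_beta by (intro sum.cong) auto
      then show ?thesis by (simp add: mult.commute)
    qed
    then have "E *v x = x $ c *s z" by (simp add: vec_eq_iff)
    moreover have "(t *\<^sub>R E) *v x = of_real t *s (E *v x)"
      unfolding matrix_vector_mult_def vec_eq_iff vector_scaleR_component vector_smult_component vec_lambda_beta
      by (simp add: scaleR_conv_of_real sum_distrib_left mult.assoc)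
    ultimately show ?thesis by (simp add: gt_def matrix_vector_mult_add_rdistrib vector_smult_assoc)
  qed
  define x where "x = g *v axis c 1"
  obtain u where u: "u \<in> V m" "\<forall>v\<in>V m. h (x - u) v = 0" using proj by blast
  have "\<forall>\<^sub>F t in at_right (0::real). gt t \<in> {g. invertible g \<and> act g std_flag \<in> D}"
  proof -
    have "continuous_on UNIV gt" unfolding gt_def by (intro continuous_intros)
    then have "isCont gt 0" by (simp add: continuous_on_eq_continuous_at)
    then have lim: "(gt \<longlongrightarrow> gt 0) (at_right 0)" unfolding isCont_def by (rule tendsto_mono[OF at_le, rotated]) simp
    have "gt 0 \<in> {g. invertible g \<and> act g std_flag \<in> D}" using g by (simp add: gt_def)
    then show ?thesis by (rule topological_tendstoD[OF lim open_flag_preimage[OF D(1)]])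
  qed
  moreover have "\<forall>\<^sub>F t in at_right (0::real). h (x - u + of_real t *s z) (x - u + of_real t *s z) \<noteq> 0"
  proof -
    \<comment> \<open>The self-product is a real quadratic polynomial in \<open>t\<close> whose
      leading coefficient \<open>a\<close> is nonzero, hence it does not vanish for small positive
      \<open>t\<close>.\<close>
    define r s a where "r = Re (h (x - u) (x - u))" and "s = 2 * Re (h (x - u) z)" and "a = Re (h z z)"
    have a: "a \<noteq> 0" using z(2) h.self_real[of z] by (auto simp: a_def complex_eq_iff)
    have val: "Re (h (x - u + of_real t *s z) (x - u + of_real t *s z)) = r + s * t + a * t\<^sup>2" for t
    proof -
      have "Re (h (y + of_real t *s z) (y + of_real t *s z)) = Re (h y y) + 2 * Re (h y z) * t + Re (h z z) * t\<^sup>2" for y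
      proof -
        have "Re (h z y) = Re (h y z)" by (metis cnj.simps(1) h.cnj_swap)
        then show ?thesis
          by (simp add: h.add_left h.add_right h.scale_left h.scale_right algebra_simps power2_eq_square)
      qed
      then show ?thesis by (simp add: r_def s_def a_def)
    qed
    have "\<forall>\<^sub>F t in at_right (0::real). r + s * t + a * t\<^sup>2 \<noteq> 0"
    proof (cases "r = 0")
      case False
      have "((\<lambda>t. r + s * t + a * t\<^sup>2) \<longlongrightarrow> r + s * 0 + a * 0\<^sup>2) (at_right 0)" by (intro tendsto_intros)
      then show ?thesis using False by (intro tendsto_imp_eventually_ne) auto
    next
      case True
      show ?thesis
      proof (cases "s = 0")
        case True
        show ?thesis using \<open>r = 0\<close> True a by (auto simp: eventually_at_right_field intro!: exI[of _ 1])
      next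
        case False
        have "((\<lambda>t. s + a * t) \<longlongrightarrow> s + a * 0) (at_right 0)" by (intro tendsto_intros)
        then have "\<forall>\<^sub>F t in at_right (0::real). s + a * t \<noteq> 0" using False by (intro tendsto_imp_eventually_ne) auto
        moreover have "\<forall>\<^sub>F t in at_right (0::real). t > 0" by (simp add: eventually_at_right_less)
        ultimately show ?thesis
        proof eventually_elim
          case (elim t)
          have "r + s * t + a * t\<^sup>2 = t * (s + a * t)" using \<open>r = 0\<close> by (simp add: algebra_simps power2_eq_square)
          then show ?case using elim by simp
        qed
      qed
    qed
    then show ?thesis
    proof eventually_elim
      case (elim t)
      then show ?case using val[of t] by fastforce
    qed
  qed
  ultimately have "\<forall>\<^sub>F t in at_right (0::real). gt t \<in> {g. invertible g \<and> act g std_flag \<in> D} \<and>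
      h (x - u + of_real t *s z) (x - u + of_real t *s z) \<noteq> 0"
    by (rule eventually_conj)
  from eventually_happens'[OF trivial_limit_at_right_real this]
  obtain t where t: "invertible (gt t)" "act (gt t) std_flag \<in> D"
      "h (x - u + of_real t *s z) (x - u + of_real t *s z) \<noteq> 0"
    by auto
  have same: "act (gt t) std_flag k = V k" if "k \<le> m" for k
  proof -
    have "gt t *v w = g *v w" if "w \<in> std_flag k" for w
      using that \<open>k \<le> m\<close> idxc by (simp add: gt_mult std_flag_eq)
    then show ?thesis by (simp add: V_def act_def)
  qed
  have "nondegenerate_on p q (act (gt t) std_flag (Suc m))"
    unfolding nondegenerate_on_iff
  proof (intro ballI impI)
    let ?W = "act (gt t) std_flag (Suc m)" and ?x = "x - u + of_real t *s z"
    have Wc: "act (gt t) std_flag \<in> complete_flags" using t by simp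
    have subW: "vec.subspace ?W" by (rule complete_flagsD(2)[OF Wc])
    have VW: "V m \<subseteq> ?W" using same[of m] monoD[OF complete_flagsD(1)[OF Wc], of m "Suc m"] by simp
    have "axis c 1 \<in> (std_flag (Suc m) :: 'n cvec set)" by (simp add: std_flag_eq axis_def flip: idxc)
    then have "gt t *v axis c 1 \<in> ?W" unfolding act_def by (rule imageI)
    then have xW: "?x \<in> ?W"
    proof -
      have "?x = gt t *v axis c 1 - u" by (simp add: gt_mult x_def axis_def)
      then show ?thesis
        using vec.subspace_diff[OF subW \<open>gt t *v axis c 1 \<in> ?W\<close> subsetD[OF VW u(1)]] by (simp only:)
    qed
    have xorth: "h ?x v = 0" if "v \<in> V m" for v
      using u(2) z(1) that by (simp add: h.add_left h.scale_left)
    fix v assume v: "v \<in> ?W" "\<forall>w\<in>?W. h v w = 0"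
    \<comment> \<open>The new step is the orthogonal sum of \<open>V m\<close> and the line of the
      non-isotropic vector \<open>?x\<close>. Pairing a vector of the radical with \<open>?x\<close>
      gives \<open>e = 0\<close>, and what is left lies in the radical of
      \<open>V m\<close>.\<close>
    have "\<exists>e. v - e *s ?x \<in> V m"
    proof -
      obtain w where w: "v = gt t *v w" "w \<in> std_flag (Suc m)" using v(1) by (auto simp: act_def)
      have "w - w $ c *s axis c 1 \<in> std_flag m"
      proof -
        have "(w - w $ c *s axis c 1) $ a = 0" if "m < idx a" for a
        proof (cases "a = c")
          case False
          then have "idx a \<noteq> Suc m" using idxc by (metis idx_eq_iff)
          then show ?thesis using that w(2) False by (simp add: std_flag_eq axis_def)
        qed (simp add: axis_def)
        then show ?thesis by (simp add: std_flag_eq)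
      qed
      then have "gt t *v (w - w $ c *s axis c 1) \<in> V m" using same[of m] by (auto simp: act_def)
      then have "gt t *v (w - w $ c *s axis c 1) + w $ c *s u \<in> V m"
        using u(1) complete_flagsD(2)[OF V] by (intro vec.subspace_add vec.subspace_scale)
      moreover have "v - w $ c *s ?x = gt t *v (w - w $ c *s axis c 1) + w $ c *s u"
      proof -
        have xg: "?x = gt t *v axis c 1 - u" by (simp add: gt_mult x_def axis_def)
        show ?thesis
          unfolding xg w(1) matrix_vector_mult_diff_distrib vector_scalar_commute vec.scale_right_diff_distrib by simp
      qed
      ultimately show ?thesis by (intro exI[of _ "w $ c"]) (simp only:)
    qed
    then obtain e where e: "v - e *s ?x \<in> V m" by blast
    have "h ?x (v - e *s ?x) = 0" using xorth[OF e] .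
    moreover have "h ?x v = 0" using v(2) xW h.zero_sym by blast
    moreover have "h y (v - e *s y) = h y v - cnj e * h y y" for y
      using h.add_right[of y "v - e *s y" "e *s y"] by (simp add: h.scale_right)
    then have "h ?x (v - e *s ?x) = h ?x v - cnj e * h ?x ?x" .
    ultimately have "e = 0" using t(3) by simp
    then have vV: "v \<in> V m" using e by simp
    show "v = 0"
    proof (cases "m = 0")
      case True
      then show ?thesis using vV complete_flagsD(4)[OF V] by simp
    next
      case False
      then have "nondegenerate_on p q (V m)" using g(3)[of m] by (simp add: V_def)
      moreover have "\<forall>w\<in>V m. h v w = 0" using v(2) VW by blast
      ultimately show ?thesis using vV by (simp add: nondegenerate_on_def)
    qed
  qed
  moreover have "nondegenerate_on p q (act (gt t) std_flag k)" if "k \<in> {1..m}" for k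
    using same[of k] g(3)[OF that] that by (simp add: V_def)
  ultimately have "nondegenerate_on p q (act (gt t) std_flag k)" if "k \<in> {1..Suc m}" for k
    using that by (cases "k = Suc m") auto
  then show ?case using t by blast
qed

text \<open>An open orbit contains a nondegenerate flag, and the orbit of such a flag is determined
  by its signs.\<close>

lemma open_orbitsE:
  fixes D :: "'n flag set"
  assumes "D \<in> open_orbits p q"
  obtains \<alpha> where "length \<alpha> = p + q" "count_list \<alpha> Minus = q" "count_list \<alpha> Plus = p" "D = sign_orbit p q \<alpha>" "D \<noteq> {}"
proof -
  obtain V0 where V0: "D = orbit (SU p q) V0" "V0 \<in> complete_flags" and op: "openin flag_topology D"
    using assms by (auto simp: open_orbits_def)
  have "V0 \<in> D" unfolding V0 orbit_def using SU_one act_one by force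
  then obtain g where g: "invertible g" "act g std_flag \<in> D" "\<And>k. k \<in> {1..p + q} \<Longrightarrow> nondegenerate_on p q (act g std_flag k)"
    using open_contains_nondegenerate[OF op _ order_refl] by blast
  obtain \<alpha> A where A: "length \<alpha> = p + q" "invertible A" "sign_frame \<alpha> A" "act g std_flag = act A std_flag"
    by (rule sign_frame_of_flag[OF act_std_flag_complete[OF g(1)] g(3)])
  then have V: "act g std_flag \<in> sign_orbit p q \<alpha>" using sign_orbit_iff[OF A(1)] by blast
  have "D = orbit (SU p q) (act g std_flag)"
    using orbit_eqI[OF SU_mult SU_inv, of "act g std_flag" V0] g(2) V0(1) by blast
  then have "D = sign_orbit p q \<alpha>" using sign_orbit_eq_orbit[OF V A(1)] by simp
  then show ?thesis using that[OF A(1) sign_orbit_count[OF V A(1)]] \<open>V0 \<in> D\<close> by blast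
qed

subsection \<open>The base cycle\<close>

text \<open>The explicit form of the base cycle; \<open>base_cycle_eq\<close> identifies it with the
  orbit characterized by the complex structure.\<close>

definition cycle :: "sign list \<Rightarrow> 'n flag set" where
  "cycle \<alpha> = {V \<in> sign_orbit p q \<alpha>. \<forall>k. \<forall>v\<in>V k. Jmat q *v v \<in> V k}"

definition split_frame :: "sign list \<Rightarrow> 'n cmat \<Rightarrow> bool" where
  "split_frame \<alpha> A \<longleftrightarrow> conj_transpose A ** A = mat 1 \<and>
    (\<forall>a. Jmat q *v (A *v axis a 1) = of_real (sgn_of (\<alpha> ! (idx a - 1))) *s (A *v axis a 1))"

definition Dmat :: "sign list \<Rightarrow> 'n cmat" where
  "Dmat \<alpha> = (\<chi> i j. if i = j then of_real (sgn_of (\<alpha> ! (idx i - 1))) else 0)"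

lemma Dmat_mult: "Dmat \<alpha> *v x = (\<chi> i. of_real (sgn_of (\<alpha> ! (idx i - 1))) * x $ i)"
  by (simp add: Dmat_def matrix_vector_mult_def vec_eq_iff if_distrib[of "\<lambda>c. c * _"] cong: if_cong)

lemma Dmat_conj_transpose [simp]: "conj_transpose (Dmat \<alpha>) = Dmat \<alpha>"
  by (simp add: conj_transpose_def Dmat_def vec_eq_iff)

lemma eigenframe_iff: "(\<forall>a. Jmat q *v (A *v axis a 1) = of_real (sgn_of (\<alpha> ! (idx a - 1))) *s (A *v axis a 1)) \<longleftrightarrow>
    Jmat q ** A = A ** Dmat \<alpha>" for A :: "'n cmat"
proof -
  have "Dmat \<alpha> *v axis a 1 = of_real (sgn_of (\<alpha> ! (idx a - 1))) *s axis a 1" for a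
    by (simp add: Dmat_mult vec_eq_iff axis_def)
  then have *: "(A ** Dmat \<alpha>) *v axis a 1 = of_real (sgn_of (\<alpha> ! (idx a - 1))) *s (A *v axis a 1)" for a
    by (simp add: vector_scalar_commute flip: matrix_vector_mul_assoc)
  show ?thesis
  proof
    assume l: "\<forall>a. Jmat q *v (A *v axis a 1) = of_real (sgn_of (\<alpha> ! (idx a - 1))) *s (A *v axis a 1)"
    show "Jmat q ** A = A ** Dmat \<alpha>"
    proof (rule mat_eqI)
      fix i assume "1 \<le> i" "i \<le> CARD('n)"
      then show "(Jmat q ** A) *v e_vec i = (A ** Dmat \<alpha>) *v e_vec i"
        using l * by (simp add: e_vec_def flip: matrix_vector_mul_assoc)
    qed
  next
    assume "Jmat q ** A = A ** Dmat \<alpha>"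
    then show "\<forall>a. Jmat q *v (A *v axis a 1) = of_real (sgn_of (\<alpha> ! (idx a - 1))) *s (A *v axis a 1)"
      using * by (metis matrix_vector_mul_assoc)
  qed
qed

text \<open>On combinations of columns of sign \<open>s\<close> the form is \<open>sgn_of s\<close>
  times the inner product, and therefore definite.\<close>

lemma eigenframe_cycle:
  assumes A: "invertible A" "Jmat q ** A = A ** Dmat \<alpha>" and len: "length \<alpha> = p + q"
  shows "act A std_flag \<in> cycle \<alpha>"
proof -
  have J: "Jmat q *v (A *v c) = A *v (Dmat \<alpha> *v c)" for c
    by (simp add: matrix_vector_mul_assoc A(2))
  have "act A std_flag \<in> sign_orbit p q \<alpha>"
  proof (rule definite_frame_sign_orbit[OF A(1) len])
    fix c :: "'n cvec" and s assume c: "c \<noteq> 0" "\<And>a. c $ a \<noteq> 0 \<Longrightarrow> \<alpha> ! (idx a - 1) = s"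
    have "Dmat \<alpha> *v c = of_real (sgn_of s) *s c"
      using c(2) by (auto simp: Dmat_mult vec_eq_iff)
    then have "h (A *v c) (A *v c) = of_real (sgn_of s) * sip (A *v c) (A *v c)"
      by (simp add: h_eq J vector_scalar_commute sip.scale_left)
    moreover have "A *v c \<noteq> 0" using A(1) c(1) by (metis invertible_iff_inj)
    then have "Re (sip (A *v c) (A *v c)) > 0"
      using sip_self_nonneg[of "A *v c"] sip.self_real[of "A *v c"] sip_self_eq_0[of "A *v c"]
      by (auto simp: complex_eq_iff order.order_iff_strict)
    ultimately show "Re (h (A *v c) (A *v c)) * sgn_of s > 0" by (cases s) auto
  qed
  moreover have "Jmat q *v v \<in> act A std_flag k" if v: "v \<in> act A std_flag k" for v k
  proof -
    obtain c where c: "v = A *v c" "c \<in> std_flag k" using v by (auto simp: act_def)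
    then have "Dmat \<alpha> *v c \<in> std_flag k" by (simp add: Dmat_mult std_flag_eq)
    then show ?thesis by (auto simp: c(1) J act_def)
  qed
  ultimately show ?thesis by (simp add: cycle_def)
qed

lemma split_frame_cycle: "split_frame \<alpha> A \<Longrightarrow> length \<alpha> = p + q \<Longrightarrow> act A std_flag \<in> cycle \<alpha>"
  using eigenframe_cycle eigenframe_iff unitary_det unfolding split_frame_def by blast

text \<open>Orthonormalize a \<open>Jmat q\<close>-stable flag. Since \<open>Jmat q\<close> is
  self-adjoint, it preserves each step and the orthogonal complement of the preceding one, so every
  basis vector is an eigenvector. Its eigenvalue has to be the sign in \<alpha> because a flag
  determines its signs.\<close>

lemma cycle_split_frame:
  assumes V: "V \<in> cycle \<alpha>" and len: "length \<alpha> = p + q"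
  obtains A where "split_frame \<alpha> A" "V = act A std_flag"
proof -
  have Vc: "V \<in> complete_flags" and JV: "\<And>k v. v \<in> V k \<Longrightarrow> Jmat q *v v \<in> V k"
    using V by (auto simp: cycle_def sign_orbit_def)
  have "\<exists>y. \<forall>k. 1 \<le> k \<and> k \<le> CARD('n) \<longrightarrow> y k \<in> V k \<and> y k \<notin> V (k - 1) \<and>
    (sip (y k) (y k) = 1 \<or> sip (y k) (y k) = -1) \<and> (\<forall>v\<in>V (k - 1). sip (y k) v = 0)"
    by (intro sip.gram_schmidt[OF Vc order_refl]) auto
  then obtain y where y: "\<And>k. 1 \<le> k \<Longrightarrow> k \<le> CARD('n) \<Longrightarrow> y k \<in> V k \<and> y k \<notin> V (k - 1) \<and>
    (sip (y k) (y k) = 1 \<or> sip (y k) (y k) = -1) \<and> (\<forall>v\<in>V (k - 1). sip (y k) v = 0)"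
    by blast
  have y1: "sip (y k) (y k) = 1" if "1 \<le> k" "k \<le> CARD('n)" for k
    using y[OF that] sip_self_nonneg[of "y k"] by auto
  have eig: "Jmat q *v y k = y k \<or> Jmat q *v y k = - y k" if k: "1 \<le> k" "k \<le> CARD('n)" for k
  proof -
    have sp: "V j = vec.span (y ` {1..j})" if "j \<le> CARD('n)" for j
      by (rule adapted_span[OF Vc _ order_refl that]) (use y in auto)
    have "{1..k} = insert k {1..k - 1}" using k by auto
    then have "V k = vec.span (insert (y k) (y ` {1..k - 1}))" using sp[OF k(2)] by simp
    moreover have "Jmat q *v y k \<in> V k" using JV y[OF k] by blast
    ultimately obtain c where "Jmat q *v y k - c *s y k \<in> vec.span (y ` {1..k - 1})"
      unfolding vec.span_insert by blast
    then have u: "Jmat q *v y k - c *s y k \<in> V (k - 1)" using sp[of "k - 1"] k by simp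
    define u where "u = Jmat q *v y k - c *s y k"
    have uV: "u \<in> V (k - 1)" using u by (simp only: u_def)
    have "sip (Jmat q *v y k) u = 0" unfolding sip_Jmat using y[OF k] JV[OF uV] by blast
    moreover have "sip (y k) u = 0" using y[OF k] uV by blast
    ultimately have "sip u u = 0" unfolding u_def[symmetric] by (subst (1) u_def) (simp add: sip.diff_left sip.scale_left)
    then have Jc: "Jmat q *v y k = c *s y k" by (simp add: u_def)
    have "y k = Jmat q *v (Jmat q *v y k)" by simp
    also have "\<dots> = (c * c) *s y k" unfolding Jc vector_scalar_commute by (simp add: vector_smult_assoc)
    finally have "sip (y k) (y k) = (c * c) * sip (y k) (y k)" by (metis sip.scale_left)
    then have "c = 1 \<or> c = -1" using y1[OF k] by (simp add: square_eq_1_iff)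
    then show ?thesis unfolding Jc by (elim disjE) simp_all
  qed
  define \<beta> where "\<beta> = map (\<lambda>k. if Jmat q *v y (Suc k) = y (Suc k) then Plus else Minus) [0..<p + q]"
  have col: "colmat y *v axis a 1 = y (idx a)" for a :: 'n
    using colmat_e_vec[of "idx a" y] by simp
  have orth: "sip (y (idx a)) (y (idx b)) = 0" if "a < b" for a b :: 'n
  proof -
    have "idx a < idx b" using that by simp
    then have "idx a \<le> idx b - 1" by linarith
    then have "V (idx a) \<subseteq> V (idx b - 1)" by (intro monoD[OF complete_flagsD(1)[OF Vc]])
    then have "y (idx a) \<in> V (idx b - 1)" using y[of "idx a"] by auto
    then have "sip (y (idx b)) (y (idx a)) = 0" using y[of "idx b"] by simp
    then show ?thesis using sip.zero_sym by blast
  qed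
  have gram: "sip (y (idx a)) (y (idx b)) = (if a = b then 1 else 0)" for a b :: 'n
  proof (cases a b rule: linorder_cases)
    case less then show ?thesis using orth[OF less] by simp
  next
    case equal then show ?thesis using y1[of "idx a"] by simp
  next
    case greater then show ?thesis using orth[OF greater] sip.zero_sym[of "y (idx a)" "y (idx b)"] by simp
  qed
  have "conj_transpose (colmat y) ** colmat y = mat 1"
    by (rule unitary_colmat) (rule gram)
  moreover have "Jmat q *v (colmat y *v axis a 1) = of_real (sgn_of (\<beta> ! (idx a - 1))) *s (colmat y *v axis a 1)" for a :: 'n
  proof -
    have "idx a - 1 < p + q" "Suc (idx a - 1) = idx a"
      using idx_ge[of a] idx_le[of a] unfolding card_n by linarith+
    then have "\<beta> ! (idx a - 1) = (if Jmat q *v y (idx a) = y (idx a) then Plus else Minus)"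
      by (simp add: \<beta>_def del: One_nat_def)
    moreover have "Jmat q *v y (idx a) = y (idx a) \<or> Jmat q *v y (idx a) = - y (idx a)" by (intro eig) simp_all
    ultimately show ?thesis unfolding col by (cases "Jmat q *v y (idx a) = y (idx a)") simp_all
  qed
  ultimately have sf: "split_frame \<beta> (colmat y)" by (simp add: split_frame_def)
  moreover have Vy: "V = act (colmat y) std_flag" using flag_of_adapted_basis(2)[OF Vc, of y] y by auto
  moreover have "\<beta> = \<alpha>"
  proof -
    have lb: "length \<beta> = p + q" by (simp add: \<beta>_def)
    have "V \<in> cycle \<beta>" using split_frame_cycle[OF sf lb] Vy by simp
    then show ?thesis using V sign_orbit_unique[OF _ _ lb len] by (auto simp: cycle_def)
  qed
  ultimately show ?thesis using that by blast
qed

text \<open>The block shape rewritten as commutation with \<open>Jmat q\<close>, the only form in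
  which it is used from here on.\<close>

lemma K0_iff: "g \<in> K0 p q \<longleftrightarrow> det g = 1 \<and> conj_transpose g ** g = mat 1 \<and> Jmat q ** g = g ** Jmat q" for g :: "'n cmat"
proof -
  have "(\<forall>i\<in>{1..q}. \<forall>j\<in>{q + 1..p + q}. g $ coord i $ coord j = 0 \<and> g $ coord j $ coord i = 0) \<longleftrightarrow>
      (\<forall>a b. (idx a \<le> q) \<noteq> (idx b \<le> q) \<longrightarrow> g $ a $ b = 0)" (is "?L \<longleftrightarrow> ?R")
  proof
    assume L: ?L
    show ?R
    proof (intro allI impI)
      fix a b :: 'n assume ab: "(idx a \<le> q) \<noteq> (idx b \<le> q)"
      have r: "idx a \<in> {1..p + q}" "idx b \<in> {1..p + q}" using idx_range[where 'n='n] by (auto simp: card_n)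
      show "g $ a $ b = 0"
      proof (cases "idx a \<le> q")
        case True
        then show ?thesis using L[rule_format, of "idx a" "idx b"] ab r by auto
      next
        case False
        then show ?thesis using L[rule_format, of "idx b" "idx a"] ab r by auto
      qed
    qed
  next
    assume R: ?R
    show ?L
    proof (intro ballI)
      fix i j assume ij: "i \<in> {1..q}" "j \<in> {q + 1..p + q}"
      then have "idx (coord i :: 'n) = i" "idx (coord j :: 'n) = j" by (auto simp: idx_coord card_n)
      then show "g $ coord i $ coord j = 0 \<and> g $ coord j $ coord i = 0" using R ij by auto
    qed
  qed
  moreover have "Jmat q ** g = g ** Jmat q \<longleftrightarrow> ?R"
  proof -
    have "(Jmat q ** g) $ a $ b = (if idx a \<le> q then - g $ a $ b else g $ a $ b)" for a b
      by (simp add: matrix_matrix_mult_def Jmat_def if_distrib[of "\<lambda>c. c * _"] cong: if_cong)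
    moreover have "(g ** Jmat q) $ a $ b = (if idx b \<le> q then - g $ a $ b else g $ a $ b)" for a b
      by (simp add: matrix_matrix_mult_def Jmat_def if_distrib[of "\<lambda>c. _ * c"] cong: if_cong)
    ultimately show ?thesis by (auto simp: vec_eq_iff split: if_splits)
  qed
  ultimately show ?thesis by (simp add: K0_def)
qed

lemma K0_one: "mat 1 \<in> (K0 p q :: 'n cmat set)"
  by (simp add: K0_iff) (simp add: conj_transpose_def mat_def vec_eq_iff)

lemma K0_h: "g \<in> K0 p q \<Longrightarrow> h (g *v v) (g *v w) = h v w"
proof -
  assume g: "g \<in> K0 p q"
  then have "Jmat q ** g = g ** Jmat q" by (simp add: K0_iff)
  then have "Jmat q *v (g *v v) = g *v (Jmat q *v v)" by (metis matrix_vector_mul_assoc)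
  then show ?thesis using g by (simp add: h_eq K0_iff unitary_iff)
qed

lemma K0_stable:
  assumes g: "g \<in> (K0 p q :: 'n cmat set)" and V: "\<And>k v. v \<in> V k \<Longrightarrow> Jmat q *v v \<in> V k" and v: "v \<in> act g V k"
  shows "Jmat q *v v \<in> act g V k"
proof -
  obtain u where u: "v = g *v u" "u \<in> V k" using v by (auto simp: act_def)
  moreover have "Jmat q ** g = g ** Jmat q" using g by (simp add: K0_iff)
  ultimately have "Jmat q *v v = g *v (Jmat q *v u)" by (metis matrix_vector_mul_assoc)
  then show ?thesis using V[OF u(2)] by (auto simp: act_def)
qed

text \<open>The matrix taking one split frame to another is unitary and commutes with
  \<open>Jmat q\<close>, because it matches eigenvectors with equal eigenvalues; a scalar of modulus
  one corrects the determinant.\<close>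

lemma cycle_eq_orbit:
  assumes V: "V \<in> cycle \<alpha>" and len: "length \<alpha> = p + q"
  shows "cycle \<alpha> = orbit (K0 p q) V"
proof (intro equalityI subsetI)
  obtain A where A: "split_frame \<alpha> A" "V = act A std_flag" using cycle_split_frame[OF V len] .
  fix W assume "W \<in> cycle \<alpha>"
  then obtain A' where A': "split_frame \<alpha> A'" "W = act A' std_flag" using cycle_split_frame[OF _ len] by blast
  have inv: "invertible A" "invertible A'" using A A' unitary_det by (auto simp: split_frame_def)
  define g where "g = A' ** conj_transpose A"
  have AA: "conj_transpose A ** A = mat 1" "A ** conj_transpose A = mat 1"
    using A(1) matrix_left_right_inverse by (auto simp: split_frame_def)
  have g: "conj_transpose g ** g = mat 1"
  proof -
    have "conj_transpose g ** g = A ** (conj_transpose A' ** A') ** conj_transpose A"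
      by (simp add: g_def conj_transpose_mult matrix_mul_assoc)
    then show ?thesis using A' AA by (simp add: split_frame_def)
  qed
  have JA: "Jmat q ** A = A ** Dmat \<alpha>" "Jmat q ** A' = A' ** Dmat \<alpha>"
    using A A' eigenframe_iff by (auto simp: split_frame_def)
  have "conj_transpose A ** Jmat q = Dmat \<alpha> ** conj_transpose A"
    using arg_cong[OF JA(1), of conj_transpose] by (simp add: conj_transpose_mult)
  then have gJ: "Jmat q ** g = g ** Jmat q"
    by (simp add: g_def matrix_mul_assoc JA) (simp flip: matrix_mul_assoc)
  obtain c where c: "c \<noteq> 0" "det (mat c ** g) = 1" "cmod (det g) = 1 \<longrightarrow> cmod c = 1"
    using normalize_det[of g] unitary_det[OF g] by blast
  then have c1: "cnj c * c = 1" using unitary_det[OF g] by (simp add: mult.commute[of "cnj c"] flip: complex_norm_square)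
  have comm: "mat c ** X = X ** mat c" for X :: "'n cmat"
    by (simp add: matrix_eq mat_mult_vec vector_scalar_commute flip: matrix_vector_mul_assoc)
  have "mat c ** g \<in> K0 p q"
    unfolding K0_iff unitary_iff
  proof (intro conjI allI c(2))
    show "sip ((mat c ** g) *v v) ((mat c ** g) *v w) = sip v w" for v w
      using g c1 unfolding unitary_iff
      by (simp add: mat_mult_vec sip.scale_left sip.scale_right flip: matrix_vector_mul_assoc)
    show "Jmat q ** (mat c ** g) = mat c ** g ** Jmat q"
      using gJ comm by (metis matrix_mul_assoc)
  qed
  moreover have "act (mat c ** g) V = W"
  proof -
    have "act g V = W" unfolding A(2) A'(2) by (simp add: g_def AA flip: act_mult matrix_mul_assoc)
    then show ?thesis using A' inv c by (simp add: act_mult act_mat)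
  qed
  ultimately show "W \<in> orbit (K0 p q) V" by (auto simp: orbit_def)
next
  fix W assume "W \<in> orbit (K0 p q) V"
  then obtain g where g: "g \<in> K0 p q" "W = act g V" by (auto simp: orbit_def)
  have "W \<in> sign_orbit p q \<alpha>"
    unfolding g(2) using V by (intro isometry_sign_orbit[OF K0_h[OF g(1)] _ len]) (auto simp: cycle_def)
  moreover have "Jmat q *v v \<in> W k" if "v \<in> W k" for v k
    using K0_stable[OF g(1), of V v k] V that unfolding g(2) by (auto simp: cycle_def)
  ultimately show "W \<in> cycle \<alpha>" by (auto simp: cycle_def)
qed

text \<open>In the chart centred at a split frame the stable flags are those whose coordinate
  \<open>Y\<close> commutes with \<open>Dmat \<alpha>\<close>, that is, whose entries between
  different signs vanish. This is again a coordinate subspace.\<close>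

lemma complex_submanifold_cycle:
  assumes len: "length \<alpha> = p + q"
  shows "complex_submanifold (card {(i, j :: 'n). j < i \<and> \<alpha> ! (idx i - 1) = \<alpha> ! (idx j - 1)}) (cycle \<alpha>)"
  unfolding complex_submanifold_def
proof (intro conjI ballI)
  let ?S = "{(i, j :: 'n). j < i \<and> \<alpha> ! (idx i - 1) = \<alpha> ! (idx j - 1)}"
  show "cycle \<alpha> \<subseteq> complete_flags" by (auto simp: cycle_def sign_orbit_def)
  fix V assume "V \<in> cycle \<alpha>"
  then obtain A where A: "split_frame \<alpha> A" "V = act A std_flag" using cycle_split_frame[OF _ len] by blast
  have inv: "invertible A" using A unitary_det by (auto simp: split_frame_def)
  have JA: "Jmat q ** A = A ** Dmat \<alpha>" using A eigenframe_iff by (auto simp: split_frame_def)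
  have JAv: "Jmat q *v (A *v c) = A *v (Dmat \<alpha> *v c)" for c using JA by (simp add: matrix_vector_mul_assoc)
  have "{Y \<in> strictly_lower. flag_chart A Y \<in> cycle \<alpha>} = {Y. \<forall>i j. (i, j) \<notin> ?S \<longrightarrow> Y $ i $ j = 0}"
  proof (intro equalityI subsetI CollectI conjI allI impI)
    fix Y :: "'n cmat" and i j assume "Y \<in> {Y \<in> strictly_lower. flag_chart A Y \<in> cycle \<alpha>}" and ij: "(i, j) \<notin> ?S"
    then have Y: "Y \<in> strictly_lower" "flag_chart A Y \<in> cycle \<alpha>" by auto
    show "Y $ i $ j = 0"
    proof (cases "j < i")
      case True
      let ?s = "\<lambda>i. complex_of_real (sgn_of (\<alpha> ! (idx i - 1)))"
      define v where "v = (mat 1 + Y) *v axis j 1"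
      have vE: "A *v v \<in> flag_chart A Y (idx j)"
        unfolding v_def flag_chart_def act_def
      proof (rule image_eqI)
        show "axis j 1 \<in> (std_flag (idx j) :: 'n cvec set)" by (simp add: std_flag_eq axis_def)
      qed (simp only: matrix_vector_mul_assoc)
      then have "Jmat q *v (A *v v) \<in> flag_chart A Y (idx j)" using Y(2) by (auto simp: cycle_def)
      \<comment> \<open>Subtracting the eigenvalue of column \<open>j\<close> leaves a vector of the
        step \<open>idx j\<close> whose frame coordinates up to \<open>j\<close> vanish. Forward
        substitution shows that it is zero, and its entry at \<open>i\<close> is the difference of
        the two signs times \<open>Y $ i $ j\<close>.\<close>
      then have "A *v (Dmat \<alpha> *v v) - ?s j *s (A *v v) \<in> flag_chart A Y (idx j)"
        using vE Y(2) complete_flagsD(2)[of "flag_chart A Y" "idx j"]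
        by (intro vec.subspace_diff vec.subspace_scale) (auto simp: JAv cycle_def sign_orbit_def)
      then have "A *v (Dmat \<alpha> *v v - ?s j *s v) \<in> flag_chart A Y (idx j)"
        by (simp add: matrix_vector_mult_diff_distrib vector_scalar_commute)
      then obtain c where c: "c \<in> std_flag (idx j)" "Dmat \<alpha> *v v - ?s j *s v = (mat 1 + Y) *v c"
        unfolding flag_chart_def act_def using invertible_inj[OF inv]
        by (auto simp flip: matrix_vector_mul_assoc dest: injD)
      have vm: "v $ m = axis j 1 $ m + Y $ m $ j" for m
        by (simp add: v_def matrix_vector_mult_add_rdistrib mult_axis column_def) (simp add: mat_def axis_def)
      have D0: "(Dmat \<alpha> *v v - ?s j *s v) $ m = 0" if "m \<le> j" for m
        using that Y(1) by (cases "m = j") (auto simp: Dmat_mult vm axis_def strictly_lower_def algebra_simps)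
      have c0: "c $ m + (\<Sum>l | l < m. Y $ m $ l * c $ l) = 0" if "m \<le> j" for m
        using D0[OF that] unfolding c(2) strictly_lower_mult[OF Y(1)] .
      have "c $ m = 0" if "m \<le> j" for m
        using that
      proof (induction m rule: less_induct)
        case (less m)
        then have "(\<Sum>l | l < m. Y $ m $ l * c $ l) = 0" by (intro sum.neutral) auto
        then show ?case using c0[OF less.prems] by simp
      qed
      moreover have "c $ m = 0" if "j < m" for m using c(1) that by (simp add: std_flag_eq)
      ultimately have "c = 0" by (auto simp: vec_eq_iff) (meson not_less)
      then have "(Dmat \<alpha> *v v - ?s j *s v) $ i = 0" using c(2) by simp
      moreover have "i \<noteq> j" using True by simp
      ultimately have "(?s i - ?s j) * Y $ i $ j = 0" by (simp add: Dmat_mult vm axis_def algebra_simps)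
      moreover have "?s i - ?s j \<noteq> 0" using ij True by (auto simp: sgn_of_def split: sign.splits)
      ultimately show ?thesis by simp
    qed (use Y(1) in \<open>auto simp: strictly_lower_def not_less\<close>)
  next
    fix Y :: "'n cmat" assume Y: "Y \<in> {Y. \<forall>i j. (i, j) \<notin> ?S \<longrightarrow> Y $ i $ j = 0}"
    then show lower: "Y \<in> strictly_lower" by (auto simp: strictly_lower_def dest: leD)
    have "Dmat \<alpha> ** Y = Y ** Dmat \<alpha>"
    proof -
      have "(Dmat \<alpha> ** Y) $ i $ j = (Y ** Dmat \<alpha>) $ i $ j" for i j
      proof -
        have "(Dmat \<alpha> ** Y) $ i $ j = of_real (sgn_of (\<alpha> ! (idx i - 1))) * Y $ i $ j"
          by (simp add: matrix_matrix_mult_def Dmat_def if_distrib[of "\<lambda>c. c * _"] cong: if_cong)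
        moreover have "(Y ** Dmat \<alpha>) $ i $ j = Y $ i $ j * of_real (sgn_of (\<alpha> ! (idx j - 1)))"
          by (simp add: matrix_matrix_mult_def Dmat_def if_distrib[of "\<lambda>c. _ * c"] cong: if_cong)
        moreover have "\<alpha> ! (idx i - 1) = \<alpha> ! (idx j - 1) \<or> Y $ i $ j = 0" using Y by auto
        ultimately show ?thesis by auto
      qed
      then show ?thesis by (simp add: vec_eq_iff)
    qed
    then have "Dmat \<alpha> ** (mat 1 + Y) = (mat 1 + Y) ** Dmat \<alpha>"
      by (metis (no_types, lifting) matrix_add_ldistrib matrix_eq matrix_mul_lid matrix_mul_rid
          matrix_vector_mul_assoc matrix_vector_mult_add_rdistrib)
    then have "Jmat q ** (A ** (mat 1 + Y)) = (A ** (mat 1 + Y)) ** Dmat \<alpha>"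
      by (simp add: matrix_mul_assoc JA) (simp flip: matrix_mul_assoc)
    then show "flag_chart A Y \<in> cycle \<alpha>"
      unfolding flag_chart_def using inv invertible_unipotent[OF lower]
      by (intro eigenframe_cycle[OF _ _ len]) (auto simp: invertible_mult)
  qed
  then have "matrix_submanifold_at (card ?S) {Y \<in> strictly_lower. flag_chart A Y \<in> cycle \<alpha>} 0"
    using matrix_submanifold_at_pattern[of ?S 0] by simp
  moreover have "(0 :: 'n cmat) \<in> strictly_lower" "flag_chart A 0 = V"
    using A by (auto simp: strictly_lower_def flag_chart_def)
  ultimately show "\<exists>g X. invertible g \<and> X \<in> strictly_lower \<and> flag_chart g X = V \<and>
      matrix_submanifold_at (card ?S) {Y \<in> strictly_lower. flag_chart g Y \<in> cycle \<alpha>} X"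
    using inv by blast
qed

end

subsection \<open>The combinatorics of the algorithm\<close>

lemma inv_on_shift: "inv_on {1..n} (\<lambda>k. f (k - 1)) = inv_on {..<n} f"
  unfolding inv_on_def
  by (rule bij_betw_same_card, rule bij_betw_byWitness[of _ "\<lambda>(s, t). (Suc s, Suc t)" "\<lambda>(s, t). (s - 1, t - 1)"]) auto

text \<open>The place \<open>l\<close> has the largest value and \<open>r\<close> the smallest. A
  further place is inverted with \<open>l\<close> if it lies to the right of \<open>l\<close>, and
  with \<open>r\<close> if it lies to the left of \<open>r\<close>; a place between them counts
  twice. The pair itself contributes one, hence \<open>card R - 1\<close>.\<close>

lemma inv_on_remove_pair:
  assumes "finite R" "l \<in> R" "r \<in> R" "l < r" "f r < f l"
    and mid: "\<And>t. t \<in> R - {l, r} \<Longrightarrow> f r < f t \<and> f t < f l"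
  shows "inv_on R f = inv_on (R - {l, r}) f + (card R - 1) + card {t \<in> R. l < t \<and> t < r}"
proof -
  let ?I = "\<lambda>R. {(s, t). s \<in> R \<and> t \<in> R \<and> s < t \<and> f s > f t}"
  let ?A = "{t \<in> R. l < t}" and ?B = "{t \<in> R - {l}. t < r}"
  have *: "f r < f t \<or> t = r" "f t < f l \<or> t = l" if "t \<in> R" for t using mid[of t] that assms by auto
  have "?I R = ?I (R - {l, r}) \<union> (Pair l ` ?A \<union> (\<lambda>t. (t, r)) ` ?B)"
    using assms(2-5) * by (fastforce simp: image_iff)
  moreover have "?I (R - {l, r}) \<inter> (Pair l ` ?A \<union> (\<lambda>t. (t, r)) ` ?B) = {}" by auto
  moreover have "finite (?I (R - {l, r}))" using assms(1) by (intro inv_on_finite) simp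
  moreover have "finite (Pair l ` ?A \<union> (\<lambda>t. (t, r)) ` ?B)" using assms(1) by simp
  ultimately have "card (?I R) = card (?I (R - {l, r})) + card (Pair l ` ?A \<union> (\<lambda>t. (t, r)) ` ?B)"
    by (metis (no_types, lifting) card_Un_disjoint)
  also have "card (Pair l ` ?A \<union> (\<lambda>t. (t, r)) ` ?B) = card (Pair l ` ?A) + card ((\<lambda>t. (t, r)) ` ?B)"
    using assms(1) by (intro card_Un_disjoint) auto
  also have "\<dots> = card ?A + card ?B" by (simp add: card_image inj_on_def)
  also have "\<dots> = card (?A \<union> ?B) + card (?A \<inter> ?B)" using assms(1) by (intro card_Un_Int) auto
  also have "?A \<union> ?B = R - {l}" using assms(4) by auto
  also have "?A \<inter> ?B = {t \<in> R. l < t \<and> t < r}" by auto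
  also have "card (R - {l}) = card R - 1" using assms by simp
  finally show ?thesis by (simp add: inv_on_def)
qed

definition free :: "nat \<Rightarrow> (nat \<Rightarrow> nat) \<Rightarrow> (nat \<Rightarrow> nat) \<Rightarrow> nat \<Rightarrow> nat set" where
  "free n l r j = {..<n} - (\<Union>i\<in>{1..<j}. {l i, r i})"

lemma free_finite [simp]: "finite (free n l r j)"
  by (simp add: free_def)

lemma free_1 [simp]: "free n l r (Suc 0) = {..<n}"
  by (simp add: free_def)

lemma free_Suc: "1 \<le> j \<Longrightarrow> free n l r (Suc j) = free n l r j - {l j, r j}"
  by (auto simp: free_def atLeastLessThanSuc)

lemma free_cong: "(\<And>i. 1 \<le> i \<Longrightarrow> i < j \<Longrightarrow> l i = l' i \<and> r i = r' i) \<Longrightarrow> free n l r j = free n l' r' j"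
  by (auto simp: free_def)

lemma free_avoid:
  assumes "s \<in> free n l r j" "1 \<le> i" "i < j"
  shows "s \<noteq> l i" "s \<noteq> r i"
proof -
  have "i \<in> {1..<j}" using assms by simp
  then show "s \<noteq> l i" "s \<noteq> r i" using assms(1) unfolding free_def by blast+
qed

lemma not_freeE:
  assumes "s < n" "s \<notin> free n l r j"
  obtains i where "1 \<le> i" "i < j" "s = l i \<or> s = r i"
  using assms by (auto simp: free_def)

locale pairing =
  fixes n m :: nat and l r :: "nat \<Rightarrow> nat"
  assumes lr: "\<And>j. 1 \<le> j \<Longrightarrow> j \<le> m \<Longrightarrow> l j < r j \<and> l j \<in> free n l r j \<and> r j \<in> free n l r j"
begin

lemma lt: "1 \<le> j \<Longrightarrow> j \<le> m \<Longrightarrow> l j < n \<and> r j < n"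
  using lr[of j] by (auto simp: free_def)

lemma card_free: "j \<le> m \<Longrightarrow> card (free n l r (Suc j)) + 2 * j = n"
proof (induction j)
  case (Suc j)
  have "card (free n l r (Suc j) - {l (Suc j), r (Suc j)}) = card (free n l r (Suc j)) - card {l (Suc j), r (Suc j)}"
    using lr[of "Suc j"] Suc.prems by (intro card_Diff_subset) auto
  moreover have "card {l (Suc j), r (Suc j)} = 2" using lr[of "Suc j"] Suc.prems by simp
  moreover have "card {l (Suc j), r (Suc j)} \<le> card (free n l r (Suc j))"
    using lr[of "Suc j"] Suc.prems by (intro card_mono) auto
  ultimately show ?case using Suc free_Suc[of "Suc j" n l r] by simp
qed simp

text \<open>The pairs are peeled off in order. Before step \<open>j\<close> there are
  \<open>n + 2 - 2 * j\<close> places, so each pair contributes \<open>n + 1 - 2 * j\<close>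
  inversions besides the free places between its members, and these constants sum to
  \<open>m * (n - m)\<close>.\<close>

lemma inv_on_pairing:
  assumes f: "\<And>j. 1 \<le> j \<Longrightarrow> j \<le> m \<Longrightarrow> f (l j) = n + 1 - j \<and> f (r j) = j"
    and mid: "\<And>t. t \<in> free n l r (Suc m) \<Longrightarrow> m < f t \<and> f t + m \<le> n" and m: "2 * m \<le> n"
  shows "inv_on {..<n} f = m * (n - m) + (\<Sum>j=1..m. card {t \<in> free n l r j. l j < t \<and> t < r j}) +
    inv_on (free n l r (Suc m)) f"
proof -
  \<comment> \<open>Values at places still free at step \<open>i\<close> lie between
    \<open>i\<close> and \<open>n + 1 - i\<close>; so \<open>l i\<close> and \<open>r i\<close>
    carry the extreme values there, as \<open>inv_on_remove_pair\<close> demands.\<close>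
  have range: "i \<le> f t \<and> f t + i \<le> n + 1" if "t \<in> free n l r i" "1 \<le> i" "i \<le> Suc m" for t i
  proof (cases "t \<in> free n l r (Suc m)")
    case True
    then show ?thesis using mid[OF True] that by auto
  next
    case False
    have "t < n" using that by (auto simp: free_def)
    then obtain k where k: "1 \<le> k" "k < Suc m" "t = l k \<or> t = r k" using not_freeE[OF _ False] by blast
    then have "i \<le> k" using free_avoid[OF that(1), of k] by (cases "k < i") auto
    then show ?thesis using f[of k] k m by auto
  qed
  have "inv_on {..<n} f = (\<Sum>j=1..k. n + 1 - 2 * j + card {t \<in> free n l r j. l j < t \<and> t < r j}) +
      inv_on (free n l r (Suc k)) f" if "k \<le> m" for k
    using that
  proof (induction k)
    case (Suc k)
    let ?j = "Suc k"
    have fj: "f (l ?j) = n + 1 - ?j" "f (r ?j) = ?j" using f[of ?j] Suc.prems by auto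
    have "inv_on (free n l r ?j) f = inv_on (free n l r ?j - {l ?j, r ?j}) f + (card (free n l r ?j) - 1) +
        card {t \<in> free n l r ?j. l ?j < t \<and> t < r ?j}"
    proof (rule inv_on_remove_pair)
      fix t assume t: "t \<in> free n l r ?j - {l ?j, r ?j}"
      then have "t \<in> free n l r (Suc ?j)" using free_Suc[of ?j n l r] by auto
      then have "Suc ?j \<le> f t \<and> f t + Suc ?j \<le> n + 1" using Suc.prems by (intro range) auto
      then show "f (r ?j) < f t \<and> f t < f (l ?j)" unfolding fj by auto
    qed (use lr[of ?j] Suc.prems fj m in auto)
    moreover have "card (free n l r ?j) - 1 = n + 1 - 2 * ?j" using card_free[of k] Suc.prems m by simp
    ultimately show ?case using Suc free_Suc[of ?j n l r] by simp
  qed simp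
  from this[OF order_refl] show ?thesis
  proof -
    have "(\<Sum>j=1..k. n + 1 - 2 * j) = k * (n - k)" if "k \<le> m" for k
      using that
    proof (induction k)
      case (Suc k)
      obtain d where d: "n = 2 * Suc k + d" using Suc.prems m by (metis le_Suc_ex mult_le_mono2 order_trans)
      have "(\<Sum>j=1..k. n + 1 - 2 * j) = k * (n - k)" using Suc by simp
      moreover have "k * (n - k) + (n + 1 - 2 * Suc k) = Suc k * (n - Suc k)" by (simp add: d algebra_simps)
      ultimately show ?case by simp
    qed simp
    then show ?thesis
      using \<open>inv_on {..<n} f = (\<Sum>j=1..m. n + 1 - 2 * j + card {t \<in> free n l r j. l j < t \<and> t < r j}) + inv_on (free n l r (Suc m)) f\<close>
      by (simp add: sum.distrib)
  qed
qed

end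

section \<open>Runs of the algorithm as pairings of places\<close>

lemma fill_signs_length [simp]: "length (fill_signs m xs) = length xs"
  by (induction m xs rule: fill_signs.induct) auto

lemma fill_signs_nth:
  "s < length xs \<Longrightarrow> fill_signs m xs ! s = (case xs ! s of Inl _ \<Rightarrow> m + card {t. t < s \<and> isl (xs ! t)} | Inr k \<Rightarrow> k)"
proof (induction m xs arbitrary: s rule: fill_signs.induct)
  case (2 m a xs)
  show ?case
  proof (cases s)
    case (Suc s')
    have "{t. t < Suc s' \<and> isl ((Inl a # xs) ! t)} = insert 0 (Suc ` {t. t < s' \<and> isl (xs ! t)})"
      by (auto simp: image_iff less_Suc_eq_0_disj)
    then have "card {t. t < Suc s' \<and> isl ((Inl a # xs) ! t)} = Suc (card {t. t < s' \<and> isl (xs ! t)})"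
      by (simp add: card_image)
    then show ?thesis using 2 Suc by (auto split: sum.splits)
  qed simp
next
  case (3 m i xs)
  show ?case
  proof (cases s)
    case (Suc s')
    have "{t. t < Suc s' \<and> isl ((Inr i # xs) ! t)} = Suc ` {t. t < s' \<and> isl (xs ! t)}"
      by (auto simp: image_iff less_Suc_eq_0_disj)
    then have "card {t. t < Suc s' \<and> isl ((Inr i # xs) ! t)} = card {t. t < s' \<and> isl (xs ! t)}"
      by (simp add: card_image)
    then show ?thesis using 3 Suc by (auto split: sum.splits)
  qed simp
qed simp

definition paired_number :: "nat \<Rightarrow> sign \<Rightarrow> nat \<Rightarrow> nat" where
  "paired_number q s j = (if s = Minus then j else 2 * q + 1 - j)"

text \<open>The invariant after \<open>i\<close> steps, with the history of the run recorded in
  \<open>l\<close> and \<open>r\<close>. Keeping the history makes it equivalent to the existence of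
  a run, so the inductive predicate can be replaced by statements about places.\<close>

definition pairing_state ::
  "nat \<Rightarrow> nat \<Rightarrow> sign list \<Rightarrow> nat \<Rightarrow> (nat \<Rightarrow> nat) \<Rightarrow> (nat \<Rightarrow> nat) \<Rightarrow> (sign + nat) list \<Rightarrow> (sign + nat) list \<Rightarrow> bool" where
  "pairing_state p q \<alpha> i l r e w \<longleftrightarrow> length e = p + q \<and> length w = p + q \<and>
    (\<forall>j. 1 \<le> j \<and> j \<le> i \<longrightarrow> l j < r j \<and> l j \<in> free (p + q) l r j \<and> r j \<in> free (p + q) l r j \<and>
      (\<forall>t\<in>free (p + q) l r j. \<not> (l j < t \<and> t < r j)) \<and> \<alpha> ! l j \<noteq> \<alpha> ! r j \<and>
      e ! l j = Inr (paired_number q (\<alpha> ! l j) j) \<and> e ! r j = Inr (paired_number q (\<alpha> ! r j) j) \<and>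
      w ! l j = Inr (p + q + 1 - j) \<and> w ! r j = Inr j) \<and>
    (\<forall>s\<in>free (p + q) l r (Suc i). e ! s = Inl (\<alpha> ! s) \<and> w ! s = Inl (\<alpha> ! s))"

lemma pairing_state_pairing: "pairing_state p q \<alpha> i l r e w \<Longrightarrow> pairing (p + q) i l r"
  by (auto simp: pairing_state_def pairing_def)

lemma pairing_state_isl:
  assumes "pairing_state p q \<alpha> i l r e w" "s < p + q"
  shows "isl (e ! s) \<longleftrightarrow> s \<in> free (p + q) l r (Suc i)" "isl (w ! s) \<longleftrightarrow> s \<in> free (p + q) l r (Suc i)"
proof -
  have "(isl (e ! s) \<longleftrightarrow> s \<in> free (p + q) l r (Suc i)) \<and> (isl (w ! s) \<longleftrightarrow> s \<in> free (p + q) l r (Suc i))"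
  proof (cases "s \<in> free (p + q) l r (Suc i)")
    case True
    then show ?thesis using assms by (auto simp: pairing_state_def)
  next
    case False
    then obtain k where "1 \<le> k" "k < Suc i" "s = l k \<or> s = r k" using not_freeE[OF assms(2)] by blast
    then show ?thesis using assms False by (auto simp: pairing_state_def)
  qed
  then show "isl (e ! s) \<longleftrightarrow> s \<in> free (p + q) l r (Suc i)" "isl (w ! s) \<longleftrightarrow> s \<in> free (p + q) l r (Suc i)" by auto
qed

lemma pairing_state_extend:
  assumes st: "pairing_state p q \<alpha> i l r e w"
    and jk: "j < k" "j \<in> free (p + q) l r (Suc i)" "k \<in> free (p + q) l r (Suc i)"
      "\<forall>t\<in>free (p + q) l r (Suc i). \<not> (j < t \<and> t < k)" "\<alpha> ! j \<noteq> \<alpha> ! k"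
  shows "pairing_state p q \<alpha> (Suc i) (l(Suc i := j)) (r(Suc i := k))
    (e[j := Inr (paired_number q (\<alpha> ! j) (Suc i)), k := Inr (paired_number q (\<alpha> ! k) (Suc i))])
    (w[j := Inr (p + q + 1 - Suc i), k := Inr (Suc i)])"
proof -
  let ?l = "l(Suc i := j)" and ?r = "r(Suc i := k)"
  have fr: "free (p + q) ?l ?r m = free (p + q) l r m" if "m \<le> Suc i" for m
    using that by (intro free_cong) auto
  have fS: "free (p + q) ?l ?r (Suc (Suc i)) = free (p + q) l r (Suc i) - {j, k}"
    using free_Suc[of "Suc i" "p + q" ?l ?r] fr[of "Suc i"] by simp
  have jkn: "j < p + q" "k < p + q" using jk by (auto simp: free_def)
  have len: "length e = p + q" "length w = p + q" using st by (auto simp: pairing_state_def)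
  have other: "l m \<noteq> j" "l m \<noteq> k" "r m \<noteq> j" "r m \<noteq> k" if "1 \<le> m" "m \<le> i" for m
    using free_avoid[OF jk(2), of m] free_avoid[OF jk(3), of m] that by auto
  show ?thesis
    unfolding pairing_state_def
  proof (intro conjI allI impI ballI)
    fix m assume m: "1 \<le> m \<and> m \<le> Suc i"
    show "?l m < ?r m" "?l m \<in> free (p + q) ?l ?r m" "?r m \<in> free (p + q) ?l ?r m" "\<alpha> ! ?l m \<noteq> \<alpha> ! ?r m"
      "e[j := Inr (paired_number q (\<alpha> ! j) (Suc i)), k := Inr (paired_number q (\<alpha> ! k) (Suc i))] ! ?l m =
        Inr (paired_number q (\<alpha> ! ?l m) m)"
      "e[j := Inr (paired_number q (\<alpha> ! j) (Suc i)), k := Inr (paired_number q (\<alpha> ! k) (Suc i))] ! ?r m =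
        Inr (paired_number q (\<alpha> ! ?r m) m)"
      "w[j := Inr (p + q + 1 - Suc i), k := Inr (Suc i)] ! ?l m = Inr (p + q + 1 - m)"
      "w[j := Inr (p + q + 1 - Suc i), k := Inr (Suc i)] ! ?r m = Inr m"
      using m st jk jkn len other[of m] fr[of m]
      by (cases "m = Suc i"; simp add: pairing_state_def nth_list_update)+
    fix t assume "t \<in> free (p + q) ?l ?r m"
    then show "\<not> (?l m < t \<and> t < ?r m)"
      using m st jk fr[of m] by (cases "m = Suc i") (auto simp: pairing_state_def)
  next
    fix s assume s: "s \<in> free (p + q) ?l ?r (Suc (Suc i))"
    then show "e[j := Inr (paired_number q (\<alpha> ! j) (Suc i)), k := Inr (paired_number q (\<alpha> ! k) (Suc i))] ! s = Inl (\<alpha> ! s)"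
      "w[j := Inr (p + q + 1 - Suc i), k := Inr (Suc i)] ! s = Inl (\<alpha> ! s)"
      using st by (auto simp: fS pairing_state_def nth_list_update)
  qed (simp_all add: len)
qed

lemma sign_neq_iff: "s \<noteq> t \<longleftrightarrow> s = Minus \<and> t = Plus \<or> s = Plus \<and> t = Minus" for s t :: sign
  by (cases s; cases t) auto

lemma adjacent_signs_free:
  assumes st: "pairing_state p q \<alpha> i l r e w" and adj: "adjacent_signs e j k"
  shows "j < k" "j \<in> free (p + q) l r (Suc i)" "k \<in> free (p + q) l r (Suc i)"
    "\<forall>t\<in>free (p + q) l r (Suc i). \<not> (j < t \<and> t < k)" "e ! j = Inl (\<alpha> ! j)" "e ! k = Inl (\<alpha> ! k)"
proof -
  have len: "length e = p + q" using st by (simp add: pairing_state_def)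
  have jk: "j < p + q" "k < p + q" "j < k" "isl (e ! j)" "isl (e ! k)" "\<And>t. j < t \<Longrightarrow> t < k \<Longrightarrow> \<not> isl (e ! t)"
    using adj unfolding adjacent_signs_def len by auto
  show "j < k" by fact
  show fr: "j \<in> free (p + q) l r (Suc i)" "k \<in> free (p + q) l r (Suc i)"
    using jk pairing_state_isl(1)[OF st] by blast+
  show "\<forall>t\<in>free (p + q) l r (Suc i). \<not> (j < t \<and> t < k)"
    using jk pairing_state_isl(1)[OF st] by (metis order.strict_trans)
  show "e ! j = Inl (\<alpha> ! j)" "e ! k = Inl (\<alpha> ! k)" using st fr unfolding pairing_state_def by blast+
qed

lemma algorithm_steps_imp_state:
  assumes "algorithm_steps p q \<alpha> i e w" "length \<alpha> = p + q"
  shows "i \<le> q \<and> (\<exists>l r. pairing_state p q \<alpha> i l r e w)"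
  using assms(1)
proof induction
  case start
  have "pairing_state p q \<alpha> 0 l r (map Inl \<alpha>) (map Inl \<alpha>)" for l r
    using assms(2) by (auto simp: pairing_state_def)
  then show ?case by blast
next
  case (minus_plus i e w j k)
  then obtain l r where st: "pairing_state p q \<alpha> (i - 1) l r e w" by blast
  have i: "Suc (i - 1) = i" using minus_plus.hyps by simp
  note adj = adjacent_signs_free[OF st \<open>adjacent_signs e j k\<close>]
  have sg: "\<alpha> ! j = Minus" "\<alpha> ! k = Plus" using adj(5,6) minus_plus.hyps by auto
  have "pairing_state p q \<alpha> (Suc (i - 1)) (l(Suc (i - 1) := j)) (r(Suc (i - 1) := k))
     (e[j := Inr (paired_number q (\<alpha> ! j) (Suc (i - 1))), k := Inr (paired_number q (\<alpha> ! k) (Suc (i - 1)))])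
     (w[j := Inr (p + q + 1 - Suc (i - 1)), k := Inr (Suc (i - 1))])"
    by (intro pairing_state_extend[OF st adj(1-4)]) (simp add: sg)
  then have "pairing_state p q \<alpha> i (l(i := j)) (r(i := k))
     (e[j := Inr (paired_number q Minus i), k := Inr (paired_number q Plus i)]) (w[j := Inr (p + q + 1 - i), k := Inr i])"
    by (simp only: sg i)
  moreover have "2 * q + 1 - i = 2 * q - i + 1" "p + q + 1 - i = p + q - i + 1" using minus_plus.hyps by auto
  ultimately have "pairing_state p q \<alpha> i (l(i := j)) (r(i := k))
     (e[j := Inr (i), k := Inr (2 * q - i + 1)]) (w[j := Inr (p + q - i + 1), k := Inr i])"
    by (simp only: paired_number_def sign.distinct if_True if_False refl)
  then show ?case using minus_plus.hyps by blast
next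
  case (plus_minus i e w j k)
  then obtain l r where st: "pairing_state p q \<alpha> (i - 1) l r e w" by blast
  have i: "Suc (i - 1) = i" using plus_minus.hyps by simp
  note adj = adjacent_signs_free[OF st \<open>adjacent_signs e j k\<close>]
  have sg: "\<alpha> ! j = Plus" "\<alpha> ! k = Minus" using adj(5,6) plus_minus.hyps by auto
  have "pairing_state p q \<alpha> (Suc (i - 1)) (l(Suc (i - 1) := j)) (r(Suc (i - 1) := k))
     (e[j := Inr (paired_number q (\<alpha> ! j) (Suc (i - 1))), k := Inr (paired_number q (\<alpha> ! k) (Suc (i - 1)))])
     (w[j := Inr (p + q + 1 - Suc (i - 1)), k := Inr (Suc (i - 1))])"
    by (intro pairing_state_extend[OF st adj(1-4)]) (simp add: sg)
  then have "pairing_state p q \<alpha> i (l(i := j)) (r(i := k))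
     (e[j := Inr (paired_number q Plus i), k := Inr (paired_number q Minus i)]) (w[j := Inr (p + q + 1 - i), k := Inr i])"
    by (simp only: sg i)
  moreover have "2 * q + 1 - i = 2 * q - i + 1" "p + q + 1 - i = p + q - i + 1" using plus_minus.hyps by auto
  ultimately have "pairing_state p q \<alpha> i (l(i := j)) (r(i := k))
     (e[j := Inr (2 * q - i + 1), k := Inr (i)]) (w[j := Inr (p + q - i + 1), k := Inr i])"
    by (simp only: paired_number_def sign.distinct if_True if_False refl)
  then show ?case using plus_minus.hyps by blast
qed

lemma algorithm_steps_extend:
  assumes steps: "algorithm_steps p q \<alpha> i e w" and st: "pairing_state p q \<alpha> i l r e w" and i: "Suc i \<le> q"
    and jk: "j < k" "j \<in> free (p + q) l r (Suc i)" "k \<in> free (p + q) l r (Suc i)"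
      "\<forall>t\<in>free (p + q) l r (Suc i). \<not> (j < t \<and> t < k)" "\<alpha> ! j \<noteq> \<alpha> ! k"
  shows "algorithm_steps p q \<alpha> (Suc i)
    (e[j := Inr (paired_number q (\<alpha> ! j) (Suc i)), k := Inr (paired_number q (\<alpha> ! k) (Suc i))])
    (w[j := Inr (p + q + 1 - Suc i), k := Inr (Suc i)])"
proof -
  have jkn: "j < p + q" "k < p + q" using jk by (auto simp: free_def)
  have e: "e ! j = Inl (\<alpha> ! j)" "e ! k = Inl (\<alpha> ! k)" using st jk by (auto simp: pairing_state_def)
  have adj: "adjacent_signs e j k"
    unfolding adjacent_signs_def
    using st jk jkn e pairing_state_isl(1)[OF st] by (auto simp: pairing_state_def)
  have a: "2 * q + 1 - Suc i = 2 * q - Suc i + 1" "p + q + 1 - Suc i = p + q - Suc i + 1" using i by auto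
  have st': "algorithm_steps p q \<alpha> (Suc i - 1) e w" using steps by simp
  show ?thesis
  proof (cases "\<alpha> ! j")
    case Minus
    then have "\<alpha> ! k = Plus" using jk(5) by (cases "\<alpha> ! k") auto
    with Minus show ?thesis
      using algorithm_steps.minus_plus[OF st' _ i adj] e unfolding paired_number_def a by simp
  next
    case Plus
    then have "\<alpha> ! k = Minus" using jk(5) by (cases "\<alpha> ! k") auto
    with Plus show ?thesis
      using algorithm_steps.plus_minus[OF st' _ i adj] e unfolding paired_number_def a by simp
  qed
qed

text \<open>The run is recovered backwards: putting the signs back at the places of the last pair
  gives the preceding state.\<close>

lemma state_imp_algorithm_steps:
  assumes "pairing_state p q \<alpha> i l r e w" "i \<le> q" "length \<alpha> = p + q"
  shows "algorithm_steps p q \<alpha> i e w"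
  using assms(1,2)
proof (induction i arbitrary: e w)
  case 0
  then have "e = map Inl \<alpha>" "w = map Inl \<alpha>"
    using assms(3) by (auto simp: pairing_state_def intro!: nth_equalityI)
  then show ?case by (simp add: algorithm_steps.start)
next
  case (Suc i)
  let ?j = "l (Suc i)" and ?k = "r (Suc i)"
  let ?e = "e[?j := Inl (\<alpha> ! ?j), ?k := Inl (\<alpha> ! ?k)]" and ?w = "w[?j := Inl (\<alpha> ! ?j), ?k := Inl (\<alpha> ! ?k)]"
  have st: "pairing_state p q \<alpha> (Suc i) l r e w" by fact
  have len: "length e = p + q" "length w = p + q" using st by (auto simp: pairing_state_def)
  have jk: "?j < ?k" "?j \<in> free (p + q) l r (Suc i)" "?k \<in> free (p + q) l r (Suc i)"
      "\<forall>t\<in>free (p + q) l r (Suc i). \<not> (?j < t \<and> t < ?k)" "\<alpha> ! ?j \<noteq> \<alpha> ! ?k"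
    and val: "e ! ?j = Inr (paired_number q (\<alpha> ! ?j) (Suc i))" "e ! ?k = Inr (paired_number q (\<alpha> ! ?k) (Suc i))"
      "w ! ?j = Inr (p + q + 1 - Suc i)" "w ! ?k = Inr (Suc i)"
    using st by (auto simp: pairing_state_def)
  have jkn: "?j < p + q" "?k < p + q" using jk by (auto simp: free_def)
  have "pairing_state p q \<alpha> i l r ?e ?w"
    unfolding pairing_state_def
  proof (intro conjI allI impI ballI)
    fix m assume m: "1 \<le> m \<and> m \<le> i"
    then have "l m \<noteq> ?j" "l m \<noteq> ?k" "r m \<noteq> ?j" "r m \<noteq> ?k"
      using free_avoid[OF jk(2), of m] free_avoid[OF jk(3), of m] by auto
    then show "l m < r m" "l m \<in> free (p + q) l r m" "r m \<in> free (p + q) l r m" "\<alpha> ! l m \<noteq> \<alpha> ! r m"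
      "?e ! l m = Inr (paired_number q (\<alpha> ! l m) m)" "?e ! r m = Inr (paired_number q (\<alpha> ! r m) m)"
      "?w ! l m = Inr (p + q + 1 - m)" "?w ! r m = Inr m"
      using m st by (simp_all add: pairing_state_def)
    fix t assume "t \<in> free (p + q) l r m"
    then show "\<not> (l m < t \<and> t < r m)" using m st by (auto simp: pairing_state_def)
  next
    fix s assume s: "s \<in> free (p + q) l r (Suc i)"
    have "s \<in> free (p + q) l r (Suc (Suc i)) \<or> s = ?j \<or> s = ?k" using s free_Suc[of "Suc i" "p + q" l r] by auto
    then show "?e ! s = Inl (\<alpha> ! s)" "?w ! s = Inl (\<alpha> ! s)"
      using st jkn len by (auto simp: pairing_state_def nth_list_update)
  qed (simp_all add: len)
  moreover from Suc.IH[OF this] have "algorithm_steps p q \<alpha> i ?e ?w" using Suc.prems by simp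
  ultimately have "algorithm_steps p q \<alpha> (Suc i)
    (?e[?j := Inr (paired_number q (\<alpha> ! ?j) (Suc i)), ?k := Inr (paired_number q (\<alpha> ! ?k) (Suc i))])
    (?w[?j := Inr (p + q + 1 - Suc i), ?k := Inr (Suc i)])"
    using Suc.prems jk by (intro algorithm_steps_extend) auto
  moreover have "?e[?j := Inr (paired_number q (\<alpha> ! ?j) (Suc i)), ?k := Inr (paired_number q (\<alpha> ! ?k) (Suc i))] = e"
    using jk(1) jkn len val by (intro nth_equalityI) (auto simp: nth_list_update)
  moreover have "?w[?j := Inr (p + q + 1 - Suc i), ?k := Inr (Suc i)] = w"
    using jk(1) jkn len val by (intro nth_equalityI) (auto simp: nth_list_update)
  ultimately show ?case by simp
qed

lemma count_list_card: "count_list xs s = card {i. i < length xs \<and> xs ! i = s}"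
proof -
  have "count_list xs s = card {i \<in> {1..length xs}. xs ! (i - 1) = s}" using count_list_take[of "length xs" xs s] by simp
  also have "\<dots> = card {i. i < length xs \<and> xs ! i = s}"
    by (rule bij_betw_same_card, rule bij_betw_byWitness[of _ Suc "\<lambda>i. i - 1"]) auto
  finally show ?thesis .
qed

text \<open>Every pair uses up one place of either sign.\<close>

lemma card_free_sign:
  assumes "pairing_state p q \<alpha> i l r e w" "length \<alpha> = p + q"
  shows "card {t \<in> free (p + q) l r (Suc i). \<alpha> ! t = s} + i = count_list \<alpha> s"
proof -
  have "card {t \<in> free (p + q) l r (Suc j). \<alpha> ! t = s} + j = count_list \<alpha> s" if "j \<le> i" for j
    using that
  proof (induction j)
    case 0
    then show ?case using assms(2) by (simp add: count_list_card lessThan_def)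
  next
    case (Suc j)
    let ?F = "{t \<in> free (p + q) l r (Suc j). \<alpha> ! t = s}"
    have jk: "l (Suc j) \<in> free (p + q) l r (Suc j)" "r (Suc j) \<in> free (p + q) l r (Suc j)"
        "\<alpha> ! l (Suc j) \<noteq> \<alpha> ! r (Suc j)"
      using assms(1) Suc.prems by (auto simp: pairing_state_def)
    define x where "x = (if \<alpha> ! l (Suc j) = s then l (Suc j) else r (Suc j))"
    have "x \<in> ?F" "{t \<in> free (p + q) l r (Suc (Suc j)). \<alpha> ! t = s} = ?F - {x}"
      using jk free_Suc[of "Suc j" "p + q" l r] sign_neq_iff by (auto simp: x_def split: if_splits)
    then have "card {t \<in> free (p + q) l r (Suc (Suc j)). \<alpha> ! t = s} = card ?F - 1" "card ?F > 0"
      by (auto simp: card_gt_0_iff)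
    then show ?case using Suc by simp
  qed
  then show ?thesis by blast
qed

text \<open>The algorithm never gets stuck, since \<open>q <= p\<close> leaves both signs among the
  free places before each step. The result makes the sets of intersection points nonempty, which
  injectivity requires.\<close>

lemma algorithm_exists:
  assumes "length \<alpha> = p + q" "count_list \<alpha> Minus = q" "count_list \<alpha> Plus = p" "q \<le> p"
  shows "\<exists>\<epsilon> \<omega>. algorithm_output p q \<alpha> \<epsilon> \<omega>"
proof -
  have "\<exists>e w. algorithm_steps p q \<alpha> i e w" if "i \<le> q" for i
    using that
  proof (induction i)
    case 0 then show ?case using algorithm_steps.start by blast
  next
    case (Suc i)
    then obtain e w where steps: "algorithm_steps p q \<alpha> i e w" by auto
    then obtain l r where st: "pairing_state p q \<alpha> i l r e w" using algorithm_steps_imp_state assms(1) by blast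
    let ?F = "free (p + q) l r (Suc i)"
    have "card {t \<in> ?F. \<alpha> ! t = Minus} > 0" "card {t \<in> ?F. \<alpha> ! t = Plus} > 0"
      using card_free_sign[OF st assms(1), of Minus] card_free_sign[OF st assms(1), of Plus] assms Suc.prems by auto
    then obtain a b where "a \<in> ?F" "\<alpha> ! a = Minus" "b \<in> ?F" "\<alpha> ! b = Plus" by (auto simp: card_gt_0_iff)
    \<comment> \<open>Two free places of opposite sign at minimal distance are adjacent: a free
      place between them would differ in sign from one of the two and be closer to it.\<close>
    then have "\<exists>d j k. j \<in> ?F \<and> k \<in> ?F \<and> j < k \<and> \<alpha> ! j \<noteq> \<alpha> ! k \<and> k - j = d"
      by (metis linorder_neqE_nat sign.distinct(1))
    then obtain d where d: "\<exists>j k. j \<in> ?F \<and> k \<in> ?F \<and> j < k \<and> \<alpha> ! j \<noteq> \<alpha> ! k \<and> k - j = d"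
      and least: "\<And>d'. d' < d \<Longrightarrow> \<not> (\<exists>j k. j \<in> ?F \<and> k \<in> ?F \<and> j < k \<and> \<alpha> ! j \<noteq> \<alpha> ! k \<and> k - j = d')"
      using exists_least_iff[of "\<lambda>d. \<exists>j k. j \<in> ?F \<and> k \<in> ?F \<and> j < k \<and> \<alpha> ! j \<noteq> \<alpha> ! k \<and> k - j = d"] by blast
    obtain j k where jk: "j \<in> ?F" "k \<in> ?F" "j < k" "\<alpha> ! j \<noteq> \<alpha> ! k" "k - j = d" using d by blast
    have "\<not> (j < t \<and> t < k)" if "t \<in> ?F" for t
    proof
      assume t: "j < t \<and> t < k"
      then have "k - t < d" "t - j < d" using jk by auto
      moreover have "\<alpha> ! j \<noteq> \<alpha> ! t \<or> \<alpha> ! t \<noteq> \<alpha> ! k" using jk(4) by auto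
      ultimately show False using least[of "k - t"] least[of "t - j"] jk that t by blast
    qed
    then show ?case using algorithm_steps_extend[OF steps st Suc.prems jk(3,1,2) _ jk(4)] by blast
  qed
  then show ?thesis unfolding algorithm_output_def by blast
qed

subsection \<open>The Iwasawa flag\<close>

lemma invertibleI_range:
  fixes A :: "'n::{finite,wellorder} cmat"
  assumes "\<And>i. 1 \<le> i \<Longrightarrow> i \<le> CARD('n) \<Longrightarrow> e_vec i \<in> range ((*v) A)"
  shows "invertible A"
proof -
  have sub: "vec.subspace (range ((*v) A))" using vec.subspace_image[OF vec.subspace_UNIV] by blast
  have "std_flag CARD('n) \<subseteq> range ((*v) A)"
    unfolding std_flag_alt using assms by (intro vec.span_minimal sub) auto
  then show ?thesis by (auto simp: invertible_iff_surj std_flag_full)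
qed

lemma act_subsetI:
  fixes A :: "'n::{finite,wellorder} cmat"
  assumes "vec.subspace W" "\<And>i. 1 \<le> i \<Longrightarrow> i \<le> k \<Longrightarrow> i \<le> CARD('n) \<Longrightarrow> A *v e_vec i \<in> W"
  shows "act A std_flag k \<subseteq> W"
  unfolding act_std_flag using assms by (intro vec.span_minimal) auto

lemma (in hermitian) diff_right: "B v (u - w) = B v u - B v w"
  by (metis diff_left cnj_swap complex_cnj_diff)

lemma orthonormal_frame:
  fixes V :: "'n::{finite,wellorder} flag"
  assumes V: "V \<in> complete_flags"
  obtains y where "\<And>k. 1 \<le> k \<Longrightarrow> k \<le> CARD('n) \<Longrightarrow> y k \<in> V k \<and> y k \<notin> V (k - 1)"
    "\<And>i j. i \<in> {1..CARD('n)} \<Longrightarrow> j \<in> {1..CARD('n)} \<Longrightarrow> sip (y i) (y j) = (if i = j then 1 else 0)"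
proof -
  have "\<exists>y. \<forall>k. 1 \<le> k \<and> k \<le> CARD('n) \<longrightarrow> y k \<in> V k \<and> y k \<notin> V (k - 1) \<and>
    (sip (y k) (y k) = 1 \<or> sip (y k) (y k) = -1) \<and> (\<forall>v\<in>V (k - 1). sip (y k) v = 0)"
    by (intro sip.gram_schmidt[OF V order_refl]) auto
  then obtain y where y: "\<And>k. 1 \<le> k \<Longrightarrow> k \<le> CARD('n) \<Longrightarrow> y k \<in> V k \<and> y k \<notin> V (k - 1) \<and>
    (sip (y k) (y k) = 1 \<or> sip (y k) (y k) = -1) \<and> (\<forall>v\<in>V (k - 1). sip (y k) v = 0)"
    by blast
  have lt: "sip (y j) (y i) = 0" if "1 \<le> i" "i < j" "j \<le> CARD('n)" for i j
  proof -
    have "V i \<subseteq> V (j - 1)" using that by (intro monoD[OF complete_flagsD(1)[OF V]]) simp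
    moreover have "y i \<in> V i" using y[of i] that by simp
    ultimately have "y i \<in> V (j - 1)" by blast
    then show ?thesis using y[of j] that by auto
  qed
  have "sip (y i) (y j) = (if i = j then 1 else 0)" if "i \<in> {1..CARD('n)}" "j \<in> {1..CARD('n)}" for i j
  proof (cases i j rule: linorder_cases)
    case less then show ?thesis using lt[of i j] that sip.zero_sym[of "y i" "y j"] by simp
  next
    case equal
    then show ?thesis using y[of i] that sip_self_nonneg[of "y i"] by auto
  next
    case greater then show ?thesis using lt[of j i] that by simp
  qed
  with y show ?thesis using that by blast
qed

locale iwasawa = signature p q tp for p q :: nat and tp :: "'n::{finite,wellorder} itself" +
  assumes q_le_p: "q \<le> p" and q_pos: "1 \<le> q"
begin

definition u :: "nat \<Rightarrow> 'n cvec" where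
  "u i = (if i \<le> q then e_vec i + e_vec (2 * q + 1 - i)
     else if i \<le> p then e_vec (q + i)
     else e_vec (p + q + 1 - i) - e_vec (2 * q + 1 - (p + q + 1 - i)))"

definition U :: "'n cmat" where "U = colmat u"

lemma iwasawa_basis_nth: "i \<in> {1..p + q} \<Longrightarrow> iwasawa_basis p q ! (i - 1) = u i"
  using q_le_p
  by (auto simp: iwasawa_basis_def u_def nth_append rev_nth Suc_diff_le add_ac simp del: upt_Suc)

lemma iwasawa_basis_length: "length (iwasawa_basis p q :: 'n cvec list) = p + q"
  using q_le_p q_pos by (simp add: iwasawa_basis_def)

lemma u_low: "i \<le> q \<Longrightarrow> u i = e_vec i + e_vec (2 * q + 1 - i)"
  by (simp add: u_def)

lemma u_mid: "q < i \<Longrightarrow> i \<le> p \<Longrightarrow> u i = e_vec (q + i)"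
  by (simp add: u_def)

lemma u_high: "1 \<le> j \<Longrightarrow> j \<le> q \<Longrightarrow> u (p + q + 1 - j) = e_vec j - e_vec (2 * q + 1 - j)"
proof -
  assume j: "1 \<le> j" "j \<le> q"
  then have "\<not> p + q + 1 - j \<le> q" "\<not> p + q + 1 - j \<le> p" "p + q + 1 - (p + q + 1 - j) = j"
    using q_le_p by linarith+
  then show ?thesis by (simp add: u_def del: One_nat_def)
qed

lemma U_e_vec: "i \<in> {1..p + q} \<Longrightarrow> U *v e_vec i = u i"
  unfolding U_def by (intro colmat_e_vec) (auto simp: card_n)

lemma invertible_U: "invertible U"
proof (rule invertibleI_range)
  have sub: "vec.subspace (range ((*v) U))" using vec.subspace_image[OF vec.subspace_UNIV] by blast
  have r: "u i \<in> range ((*v) U)" if "i \<in> {1..p + q}" for i using U_e_vec[OF that] by (metis rangeI)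
  fix i assume i: "1 \<le> i" "i \<le> CARD('n)"
  consider "i \<le> q" | "q < i" "i \<le> 2 * q" | "2 * q < i" by linarith
  then show "e_vec i \<in> range ((*v) U)"
  proof cases
    case 1
    have "u i + u (p + q + 1 - i) = 2 *s e_vec i" using 1 i by (simp add: u_low u_high vec_eq_iff del: One_nat_def)
    then have "e_vec i = (1/2) *s (u i + u (p + q + 1 - i))" by (simp add: vector_smult_assoc)
    moreover have "u i + u (p + q + 1 - i) \<in> range ((*v) U)"
      using 1 i q_le_p by (intro vec.subspace_add[OF sub] r) auto
    ultimately show ?thesis using vec.subspace_scale[OF sub] by metis
  next
    case 2
    define j where "j = 2 * q + 1 - i"
    have j: "1 \<le> j" "j \<le> q" "2 * q + 1 - j = i" using 2 by (auto simp: j_def)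
    have "u j - u (p + q + 1 - j) = 2 *s e_vec i" using j by (simp add: u_low u_high vec_eq_iff del: One_nat_def)
    then have "e_vec i = (1/2) *s (u j - u (p + q + 1 - j))" by (simp add: vector_smult_assoc)
    moreover have "u j - u (p + q + 1 - j) \<in> range ((*v) U)"
      using j q_le_p by (intro vec.subspace_diff[OF sub] r) auto
    ultimately show ?thesis using vec.subspace_scale[OF sub] by metis
  next
    case 3
    have "q < i - q" "i - q \<le> p" "q + (i - q) = i" using 3 i card_n by linarith+
    then have "u (i - q) = e_vec i" by (simp add: u_mid)
    moreover have "i - q \<in> {1..p + q}" using 3 i unfolding atLeastAtMost_iff card_n by linarith
    ultimately show ?thesis using r[of "i - q"] by simp
  qed
qed

lemma U_perm_flag:
  assumes w: "w \<in> permutations_of_set {1..p + q}"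
  shows "basis_flag (map (\<lambda>i. iwasawa_basis p q ! (i - 1)) w) =
    act (U ** perm_mat (\<lambda>k. w ! (k - 1))) (std_flag :: 'n flag)"
proof -
  have len: "length w = CARD('n)" using w length_finite_permutations_of_set card_n by fastforce
  have "w ! (k - 1) \<in> {1..p + q}" if "1 \<le> k" "k \<le> CARD('n)" for k
  proof -
    have "w ! (k - 1) \<in> set w" using that len by (intro nth_mem) auto
    then show ?thesis using permutations_of_setD(1)[OF w] by simp
  qed
  then have "colmat (\<lambda>k. iwasawa_basis p q ! (w ! (k - 1) - 1) :: 'n cvec) = U ** perm_mat (\<lambda>k. w ! (k - 1))"
    using iwasawa_basis_nth by (intro mat_eqI) (simp add: U_e_vec flip: matrix_vector_mul_assoc)
  then show ?thesis using basis_flag_map[OF len, of "\<lambda>i. iwasawa_basis p q ! (i - 1)"] by simp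
qed

lemma iwasawa_flag: "basis_flag (iwasawa_basis p q) = act U (std_flag :: 'n flag)"
proof -
  let ?w = "[1..<p + q + 1]"
  have w: "?w \<in> permutations_of_set {1..p + q}" by (intro permutations_of_setI) auto
  have "map (\<lambda>i. iwasawa_basis p q ! (i - 1)) ?w = (iwasawa_basis p q :: 'n cvec list)"
    by (rule nth_equalityI) (auto simp: iwasawa_basis_length simp del: upt_Suc)
  moreover have "perm_mat (\<lambda>k. ?w ! (k - 1)) = (mat 1 :: 'n cmat)"
    by (rule mat_eqI) (simp add: card_n del: upt_Suc)
  ultimately show ?thesis using U_perm_flag[OF w] by simp
qed

lemma perm_bij: "w \<in> permutations_of_set {1..p + q} \<Longrightarrow> bij_betw (\<lambda>k. w ! (k - 1)) {1..CARD('n)} {1..CARD('n)}"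
proof -
  assume w: "w \<in> permutations_of_set {1..p + q}"
  then have len: "length w = p + q" and d: "distinct w" "set w = {1..p + q}"
    using length_finite_permutations_of_set permutations_of_setD by fastforce+
  have "bij_betw ((!) w) {..<p + q} {1..p + q}" using bij_betw_nth[OF d(1), of "{..<p + q}" "{1..p + q}"] len d(2) by simp
  moreover have "bij_betw (\<lambda>k. k - 1) {1..p + q} {..<p + q}"
    by (rule bij_betw_byWitness[of _ Suc]) auto
  ultimately show ?thesis using bij_betw_trans by (fastforce simp: card_n o_def)
qed

lemma borel_conj:
  assumes "invertible g"
  shows "act g (act U std_flag) = act U std_flag \<longleftrightarrow> matrix_inv U ** g ** U \<in> upper_borel"
  using act_eq_iff[of "g ** U" U] assms invertible_U
  by (simp add: act_mult invertible_mult matrix_mul_assoc)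

text \<open>The Iwasawa-Borel group is the conjugate by \<open>U\<close> of the upper triangular
  matrices of determinant one, so its orbits are Bruhat cells seen from the frame \<open>U\<close>;
  a scalar supplies the determinant.\<close>

lemma orbit_eq_cell:
  assumes w: "bij_betw w {1..CARD('n)} {1..CARD('n)}"
  shows "orbit (iwasawa_borel p q) (act (U ** perm_mat w) (std_flag :: 'n flag)) = cell U w"
proof (intro equalityI subsetI)
  fix V :: "'n flag" assume "V \<in> orbit (iwasawa_borel p q) (act (U ** perm_mat w) std_flag)"
  then obtain g where g: "det g = 1" "act g (act U std_flag) = act U std_flag" "V = act g (act (U ** perm_mat w) std_flag)"
    by (auto simp: orbit_def iwasawa_borel_def iwasawa_flag)
  have inv: "invertible g" using g(1) by (simp add: invertible_det_nz)
  have "matrix_inv U ** g ** U \<in> upper_borel" using borel_conj[OF inv] g(2) by simp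
  then have "(matrix_inv U ** g ** U) ** perm_mat w ** mat 1 \<in> bruhat w"
    by (intro bruhat_mult perm_mat_bruhat) auto
  then have "matrix_inv U ** (g ** (U ** perm_mat w)) \<in> bruhat w" by (simp add: matrix_mul_assoc)
  then show "V \<in> cell U w"
    using g(3) inv invertible_U invertible_perm_mat[OF w] by (simp add: act_mem_cell invertible_mult flip: act_mult)
next
  fix V :: "'n flag" assume "V \<in> cell U w"
  then obtain A where A: "V = act A std_flag" "invertible A" "matrix_inv U ** A \<in> bruhat w"
    by (auto simp: cell_def)
  then obtain a b where ab: "matrix_inv U ** A = a ** perm_mat w ** b" "a \<in> upper_borel" "b \<in> upper_borel"
    by (auto simp: bruhat_def)
  define g where "g = U ** a ** matrix_inv U"
  have g: "invertible g" using invertible_U ab by (simp add: g_def invertible_mult upper_borel_invertible)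
  obtain c where c: "c \<noteq> 0" "det (mat c ** g) = 1" using normalize_det[OF g] by blast
  have "matrix_inv U ** g ** U = (matrix_inv U ** U) ** a ** (matrix_inv U ** U)" by (simp add: g_def matrix_mul_assoc)
  then have fix_F: "act g (act U std_flag) = act U std_flag" using borel_conj[OF g] ab(2) invertible_U by simp
  have gU: "g ** U = U ** a" using invertible_U by (simp add: g_def flip: matrix_mul_assoc)
  have "A = U ** (a ** perm_mat w ** b)" using invertible_U by (simp flip: ab(1))
  then have "A = (g ** (U ** perm_mat w)) ** b" by (simp add: matrix_mul_assoc gU)
  then have V: "V = act g (act (U ** perm_mat w) std_flag)" using A(1) act_upper_borel[OF ab(3)] by (simp add: act_mult)
  have "mat c ** g \<in> iwasawa_borel p q"
    using c fix_F invertible_U by (simp add: iwasawa_borel_def iwasawa_flag act_mult act_mat)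
  moreover have "act (mat c ** g) (act (U ** perm_mat w) std_flag) = V"
    using c(1) A by (simp add: act_mult[of "mat c"] V[symmetric] act_mat)
  ultimately show "V \<in> orbit (iwasawa_borel p q) (act (U ** perm_mat w) std_flag)"
    unfolding orbit_def by blast
qed

lemma schubert_variety_eq:
  assumes "w \<in> permutations_of_set {1..p + q}"
  shows "schubert_variety p q w = flag_topology closure_of (cell U (\<lambda>k. w ! (k - 1)))"
  unfolding schubert_variety_def U_perm_flag[OF assms] orbit_eq_cell[OF perm_bij[OF assms]] ..

section \<open>The hermitian form in the Iwasawa basis\<close>

lemma h_pairs:
  assumes "1 \<le> i" "i \<le> q" "1 \<le> j" "j \<le> q"
  shows "h (e_vec i) (e_vec j) = (if i = j then -1 else 0)"
    "h (e_vec i) (e_vec (2 * q + 1 - j)) = 0" "h (e_vec (2 * q + 1 - i)) (e_vec j) = 0"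
    "h (e_vec (2 * q + 1 - i)) (e_vec (2 * q + 1 - j)) = (if i = j then 1 else 0)"
  using assms q_le_p by (subst h_e_vec; auto)+

lemma h_pairs_mid:
  assumes "1 \<le> i" "i \<le> q" "q < m" "m \<le> p"
  shows "h (e_vec i) (e_vec (q + m)) = 0" "h (e_vec (2 * q + 1 - i)) (e_vec (q + m)) = 0"
    "h (e_vec (q + m)) (e_vec i) = 0" "h (e_vec (q + m)) (e_vec (2 * q + 1 - i)) = 0"
  using assms q_le_p by (subst h_e_vec; auto)+

lemma index_cases:
  assumes "i \<in> {1..p + q}"
  obtains "1 \<le> i" "i \<le> q" | "q < i" "i \<le> p" | j where "1 \<le> j" "j \<le> q" "i = p + q + 1 - j"
proof -
  consider "i \<le> q" | "q < i" "i \<le> p" | "p < i" by linarith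
  then show ?thesis
  proof cases
    case 3
    then show ?thesis using assms by (intro that(3)[of "p + q + 1 - i"]) auto
  qed (use assms that in auto)
qed

text \<open>The first \<open>q\<close> vectors span an isotropic subspace in duality with the span
  of the last \<open>q\<close>, in reverse order; the middle vectors are orthonormal. The value -2
  is the product of \<open>e_i + e_k\<close> with \<open>e_i - e_k\<close> for
  \<open>k = 2q + 1 - i\<close>.\<close>

lemma h_u:
  assumes "i \<in> {1..p + q}" "m \<in> {1..p + q}"
  shows "h (u i) (u m) = (if q < i \<and> i \<le> p then (if i = m then 1 else 0) else if i + m = p + q + 1 then -2 else 0)"
  using assms(1)
proof (cases rule: index_cases)
  case 1
  from assms(2) show ?thesis
  proof (cases rule: index_cases)
    case (3 k)
    then show ?thesis
      using 1 q_le_p by (auto simp: u_low u_high h.add_left h.add_right h.diff_right h_pairs simp del: One_nat_def)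
  qed (use 1 q_le_p in \<open>simp add: u_low u_mid h.add_left h.add_right h_pairs h_pairs_mid del: One_nat_def\<close>)+
next
  case 2
  from assms(2) show ?thesis
  proof (cases rule: index_cases)
    case mid: 2
    have "h (e_vec (q + i)) (e_vec (q + m)) = (if i = m then 1 else 0)"
      using 2 mid by (subst h_e_vec) auto
    then show ?thesis using 2 mid by (simp add: u_mid)
  next
    case (3 k)
    then show ?thesis
      using 2 q_le_p by (auto simp: u_mid u_high h.diff_right h_pairs_mid simp del: One_nat_def)
  qed (use 2 q_le_p in \<open>simp add: u_low u_mid h.add_right h_pairs_mid del: One_nat_def\<close>)
next
  case (3 j)
  from assms(2) show ?thesis
  proof (cases rule: index_cases)
    case 1
    then show ?thesis
      using 3 q_le_p by (auto simp: u_low u_high h.add_right h.diff_left h_pairs simp del: One_nat_def)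
  next
    case 2
    then show ?thesis
      using 3 q_le_p by (auto simp: u_mid u_high h.diff_left h_pairs_mid simp del: One_nat_def)
  next
    case (3 k)
    then show ?thesis
      using \<open>1 \<le> j\<close> \<open>j \<le> q\<close> \<open>i = p + q + 1 - j\<close> q_le_p
      by (auto simp: u_high h.diff_left h.diff_right h_pairs simp del: One_nat_def)
  qed
qed

lemma U_flag_subspace: "vec.subspace (act U std_flag k :: 'n cvec set)"
  by (simp add: act_std_flag)

lemma U_flag_eq_span: "k \<le> p + q \<Longrightarrow> act U std_flag k = vec.span (u ` {1..k})"
  unfolding act_std_flag by (rule arg_cong[of _ _ vec.span]) (auto simp: U_e_vec card_n intro!: image_cong)

lemma U_flag_orth:
  assumes "x \<in> act U std_flag q" "z \<in> act U std_flag p"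
  shows "h x z = 0"
proof -
  have 1: "h (u i) z = 0" if i: "i \<in> {1..q}" for i
  proof (rule h.orth_span)
    show "z \<in> vec.span (u ` {1..p})" using assms(2) U_flag_eq_span[of p] by simp
    show "h (u i) y = 0" if "y \<in> u ` {1..p}" for y using that i q_le_p by (auto simp: h_u)
  qed
  have "h z x = 0"
  proof (rule h.orth_span)
    show "x \<in> vec.span (u ` {1..q})" using assms(1) U_flag_eq_span[of q] by simp
    show "h z y = 0" if "y \<in> u ` {1..q}" for y using that 1 h.zero_sym by auto
  qed
  then show ?thesis using h.zero_sym by blast
qed

text \<open>The upper steps are the orthogonal complements of the lower ones, so an isometry
  preserving the steps up to \<open>q\<close> also preserves those from \<open>p\<close> on.\<close>

lemma U_flag_perp:
  assumes j: "j \<le> q"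
  shows "act U std_flag (p + q - j) = {v. \<forall>w\<in>act U std_flag j. h v w = 0}"
proof (intro equalityI subsetI CollectI ballI)
  fix v w assume v: "v \<in> act U std_flag (p + q - j)" and w: "w \<in> act U std_flag j"
  have 1: "h (u i) v = 0" if i: "i \<in> {1..j}" for i
  proof (rule h.orth_span)
    show "v \<in> vec.span (u ` {1..p + q - j})" using v U_flag_eq_span[of "p + q - j"] by simp
    show "h (u i) y = 0" if "y \<in> u ` {1..p + q - j}" for y using that i j q_le_p by (auto simp: h_u)
  qed
  show "h v w = 0"
  proof (rule h.orth_span)
    show "w \<in> vec.span (u ` {1..j})" using w U_flag_eq_span[of j] j by simp
    show "h v y = 0" if "y \<in> u ` {1..j}" for y using that 1 h.zero_sym by auto
  qed
next
  fix v assume v: "v \<in> {v. \<forall>w\<in>act U std_flag j. h v w = 0}"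
  define x where "x = matrix_inv U *v v"
  have vx: "v = U *v x" using invertible_U by (simp add: x_def)
  have "x $ a = 0" if a: "p + q - j < idx a" for a
  proof -
    \<comment> \<open>\<open>u i\<close> is the dual partner of the basis vector of number
      \<open>idx a\<close>; pairing with it reads off the coordinate at \<open>a\<close>, up to the
      factor -2.\<close>
    define i where "i = p + q + 1 - idx a"
    have i: "1 \<le> i" "i \<le> j" "idx a + i = p + q + 1" using a idx_le[of a] by (auto simp: i_def card_n)
    have "u i \<in> act U std_flag j"
      using U_flag_eq_span[of j] i j by (auto intro!: vec.span_base)
    then have "h v (u i) = 0" using v by blast
    moreover have "h v (u i) = -2 * x $ a"
    proof -
      have "v = (\<Sum>m=1..p + q. x $ coord m *s u m)"
        unfolding vx colmat_mult[of U x] card_n by (intro sum.cong) (auto simp: U_e_vec)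
      then have "h v (u i) = (\<Sum>m=1..p + q. x $ coord m * h (u m) (u i))"
        by (simp add: h.sum_left h.scale_left)
      also have "\<dots> = (\<Sum>m=1..p + q. if m = idx a then -2 * x $ a else 0)"
      proof (rule sum.cong[OF refl])
        fix m assume m: "m \<in> {1..p + q}"
        have "i \<in> {1..p + q}" using i j by auto
        then have "h (u m) (u i) = (if m = idx a then -2 else 0)" using m i j q_le_p by (subst h_u) auto
        then show "x $ coord m * h (u m) (u i) = (if m = idx a then -2 * x $ a else 0)" by auto
      qed
      also have "\<dots> = -2 * x $ a" using idx_range[of a] by (simp add: card_n)
      finally show ?thesis .
    qed
    ultimately show ?thesis by simp
  qed
  then have "x \<in> std_flag (p + q - j)" by (simp add: std_flag_eq)
  then show "v \<in> act U std_flag (p + q - j)" unfolding vx act_def by (rule imageI)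
qed

lemma exists_coordinate_flag:
  assumes "length \<alpha> = p + q" "count_list \<alpha> Minus = q"
  obtains \<epsilon> where "bij_betw \<epsilon> {1..p + q} {1..p + q}" "\<And>k. k \<in> {1..p + q} \<Longrightarrow> \<epsilon> k \<le> q \<longleftrightarrow> \<alpha> ! (k - 1) = Minus"
proof -
  let ?M = "{k \<in> {1..p + q}. \<alpha> ! (k - 1) = Minus}" and ?P = "{k \<in> {1..p + q}. \<alpha> ! (k - 1) \<noteq> Minus}"
  have cM: "card ?M = card {1..q}" using count_list_take[of "p + q" \<alpha> Minus] assms by simp
  have P: "?P = {1..p + q} - ?M" by auto
  have "card ({1..p + q} - ?M) = card {1..p + q} - card ?M" by (rule card_Diff_subset) auto
  then have "card ?P = card {q + 1..p + q}" unfolding P cM by simp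
  then obtain g where g: "bij_betw g ?P {q + 1..p + q}" using finite_same_card_bij[of ?P "{q + 1..p + q}"] by auto
  obtain f where f: "bij_betw f ?M {1..q}" using finite_same_card_bij[OF _ _ cM] by auto
  define \<epsilon> where "\<epsilon> k = (if k \<in> ?M then f k else g k)" for k
  have e1: "bij_betw \<epsilon> ?M {1..q}" using f by (rule bij_betw_cong[THEN iffD1, rotated]) (simp add: \<epsilon>_def)
  have e2: "bij_betw \<epsilon> ?P {q + 1..p + q}" using g by (rule bij_betw_cong[THEN iffD1, rotated]) (auto simp: \<epsilon>_def)
  have "bij_betw \<epsilon> (?M \<union> ?P) ({1..q} \<union> {q + 1..p + q})" using e1 e2 by (rule bij_betw_combine) auto
  moreover have "?M \<union> ?P = {1..p + q}" "{1..q} \<union> {q + 1..p + q} = {1..p + q}" by auto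
  ultimately have "bij_betw \<epsilon> {1..p + q} {1..p + q}" by simp
  moreover have "\<epsilon> k \<le> q \<longleftrightarrow> \<alpha> ! (k - 1) = Minus" if "k \<in> {1..p + q}" for k
  proof (cases "\<alpha> ! (k - 1) = Minus")
    case True
    then show ?thesis using bij_betwE[OF e1, rule_format, of k] that by simp
  next
    case False
    then show ?thesis using bij_betwE[OF e2, rule_format, of k] that by simp
  qed
  ultimately show ?thesis using that by blast
qed

lemma Jmat_e_vec: "i \<in> {1..p + q} \<Longrightarrow> Jmat q *v e_vec i = ((if i \<le> q then - e_vec i else e_vec i) :: 'n cvec)"
  by (auto simp: Jmat_mult vec_eq_iff e_vec_nth card_n)

lemma coordinate_eigenframe:
  assumes "bij_betw \<epsilon> {1..p + q} {1..p + q}" "\<And>k. k \<in> {1..p + q} \<Longrightarrow> \<epsilon> k \<le> q \<longleftrightarrow> \<alpha> ! (k - 1) = Minus"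
  shows "Jmat q ** colmat (\<lambda>k. e_vec (\<epsilon> k)) = colmat (\<lambda>k. e_vec (\<epsilon> k) :: 'n cvec) ** Dmat \<alpha>"
  unfolding eigenframe_iff[symmetric]
proof
  fix a :: 'n
  have r: "idx a \<in> {1..p + q}" using idx_range[of a] by (simp add: card_n)
  then have e: "\<epsilon> (idx a) \<in> {1..p + q}" using assms(1) by (auto dest: bij_betwE)
  have c: "colmat (\<lambda>k. e_vec (\<epsilon> k)) *v axis a 1 = (e_vec (\<epsilon> (idx a)) :: 'n cvec)"
    using colmat_e_vec[of "idx a" "\<lambda>k. e_vec (\<epsilon> k) :: 'n cvec"] by simp
  show "Jmat q *v (colmat (\<lambda>k. e_vec (\<epsilon> k)) *v axis a 1) =
      of_real (sgn_of (\<alpha> ! (idx a - 1))) *s (colmat (\<lambda>k. e_vec (\<epsilon> k) :: 'n cvec) *v axis a 1)"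
    unfolding c Jmat_e_vec[OF e] using assms(2)[OF r] by (cases "\<alpha> ! (idx a - 1)") auto
qed

text \<open>The Iwasawa decomposition: orthonormalising the flag \<open>act M std_flag\<close> for the standard inner product, the first
  \<open>q\<close> vectors, being isotropic, split into orthogonal halves of equal length in the two eigenspaces of \<open>Jmat q\<close>.\<close>

lemma iwasawa_unitary:
  assumes M: "invertible M" and iso: "\<And>v w. h (M *v v) (M *v w) = h v w"
  obtains k where "conj_transpose k ** k = mat 1" "Jmat q ** k = k ** Jmat q"
    "\<And>i. i \<in> {1..p} \<Longrightarrow> k *v u i \<in> act M (act U std_flag) i"
proof -
  define F where "F = act M (act U (std_flag :: 'n flag))"
  have F: "F \<in> complete_flags" using M invertible_U by (simp add: F_def act_complete_flags)
  have hF: "h x z = 0" if x: "x \<in> F q" and z: "z \<in> F p" for x z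
  proof -
    obtain x' z' where "x = M *v x'" "x' \<in> act U std_flag q" "z = M *v z'" "z' \<in> act U std_flag p"
      using x z unfolding F_def act_def[of M] by blast
    then show ?thesis using iso U_flag_orth by simp
  qed
  obtain y where y: "\<And>k. 1 \<le> k \<Longrightarrow> k \<le> CARD('n) \<Longrightarrow> y k \<in> F k \<and> y k \<notin> F (k - 1)"
    and "\<And>i j. i \<in> {1..CARD('n)} \<Longrightarrow> j \<in> {1..CARD('n)} \<Longrightarrow> sip (y i) (y j) = (if i = j then 1 else 0)"
    using orthonormal_frame[OF F] by blast
  note sipy = this(2)[unfolded card_n]
  have F_le: "F k \<subseteq> F l" if "k \<le> l" for k l by (rule monoD[OF complete_flagsD(1)[OF F] that])
  have hy: "h (y i) (y j) = 0" if "i \<in> {1..q}" "j \<in> {1..p}" for i j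
    using y[of i] y[of j] F_le[of i q] F_le[of j p] that q_le_p by (intro hF) (auto simp: card_n)
  \<comment> \<open>The components of \<open>y i\<close> in the two eigenspaces of
    \<open>Jmat q\<close>. For \<open>i <= q\<close> the vector \<open>y i\<close> is isotropic, so
    \<open>y i\<close> and its image are orthonormal and the factor \<open>1 / sqrt 2\<close>
    produces unit vectors.\<close>
  define a where "a i = (1 / sqrt 2) *\<^sub>R (y i - Jmat q *v y i)" for i
  define b where "b i = (1 / sqrt 2) *\<^sub>R (y i + Jmat q *v y i)" for i
  have scale: "sip (r *\<^sub>R v) w = of_real r * sip v w" "sip w (r *\<^sub>R v) = of_real r * sip w v" for r and v w :: "'n cvec"
    unfolding sip_def vector_scaleR_component
    by (simp_all add: sum_distrib_left scaleR_conv_of_real algebra_simps)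
  have Jsc: "Jmat q *v (r *\<^sub>R v) = r *\<^sub>R (Jmat q *v v)" for r and v :: "'n cvec"
    by (simp add: Jmat_mult vec_eq_iff)
  have half: "complex_of_real (1 / sqrt 2) * complex_of_real (1 / sqrt 2) = 1 / 2"
  proof -
    have "(1 / sqrt 2) * (1 / sqrt 2) = (1 / 2 :: real)" by simp
    then show ?thesis by (metis of_real_1 of_real_divide of_real_mult of_real_numeral)
  qed
  have Ja: "Jmat q *v a i = - a i" and Jb: "Jmat q *v b i = b i" for i
    by (simp_all add: a_def b_def Jsc matrix_vector_mult_diff_distrib matrix_vector_right_distrib scaleR_diff_right scaleR_add_right)
  have sa: "sip (a i) v = of_real (1 / sqrt 2) * (sip (y i) v - h (y i) v)" for i v
    by (simp add: a_def scale sip.diff_left h_eq)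
  have sb: "sip (b i) v = of_real (1 / sqrt 2) * (sip (y i) v + h (y i) v)" for i v
    by (simp add: b_def scale sip.add_left h_eq)
  have sJ: "sip (Jmat q *v v) w = h v w" "h v (Jmat q *v w) = sip v w" for v w
    by (simp_all add: h_eq sip_Jmat)
  have orth_eig: "sip x z = 0" if "Jmat q *v x = - x" "Jmat q *v z = z" for x z :: "'n cvec"
  proof -
    have "sip (Jmat q *v x) z = sip x (Jmat q *v z)" by (rule sip_Jmat)
    then have "- sip x z = sip x z" by (simp only: that sip.minus_left)
    then show ?thesis by (simp add: complex_eq_iff)
  qed
  have aa: "sip (a i) (a j) = (if i = j then 1 else 0)" if "i \<in> {1..q}" "j \<in> {1..q}" for i j
  proof -
    have "sip (a i) (a j) = of_real (1 / sqrt 2) * (sip (y i) (a j) - h (y i) (a j))" by (rule sa)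
    also have "sip (y i) (a j) = of_real (1 / sqrt 2) * (sip (y i) (y j) - h (y i) (y j))"
      unfolding a_def scale h_eq sip_Jmat by (simp add: sip.diff_right)
    also have "h (y i) (a j) = - of_real (1 / sqrt 2) * (sip (y i) (y j) - h (y i) (y j))"
      unfolding a_def h_eq scale sip_Jmat[of q "y i"]
      by (simp add: sip.diff_right matrix_vector_mult_diff_distrib algebra_simps Jsc scale)
    finally have "sip (a i) (a j) = (of_real (1 / sqrt 2) * of_real (1 / sqrt 2)) * (2 * (sip (y i) (y j) - h (y i) (y j)))"
      by (simp add: algebra_simps)
    then show ?thesis unfolding half using sipy[of i j] hy[of i j] that q_le_p by simp
  qed
  have bb: "sip (b i) (b j) = (if i = j then 1 else 0)" if "i \<in> {1..q}" "j \<in> {1..q}" for i j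
  proof -
    have "sip (b i) (b j) = of_real (1 / sqrt 2) * (sip (y i) (b j) + h (y i) (b j))" by (rule sb)
    also have "h (y i) (b j) = sip (y i) (b j)" by (simp add: h_eq sip_Jmat Jb)
    also have "sip (y i) (b j) = of_real (1 / sqrt 2) * (sip (y i) (y j) + h (y i) (y j))"
      unfolding b_def scale h_eq sip_Jmat by (simp add: sip.add_right)
    finally have "sip (b i) (b j) = (of_real (1 / sqrt 2) * of_real (1 / sqrt 2)) * (2 * (sip (y i) (y j) + h (y i) (y j)))"
      by (simp add: algebra_simps)
    then show ?thesis unfolding half using sipy[of i j] hy[of i j] that q_le_p by simp
  qed
  have ymid: "sip (a i) (y j) = 0" "sip (b i) (y j) = 0" if "i \<in> {1..q}" "j \<in> {q + 1..p}" for i j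
    unfolding sa sb using that sipy[of i j] hy[of i j] q_le_p by auto
  \<comment> \<open>The vectors \<open>a 1, ..., a q\<close> exhaust the eigenspace for -1, which
    has dimension \<open>q\<close>. The component \<open>d\<close> of \<open>y j\<close> in that
    eigenspace is orthogonal to them and to the rest of the basis \<open>z\<close>, hence
    zero.\<close>
  have Jy: "Jmat q *v y j = y j" if j: "j \<in> {q + 1..p}" for j
  proof -
    define d where "d = y j - Jmat q *v y j"
    have Jd: "Jmat q *v d = - d" by (simp add: d_def matrix_vector_mult_diff_distrib)
    define z where "z i = (if i \<le> q then a i else e_vec i)" for i
    have Jz: "Jmat q *v e_vec (idx c) = (e_vec (idx c) :: 'n cvec)" if "\<not> idx c \<le> q" for c :: 'n
      using Jmat_e_vec[of "idx c"] that idx_range[of c] by (simp add: card_n del: e_vec_idx)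
    have zz: "sip (z (idx c)) (z (idx c')) = (if c = c' then 1 else 0)" for c c' :: 'n
    proof (cases "idx c \<le> q"; cases "idx c' \<le> q")
      assume "idx c \<le> q" "idx c' \<le> q"
      then show ?thesis using aa[of "idx c" "idx c'"] by (simp add: z_def)
    next
      assume cc: "idx c \<le> q" "\<not> idx c' \<le> q"
      then have "c \<noteq> c'" by auto
      then show ?thesis using orth_eig[OF Ja Jz[OF cc(2)]] cc by (simp add: z_def del: e_vec_idx)
    next
      assume cc: "\<not> idx c \<le> q" "idx c' \<le> q"
      then have "c \<noteq> c'" by auto
      then show ?thesis using orth_eig[OF Ja Jz[OF cc(1)]] cc sip.zero_sym by (auto simp: z_def simp del: e_vec_idx)
    next
      assume cc: "\<not> idx c \<le> q" "\<not> idx c' \<le> q"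
      have "sip (axis c 1) (axis c' 1 :: 'n cvec) = (\<Sum>x\<in>UNIV. if x = c then (if c = c' then 1 else 0) else 0)"
        unfolding sip_def by (intro sum.cong) (auto simp: axis_def)
      then show ?thesis using cc by (simp add: z_def)
    qed
    have inv: "invertible (colmat z)" using unitary_det[OF unitary_colmat[OF zz]] by simp
    have "sip d (z i) = 0" if i: "1 \<le> i" "i \<le> CARD('n)" for i
    proof (cases "i \<le> q")
      case True
      have "sip (a i) d = sip (a i) (y j) - sip (Jmat q *v a i) (y j)"
        by (simp add: d_def sip.diff_right sip_Jmat)
      then have "sip (a i) d = 0" using ymid(1)[of i j] True i j by (simp add: Ja sip.minus_left)
      then have "sip d (a i) = 0" by (rule sip.zero_sym[THEN iffD1])
      then show ?thesis using True by (simp add: z_def)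
    next
      case False
      then have "Jmat q *v e_vec i = (e_vec i :: 'n cvec)" using Jmat_e_vec[of i] i by (simp add: card_n)
      from orth_eig[OF Jd this] show ?thesis using False by (simp add: z_def)
    qed
    note dz = this
    have "sip d d = 0"
    proof (rule sip.orth_span[rotated])
      have "d \<in> act (colmat z) std_flag CARD('n)"
        using inv by (simp add: complete_flagsD(5))
      then show "d \<in> vec.span ((\<lambda>i. colmat z *v e_vec i) ` {1..CARD('n)})" by (simp add: act_std_flag)
    next
      fix x assume "x \<in> (\<lambda>i. colmat z *v e_vec i) ` {1..CARD('n)}"
      then show "sip d x = 0" using dz by auto
    qed
    then show ?thesis by (simp add: d_def)
  qed
  \<comment> \<open>The images of the standard basis, arranged so that \<open>u i\<close> goes to
    \<open>a i + b i\<close>, a multiple of \<open>y i\<close>, for \<open>i <= q\<close>, and to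
    \<open>y i\<close> for the middle indices.\<close>
  define \<kappa> where "\<kappa> m = (if m \<le> q then a m else if m \<le> 2 * q then b (2 * q + 1 - m) else y (m - q))" for m
  have J\<kappa>: "Jmat q *v \<kappa> m = (if m \<le> q then - \<kappa> m else \<kappa> m)" if "m \<in> {1..p + q}" for m
  proof -
    have "m - q \<in> {q + 1..p}" if "\<not> m \<le> 2 * q" using that \<open>m \<in> {1..p + q}\<close> by auto
    then have "Jmat q *v y (m - q) = y (m - q)" if "\<not> m \<le> 2 * q" using that Jy by blast
    then show ?thesis using q_le_p by (simp add: \<kappa>_def Ja Jb)
  qed
  have \<kappa>lt: "sip (\<kappa> m) (\<kappa> m') = (if m = m' then 1 else 0)" if m: "m \<in> {1..p + q}" "m' \<in> {1..p + q}" "m \<le> m'" for m m'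
  proof -
    consider "m' \<le> q" | "m \<le> q" "q < m'" | "q < m" "m' \<le> 2 * q" | "q < m" "m \<le> 2 * q" "2 * q < m'" | "2 * q < m"
      using m(3) by linarith
    then show ?thesis
    proof cases
      case 1
      then show ?thesis using aa[of m m'] m by (simp add: \<kappa>_def)
    next
      case 2
      then show ?thesis using orth_eig[of "\<kappa> m" "\<kappa> m'"] J\<kappa>[OF m(1)] J\<kappa>[OF m(2)] by simp
    next
      case 3
      then have "2 * q + 1 - m = 2 * q + 1 - m' \<longleftrightarrow> m = m'" using m(3) by linarith
      moreover have "2 * q + 1 - m \<in> {1..q}" "2 * q + 1 - m' \<in> {1..q}" using 3 m(3) by auto
      moreover have "\<kappa> m = b (2 * q + 1 - m)" "\<kappa> m' = b (2 * q + 1 - m')" using 3 m(3) by (simp_all add: \<kappa>_def)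
      ultimately show ?thesis using bb by presburger
    next
      case 4
      then have "m \<noteq> m'" by simp
      moreover have "2 * q + 1 - m \<in> {1..q}" "m' - q \<in> {q + 1..p}" using 4 m by auto
      moreover have "\<kappa> m = b (2 * q + 1 - m)" "\<kappa> m' = y (m' - q)" using 4 by (simp_all add: \<kappa>_def)
      ultimately show ?thesis using ymid(2) by presburger
    next
      case 5
      then have "m - q = m' - q \<longleftrightarrow> m = m'" using m(3) by linarith
      moreover have "m - q \<in> {1..p + q}" "m' - q \<in> {1..p + q}" using 5 m by auto
      moreover have "\<kappa> m = y (m - q)" "\<kappa> m' = y (m' - q)" using 5 m(3) by (simp_all add: \<kappa>_def)
      ultimately show ?thesis using sipy by presburger
    qed
  qed
  have \<kappa>\<kappa>: "sip (\<kappa> (idx c)) (\<kappa> (idx c')) = (if c = c' then 1 else 0)" for c c' :: 'n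
    using \<kappa>lt[of "idx c" "idx c'"] \<kappa>lt[of "idx c'" "idx c"] idx_range[of c] idx_range[of c'] sip.zero_sym[of "\<kappa> (idx c)" "\<kappa> (idx c')"]
    by (cases "idx c \<le> idx c'") (auto simp: card_n split: if_splits)
  have \<kappa>e: "colmat \<kappa> *v e_vec m = \<kappa> m" if "m \<in> {1..p + q}" for m
    using that by (intro colmat_e_vec) (auto simp: card_n)
  have JK: "Jmat q ** colmat \<kappa> = colmat \<kappa> ** Jmat q"
  proof (rule mat_eqI)
    fix m assume "1 \<le> m" "m \<le> CARD('n)"
    then have m: "m \<in> {1..p + q}" by (simp add: card_n)
    have "colmat \<kappa> *v (- e_vec m) = - \<kappa> m"
      using matrix_vector_mult_diff_distrib[of "colmat \<kappa>" 0 "e_vec m"] \<kappa>e[OF m] by simp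
    then show "(Jmat q ** colmat \<kappa>) *v e_vec m = (colmat \<kappa> ** Jmat q) *v e_vec m"
      using J\<kappa>[OF m] \<kappa>e[OF m] Jmat_e_vec[OF m] by (simp flip: matrix_vector_mul_assoc)
  qed
  have ku: "colmat \<kappa> *v u i \<in> F i" if i: "i \<in> {1..p}" for i
  proof (cases "i \<le> q")
    case True
    have "colmat \<kappa> *v u i = \<kappa> i + \<kappa> (2 * q + 1 - i)"
    proof -
      have "i \<in> {1..p + q}" "2 * q + 1 - i \<in> {1..p + q}" using True i q_le_p by auto
      then show ?thesis using True \<kappa>e by (simp only: u_low matrix_vector_right_distrib)
    qed
    also have "\<dots> = a i + b i" using True i by (auto simp: \<kappa>_def)
    also have "\<dots> = of_real (2 / sqrt 2) *s y i"
      unfolding a_def b_def vec_eq_iff by (simp add: scaleR_conv_of_real[where 'a=complex] algebra_simps)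
    finally show ?thesis
      using y[of i] i vec.subspace_scale[OF complete_flagsD(2)[OF F], of "y i" i] by (simp add: card_n)
  next
    case False
    then show ?thesis using \<kappa>e[of "q + i"] i y[of i] by (simp add: u_mid \<kappa>_def card_n)
  qed
  show ?thesis using that[OF unitary_colmat[OF \<kappa>\<kappa>] JK] ku by (simp add: F_def)
qed

text \<open>Let \<open>E\<close> be a coordinate frame in the base cycle and \<open>g\<close> the
  isometry taking it to the sign frame \<open>A\<close> of \<open>V\<close>. Write
  \<open>b = g k\<close> with \<open>k\<close> unitary and commuting with \<open>Jmat q\<close>,
  such that \<open>b\<close> fixes the Iwasawa flag. The frame \<open>k^-1 E\<close> then describes
  a point of the base cycle, and \<open>b\<close> takes this point to \<open>V\<close>, so both lie
  in the same cell.\<close>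

lemma iwasawa_decomposition:
  assumes V: "V \<in> sign_orbit p q \<alpha>" "V \<in> cell U w" and \<alpha>: "length \<alpha> = p + q"
  shows "\<exists>W \<in> cycle \<alpha>. W \<in> cell U w"
proof -
  obtain A where A: "invertible A" "sign_frame \<alpha> A" "V = act A std_flag" using V(1) sign_orbit_iff[OF \<alpha>] by blast
  obtain \<epsilon> where \<epsilon>: "bij_betw \<epsilon> {1..p + q} {1..p + q}" "\<And>k. k \<in> {1..p + q} \<Longrightarrow> \<epsilon> k \<le> q \<longleftrightarrow> \<alpha> ! (k - 1) = Minus"
    using exists_coordinate_flag[OF \<alpha> sign_orbit_count(1)[OF V(1) \<alpha>]] by blast
  define E where "E = (colmat (\<lambda>k. e_vec (\<epsilon> k)) :: 'n cmat)"
  have "map (\<lambda>k. if \<epsilon> (Suc k) \<le> q then Minus else Plus) [0..<p + q] = \<alpha>"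
  proof (rule nth_equalityI)
    fix i assume "i < length (map (\<lambda>k. if \<epsilon> (Suc k) \<le> q then Minus else Plus) [0..<p + q])"
    then show "map (\<lambda>k. if \<epsilon> (Suc k) \<le> q then Minus else Plus) [0..<p + q] ! i = \<alpha> ! i"
      using \<epsilon>(2)[of "Suc i"] by (cases "\<alpha> ! i") auto
  qed (simp add: \<alpha>)
  then have E: "sign_frame \<alpha> E" using coordinate_sign_frame[OF \<epsilon>(1)] by (simp add: E_def)
  have JE: "Jmat q ** E = E ** Dmat \<alpha>" unfolding E_def using coordinate_eigenframe[OF \<epsilon>] .
  have "E = perm_mat \<epsilon>" by (simp add: E_def perm_mat_def)
  then have invE: "invertible E" using invertible_perm_mat[where 'n='n, of \<epsilon>] \<epsilon>(1) by (simp add: card_n)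
  define g where "g = A ** matrix_inv E"
  have g: "invertible g" using A invE by (simp add: g_def invertible_mult)
  have gE: "g ** E = A" using invE by (simp add: g_def flip: matrix_mul_assoc)
  have g_iso: "h (g *v v) (g *v w) = h v w" for v w
    using sign_frame_gram[OF A(2) E, of "matrix_inv E *v v" "matrix_inv E *v w"] invE
    by (simp add: g_def flip: matrix_vector_mul_assoc)
  have inv_iso: "h (matrix_inv g *v v) (matrix_inv g *v w) = h v w" for v w
    using g_iso[of "matrix_inv g *v v" "matrix_inv g *v w"] g by simp
  obtain k where k: "conj_transpose k ** k = mat 1" "Jmat q ** k = k ** Jmat q"
    "\<And>i. i \<in> {1..p} \<Longrightarrow> k *v u i \<in> act (matrix_inv g) (act U std_flag) i"
    using iwasawa_unitary[OF invertible_matrix_inv[OF g] inv_iso] by blast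
  have invk: "invertible k" using unitary_det[OF k(1)] by simp
  have k_iso: "h (k *v v) (k *v w) = h v w" for v w
  proof -
    have "Jmat q *v (k *v v) = k *v (Jmat q *v v)" by (simp add: matrix_vector_mul_assoc k(2))
    then show ?thesis using k(1) by (simp add: h_eq unitary_iff)
  qed
  define b where "b = g ** k"
  have b: "invertible b" using g invk by (simp add: b_def invertible_mult)
  have b_iso: "h (b *v v) (b *v w) = h v w" for v w using g_iso k_iso by (simp add: b_def flip: matrix_vector_mul_assoc)
  have F: "act U std_flag \<in> (complete_flags :: 'n flag set)" using invertible_U by simp
  have low: "act b (act U std_flag) j \<subseteq> act U std_flag j" if "j \<le> p" for j
  proof -
    have "b *v u i \<in> act U std_flag i" if "i \<in> {1..p}" for i
    proof -
      have "g *v (k *v u i) \<in> act g (act (matrix_inv g) (act U std_flag)) i"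
        unfolding act_def[of g] by (intro imageI k(3)[OF that])
      then show ?thesis using g by (simp add: b_def matrix_vector_mul_assoc flip: act_mult)
    qed
    then have "(b ** U) *v e_vec i \<in> act U std_flag j" if "1 \<le> i" "i \<le> j" for i
      using that \<open>j \<le> p\<close> monoD[OF complete_flagsD(1)[OF F], of i j] U_e_vec[of i]
      by (auto simp flip: matrix_vector_mul_assoc)
    then show ?thesis unfolding act_mult[symmetric] by (intro act_subsetI U_flag_subspace)
  qed
  have "act b (act U std_flag) j \<subseteq> act U std_flag j" for j
  \<comment> \<open>The vectors \<open>u i\<close> control only the steps up to \<open>p\<close>. A
    higher step is the orthogonal complement of a step of index at most \<open>q\<close>, and
    \<open>b\<close> is an isometry.\<close>
  proof (cases "j \<le> p")
    case False
    show ?thesis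
    proof (cases "j \<le> p + q")
      case True
      define i where "i = p + q - j"
      have i: "i \<le> q" "j = p + q - i" using False True by (auto simp: i_def)
      have "act b (act U std_flag) i = act U std_flag i"
      proof (rule vec.subspace_dim_equal)
        show "act b (act U std_flag) i \<subseteq> act U std_flag i" using i q_le_p by (intro low) simp
        show "vec.dim (act U std_flag i :: 'n cvec set) \<le> vec.dim (act b (act U std_flag) i)"
          using complete_flagsD(3)[OF F] complete_flagsD(3)[OF act_complete_flags[OF b F]] by simp
      qed (use complete_flagsD(2)[OF act_complete_flags[OF b F]] U_flag_subspace in auto)
      then have sur: "\<exists>w'\<in>act U std_flag i. w = b *v w'" if "w \<in> act U std_flag i" for w
        using that unfolding act_def[of b] by (metis imageE)
      show ?thesis
      proof
        fix x assume "x \<in> act b (act U std_flag) j"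
        then obtain v where v: "x = b *v v" "v \<in> act U std_flag j" unfolding act_def[of b] by blast
        have "h x w = 0" if w: "w \<in> act U std_flag i" for w
        proof -
          obtain w' where "w' \<in> act U std_flag i" "w = b *v w'" using sur[OF w] by blast
          then show ?thesis using v U_flag_perp[OF i(1)] b_iso by (simp add: i(2))
        qed
        then show "x \<in> act U std_flag j" using U_flag_perp[OF i(1)] i(2) by simp
      qed
    next
      case False
      then show ?thesis using complete_flagsD(5)[OF F, of j] by (simp add: card_n)
    qed
  qed (rule low)
  then have bF: "act b (act U std_flag) = act U std_flag"
    using act_complete_flags[OF b F] F by (intro complete_flag_eqI)
  define W where "W = act (matrix_inv k ** E) (std_flag :: 'n flag)"
  have "Jmat q ** (matrix_inv k ** E) = (matrix_inv k ** E) ** Dmat \<alpha>"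
  proof -
    have "matrix_inv k ** (Jmat q ** k) ** matrix_inv k = matrix_inv k ** (k ** Jmat q) ** matrix_inv k" by (simp only: k(2))
    then have "Jmat q ** matrix_inv k = matrix_inv k ** Jmat q"
      using invk by (simp add: matrix_mul_assoc) (simp flip: matrix_mul_assoc add: invk)
    then show ?thesis by (simp add: matrix_mul_assoc) (simp flip: matrix_mul_assoc add: JE)
  qed
  then have "W \<in> cycle \<alpha>" unfolding W_def
    using invk invE by (intro eigenframe_cycle[OF _ _ \<alpha>]) (simp_all add: invertible_mult)
  moreover have "W \<in> cell U w"
  proof -
    have bW: "b ** (matrix_inv k ** E) = A"
      using invk gE by (simp add: b_def flip: matrix_mul_assoc)
    have "matrix_inv U ** matrix_inv b ** U \<in> upper_borel"
    proof -
      have "act (matrix_inv b) (act U std_flag) = act (matrix_inv b) (act b (act U (std_flag :: 'n flag)))" by (simp only: bF)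
      then have "act (matrix_inv b) (act U std_flag) = act U (std_flag :: 'n flag)" using b by (simp flip: act_mult)
      then show ?thesis using borel_conj[of "matrix_inv b"] b by simp
    qed
    moreover have "matrix_inv U ** A \<in> bruhat w" using V(2) A act_mem_cell by blast
    ultimately have "(matrix_inv U ** matrix_inv b ** U) ** (matrix_inv U ** A) ** mat 1 \<in> bruhat w"
      by (intro bruhat_mult) auto
    moreover have "(matrix_inv U ** matrix_inv b ** U) ** (matrix_inv U ** A) ** mat 1 = matrix_inv U ** (matrix_inv k ** E)"
      unfolding bW[symmetric] using b invertible_U by (simp flip: matrix_mul_assoc)
    ultimately show ?thesis unfolding W_def using invk invE by (simp add: act_mem_cell invertible_mult)
  qed
  ultimately show ?thesis by blast
qed

end

subsection \<open>Coordinate flags and the output of the algorithm\<close>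

text \<open>The relative position to the Iwasawa flag of the coordinate flag with the ordered basis
  \<open>e_vec (\<epsilon> 1), \<dots>, e_vec (\<epsilon> n)\<close>.\<close>

definition cell_perm :: "nat \<Rightarrow> nat \<Rightarrow> (nat \<Rightarrow> nat) \<Rightarrow> nat \<Rightarrow> nat" where
  "cell_perm p q \<epsilon> s =
     (if 2 * q < \<epsilon> s then \<epsilon> s - q
      else if \<exists>t\<in>{1..p + q}. s < t \<and> \<epsilon> t = 2 * q + 1 - \<epsilon> s
      then p + q + 1 - min (\<epsilon> s) (2 * q + 1 - \<epsilon> s)
      else min (\<epsilon> s) (2 * q + 1 - \<epsilon> s))"

lemma inv_on_cong: "(\<And>s. s \<in> R \<Longrightarrow> f s = g s) \<Longrightarrow> inv_on R f = inv_on R g"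
  unfolding inv_on_def by (rule arg_cong[of _ _ card]) auto

lemma inv_on_0_iff: "finite R \<Longrightarrow> inv_on R f = 0 \<longleftrightarrow> (\<forall>s\<in>R. \<forall>t\<in>R. s < t \<longrightarrow> f s \<le> f t)"
proof -
  assume R: "finite R"
  have "inv_on R f = 0 \<longleftrightarrow> {(s, t). s \<in> R \<and> t \<in> R \<and> s < t \<and> f s > f t} = {}"
    unfolding inv_on_def using inv_on_finite[OF R, of f] by simp
  also have "\<dots> \<longleftrightarrow> (\<forall>s\<in>R. \<forall>t\<in>R. s < t \<longrightarrow> f s \<le> f t)" unfolding not_less[symmetric] by blast
  finally show ?thesis .
qed

text \<open>\<open>l j\<close> and \<open>r j\<close> are the left and the right one of the places
  of the partners \<open>j\<close> and \<open>2 * q + 1 - j\<close>, counted from 0 as in the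
  algorithm, whereas \<open>\<epsilon>\<close> counts from 1; hence the \<open>Suc\<close>.\<close>

locale positions =
  fixes p q :: nat and \<epsilon> l r :: "nat \<Rightarrow> nat"
  assumes q_le_p: "q \<le> p"
    and bij: "bij_betw \<epsilon> {1..p + q} {1..p + q}"
    and l_less_r: "\<And>j. 1 \<le> j \<Longrightarrow> j \<le> q \<Longrightarrow> l j < r j \<and> r j < p + q"
    and eps_values: "\<And>j. 1 \<le> j \<Longrightarrow> j \<le> q \<Longrightarrow>
      \<epsilon> (Suc (l j)) = j \<and> \<epsilon> (Suc (r j)) = 2 * q + 1 - j \<or> \<epsilon> (Suc (l j)) = 2 * q + 1 - j \<and> \<epsilon> (Suc (r j)) = j"
begin

lemma inj: "s < p + q \<Longrightarrow> t < p + q \<Longrightarrow> \<epsilon> (Suc s) = \<epsilon> (Suc t) \<Longrightarrow> s = t"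
  using inj_onD[OF bij_betw_imp_inj_on[OF bij], of "Suc s" "Suc t"] by simp

lemma range: "s < p + q \<Longrightarrow> 1 \<le> \<epsilon> (Suc s) \<and> \<epsilon> (Suc s) \<le> p + q"
  using bij_betwE[OF bij, rule_format, of "Suc s"] by simp

lemma values_min: "1 \<le> j \<Longrightarrow> j \<le> q \<Longrightarrow> min (\<epsilon> (Suc (l j))) (2 * q + 1 - \<epsilon> (Suc (l j))) = j \<and>
    min (\<epsilon> (Suc (r j))) (2 * q + 1 - \<epsilon> (Suc (r j))) = j \<and> \<epsilon> (Suc (l j)) \<le> 2 * q \<and> \<epsilon> (Suc (r j)) \<le> 2 * q \<and>
    \<epsilon> (Suc (l j)) + \<epsilon> (Suc (r j)) = 2 * q + 1"
  using eps_values[of j] by auto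

lemma l_free: "1 \<le> j \<Longrightarrow> j \<le> q \<Longrightarrow> i \<le> j \<Longrightarrow> l j \<in> free (p + q) l r i"
  and r_free: "1 \<le> j \<Longrightarrow> j \<le> q \<Longrightarrow> i \<le> j \<Longrightarrow> r j \<in> free (p + q) l r i"
proof -
  assume j: "1 \<le> j" "j \<le> q" "i \<le> j"
  have *: "l j \<noteq> l k \<and> l j \<noteq> r k \<and> r j \<noteq> l k \<and> r j \<noteq> r k" if "1 \<le> k" "k < i" for k
  proof -
    have "k \<le> q" "k \<noteq> j" using that j by auto
    then show ?thesis using values_min[OF j(1,2)] values_min[of k] that(1) by metis
  qed
  then show "l j \<in> free (p + q) l r i" "r j \<in> free (p + q) l r i"
    using l_less_r[OF j(1,2)] by (auto simp: free_def)
qed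

sublocale pairing "p + q" q l r
  using l_less_r l_free r_free by unfold_locales auto

lemma pos: "1 \<le> v \<Longrightarrow> v \<le> p + q \<Longrightarrow> \<exists>s<p + q. \<epsilon> (Suc s) = v"
proof -
  assume "1 \<le> v" "v \<le> p + q"
  then have "v \<in> \<epsilon> ` {1..p + q}" using bij by (simp add: bij_betw_def)
  then obtain k where k: "k \<in> {1..p + q}" "\<epsilon> k = v" by auto
  then have "k - 1 < p + q" "Suc (k - 1) = k" by auto
  then show ?thesis using k by metis
qed

lemma free_iff: "s < p + q \<Longrightarrow> s \<in> free (p + q) l r (Suc q) \<longleftrightarrow> 2 * q < \<epsilon> (Suc s)"
proof
  assume s: "s < p + q" and fr: "s \<in> free (p + q) l r (Suc q)"
  show "2 * q < \<epsilon> (Suc s)"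
  proof (rule ccontr)
    assume "\<not> 2 * q < \<epsilon> (Suc s)"
    define j where "j = min (\<epsilon> (Suc s)) (2 * q + 1 - \<epsilon> (Suc s))"
    have j: "1 \<le> j" "j \<le> q" "\<epsilon> (Suc s) = j \<or> \<epsilon> (Suc s) = 2 * q + 1 - j"
      using range[OF s] \<open>\<not> 2 * q < \<epsilon> (Suc s)\<close> by (auto simp: j_def)
    then have "\<epsilon> (Suc s) = \<epsilon> (Suc (l j)) \<or> \<epsilon> (Suc s) = \<epsilon> (Suc (r j))" using eps_values[OF j(1,2)] by auto
    then have "s = l j \<or> s = r j" using inj[OF s] l_less_r[OF j(1,2)] by auto
    then show False using free_avoid[OF fr j(1)] j(2) by auto
  qed
next
  assume s: "s < p + q" "2 * q < \<epsilon> (Suc s)"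
  show "s \<in> free (p + q) l r (Suc q)"
  proof (rule ccontr)
    assume "\<not> ?thesis"
    then obtain j where "1 \<le> j" "j < Suc q" "s = l j \<or> s = r j" using not_freeE[OF s(1)] by blast
    then show False using values_min[of j] s(2) by auto
  qed
qed

abbreviation "f s \<equiv> cell_perm p q \<epsilon> (Suc s)"

lemma f_values:
  "1 \<le> j \<Longrightarrow> j \<le> q \<Longrightarrow> f (l j) = p + q + 1 - j \<and> f (r j) = j"
proof -
  assume j: "1 \<le> j" "j \<le> q"
  note v = values_min[OF j] and lr = l_less_r[OF j]
  have A: "\<exists>t\<in>{1..p + q}. Suc (l j) < t \<and> \<epsilon> t = 2 * q + 1 - \<epsilon> (Suc (l j))"
    using v lr by (intro bexI[of _ "Suc (r j)"] conjI) auto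
  have B: "\<not> (\<exists>t\<in>{1..p + q}. Suc (r j) < t \<and> \<epsilon> t = 2 * q + 1 - \<epsilon> (Suc (r j)))"
  proof (rule notI, elim bexE conjE)
    fix t assume t: "t \<in> {1..p + q}" "Suc (r j) < t" "\<epsilon> t = 2 * q + 1 - \<epsilon> (Suc (r j))"
    then have "\<epsilon> (Suc (t - 1)) = \<epsilon> (Suc (l j))" using v by auto
    moreover have "t - 1 < p + q" "l j < p + q" using t lr by auto
    ultimately have "t - 1 = l j" using inj by blast
    then show False using t lr by auto
  qed
  show ?thesis using v unfolding cell_perm_def if_P[OF A] if_not_P[OF B] by simp
qed

lemma f_free: "s \<in> free (p + q) l r (Suc q) \<Longrightarrow> f s = \<epsilon> (Suc s) - q"
  using free_iff[of s] by (auto simp: cell_perm_def free_def)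

lemma f_bij: "bij_betw (cell_perm p q \<epsilon>) {1..p + q} {1..p + q}"
proof -
  have sub: "{1..p + q} \<subseteq> cell_perm p q \<epsilon> ` {1..p + q}"
  proof
    fix v assume v: "v \<in> {1..p + q}"
    consider "v \<le> q" | "q < v" "v \<le> p" | "p < v" by linarith
    then have "\<exists>s<p + q. f s = v"
    proof cases
      case 1
      then show ?thesis using f_values[of v] l_less_r[of v] v by auto
    next
      case 2
      then obtain s where s: "s < p + q" "\<epsilon> (Suc s) = v + q" using pos[of "v + q"] by auto
      then have "s \<in> free (p + q) l r (Suc q)" using free_iff[OF s(1)] 2 by simp
      then show ?thesis using f_free s by force
    next
      case 3
      define j where "j = p + q + 1 - v"
      have "1 \<le> j" "j \<le> q" "p + q + 1 - j = v" using 3 v by (auto simp: j_def)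
      then show ?thesis using f_values[of j] l_less_r[of j] by (intro exI[of _ "l j"]) auto
    qed
    then obtain s where s: "s < p + q" "f s = v" by blast
    then show "v \<in> cell_perm p q \<epsilon> ` {1..p + q}" by (intro image_eqI[of _ _ "Suc s"]) auto
  qed
  have "card (cell_perm p q \<epsilon> ` {1..p + q}) \<le> card {1..p + q}" by (rule card_image_le) simp
  then have eq: "{1..p + q} = cell_perm p q \<epsilon> ` {1..p + q}" by (intro card_seteq[OF _ sub]) auto
  then have "inj_on (cell_perm p q \<epsilon>) {1..p + q}" by (intro eq_card_imp_inj_on) auto
  with eq show ?thesis by (simp add: bij_betw_def)
qed

text \<open>The excess over \<open>p * q\<close> consists of the free places between partners and of
  the inversions among the single elements. It vanishes exactly if partners are adjacent when they
  are placed and the single elements are increasing, which are the rules of the algorithm.\<close>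

lemma inv_on_f: "inv_on {1..p + q} (cell_perm p q \<epsilon>) = p * q +
    (\<Sum>j=1..q. card {t \<in> free (p + q) l r j. l j < t \<and> t < r j}) + inv_on (free (p + q) l r (Suc q)) f"
proof -
  have "inv_on {1..p + q} (cell_perm p q \<epsilon>) = inv_on {1..p + q} (\<lambda>k. f (k - 1))"
    by (rule inv_on_cong) auto
  also have "\<dots> = inv_on {..<p + q} f" by (rule inv_on_shift)
  also have "\<dots> = q * (p + q - q) + (\<Sum>j=1..q. card {t \<in> free (p + q) l r j. l j < t \<and> t < r j}) +
      inv_on (free (p + q) l r (Suc q)) f"
  proof (rule inv_on_pairing)
    fix t assume t: "t \<in> free (p + q) l r (Suc q)"
    then have tn: "t < p + q" by (simp add: free_def)
    show "q < f t \<and> f t + q \<le> p + q" using f_free[OF t] free_iff[OF tn] range[OF tn] t by auto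
  qed (use f_values q_le_p in auto)
  finally show ?thesis by (simp add: mult.commute)
qed

text \<open>Increasing single elements are numbered consecutively from left to right starting with
  \<open>2 * q + 1\<close>, which is how \<open>fill_signs\<close> generates them.\<close>

lemma sorted_free_card:
  assumes sorted: "\<And>s t. s \<in> free (p + q) l r (Suc q) \<Longrightarrow> t \<in> free (p + q) l r (Suc q) \<Longrightarrow> s < t \<Longrightarrow> \<epsilon> (Suc s) < \<epsilon> (Suc t)"
    and s: "s \<in> free (p + q) l r (Suc q)"
  shows "\<epsilon> (Suc s) = 2 * q + 1 + card {t \<in> free (p + q) l r (Suc q). t < s}"
proof -
  let ?F = "free (p + q) l r (Suc q)"
  have sn: "s < p + q" using s by (simp add: free_def)
  have "bij_betw (\<lambda>t. \<epsilon> (Suc t)) {t \<in> ?F. t < s} {2 * q + 1..<\<epsilon> (Suc s)}"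
    unfolding bij_betw_def
  proof
    show "inj_on (\<lambda>t. \<epsilon> (Suc t)) {t \<in> ?F. t < s}" using inj by (auto simp: inj_on_def free_def)
    show "(\<lambda>t. \<epsilon> (Suc t)) ` {t \<in> ?F. t < s} = {2 * q + 1..<\<epsilon> (Suc s)}"
    proof (intro equalityI subsetI)
      fix v assume "v \<in> (\<lambda>t. \<epsilon> (Suc t)) ` {t \<in> ?F. t < s}"
      then obtain t where t: "t \<in> ?F" "t < s" "v = \<epsilon> (Suc t)" by auto
      then show "v \<in> {2 * q + 1..<\<epsilon> (Suc s)}"
        using sorted[OF t(1) s t(2)] free_iff[of t] sn by auto
    next
      fix v assume v: "v \<in> {2 * q + 1..<\<epsilon> (Suc s)}"
      then obtain t where t: "t < p + q" "\<epsilon> (Suc t) = v" using pos[of v] range[OF sn] by auto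
      then have tF: "t \<in> ?F" using free_iff v by auto
      have "t < s"
      proof (rule ccontr)
        assume "\<not> t < s"
        then have "t = s \<or> s < t" by auto
        then show False using sorted[OF s tF] t v by auto
      qed
      then show "v \<in> (\<lambda>t. \<epsilon> (Suc t)) ` {t \<in> ?F. t < s}" using t tF by auto
    qed
  qed
  then have "card {t \<in> ?F. t < s} = \<epsilon> (Suc s) - (2 * q + 1)" by (simp add: bij_betw_same_card)
  then show ?thesis using s free_iff[OF sn] by simp
qed

end

lemma positions_exist:
  assumes "q \<le> p" and bij: "bij_betw \<epsilon> {1..p + q} {1..p + q}"
  obtains l r where "positions p q \<epsilon> l r"
proof -
  define P where "P v = inv_into {1..p + q} \<epsilon> v - 1" for v
  have P: "P v < p + q \<and> \<epsilon> (Suc (P v)) = v" if "1 \<le> v" "v \<le> p + q" for v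
  proof -
    have v: "v \<in> {1..p + q}" using that by simp
    have i: "inv_into {1..p + q} \<epsilon> v \<in> {1..p + q}" using bij_betwE[OF bij_betw_inv_into[OF bij]] v by blast
    then have "Suc (P v) = inv_into {1..p + q} \<epsilon> v" by (auto simp: P_def)
    then show ?thesis using i bij_betw_inv_into_right[OF bij v] by (metis Suc_le_eq atLeastAtMost_iff)
  qed
  define l r where "l j = min (P j) (P (2 * q + 1 - j))" and "r j = max (P j) (P (2 * q + 1 - j))" for j
  have "positions p q \<epsilon> l r"
  proof
    fix j assume j: "1 \<le> j" "j \<le> q"
    then have a: "P j < p + q" "\<epsilon> (Suc (P j)) = j" using P[of j] assms by auto
    have b: "P (2 * q + 1 - j) < p + q" "\<epsilon> (Suc (P (2 * q + 1 - j))) = 2 * q + 1 - j"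
      using P[of "2 * q + 1 - j"] j assms by auto
    have ne: "P j \<noteq> P (2 * q + 1 - j)"
    proof
      assume "P j = P (2 * q + 1 - j)"
      then have "j = 2 * q + 1 - j" using a b by simp
      then show False using j by linarith
    qed
    then show "l j < r j \<and> r j < p + q" using a b by (auto simp: l_def r_def)
    show "\<epsilon> (Suc (l j)) = j \<and> \<epsilon> (Suc (r j)) = 2 * q + 1 - j \<or> \<epsilon> (Suc (l j)) = 2 * q + 1 - j \<and> \<epsilon> (Suc (r j)) = j"
      using a b by (auto simp: l_def r_def min_def max_def)
  qed (use assms in auto)
  then show ?thesis by (rule that)
qed

lemma cell_perm_bij:
  assumes "q \<le> p" "bij_betw \<epsilon> {1..p + q} {1..p + q}"
  shows "bij_betw (cell_perm p q \<epsilon>) {1..p + q} {1..p + q}"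
proof -
  obtain l r where "positions p q \<epsilon> l r" using positions_exist[OF assms] .
  then show ?thesis by (rule positions.f_bij)
qed

text \<open>\<open>cell_perm\<close> only forgets which of the two partners is \<open>j\<close> and
  which is \<open>2 * q + 1 - j\<close>; whether the entry is at most \<open>q\<close>, its sign,
  restores this.\<close>

lemma cell_perm_inject:
  assumes "q \<le> p" and bij: "bij_betw \<epsilon> {1..p + q} {1..p + q}" "bij_betw \<delta> {1..p + q} {1..p + q}"
    and sign: "\<epsilon> k \<le> q \<longleftrightarrow> \<delta> k \<le> q" and eq: "cell_perm p q \<epsilon> k = cell_perm p q \<delta> k" and k: "k \<in> {1..p + q}"
  shows "\<epsilon> k = \<delta> k"
proof -
  have r: "1 \<le> \<epsilon> k" "\<epsilon> k \<le> p + q" "1 \<le> \<delta> k" "\<delta> k \<le> p + q"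
    using bij_betwE[OF bij(1), rule_format, OF k] bij_betwE[OF bij(2), rule_format, OF k] by auto
  have mid: "2 * q < f k \<longleftrightarrow> q < cell_perm p q f k \<and> cell_perm p q f k \<le> p" if "1 \<le> f k" "f k \<le> p + q" for f
    using that assms(1) by (auto simp: cell_perm_def)
  have out: "min (f k) (2 * q + 1 - f k) = min (cell_perm p q f k) (p + q + 1 - cell_perm p q f k)"
    if "1 \<le> f k" "f k \<le> 2 * q" for f
    using that assms(1) by (auto simp: cell_perm_def min_def)
  show ?thesis
  proof (cases "2 * q < \<epsilon> k")
    case True
    then have "2 * q < \<delta> k" using mid[of \<epsilon>] mid[of \<delta>] r eq by simp
    then show ?thesis using True eq by (simp add: cell_perm_def)
  next
    case False
    then have "\<not> 2 * q < \<delta> k" using mid[of \<epsilon>] mid[of \<delta>] r eq by simp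
    then have "min (\<epsilon> k) (2 * q + 1 - \<epsilon> k) = min (\<delta> k) (2 * q + 1 - \<delta> k)"
      using out[of \<epsilon>] out[of \<delta>] r eq False by simp
    then show ?thesis using sign False \<open>\<not> 2 * q < \<delta> k\<close> r by (auto simp: min_def split: if_splits)
  qed
qed

lemma coordinate_flag_algorithm:
  assumes qp: "q \<le> p" and bij: "bij_betw \<epsilon> {1..p + q} {1..p + q}" and len: "length \<alpha> = p + q"
    and sign: "\<And>k. k \<in> {1..p + q} \<Longrightarrow> \<epsilon> k \<le> q \<longleftrightarrow> \<alpha> ! (k - 1) = Minus"
    and inv: "inv_on {1..p + q} (cell_perm p q \<epsilon>) = p * q"
  shows "algorithm_output p q \<alpha> (map \<epsilon> [1..<p + q + 1]) (map (cell_perm p q \<epsilon>) [1..<p + q + 1])"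
proof -
  obtain l r where "positions p q \<epsilon> l r" using positions_exist[OF qp bij] .
  then interpret positions p q \<epsilon> l r .
  let ?F = "free (p + q) l r (Suc q)"
  have zero: "(\<Sum>j=1..q. card {t \<in> free (p + q) l r j. l j < t \<and> t < r j}) = 0" "inv_on ?F f = 0"
    using inv_on_f inv by auto
  have adj: "\<not> (l j < t \<and> t < r j)" if "1 \<le> j" "j \<le> q" "t \<in> free (p + q) l r j" for j t
  proof -
    have "card {t \<in> free (p + q) l r j. l j < t \<and> t < r j} = 0" using zero(1) that by simp
    then have "{t \<in> free (p + q) l r j. l j < t \<and> t < r j} = {}" by simp
    then show ?thesis using that by blast
  qed
  have sorted: "\<epsilon> (Suc s) < \<epsilon> (Suc t)" if "s \<in> ?F" "t \<in> ?F" "s < t" for s t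
  proof -
    have "f s \<le> f t" using zero(2) that by (simp add: inv_on_0_iff)
    moreover have "s < p + q" "t < p + q" using that by (auto simp: free_def)
    ultimately have "\<epsilon> (Suc s) \<le> \<epsilon> (Suc t)" "\<epsilon> (Suc s) \<noteq> \<epsilon> (Suc t)"
      using f_free[OF that(1)] f_free[OF that(2)] free_iff[of s] free_iff[of t] that inj[of s t] by auto
    then show ?thesis by simp
  qed
  have sg: "\<alpha> ! s = Minus \<longleftrightarrow> \<epsilon> (Suc s) \<le> q" if "s < p + q" for s using sign[of "Suc s"] that by simp
  \<comment> \<open>The final state of the run to be constructed: the single elements, which
    \<open>fill_signs\<close> will put back, are replaced by their signs.\<close>
  define e where "e = map (\<lambda>s. if s \<in> ?F then Inl (\<alpha> ! s) else Inr (\<epsilon> (Suc s))) [0..<p + q]"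
  define w where "w = map (\<lambda>s. if s \<in> ?F then Inl (\<alpha> ! s) else Inr (f s)) [0..<p + q]"
  have st: "pairing_state p q \<alpha> q l r e w"
    unfolding pairing_state_def
  proof (intro conjI allI impI ballI)
    fix j assume j: "1 \<le> j \<and> j \<le> q"
    then have lr: "l j < r j" "r j < p + q" "l j < p + q" using l_less_r[of j] by auto
    have nf: "l j \<notin> ?F" "r j \<notin> ?F" using free_avoid[of _ "p + q" l r "Suc q" j] j by auto
    have par: "paired_number q (\<alpha> ! l j) j = \<epsilon> (Suc (l j))" "paired_number q (\<alpha> ! r j) j = \<epsilon> (Suc (r j))" "\<alpha> ! l j \<noteq> \<alpha> ! r j"
      using eps_values[of j] j sg[OF lr(2)] sg[OF lr(3)] by (auto simp: paired_number_def)
    show "l j < r j" "\<alpha> ! l j \<noteq> \<alpha> ! r j" by fact+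
    show "l j \<in> free (p + q) l r j" "r j \<in> free (p + q) l r j" using l_free r_free j by auto
    show "e ! l j = Inr (paired_number q (\<alpha> ! l j) j)" "e ! r j = Inr (paired_number q (\<alpha> ! r j) j)"
      using lr nf by (simp_all add: e_def par)
    show "w ! l j = Inr (p + q + 1 - j)" "w ! r j = Inr j" using lr nf f_values[of j] j by (simp_all add: w_def)
    fix t assume "t \<in> free (p + q) l r j"
    then show "\<not> (l j < t \<and> t < r j)" using adj j by blast
  next
    fix s assume s: "s \<in> ?F"
    then have "s < p + q" by (simp add: free_def)
    then show "e ! s = Inl (\<alpha> ! s)" "w ! s = Inl (\<alpha> ! s)" using s by (simp_all add: e_def w_def)
  qed (simp_all add: e_def w_def)
  have isl_eq: "{t. t < s \<and> isl (e ! t)} = {t \<in> ?F. t < s}" "{t. t < s \<and> isl (w ! t)} = {t \<in> ?F. t < s}" if "s < p + q" for s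
    using that by (auto simp: pairing_state_isl[OF st])
  have "fill_signs (2 * q + 1) e = map \<epsilon> [1..<p + q + 1]"
  proof (rule nth_equalityI)
    fix s assume "s < length (fill_signs (2 * q + 1) e)"
    then have s: "s < p + q" by (simp add: e_def)
    have "fill_signs (2 * q + 1) e ! s = (case e ! s of Inl _ \<Rightarrow> 2 * q + 1 + card {t. t < s \<and> isl (e ! t)} | Inr k \<Rightarrow> k)"
      using s by (intro fill_signs_nth) (simp add: e_def)
    also have "\<dots> = \<epsilon> (Suc s)"
      unfolding isl_eq[OF s] using s sorted_free_card[OF sorted, of s] by (auto simp: e_def)
    finally show "fill_signs (2 * q + 1) e ! s = map \<epsilon> [1..<p + q + 1] ! s" using s by (simp del: upt_Suc)
  qed (simp add: e_def del: upt_Suc)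
  moreover have "fill_signs (q + 1) w = map (cell_perm p q \<epsilon>) [1..<p + q + 1]"
  proof (rule nth_equalityI)
    fix s assume "s < length (fill_signs (q + 1) w)"
    then have s: "s < p + q" by (simp add: w_def)
    have "fill_signs (q + 1) w ! s = (case w ! s of Inl _ \<Rightarrow> q + 1 + card {t. t < s \<and> isl (w ! t)} | Inr k \<Rightarrow> k)"
      using s by (intro fill_signs_nth) (simp add: w_def)
    also have "\<dots> = f s"
      unfolding isl_eq[OF s] using s sorted_free_card[OF sorted, of s] f_free[of s] by (auto simp: w_def)
    finally show "fill_signs (q + 1) w ! s = map (cell_perm p q \<epsilon>) [1..<p + q + 1] ! s" using s by (simp del: upt_Suc)
  qed (simp add: w_def del: upt_Suc)
  moreover have "algorithm_steps p q \<alpha> q e w" by (rule state_imp_algorithm_steps[OF st order_refl len])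
  ultimately show ?thesis unfolding algorithm_output_def by metis
qed

lemma algorithm_coordinate_flag:
  assumes out: "algorithm_output p q \<alpha> es ws" and len: "length \<alpha> = p + q" and qp: "q \<le> p"
    and cnt: "count_list \<alpha> Minus = q"
  defines "\<epsilon> \<equiv> \<lambda>k. es ! (k - 1)"
  shows "length es = p + q" "length ws = p + q" "bij_betw \<epsilon> {1..p + q} {1..p + q}"
    "\<And>k. k \<in> {1..p + q} \<Longrightarrow> \<epsilon> k \<le> q \<longleftrightarrow> \<alpha> ! (k - 1) = Minus"
    "\<And>k. k \<in> {1..p + q} \<Longrightarrow> ws ! (k - 1) = cell_perm p q \<epsilon> k"
    "inv_on {1..p + q} (cell_perm p q \<epsilon>) = p * q"
proof -
  obtain e w where steps: "algorithm_steps p q \<alpha> q e w" and es: "es = fill_signs (2 * q + 1) e" and ws: "ws = fill_signs (q + 1) w"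
    using out by (auto simp: algorithm_output_def)
  obtain l r where st: "pairing_state p q \<alpha> q l r e w" using algorithm_steps_imp_state[OF steps len] by blast
  interpret pr: pairing "p + q" q l r by (rule pairing_state_pairing[OF st])
  let ?F = "free (p + q) l r (Suc q)"
  have ln: "length e = p + q" "length w = p + q" using st by (auto simp: pairing_state_def)
  then show lens: "length es = p + q" "length ws = p + q" by (simp_all add: es ws)
  \<comment> \<open>The \<open>q\<close> pairs have used all \<open>q\<close> minus signs.\<close>
  have plus: "\<alpha> ! s = Plus" if "s \<in> ?F" for s
  proof -
    have "card {t \<in> ?F. \<alpha> ! t = Minus} = 0" using card_free_sign[OF st len, of Minus] cnt by simp
    then have "\<alpha> ! s \<noteq> Minus" using that by auto
    then show ?thesis by (cases "\<alpha> ! s") auto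
  qed
  have isl_eq: "{t. t < s \<and> isl (e ! t)} = {t \<in> ?F. t < s}" "{t. t < s \<and> isl (w ! t)} = {t \<in> ?F. t < s}" if "s < p + q" for s
    using that by (auto simp: pairing_state_isl[OF st])
  have es_free: "es ! s = 2 * q + 1 + card {t \<in> ?F. t < s}" "ws ! s = q + 1 + card {t \<in> ?F. t < s}" if "s \<in> ?F" for s
  proof -
    have s: "s < p + q" using that by (simp add: free_def)
    have "e ! s = Inl (\<alpha> ! s)" "w ! s = Inl (\<alpha> ! s)" using st that by (auto simp: pairing_state_def)
    then show "es ! s = 2 * q + 1 + card {t \<in> ?F. t < s}" "ws ! s = q + 1 + card {t \<in> ?F. t < s}"
      using s ln by (simp_all add: es ws fill_signs_nth isl_eq[OF s])
  qed
  have pair: "l j < r j" "r j < p + q" "\<alpha> ! l j \<noteq> \<alpha> ! r j" "es ! l j = paired_number q (\<alpha> ! l j) j"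
      "es ! r j = paired_number q (\<alpha> ! r j) j" "ws ! l j = p + q + 1 - j" "ws ! r j = j"
      "\<forall>t\<in>free (p + q) l r j. \<not> (l j < t \<and> t < r j)" if "1 \<le> j" "j \<le> q" for j
  proof -
    have j: "l j < r j \<and> l j \<in> free (p + q) l r j \<and> r j \<in> free (p + q) l r j \<and>
      (\<forall>t\<in>free (p + q) l r j. \<not> (l j < t \<and> t < r j)) \<and> \<alpha> ! l j \<noteq> \<alpha> ! r j \<and>
      e ! l j = Inr (paired_number q (\<alpha> ! l j) j) \<and> e ! r j = Inr (paired_number q (\<alpha> ! r j) j) \<and>
      w ! l j = Inr (p + q + 1 - j) \<and> w ! r j = Inr j" using st that unfolding pairing_state_def by blast
    then have n: "l j < p + q" "r j < p + q" by (auto simp: free_def)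
    show "l j < r j" "r j < p + q" "\<alpha> ! l j \<noteq> \<alpha> ! r j" "es ! l j = paired_number q (\<alpha> ! l j) j"
      "es ! r j = paired_number q (\<alpha> ! r j) j" "ws ! l j = p + q + 1 - j" "ws ! r j = j"
      "\<forall>t\<in>free (p + q) l r j. \<not> (l j < t \<and> t < r j)"
      using j n ln by (simp_all add: es ws fill_signs_nth)
  qed
  have vals: "es ! l j = j \<and> es ! r j = 2 * q + 1 - j \<or> es ! l j = 2 * q + 1 - j \<and> es ! r j = j" if "1 \<le> j" "j \<le> q" for j
    using pair[OF that] by (cases "\<alpha> ! l j"; cases "\<alpha> ! r j") (simp_all add: paired_number_def)
  have small: "card {t \<in> ?F. t < s} < card {t \<in> ?F. t < s'}" if "s \<in> ?F" "s < s'" for s s'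
    by (rule psubset_card_mono) (use that in auto)
  have "card {t \<in> ?F. t < s} < card ?F" if "s \<in> ?F" for s
    by (rule psubset_card_mono) (use that in auto)
  then have bound: "2 * q + 1 + card {t \<in> ?F. t < s} \<le> p + q" if "s \<in> ?F" for s
    using pr.card_free[of q] that by fastforce
  have cases_s: "s \<in> ?F \<or> (\<exists>j. 1 \<le> j \<and> j \<le> q \<and> (s = l j \<or> s = r j))" if "s < p + q" for s
    using not_freeE[OF that, of l r "Suc q"] by (metis less_Suc_eq_le)
  have outer: "1 \<le> es ! s \<and> es ! s \<le> 2 * q \<and> (s = l j \<or> s = r j) \<and> 1 \<le> j \<and> j \<le> q \<and> j = min (es ! s) (2 * q + 1 - es ! s)"
    if "1 \<le> j" "j \<le> q" "s = l j \<or> s = r j" for s j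
    using vals[OF that(1,2)] that by (auto simp: min_def)
  have "inj_on (\<lambda>s. es ! s) {..<p + q}"
  proof (rule inj_onI)
    fix s t assume st: "s \<in> {..<p + q}" "t \<in> {..<p + q}" "es ! s = es ! t"
    show "s = t"
    proof (cases "s \<in> ?F"; cases "t \<in> ?F")
      assume "s \<in> ?F" "t \<in> ?F"
      then show ?thesis using es_free st small[of s t] small[of t s] by (cases s t rule: linorder_cases) auto
    next
      assume "s \<in> ?F" "t \<notin> ?F"
      then obtain j where "1 \<le> j" "j \<le> q" "t = l j \<or> t = r j" using cases_s[of t] st by auto
      then show ?thesis using outer[of j t] es_free(1)[OF \<open>s \<in> ?F\<close>] st by auto
    next
      assume "s \<notin> ?F" "t \<in> ?F"
      then obtain j where "1 \<le> j" "j \<le> q" "s = l j \<or> s = r j" using cases_s[of s] st by auto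
      then show ?thesis using outer[of j s] es_free(1)[OF \<open>t \<in> ?F\<close>] st by auto
    next
      assume "s \<notin> ?F" "t \<notin> ?F"
      then obtain j k where j: "1 \<le> j" "j \<le> q" "s = l j \<or> s = r j" and k: "1 \<le> k" "k \<le> q" "t = l k \<or> t = r k"
        using cases_s[of s] cases_s[of t] st by auto
      have "j = k" using outer[OF j] outer[OF k] st(3) by auto
      then show ?thesis using j k st(3) vals[OF j(1,2)] by auto
    qed
  qed
  moreover have "es ! s \<in> {1..p + q}" if "s < p + q" for s
    using cases_s[OF that] es_free(1)[of s] bound[of s] outer[of _ s] qp by fastforce
  moreover have "s - 1 < p + q" if "s \<in> {1..p + q}" for s using that by auto
  ultimately have sub: "\<epsilon> ` {1..p + q} \<subseteq> {1..p + q}" and "inj_on (\<lambda>s. es ! s) ((\<lambda>k. k - 1) ` {1..p + q})"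
    by (auto simp: \<epsilon>_def elim!: inj_on_subset)
  moreover have "inj_on (\<lambda>k::nat. k - 1) {1..p + q}" by (auto simp: inj_on_def)
  ultimately have "inj_on ((\<lambda>s. es ! s) \<circ> (\<lambda>k. k - 1)) {1..p + q}" by (intro comp_inj_on)
  then have inj: "inj_on \<epsilon> {1..p + q}" by (simp add: \<epsilon>_def o_def)
  with sub show bij: "bij_betw \<epsilon> {1..p + q} {1..p + q}" by (simp add: bij_betw_def endo_inj_surj)
  have pos: "positions p q \<epsilon> l r"
    by unfold_locales (use qp bij pair vals in \<open>auto simp: \<epsilon>_def\<close>)
  then interpret positions p q \<epsilon> l r .
  have sg: "es ! s \<le> q \<longleftrightarrow> \<alpha> ! s = Minus" if "s < p + q" for s
    using cases_s[OF that]
  proof (elim disjE exE conjE)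
    assume "s \<in> ?F"
    then show ?thesis using es_free plus by simp
  next
    fix j assume j: "1 \<le> j" "j \<le> q" "s = l j"
    then show ?thesis using pair[OF j(1,2)] by (auto simp: paired_number_def)
  next
    fix j assume j: "1 \<le> j" "j \<le> q" "s = r j"
    then show ?thesis using pair[OF j(1,2)] by (auto simp: paired_number_def)
  qed
  show "\<epsilon> k \<le> q \<longleftrightarrow> \<alpha> ! (k - 1) = Minus" if "k \<in> {1..p + q}" for k
    using sg[of "k - 1"] that by (auto simp: \<epsilon>_def)
  have wf: "ws ! s = f s" if "s < p + q" for s
    using cases_s[OF that]
  proof (elim disjE exE conjE)
    assume s: "s \<in> ?F"
    then show ?thesis using f_free[OF s] es_free[OF s] by (simp add: \<epsilon>_def)
  next
    fix j assume j: "1 \<le> j" "j \<le> q" "s = l j"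
    then show ?thesis using pair[OF j(1,2)] f_values[OF j(1,2)] by simp
  next
    fix j assume j: "1 \<le> j" "j \<le> q" "s = r j"
    then show ?thesis using pair[OF j(1,2)] f_values[OF j(1,2)] by simp
  qed
  show "ws ! (k - 1) = cell_perm p q \<epsilon> k" if "k \<in> {1..p + q}" for k
    using wf[of "k - 1"] that by auto
  have "card {t \<in> free (p + q) l r j. l j < t \<and> t < r j} = 0" if "j \<in> {1..q}" for j
  proof -
    have "{t \<in> free (p + q) l r j. l j < t \<and> t < r j} = {}" using pair(8)[of j] that by auto
    then show ?thesis by simp
  qed
  then have "(\<Sum>j=1..q. card {t \<in> free (p + q) l r j. l j < t \<and> t < r j}) = 0" by simp
  moreover have "inv_on ?F f = 0"
    using f_free es_free(1) small by (auto simp: inv_on_0_iff \<epsilon>_def less_imp_le)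
  ultimately show "inv_on {1..p + q} (cell_perm p q \<epsilon>) = p * q" using inv_on_f by simp
qed

subsection \<open>The dimension of a cell that meets the base cycle\<close>

lemma bounded_bilinear_matrix_mult: "bounded_bilinear ((**) :: 'n::{finite,wellorder} cmat \<Rightarrow> 'n cmat \<Rightarrow> 'n cmat)"
proof -
  have "(r *\<^sub>R A) ** B = r *\<^sub>R (A ** B)" "A ** (r *\<^sub>R B) = r *\<^sub>R (A ** B)" for r and A B :: "'n cmat"
    unfolding matrix_matrix_mult_def vec_eq_iff vector_scaleR_component vec_lambda_beta
    by (simp_all add: scaleR_sum_right)
  moreover have "(A + B) ** C = A ** C + B ** C" for A B C :: "'n cmat"
    by (simp add: matrix_matrix_mult_def vec_eq_iff sum.distrib distrib_right)
  ultimately have "bilinear ((**) :: 'n cmat \<Rightarrow> 'n cmat \<Rightarrow> 'n cmat)"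
    unfolding bilinear_def by (auto intro!: linearI simp: matrix_add_ldistrib)
  then show ?thesis by (rule bilinear_conv_bounded_bilinear[THEN iffD1])
qed

interpretation matrix_mult: bounded_bilinear "(**) :: 'n::{finite,wellorder} cmat \<Rightarrow> 'n cmat \<Rightarrow> 'n cmat"
  by (rule bounded_bilinear_matrix_mult)

lemma subspace_pattern: "subspace {X :: 'n::{finite,wellorder} cmat. \<forall>i j. (i, j) \<notin> S \<longrightarrow> X $ i $ j = 0}"
  by (auto simp: subspace_def)

section \<open>Matrices that lower a flag\<close>

definition strictly_upper :: "'n::{finite,wellorder} cmat set" where
  "strictly_upper = {M. \<forall>i j. j \<le> i \<longrightarrow> M $ i $ j = 0}"

text \<open>The description by the flag makes invariance under conjugation by its stabilizer
  immediate.\<close>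

lemma strictly_upper_iff:
  fixes M :: "'n::{finite,wellorder} cmat"
  shows "M \<in> strictly_upper \<longleftrightarrow> (\<forall>k x. x \<in> std_flag (Suc k) \<longrightarrow> M *v x \<in> std_flag k)"
proof
  assume M: "M \<in> strictly_upper"
  show "\<forall>k x. x \<in> std_flag (Suc k) \<longrightarrow> M *v x \<in> std_flag k"
  proof (intro allI impI)
    fix k and x :: "'n cvec" assume x: "x \<in> std_flag (Suc k)"
    have "M $ a $ b * x $ b = 0" if "k < idx a" for a b
    proof (cases "b \<le> a")
      case True
      then show ?thesis using M by (simp add: strictly_upper_def)
    next
      case False
      then have "idx a < idx b" by simp
      then have "Suc k < idx b" using that by linarith
      then show ?thesis using x by (simp add: std_flag_eq)
    qed
    then show "M *v x \<in> std_flag k" unfolding std_flag_eq matrix_vector_mult_def by (auto intro!: sum.neutral)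
  qed
next
  assume R: "\<forall>k x. x \<in> std_flag (Suc k) \<longrightarrow> M *v x \<in> std_flag k"
  have "M $ i $ j = 0" if "j \<le> i" for i j
  proof -
    have "axis j 1 \<in> (std_flag (Suc (idx j - 1)) :: 'n cvec set)" by (auto simp: std_flag_eq axis_def)
    then have "M *v axis j 1 \<in> std_flag (idx j - 1)" using R by blast
    moreover have "idx j - 1 < idx i" using that idx_ge[of j] idx_le_iff[of j i] by linarith
    ultimately show ?thesis by (simp add: std_flag_eq mult_axis column_def)
  qed
  then show "M \<in> strictly_upper" by (simp add: strictly_upper_def)
qed

lemma strictly_upper_conj:
  assumes b: "b \<in> upper_borel" and M: "M \<in> strictly_upper"
  shows "b ** M ** matrix_inv b \<in> strictly_upper" "matrix_inv b ** M ** b \<in> strictly_upper"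
proof -
  have "c ** M ** d \<in> strictly_upper" if c: "c \<in> upper_borel" and d: "d \<in> upper_borel" for c d
    unfolding strictly_upper_iff
  proof (intro allI impI)
    fix k and x :: "'a cvec" assume "x \<in> std_flag (Suc k)"
    then have "d *v x \<in> std_flag (Suc k)" using upper_borel_mem[OF d] by blast
    then have "M *v (d *v x) \<in> std_flag k" using M strictly_upper_iff by blast
    then show "(c ** M ** d) *v x \<in> std_flag k"
      using upper_borel_mem[OF c] by (simp flip: matrix_vector_mul_assoc)
  qed
  then show "b ** M ** matrix_inv b \<in> strictly_upper" "matrix_inv b ** M ** b \<in> strictly_upper"
    using b upper_borel_inv by blast+
qed

text \<open>The annihilation property of the trace form on which the second claim of
  \<open>cycle_cell\<close> rests.\<close>

lemma trace_upper_strictly_upper: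
  fixes A M :: "'n::{finite,wellorder} cmat"
  assumes "\<And>i j. j < i \<Longrightarrow> A $ i $ j = 0" "M \<in> strictly_upper"
  shows "trace (A ** M) = 0"
proof -
  have "A $ i $ k * M $ k $ i = 0" for i k
    using assms by (cases "k < i") (auto simp: strictly_upper_def not_less)
  then show ?thesis by (simp only: trace_def matrix_matrix_mult_def vec_lambda_beta sum.neutral_const)
qed

text \<open>The non-inversions count the entries of a strictly upper triangular matrix that remain
  above the diagonal after conjugation by \<open>perm_mat w\<close>: the dimension of the matrices
  lowering two flags in relative position \<open>w\<close>.\<close>

lemma card_pairs_inv_on:
  assumes w: "bij_betw w {1..CARD('n)} {1..CARD('n)}"
  shows "card {(i, j :: 'n::{finite,wellorder}). i < j} =
    card {(i, j :: 'n). i < j \<and> w (idx i) < w (idx j)} + inv_on {1..CARD('n)} w"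
proof -
  let ?I = "{(i, j :: 'n). j < i \<and> w (idx i) < w (idx j)}"
  have "w (idx i) \<noteq> w (idx j)" if "i \<noteq> j" for i j :: 'n
  proof
    assume "w (idx i) = w (idx j)"
    then have "idx i = idx j" using inj_onD[OF bij_betw_imp_inj_on[OF w]] idx_range by blast
    then show False using that by simp
  qed
  then have "{(i, j :: 'n). i < j} = {(i, j :: 'n). i < j \<and> w (idx i) < w (idx j)} \<union> prod.swap ` ?I"
    by (auto simp: image_iff neq_iff) (metis less_irrefl)
  moreover have "card (prod.swap ` ?I) = inv_on {1..CARD('n)} w"
    using card_image[of prod.swap ?I] card_cell_coords[OF w] by simp
  moreover have "{(i, j :: 'n). i < j \<and> w (idx i) < w (idx j)} \<inter> prod.swap ` ?I = {}" by auto
  ultimately show ?thesis by (metis (no_types, lifting) card_Un_disjoint finite)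
qed

context signature
begin

lemma Dmat_mult_nth: "(Dmat \<alpha> ** N) $ i $ j = of_real (sgn_of (\<alpha> ! (idx i - 1))) * N $ i $ j"
  "(N ** Dmat \<alpha>) $ i $ j = of_real (sgn_of (\<alpha> ! (idx j - 1))) * N $ i $ j" for N :: "'n cmat"
proof -
  have "(Dmat \<alpha> ** N) $ i $ j = (\<Sum>k\<in>UNIV. if k = i then of_real (sgn_of (\<alpha> ! (idx i - 1))) * N $ k $ j else 0)"
    unfolding matrix_matrix_mult_def Dmat_def vec_lambda_beta by (intro sum.cong) auto
  then show "(Dmat \<alpha> ** N) $ i $ j = of_real (sgn_of (\<alpha> ! (idx i - 1))) * N $ i $ j" by simp
  have "(N ** Dmat \<alpha>) $ i $ j = (\<Sum>k\<in>UNIV. if k = j then of_real (sgn_of (\<alpha> ! (idx j - 1))) * N $ i $ k else 0)"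
    unfolding matrix_matrix_mult_def Dmat_def vec_lambda_beta by (intro sum.cong) auto
  then show "(N ** Dmat \<alpha>) $ i $ j = of_real (sgn_of (\<alpha> ! (idx j - 1))) * N $ i $ j" by simp
qed

text \<open>Two places of opposite sign amount to the choice of a minus and a plus, in whatever
  order they stand.\<close>

lemma card_pairs_sign:
  assumes len: "length \<alpha> = p + q" and cnt: "count_list \<alpha> Minus = q" "count_list \<alpha> Plus = p"
  shows "card {(i, j :: 'n). i < j} = card {(i, j :: 'n). i < j \<and> \<alpha> ! (idx i - 1) = \<alpha> ! (idx j - 1)} + p * q"
proof -
  let ?s = "\<lambda>a :: 'n. \<alpha> ! (idx a - 1)"
  have card_s: "card {a. ?s a = s} = count_list \<alpha> s" for s
  proof -
    have "bij_betw idx {a. ?s a = s} {i \<in> {1..p + q}. \<alpha> ! (i - 1) = s}"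
    proof (rule bij_betw_imageI)
      show "inj_on idx {a. ?s a = s}" by (auto simp: inj_on_def)
      show "idx ` {a. ?s a = s} = {i \<in> {1..p + q}. \<alpha> ! (i - 1) = s}"
      proof (intro equalityI subsetI)
        fix i assume i: "i \<in> {i \<in> {1..p + q}. \<alpha> ! (i - 1) = s}"
        then have "idx (coord i :: 'n) = i" by (simp add: idx_coord card_n)
        then show "i \<in> idx ` {a. ?s a = s}" using i by (intro image_eqI[of _ _ "coord i"]) auto
      next
        fix i assume "i \<in> idx ` {a. ?s a = s}"
        then show "i \<in> {i \<in> {1..p + q}. \<alpha> ! (i - 1) = s}" using idx_range[where 'n='n] by (auto simp: card_n)
      qed
    qed
    then have "card {a. ?s a = s} = card {i \<in> {1..p + q}. \<alpha> ! (i - 1) = s}" by (rule bij_betw_same_card)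
    then show ?thesis using count_list_take[of "p + q" \<alpha> s] len by simp
  qed
  let ?D = "{(i, j :: 'n). i < j \<and> ?s i \<noteq> ?s j}"
  define \<phi> where "\<phi> = (\<lambda>(i, j :: 'n). if ?s i = Minus then (i, j) else (j, i))"
  have "bij_betw \<phi> ?D ({a. ?s a = Minus} \<times> {a. ?s a = Plus})"
  proof (rule bij_betw_imageI)
    show "inj_on \<phi> ?D" by (auto simp: inj_on_def \<phi>_def split: if_splits)
    show "\<phi> ` ?D = {a. ?s a = Minus} \<times> {a. ?s a = Plus}"
    proof (intro equalityI subsetI)
      fix x assume "x \<in> {a. ?s a = Minus} \<times> {a. ?s a = Plus}"
      then obtain a b where x: "x = (a, b)" "?s a = Minus" "?s b = Plus" by auto
      then have "a \<noteq> b" by auto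
      then consider "a < b" | "b < a" by (auto simp: neq_iff)
      then show "x \<in> \<phi> ` ?D"
      proof cases
        case 1
        then show ?thesis using x by (intro image_eqI[of _ _ "(a, b)"]) (auto simp: \<phi>_def)
      next
        case 2
        then show ?thesis using x by (intro image_eqI[of _ _ "(b, a)"]) (auto simp: \<phi>_def)
      qed
    next
      fix x assume "x \<in> \<phi> ` ?D"
      moreover have "s = Plus" if "s \<noteq> Minus" for s using that by (cases s) auto
      moreover have "s = Minus" if "s \<noteq> Plus" for s using that by (cases s) auto
      ultimately show "x \<in> {a. ?s a = Minus} \<times> {a. ?s a = Plus}" by (auto simp: \<phi>_def) (metis sign.exhaust)+
    qed
  qed
  then have "card ?D = p * q"
    using card_s[of Minus] card_s[of Plus] cnt by (simp add: bij_betw_same_card card_cartesian_product mult.commute)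
  moreover have "{(i, j :: 'n). i < j} = {(i, j :: 'n). i < j \<and> ?s i = ?s j} \<union> ?D" by auto
  moreover have "{(i, j :: 'n). i < j \<and> ?s i = ?s j} \<inter> ?D = {}" by auto
  ultimately show ?thesis by (metis (no_types, lifting) card_Un_disjoint finite)
qed

end

context iwasawa
begin

section \<open>The involution in the Iwasawa basis\<close>

definition flip_index :: "nat \<Rightarrow> nat" where
  "flip_index m = (if q < m \<and> m \<le> p then m else p + q + 1 - m)"

definition flip_sign :: "nat \<Rightarrow> complex" where
  "flip_sign m = (if q < m \<and> m \<le> p then 1 else -1)"

lemma flip_index_range: "m \<in> {1..p + q} \<Longrightarrow> flip_index m \<in> {1..p + q}"
  and flip_index_flip: "m \<in> {1..p + q} \<Longrightarrow> flip_index (flip_index m) = m"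
  and flip_sign_flip: "m \<in> {1..p + q} \<Longrightarrow> flip_sign (flip_index m) = flip_sign m"
  using q_le_p by (auto simp: flip_index_def flip_sign_def)

lemma Jmat_u: "m \<in> {1..p + q} \<Longrightarrow> Jmat q *v u m = flip_sign m *s u (flip_index m)"
proof (cases rule: index_cases)
  assume m: "m \<in> {1..p + q}" "1 \<le> m" "m \<le> q"
  have "2 * q + 1 - m \<in> {1..p + q}" "\<not> 2 * q + 1 - m \<le> q" using m q_le_p by auto
  moreover have "flip_index m = p + q + 1 - m" "flip_sign m = -1" using m by (auto simp: flip_index_def flip_sign_def)
  ultimately show ?thesis
    using m(3) Jmat_e_vec[OF m(1)] Jmat_e_vec[of "2 * q + 1 - m"] u_high[OF m(2,3)] u_low[OF m(3)]
    by (simp add: matrix_vector_right_distrib del: One_nat_def)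
next
  assume m: "m \<in> {1..p + q}" "q < m" "m \<le> p"
  then show ?thesis
    using Jmat_e_vec[of "q + m"] by (simp add: flip_index_def flip_sign_def u_mid)
next
  fix j assume j: "m \<in> {1..p + q}" "1 \<le> j" "j \<le> q" "m = p + q + 1 - j"
  have r: "2 * q + 1 - j \<in> {1..p + q}" "\<not> 2 * q + 1 - j \<le> q" "j \<in> {1..p + q}" using j q_le_p by auto
  have f: "flip_index m = j" "flip_sign m = -1" using j q_le_p by (auto simp: flip_index_def flip_sign_def)
  show ?thesis
    unfolding f unfolding j(4) u_high[OF j(2,3)] u_low[OF j(3)]
    using j(3) r Jmat_e_vec[OF r(3)] Jmat_e_vec[OF r(1)] by (simp add: matrix_vector_mult_diff_distrib vec_eq_iff del: One_nat_def)
qed simp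

text \<open>In the basis \<open>u\<close> the involution \<open>Jmat q\<close> is the signed reversal of the outer coordinates,
  so that it takes strictly upper triangular matrices to matrices that are strictly lower triangular up to the middle block.\<close>

lemma strictly_upper_anticommuting:
  assumes M: "matrix_inv U ** X ** U \<in> strictly_upper" and anti: "X + Jmat q ** X ** Jmat q = 0"
  shows "X = 0"
proof -
  define M where "M = matrix_inv U ** X ** U"
  have UM: "U ** M = X ** U" using invertible_U by (simp add: M_def flip: matrix_mul_assoc)
  have JX: "Jmat q ** X = - (X ** Jmat q)"
  proof -
    have "Jmat q ** X ** (Jmat q ** Jmat q) + X ** Jmat q = (X + Jmat q ** X ** Jmat q) ** Jmat q"
      by (simp only: matrix_mult.add_left matrix_mul_assoc add.commute)
    then have "Jmat q ** X + X ** Jmat q = 0" using anti by (simp add: matrix_mult.zero_left)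
    then show ?thesis by (simp add: eq_neg_iff_add_eq_0)
  qed
  have r: "idx a \<in> {1..p + q}" for a :: 'n using idx_range[of a] by (simp add: card_n)
  have fr: "flip_index (idx a) \<in> {1..p + q}" for a :: 'n by (rule flip_index_range[OF r])
  define \<pi> where "\<pi> a = (coord (flip_index (idx a)) :: 'n)" for a :: 'n
  have ii: "idx (\<pi> a) = flip_index (idx a)" for a
    using fr[of a] unfolding \<pi>_def by (intro idx_coord) (auto simp: card_n)
  have \<pi>\<pi>: "\<pi> (\<pi> a) = a" for a using flip_index_flip[OF r[of a]] unfolding \<pi>_def[of "\<pi> a"] ii by simp
  define R where "R = (colmat (\<lambda>m. flip_sign m *s e_vec (flip_index m)) :: 'n cmat)"
  have R_nth: "R $ a $ b = (if b = \<pi> a then flip_sign (idx a) else 0)" for a b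
  proof -
    have "a = \<pi> b \<longleftrightarrow> b = \<pi> a" using \<pi>\<pi> by metis
    then show ?thesis using flip_sign_flip[OF r[of a]] fr[of b]
      by (auto simp: R_def colmat_def e_vec_nth card_n ii simp flip: idx_eq_iff)
  qed
  have JU: "Jmat q ** U = U ** R"
  proof (rule mat_eqI)
    fix m assume "1 \<le> m" "m \<le> CARD('n)"
    then have m: "m \<in> {1..p + q}" by (simp add: card_n)
    have "R *v e_vec m = flip_sign m *s e_vec (flip_index m)"
      unfolding R_def using m by (intro colmat_e_vec) (auto simp: card_n)
    then show "(Jmat q ** U) *v e_vec m = (U ** R) *v e_vec m"
      by (simp add: U_e_vec[OF m] U_e_vec[OF flip_index_range[OF m]] Jmat_u[OF m] vector_scalar_commute flip: matrix_vector_mul_assoc)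
  qed
  have "U ** (R ** M) = Jmat q ** (U ** M)" by (simp only: matrix_mul_assoc JU)
  also have "\<dots> = (Jmat q ** X) ** U" by (simp only: UM matrix_mul_assoc)
  also have "\<dots> = - (X ** (Jmat q ** U))" by (simp only: JX matrix_mult.minus_left matrix_mul_assoc)
  also have "\<dots> = U ** (- (M ** R))" by (simp only: JU UM[symmetric] matrix_mult.minus_right matrix_mul_assoc)
  finally have "matrix_inv U ** (U ** (R ** M)) = matrix_inv U ** (U ** (- (M ** R)))" by simp
  then have RM: "R ** M = - (M ** R)" using invertible_U by simp
  have entry: "flip_sign (idx i) * M $ \<pi> i $ \<pi> j = - flip_sign (idx j) * M $ i $ j" for i j
  proof -
    have "(R ** M) $ i $ \<pi> j = flip_sign (idx i) * M $ \<pi> i $ \<pi> j"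
      by (simp add: matrix_matrix_mult_def R_nth if_distrib[of "\<lambda>x. x * _"] cong: if_cong)
    moreover have "(M ** R) $ i $ \<pi> j = (\<Sum>k\<in>UNIV. if k = j then M $ i $ k * flip_sign (idx k) else 0)"
      unfolding matrix_matrix_mult_def vec_lambda_beta R_nth by (intro sum.cong) (auto dest: arg_cong[of _ _ \<pi>] simp: \<pi>\<pi>)
    ultimately show ?thesis using RM by (simp add: mult.commute)
  qed
  have su: "M $ i $ j = 0" if "j \<le> i" for i j
    using M that unfolding M_def[symmetric] strictly_upper_def by blast
  \<comment> \<open>A nonzero entry at \<open>(i, j)\<close> forces one at the reflected position,
    and both have to lie above the diagonal. Then \<open>i\<close> and \<open>j\<close> are middle
    indices, where the reflection is trivial with sign 1, and \<open>entry\<close> says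
    \<open>M $ i $ j = - M $ i $ j\<close>.\<close>
  have "M $ i $ j = 0" for i j
  proof (rule ccontr)
    assume nz: "M $ i $ j \<noteq> 0"
    then have "i < j" using su not_le by blast
    moreover have "M $ \<pi> i $ \<pi> j \<noteq> 0"
    proof
      assume "M $ \<pi> i $ \<pi> j = 0"
      then show False using entry[of i j] nz by (simp add: flip_sign_def split: if_splits)
    qed
    then have "\<pi> i < \<pi> j"
      using su not_le by blast
    then have "flip_index (idx i) < flip_index (idx j)" using idx_less_iff ii by metis
    ultimately have "q < idx i \<and> idx i \<le> p" "q < idx j \<and> idx j \<le> p"
      using q_le_p idx_range[of i] idx_range[of j] idx_less_iff[of i j]
      by (auto simp: flip_index_def card_n simp del: idx_less_iff split: if_splits)
    then show False using entry[of i j] nz by (simp add: \<pi>_def flip_index_def flip_sign_def)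
  qed
  then have "M = 0" by (simp add: vec_eq_iff)
  then have "X ** (U ** matrix_inv U) = 0" using UM by (simp add: matrix_mul_assoc matrix_mult.zero_right matrix_mult.zero_left flip: UM)
  then show ?thesis using invertible_U by simp
qed

text \<open>\<open>?L\<close> parametrizes the matrices lowering both flags and \<open>?L'\<close>
  those lowering \<open>V\<close> and commuting with \<open>Jmat q\<close>; \<open>\<Psi>\<close> is
  \<open>X + J X J\<close> between these coordinates. For the second claim \<open>T\<close>, the
  matrix of \<open>t\<close> in the frame \<open>A\<close>, has to be upper triangular. Its entries
  between opposite signs vanish because it commutes with \<open>Dmat \<alpha>\<close>; the other
  entries below the diagonal are traces against elements of \<open>?L'\<close>, all of which are
  values of \<open>\<Psi>\<close>.\<close>

lemma cycle_cell:
  assumes V: "V \<in> cycle \<alpha>" "V \<in> cell U w" and len: "length \<alpha> = p + q"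
    and w: "bij_betw w {1..CARD('n)} {1..CARD('n)}"
  shows "p * q \<le> inv_on {1..CARD('n)} w"
    and "inv_on {1..CARD('n)} w = p * q \<Longrightarrow> Jmat q ** t = t ** Jmat q \<Longrightarrow>
      (\<And>m. m \<in> {1..p + q} \<Longrightarrow> \<exists>c. t *v u m = c *s u m) \<Longrightarrow> v \<in> V k \<Longrightarrow> t *v v \<in> V k"
proof -
  obtain A where A: "split_frame \<alpha> A" "V = act A std_flag" using cycle_split_frame[OF V(1) len] .
  have invA: "invertible A" using A(1) unitary_det unfolding split_frame_def by blast
  have JA: "Jmat q ** A = A ** Dmat \<alpha>" using A(1) eigenframe_iff unfolding split_frame_def by blast
  have "V \<in> sign_orbit p q \<alpha>" using V(1) by (simp add: cycle_def)
  note cnt = sign_orbit_count[OF this len]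
  have "matrix_inv U ** A \<in> bruhat w" using V(2) act_mem_cell[OF invA] A(2) by simp
  then obtain a b where ab: "matrix_inv U ** A = a ** perm_mat w ** b" "a \<in> upper_borel" "b \<in> upper_borel"
    by (auto simp: bruhat_def)
  note inv = invA invertible_U invertible_perm_mat[OF w] upper_borel_invertible[OF ab(2)] upper_borel_invertible[OF ab(3)]
  \<comment> \<open>A frame adapted to both flags: it differs from \<open>A\<close> by the upper
    triangular \<open>b\<close>, and from \<open>U\<close> by an upper triangular matrix and a
    permutation.\<close>
  define Y where "Y = U ** (a ** perm_mat w)"
  have invY: "invertible Y" using inv by (simp add: Y_def invertible_mult)
  have Yb: "A = Y ** b"
  proof -
    have "A = U ** (matrix_inv U ** A)" using inv by simp
    then show ?thesis unfolding ab(1) Y_def by (simp only: matrix_mul_assoc)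
  qed
  let ?S = "{(i, j :: 'n). i < j \<and> w (idx i) < w (idx j)}"
  let ?S' = "{(i, j :: 'n). i < j \<and> \<alpha> ! (idx i - 1) = \<alpha> ! (idx j - 1)}"
  let ?L = "{Z :: 'n cmat. \<forall>i j. (i, j) \<notin> ?S \<longrightarrow> Z $ i $ j = 0}"
  let ?L' = "{Z :: 'n cmat. \<forall>i j. (i, j) \<notin> ?S' \<longrightarrow> Z $ i $ j = 0}"
  define X where "X Z = Y ** Z ** matrix_inv Y" for Z
  define N where "N Z = matrix_inv A ** X Z ** A" for Z
  define \<Psi> where "\<Psi> Z = N Z + Dmat \<alpha> ** N Z ** Dmat \<alpha>" for Z
  have XY: "X Z ** Y = Y ** Z" for Z using invY by (simp add: X_def flip: matrix_mul_assoc)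
  have AN: "A ** N Z = X Z ** A" for Z using invA by (simp add: N_def flip: matrix_mul_assoc)
  have N_su: "N Z \<in> strictly_upper" if Z: "Z \<in> ?L" for Z
  proof -
    have "Z \<in> strictly_upper"
      unfolding strictly_upper_def
    proof (intro CollectI allI impI)
      fix i j :: 'n assume "j \<le> i"
      then have "(i, j) \<notin> ?S" by auto
      then show "Z $ i $ j = 0" using Z by blast
    qed
    moreover have "X Z ** A = A ** (matrix_inv b ** Z ** b)"
    proof -
      have "X Z ** A = (Y ** Z) ** b" by (simp only: Yb matrix_mul_assoc XY)
      also have "\<dots> = Y ** (b ** (matrix_inv b ** (Z ** b)))" using inv by (simp add: matrix_mul_assoc)
      finally show ?thesis by (simp only: Yb matrix_mul_assoc)
    qed
    then have "N Z = matrix_inv b ** Z ** b" using invA by (simp add: N_def flip: matrix_mul_assoc)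
    ultimately show ?thesis using strictly_upper_conj(2)[OF ab(3)] by simp
  qed
  have U_su: "matrix_inv U ** X Z ** U \<in> strictly_upper" if Z: "Z \<in> ?L" for Z
  proof -
    let ?P = "perm_mat w :: 'n cmat"
    have "(?P ** Z ** matrix_inv ?P) $ i $ j = 0" if "j \<le> i" for i j
    proof -
      have "\<exists>m :: 'n. i = coord (w (idx m))" for i :: 'n
      proof -
        have "idx i \<in> w ` {1..CARD('n)}" using idx_range[of i] w by (simp add: bij_betw_def)
        then obtain k where k: "k \<in> {1..CARD('n)}" "idx i = w k" by blast
        then have "i = coord (w (idx (coord k :: 'n)))" by (metis atLeastAtMost_iff coord_idx idx_coord)
        then show ?thesis by blast
      qed
      then obtain m l :: 'n where ml: "i = coord (w (idx m))" "j = coord (w (idx l))" by metis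
      have wr: "w (idx x) \<in> {1..CARD('n)}" for x :: 'n using bij_betwE[OF w] idx_range by blast
      have "w (idx l) \<le> w (idx m)"
        using that wr[of l] wr[of m] unfolding ml by (simp add: idx_coord flip: idx_le_iff)
      then have "(m, l) \<notin> ?S" by simp
      then have "Z $ m $ l = 0" using Z by blast
      have "?P *v axis l 1 = axis j 1"
        using perm_mat_e_vec[of "idx l" w, where 'n='n] idx_range[of l] wr[of l] by (simp add: ml(2) e_vec_def)
      then have "(?P ** Z ** matrix_inv ?P) *v axis j 1 = ?P *v (Z *v axis l 1)"
        using inv(3) by (metis inv_mult_vec(1) matrix_vector_mul_assoc)
      then have "(?P ** Z ** matrix_inv ?P) $ i $ j = (?P *v (Z *v axis l 1)) $ i"
        by (metis column_def mult_axis vec_lambda_beta)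
      also have "\<dots> = Z $ m $ l" unfolding ml(1) perm_mat_nth[OF w] by (simp add: mult_axis column_def)
      finally show ?thesis using \<open>Z $ m $ l = 0\<close> by simp
    qed
    then have su: "a ** (?P ** Z ** matrix_inv ?P) ** matrix_inv a \<in> strictly_upper"
      by (intro strictly_upper_conj(1)[OF ab(2)]) (simp add: strictly_upper_def)
    have "U = Y ** (matrix_inv ?P ** matrix_inv a)"
    proof -
      have "a ** (?P ** (matrix_inv ?P ** matrix_inv a)) = mat 1" using inv by simp
      then show ?thesis unfolding Y_def matrix_mul_assoc[symmetric] by simp
    qed
    then have "X Z ** U = (Y ** Z) ** (matrix_inv ?P ** matrix_inv a)" using XY[of Z] by (metis matrix_mul_assoc)
    also have "\<dots> = U ** (a ** (?P ** Z ** matrix_inv ?P) ** matrix_inv a)" by (simp only: Y_def matrix_mul_assoc)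
    finally have "matrix_inv U ** X Z ** U = a ** (?P ** Z ** matrix_inv ?P) ** matrix_inv a"
      using inv by (simp flip: matrix_mul_assoc)
    then show ?thesis using su by simp
  qed
  have A\<Psi>: "A ** \<Psi> Z = (X Z + Jmat q ** X Z ** Jmat q) ** A" for Z
  proof -
    have "A ** (Dmat \<alpha> ** N Z ** Dmat \<alpha>) = Jmat q ** (A ** N Z) ** Dmat \<alpha>" by (simp only: matrix_mul_assoc JA)
    also have "\<dots> = Jmat q ** X Z ** (A ** Dmat \<alpha>)" by (simp only: AN matrix_mul_assoc)
    also have "\<dots> = Jmat q ** X Z ** Jmat q ** A" by (simp only: matrix_mul_assoc flip: JA)
    finally show ?thesis by (simp add: \<Psi>_def matrix_mult.add_right matrix_mult.add_left AN)
  qed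
  have lin: "linear \<Psi>"
    by (rule linearI) (simp_all add: \<Psi>_def N_def X_def matrix_mult.add_left matrix_mult.add_right
      matrix_mult.scaleR_left matrix_mult.scaleR_right scaleR_add_right)
  have inj: "inj_on \<Psi> ?L"
  proof (rule inj_onI)
    fix Z Z' assume Z: "Z \<in> ?L" "Z' \<in> ?L" "\<Psi> Z = \<Psi> Z'"
    define D where "D = Z - Z'"
    have D: "D \<in> ?L" unfolding D_def by (rule subspace_diff[OF subspace_pattern Z(1,2)])
    have "\<Psi> D = 0" unfolding D_def using Z(3) linear_diff[OF lin] by simp
    then have "(X D + Jmat q ** X D ** Jmat q) ** A ** matrix_inv A = 0"
      using A\<Psi>[of D] by (simp add: matrix_mult.zero_right matrix_mult.zero_left flip: A\<Psi>)
    then have "X D + Jmat q ** X D ** Jmat q = 0" using invA by (simp flip: matrix_mul_assoc)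
    then have "X D = 0" by (rule strictly_upper_anticommuting[OF U_su[OF D]])
    then have "matrix_inv Y ** (Y ** D) = 0" unfolding XY[symmetric] by (simp add: matrix_mult.zero_right matrix_mult.zero_left)
    then show "Z = Z'" using invY by (simp add: D_def)
  qed
  have sub: "\<Psi> ` ?L \<subseteq> ?L'"
  proof (intro subsetI CollectI allI impI)
    fix M i j assume "M \<in> \<Psi> ` ?L" and ij: "(i, j) \<notin> ?S'"
    then obtain Z where Z: "Z \<in> ?L" "M = \<Psi> Z" by blast
    from ij consider "j \<le> i" | "\<alpha> ! (idx i - 1) \<noteq> \<alpha> ! (idx j - 1)" by fastforce
    then show "M $ i $ j = 0"
    proof cases
      case 1
      then show ?thesis using N_su[OF Z(1)] by (simp add: Z(2) \<Psi>_def Dmat_mult_nth strictly_upper_def)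
    next
      case 2
      then show ?thesis
        by (cases "\<alpha> ! (idx i - 1)"; cases "\<alpha> ! (idx j - 1)") (simp_all add: Z(2) \<Psi>_def Dmat_mult_nth)
    qed
  qed
  have dim_eq: "dim (\<Psi> ` ?L) = 2 * card ?S"
    using dim_image_eq[OF lin, of ?L] inj by (simp only: span_eq_iff[THEN iffD2, OF subspace_pattern] dim_pattern)
  then have le: "card ?S \<le> card ?S'" using dim_subset[OF sub] by (simp only: dim_pattern)
  have counts: "card ?S + inv_on {1..CARD('n)} w = card ?S' + p * q"
    using card_pairs_inv_on[OF w] card_pairs_sign[OF len cnt] by simp
  then show "p * q \<le> inv_on {1..CARD('n)} w" using le by linarith
  assume eq: "inv_on {1..CARD('n)} w = p * q" and tJ: "Jmat q ** t = t ** Jmat q"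
    and tu: "\<And>m. m \<in> {1..p + q} \<Longrightarrow> \<exists>c. t *v u m = c *s u m" and v: "v \<in> V k"
  have "\<Psi> ` ?L = ?L'"
  proof (rule subspace_dim_equal[OF _ subspace_pattern sub])
    show "subspace (\<Psi> ` ?L)" by (rule linear_subspace_image[OF lin subspace_pattern])
    show "dim ?L' \<le> dim (\<Psi> ` ?L)" using counts eq unfolding dim_eq dim_pattern by simp
  qed
  note onto = this
  \<comment> \<open>In the frame \<open>U\<close> the matrix \<open>t\<close> is diagonal, in
    particular upper triangular, and \<open>X Z\<close> is strictly upper triangular.\<close>
  have trX: "trace (t ** X Z) = 0" if Z: "Z \<in> ?L" for Z
  proof -
    have "(matrix_inv U ** t ** U) $ i $ j = 0" if "j < i" for i j
    proof -
      have "idx j \<in> {1..p + q}" using idx_range[of j] by (simp add: card_n)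
      then obtain c where "t *v u (idx j) = c *s u (idx j)" "U *v axis j 1 = u (idx j)"
        using tu[of "idx j"] U_e_vec[of "idx j"] by auto
      then have "(matrix_inv U ** t ** U) *v axis j 1 = c *s (matrix_inv U *v (U *v axis j 1))"
        by (simp add: vector_scalar_commute flip: matrix_vector_mul_assoc)
      then have "(matrix_inv U ** t ** U) *v axis j 1 = c *s axis j 1" using invertible_U by simp
      then have "(matrix_inv U ** t ** U) $ i $ j = (c *s axis j 1) $ i"
        by (metis column_def mult_axis vec_lambda_beta)
      then show ?thesis using that by (simp add: axis_def)
    qed
    then have "trace ((matrix_inv U ** t ** U) ** (matrix_inv U ** X Z ** U)) = 0"
      by (rule trace_upper_strictly_upper[OF _ U_su[OF Z]])
    moreover have "(matrix_inv U ** t ** U) ** (matrix_inv U ** X Z ** U) = matrix_inv U ** (t ** X Z ** U)"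
      using invertible_U by (simp flip: matrix_mul_assoc)
    moreover have "trace (matrix_inv U ** (t ** X Z ** U)) = trace (t ** X Z)"
      using trace_mul_sym[of "matrix_inv U" "t ** X Z ** U"] invertible_U by (simp flip: matrix_mul_assoc)
    ultimately show ?thesis by simp
  qed
  define T where "T = matrix_inv A ** t ** A"
  have AT: "A ** T = t ** A" using invA by (simp add: T_def flip: matrix_mul_assoc)
  have "A ** (Dmat \<alpha> ** T) = Jmat q ** (A ** T)" by (simp only: matrix_mul_assoc JA)
  also have "\<dots> = t ** (Jmat q ** A)" by (simp only: AT matrix_mul_assoc tJ)
  also have "\<dots> = A ** (T ** Dmat \<alpha>)" by (simp only: JA matrix_mul_assoc AT)
  finally have "matrix_inv A ** (A ** (Dmat \<alpha> ** T)) = matrix_inv A ** (A ** (T ** Dmat \<alpha>))" by simp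
  then have DT: "Dmat \<alpha> ** T = T ** Dmat \<alpha>" using invA by simp
  have T_upper: "T $ i $ j = 0" if ji: "j < i" for i j
  proof (cases "\<alpha> ! (idx i - 1) = \<alpha> ! (idx j - 1)")
    case False
    have "(Dmat \<alpha> ** T) $ i $ j = (T ** Dmat \<alpha>) $ i $ j" using DT by simp
    then show ?thesis using False
      by (cases "\<alpha> ! (idx i - 1)"; cases "\<alpha> ! (idx j - 1)") (simp_all add: Dmat_mult_nth eq_neg_iff_add_eq_0)
  next
    case True
    \<comment> \<open>The elementary matrix whose trace against \<open>T\<close> is the entry in
      question.\<close>
    define E where "E = ((\<chi> r c. if r = j \<and> c = i then 1 else 0) :: 'n cmat)"
    have "E \<in> ?L'" using ji True by (auto simp: E_def)
    then obtain Z where Z: "Z \<in> ?L" "E = \<Psi> Z" using onto by (metis (no_types, lifting) imageE)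
    have "(T ** E) $ r $ r = (if r = i then T $ i $ j else 0)" for r
    proof -
      have "(T ** E) $ r $ r = (\<Sum>k\<in>UNIV. if k = j then (if r = i then T $ i $ j else 0) else 0)"
        unfolding matrix_matrix_mult_def E_def vec_lambda_beta by (intro sum.cong) auto
      then show ?thesis by simp
    qed
    then have "T $ i $ j = trace (T ** E)" by (simp add: trace_def)
    also have "T ** E = matrix_inv A ** (t ** (A ** E))" by (simp only: T_def matrix_mul_assoc)
    also have "\<dots> = matrix_inv A ** (t ** (X Z + Jmat q ** X Z ** Jmat q) ** A)" by (simp only: Z(2) A\<Psi> matrix_mul_assoc)
    also have "trace \<dots> = trace (t ** (X Z + Jmat q ** X Z ** Jmat q))"
      using trace_mul_sym[of "matrix_inv A" "t ** (X Z + Jmat q ** X Z ** Jmat q) ** A"] invA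
      by (simp flip: matrix_mul_assoc)
    \<comment> \<open>Conjugation by \<open>Jmat q\<close> commutes with multiplication by
      \<open>t\<close>, so both summands have the same trace, which is zero by
      \<open>trX\<close>.\<close>
    also have "\<dots> = trace (t ** X Z) + trace (Jmat q ** (t ** X Z ** Jmat q))"
      by (simp add: matrix_mult.add_right trace_add matrix_mul_assoc tJ)
    also have "trace (Jmat q ** (t ** X Z ** Jmat q)) = trace (t ** X Z)"
      using trace_mul_sym[of "Jmat q" "t ** X Z ** Jmat q"] by (simp flip: matrix_mul_assoc)
    finally show ?thesis using trX[OF Z(1)] by simp
  qed
  obtain x where x: "x \<in> std_flag k" "v = A *v x" using v A(2) by (auto simp: act_def)
  have "T *v x \<in> std_flag k"
  proof -
    have "T $ a $ b * x $ b = 0" if "k < idx a" for a b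
    proof (cases "b < a")
      case False
      then have "idx a \<le> idx b" by simp
      then have "k < idx b" using that by linarith
      then show ?thesis using x(1) by (simp add: std_flag_eq)
    qed (simp add: T_upper)
    then show ?thesis unfolding std_flag_eq matrix_vector_mult_def by (auto intro!: sum.neutral)
  qed
  moreover have "t *v v = A *v (T *v x)" by (simp add: x(2) matrix_vector_mul_assoc AT)
  ultimately show "t *v v \<in> V k" using A(2) by (simp add: act_def)
qed

end

context iwasawa
begin

text \<open>Together with \<open>Jmat q\<close>, the diagonal matrices preserving \<open>V\<close>
  generate all coordinate projections. So each step of \<open>V\<close> is spanned by standard basis
  vectors, and a new one enters at each step.\<close>

lemma extremal_coordinate_flag:
  assumes V: "V \<in> cycle \<alpha>" "V \<in> cell U w" and len: "length \<alpha> = p + q"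
    and w: "bij_betw w {1..CARD('n)} {1..CARD('n)}" and inv: "inv_on {1..CARD('n)} w = p * q"
  obtains \<epsilon> where "bij_betw \<epsilon> {1..p + q} {1..p + q}" "\<And>k. k \<in> {1..p + q} \<Longrightarrow> \<epsilon> k \<le> q \<longleftrightarrow> \<alpha> ! (k - 1) = Minus"
    "V = act (perm_mat \<epsilon>) std_flag"
proof -
  have VD: "V \<in> sign_orbit p q \<alpha>" and stable: "\<And>k v. v \<in> V k \<Longrightarrow> Jmat q *v v \<in> V k" using V(1) by (auto simp: cycle_def)
  then have Vf: "V \<in> complete_flags" by (simp add: sign_orbit_def)
  note sub = complete_flagsD(2)[OF Vf]
  have proj: "x $ c *s axis c 1 \<in> V k" if x: "x \<in> V k" for x k and c :: 'n
  proof -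
    \<comment> \<open>The index of \<open>c\<close> and its partner, if it has one. The projection
      \<open>t\<close> onto these coordinates is symmetric under exchanging partners, which makes it
      diagonal in the basis \<open>u\<close>.\<close>
    define Q where "Q i \<longleftrightarrow> i = idx c \<or> idx c \<le> 2 * q \<and> i = 2 * q + 1 - idx c" for i
    define t where "t = ((\<chi> a b. if a = b \<and> Q (idx a) then 1 else 0) :: 'n cmat)"
    have t: "t *v y = (\<chi> a. if Q (idx a) then y $ a else 0)" for y
      unfolding vec_eq_iff by (simp add: diagonal_mult t_def)
    have tJ: "Jmat q ** t = t ** Jmat q"
      unfolding matrix_eq by (simp add: t Jmat_mult vec_eq_iff flip: matrix_vector_mul_assoc)
    have te: "t *v e_vec i = (if Q i then 1 else 0) *s e_vec i" if "i \<in> {1..p + q}" for i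
      using that by (auto simp: t vec_eq_iff e_vec_nth card_n)
    have Qsym: "Q (2 * q + 1 - i) \<longleftrightarrow> Q i" if "1 \<le> i" "i \<le> q" for i
      using that idx_ge[of c] by (auto simp: Q_def)
    have tu: "\<exists>d. t *v u m = d *s u m" if "m \<in> {1..p + q}" for m
      using that
    proof (cases rule: index_cases)
      case 1
      then have "m \<in> {1..p + q}" "2 * q + 1 - m \<in> {1..p + q}" using q_le_p by auto
      then have "t *v u m = (if Q m then 1 else 0) *s u m"
        using Qsym[OF 1] unfolding u_low[OF 1(2)] by (simp only: matrix_vector_right_distrib te) (simp add: vector_add_ldistrib)
      then show ?thesis by blast
    next
      case 2
      then have "q + m \<in> {1..p + q}" by auto
      then show ?thesis using te[of "q + m"] 2 by (auto simp: u_mid)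
    next
      case (3 j)
      then have "j \<in> {1..p + q}" "2 * q + 1 - j \<in> {1..p + q}" using q_le_p by auto
      then have "t *v u m = (if Q j then 1 else 0) *s u m"
        using Qsym[OF 3(1,2)] unfolding 3(3) u_high[OF 3(1,2)]
        by (simp only: matrix_vector_mult_diff_distrib te) (simp add: vector_ssub_ldistrib)
      then show ?thesis by blast
    qed
    define z where "z = t *v x"
    have z: "z \<in> V k" unfolding z_def by (rule cycle_cell(2)[OF V len w inv tJ tu x])
    define d :: complex where "d = (if idx c \<le> q then -1 else 1)"
    \<comment> \<open>Exactly one of two partners has index at most \<open>q\<close>, so
      \<open>Jmat q\<close> has opposite signs on them and averaging with the sign \<open>d\<close>
      of \<open>c\<close> removes the partner.\<close>
    have "x $ c *s axis c 1 = (1/2) *s (z + d *s (Jmat q *v z))"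
    proof -
      have *: "(if Q (idx a) then x $ a else 0) + d * (if idx a \<le> q then - (if Q (idx a) then x $ a else 0) else (if Q (idx a) then x $ a else 0))
          = (if a = c then 2 * x $ c else 0)" for a
      proof (cases "a = c")
        case False
        then have "idx a \<noteq> idx c" by simp
        then show ?thesis using idx_ge[of c] idx_ge[of a] by (auto simp: Q_def d_def)
      qed (auto simp: Q_def d_def)
      have **: "((1/2) *s (z + d *s (Jmat q *v z))) $ a = (1/2) * (if a = c then 2 * x $ c else 0)" for a
        unfolding *[symmetric] by (simp only: z_def t Jmat_mult vector_smult_component vector_add_component vec_lambda_beta)
      have "(x $ c *s axis c 1) $ a = ((1/2) *s (z + d *s (Jmat q *v z))) $ a" for a
        unfolding ** by (simp add: axis_def)
      then show ?thesis by (intro vec_eq_iff[THEN iffD2] allI)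
    qed
    then show ?thesis
      using vec.subspace_scale[OF sub vec.subspace_add[OF sub z vec.subspace_scale[OF sub stable[OF z], of d]], of "1/2"] by simp
  qed
  have "\<exists>c. axis c 1 \<in> V k \<and> axis c 1 \<notin> V (k - 1)" if k: "k \<in> {1..p + q}" for k
  proof -
    have "\<not> V k \<subseteq> V (k - 1)"
    proof
      assume "V k \<subseteq> V (k - 1)"
      then have "vec.dim (V k) \<le> vec.dim (V (k - 1))" by (rule vec.dim_subset)
      then show False using k by (auto simp: complete_flagsD(3)[OF Vf] card_n)
    qed
    then obtain x where x: "x \<in> V k" "x \<notin> V (k - 1)" by blast
    have "\<exists>c. x $ c *s axis c 1 \<notin> V (k - 1)"
    proof (rule ccontr)
      assume "\<not> ?thesis"
      then have "(\<Sum>c\<in>UNIV. x $ c *s axis c 1) \<in> V (k - 1)" by (intro vec.subspace_sum[OF sub]) auto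
      then show False using x(2) by (simp add: basis_expansion)
    qed
    then obtain c where c: "x $ c *s axis c 1 \<notin> V (k - 1)" by blast
    then have "axis c 1 \<notin> V (k - 1)" using vec.subspace_scale[OF sub] by blast
    moreover have "x $ c \<noteq> 0" using c vec.subspace_0[OF sub] by auto
    then have "axis c 1 = (1 / x $ c) *s (x $ c *s axis c 1)" by (simp add: vector_smult_assoc)
    then have "axis c 1 \<in> V k" using vec.subspace_scale[OF sub proj[OF x(1), of c]] by metis
    ultimately show ?thesis by blast
  qed
  then obtain f where f: "\<And>k. k \<in> {1..p + q} \<Longrightarrow> axis (f k) 1 \<in> V k \<and> axis (f k) 1 \<notin> V (k - 1)" by metis
  define \<epsilon> where "\<epsilon> k = idx (f k)" for k
  have e: "e_vec (\<epsilon> k) = (axis (f k) 1 :: 'n cvec)" for k by (simp add: \<epsilon>_def)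
  have Veq: "V = act (perm_mat \<epsilon>) std_flag"
    unfolding perm_mat_def by (rule flag_of_adapted_basis(2)[OF Vf]) (use f in \<open>simp add: e card_n\<close>)
  have lt: "\<epsilon> i \<noteq> \<epsilon> j" if "i \<in> {1..p + q}" "j \<in> {1..p + q}" "i < j" for i j
  proof
    assume "\<epsilon> i = \<epsilon> j"
    then have "f i = f j" by (simp add: \<epsilon>_def)
    moreover have "V i \<subseteq> V (j - 1)" using that by (intro monoD[OF complete_flagsD(1)[OF Vf]]) auto
    ultimately show False using f[OF that(1)] f[OF that(2)] by auto
  qed
  have "inj_on \<epsilon> {1..p + q}" using lt by (metis inj_onI linorder_cases)
  moreover have "\<epsilon> ` {1..p + q} \<subseteq> {1..p + q}" using idx_range[where 'n='n] by (auto simp: \<epsilon>_def card_n)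
  ultimately have bij: "bij_betw \<epsilon> {1..p + q} {1..p + q}" by (simp add: bij_betw_def endo_inj_surj)
  define \<beta> where "\<beta> = map (\<lambda>k. if \<epsilon> (Suc k) \<le> q then Minus else Plus) [0..<p + q]"
  have "sign_frame \<beta> (perm_mat \<epsilon>)" unfolding \<beta>_def perm_mat_def by (rule coordinate_sign_frame[OF bij])
  moreover have "invertible (perm_mat \<epsilon> :: 'n cmat)" using bij by (intro invertible_perm_mat) (simp add: card_n)
  moreover have "length \<beta> = p + q" by (simp add: \<beta>_def)
  ultimately have "V \<in> sign_orbit p q \<beta>" using sign_orbit_iff Veq by blast
  then have "\<beta> = \<alpha>" using sign_orbit_unique[OF _ VD _ len] \<open>length \<beta> = p + q\<close> by blast
  then have "\<epsilon> k \<le> q \<longleftrightarrow> \<alpha> ! (k - 1) = Minus" if "k \<in> {1..p + q}" for k using that by (auto simp: \<beta>_def split: if_splits)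
  with bij Veq show ?thesis using that by blast
qed

lemma e_vec_U_flag:
  assumes "1 \<le> j" "j \<le> q"
  shows "e_vec j \<in> act U std_flag (p + q + 1 - j)" "e_vec (2 * q + 1 - j) \<in> act U std_flag (p + q + 1 - j)"
proof -
  let ?W = "act U (std_flag :: 'n flag) (p + q + 1 - j)"
  have "u i \<in> ?W" if "1 \<le> i" "i \<le> p + q + 1 - j" for i
    using that assms U_flag_eq_span[of "p + q + 1 - j"] by (auto intro!: vec.span_base)
  then have uW: "u j \<in> ?W" "u (p + q + 1 - j) \<in> ?W" using assms q_le_p by auto
  have "e_vec j = (1/2) *s (u j + u (p + q + 1 - j))" "e_vec (2 * q + 1 - j) = (1/2) *s (u j - u (p + q + 1 - j))"
    unfolding u_low[OF assms(2)] u_high[OF assms] by (simp_all add: vec_eq_iff)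
  then show "e_vec j \<in> ?W" "e_vec (2 * q + 1 - j) \<in> ?W"
    using vec.subspace_scale[OF U_flag_subspace] vec.subspace_add[OF U_flag_subspace uW] vec.subspace_diff[OF U_flag_subspace uW] by metis+
qed

text \<open>A basis \<open>y\<close> adapted to the coordinate flag is exhibited in which
  \<open>y k\<close> lies in the step \<open>cell_perm p q \<epsilon> k\<close> of the Iwasawa flag.
  Sorting it by these numbers gives an upper triangular matrix in the frame
  \<open>U\<close>.\<close>

lemma coordinate_flag_cell:
  assumes bij: "bij_betw \<epsilon> {1..p + q} {1..p + q}"
  shows "act (perm_mat \<epsilon>) std_flag \<in> (cell U (cell_perm p q \<epsilon>) :: 'n flag set)"
proof -
  obtain l r where "positions p q \<epsilon> l r" using positions_exist[OF q_le_p bij] .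
  then interpret pos: positions p q \<epsilon> l r .
  let ?w = "cell_perm p q \<epsilon>"
  let ?V = "act (perm_mat \<epsilon>) (std_flag :: 'n flag)"
  have w: "bij_betw ?w {1..CARD('n)} {1..CARD('n)}" using cell_perm_bij[OF q_le_p bij] by (simp add: card_n)
  have invE: "invertible (perm_mat \<epsilon> :: 'n cmat)" using bij by (intro invertible_perm_mat) (simp add: card_n)
  have inV: "e_vec (\<epsilon> i) \<in> ?V k" if "1 \<le> i" "i \<le> k" "k \<le> p + q" for i k
    unfolding act_perm_mat using that by (intro vec.span_base) (auto simp: card_n)
  have notV: "x $ coord (\<epsilon> k) = 0" if x: "x \<in> ?V (k - 1)" and k: "k \<in> {1..p + q}" for x k
  proof -
    have ek: "\<epsilon> k \<in> {1..p + q}" using bij_betwE[OF bij] k by blast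
    have "\<epsilon> ` {1..min (k - 1) CARD('n)} \<subseteq> {1..CARD('n)}"
      using bij k by (fastforce simp: bij_betw_def card_n)
    note sp = span_e_vec[OF this]
    have "\<epsilon> k \<notin> \<epsilon> ` {1..min (k - 1) CARD('n)}"
    proof
      assume "\<epsilon> k \<in> \<epsilon> ` {1..min (k - 1) CARD('n)}"
      then obtain i where i: "i \<in> {1..min (k - 1) CARD('n)}" "\<epsilon> k = \<epsilon> i" by blast
      then have "k = i" using inj_onD[OF bij_betw_imp_inj_on[OF bij] i(2)] k by auto
      then show False using i(1) k by auto
    qed
    moreover have "idx (coord (\<epsilon> k) :: 'n) = \<epsilon> k" using ek by (intro idx_coord) (auto simp: card_n)
    ultimately show ?thesis using x unfolding act_perm_mat sp by simp
  qed
  \<comment> \<open>A value of \<open>cell_perm\<close> at most \<open>q\<close> marks the right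
    place of a pair. There both partners belong to the flag, and their sum \<open>u j\<close> lies
    much lower in the Iwasawa flag than either of them.\<close>
  define y where "y k = (if ?w k \<le> q then u (?w k) else e_vec (\<epsilon> k))" for k
  have y: "y k \<in> ?V k \<and> y k $ coord (\<epsilon> k) \<noteq> 0 \<and> y k \<in> act U std_flag (?w k)" if k: "k \<in> {1..p + q}" for k
  proof -
    define s where "s = k - 1"
    have s: "s < p + q" "k = Suc s" using k by (auto simp: s_def)
    have ek: "1 \<le> \<epsilon> k" "\<epsilon> k \<le> p + q" using pos.range[OF s(1)] s(2) by auto
    have nz: "e_vec (\<epsilon> k) $ (coord (\<epsilon> k) :: 'n) \<noteq> 0" using ek by (simp add: e_vec_nth idx_coord card_n)
    show ?thesis
    proof (cases "s \<in> free (p + q) l r (Suc q)")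
      case True
      then have *: "?w k = \<epsilon> k - q" "2 * q < \<epsilon> k" using pos.f_free[OF True] pos.free_iff[OF s(1)] s(2) by auto
      then have um: "u (?w k) = e_vec (\<epsilon> k)" using ek by (simp add: u_mid)
      have yk: "y k = e_vec (\<epsilon> k)" by (simp only: y_def um if_cancel)
      have "u (?w k) \<in> act U std_flag (?w k)"
        using * ek U_flag_eq_span[of "?w k"] by (auto intro!: vec.span_base)
      then show ?thesis using um yk nz inV[of k k] k by simp
    next
      case False
      then obtain j where j: "1 \<le> j" "j < Suc q" "s = l j \<or> s = r j" using not_freeE[OF s(1)] by blast
      then have j': "j \<le> q" by simp
      note lr = pos.l_less_r[OF j(1) j'] and ev = pos.eps_values[OF j(1) j'] and fv = pos.f_values[OF j(1) j']
      from j(3) show ?thesis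
      proof
        assume sl: "s = l j"
        then have w': "?w k = p + q + 1 - j" "\<not> ?w k \<le> q" using fv s(2) j' q_le_p by auto
        have "\<epsilon> k = j \<or> \<epsilon> k = 2 * q + 1 - j" using ev sl s(2) by auto
        then show ?thesis using w' nz inV[of k k] k e_vec_U_flag[OF j(1) j'] by (auto simp: y_def)
      next
        assume sr: "s = r j"
        then have w': "?w k = j" using fv s(2) by auto
        have uj: "u j = e_vec (\<epsilon> k) + e_vec (\<epsilon> (Suc (l j)))"
          unfolding u_low[OF j'] using ev sr s(2) by (auto simp: add.commute)
        have "e_vec (\<epsilon> (Suc (l j))) \<in> ?V k" using lr sr s by (intro inV) auto
        then have "u j \<in> ?V k" unfolding uj act_perm_mat
          using inV[of k k] k by (intro vec.span_add) (simp_all add: act_perm_mat)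
        moreover have "\<epsilon> k \<noteq> \<epsilon> (Suc (l j))"
        proof
          assume "\<epsilon> k = \<epsilon> (Suc (l j))"
          then have "j = 2 * q + 1 - j" using ev sr s(2) by auto
          then show False using j(1) j' by presburger
        qed
        then have "u j $ coord (\<epsilon> k) \<noteq> 0"
          unfolding uj using ek pos.range[of "l j"] lr by (simp add: e_vec_nth idx_coord card_n)
        moreover have "u j \<in> act U std_flag j"
          using j j' U_flag_eq_span[of j] by (auto intro!: vec.span_base)
        ultimately show ?thesis using w' j' by (simp add: y_def)
      qed
    qed
  qed
  have adapted: "y k \<in> ?V k \<and> y k \<notin> ?V (k - 1)" if "1 \<le> k" "k \<le> CARD('n)" for k
    using y[of k] notV[of "y k" k] that by (auto simp: card_n)
  have Vf: "?V \<in> complete_flags" using invE by simp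
  have inv_y: "invertible (colmat y)" and V_eq: "?V = act (colmat y) std_flag"
    using flag_of_adapted_basis[OF Vf] adapted by blast+
  define v where "v = inv_into {1..CARD('n)} ?w"
  have v: "bij_betw v {1..CARD('n)} {1..CARD('n)}" unfolding v_def by (rule bij_betw_inv_into[OF w])
  define a where "a = matrix_inv U ** colmat y ** perm_mat v"
  have "a \<in> upper_borel"
  proof (rule upper_borelI_e_vec)
    show "invertible a" unfolding a_def using inv_y invertible_U invertible_perm_mat[OF v] by (simp add: invertible_mult)
    fix j assume j: "1 \<le> j" "j \<le> CARD('n)"
    then have vj: "v j \<in> {1..CARD('n)}" using bij_betwE[OF v] by auto
    have wv: "?w (v j) = j" unfolding v_def using j by (intro bij_betw_inv_into_right[OF w]) auto
    have "a *v e_vec j = matrix_inv U *v (colmat y *v (perm_mat v *v e_vec j))" by (simp add: a_def flip: matrix_vector_mul_assoc)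
    also have "\<dots> = matrix_inv U *v y (v j)" using j vj by simp
    finally show "a *v e_vec j \<in> std_flag j"
      using y[of "v j"] vj wv act_std_flag_iff[OF invertible_U] by (simp add: card_n)
  qed
  moreover have "matrix_inv U ** colmat y = a ** perm_mat ?w ** mat 1"
    unfolding a_def v_def matrix_mul_assoc[symmetric] perm_mat_inverse(2)[OF w] by simp
  ultimately have "matrix_inv U ** colmat y \<in> bruhat ?w" unfolding bruhat_def using upper_borel_one by blast
  then show ?thesis unfolding V_eq using act_mem_cell[OF inv_y] by blast
qed

end

subsection \<open>Uniqueness of the base cycle\<close>

lemma inner_eq_trace: "A \<bullet> B = Re (trace (A ** conj_transpose B))" for A B :: "'n::{finite,wellorder} cmat"
  by (simp add: inner_vec_def trace_def matrix_matrix_mult_def conj_transpose_def inner_complex_def)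

text \<open>Since traces are cyclic, \<open>R R^*\<close> and \<open>R^* R\<close> have the same
  norm and the same inner product with \<open>P\<close>, a two-sided unit for
  \<open>R\<close>.\<close>

lemma norm_mult_adjoint:
  fixes P R :: "'n::{finite,wellorder} cmat"
  assumes P: "conj_transpose P = P" "P ** P = P" and R: "P ** R = R" "R ** P = R"
  shows "norm (R ** conj_transpose R - P) = norm (conj_transpose R ** R - P)"
proof -
  let ?R = "conj_transpose R"
  have R': "?R ** P = ?R" "P ** ?R = ?R" using arg_cong[OF R(1), of conj_transpose] arg_cong[OF R(2), of conj_transpose] P(1)
    by (simp_all add: conj_transpose_mult)
  have sq: "norm (X - P) ^ 2 = X \<bullet> X - 2 * (X \<bullet> P) + P \<bullet> P" for X
    by (simp add: power2_norm_eq_inner inner_diff_left inner_diff_right inner_commute)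
  have "(R ** ?R) \<bullet> (R ** ?R) = (?R ** R) \<bullet> (?R ** R)"
    using trace_mul_sym[of R "?R ** R ** ?R"] by (simp add: inner_eq_trace conj_transpose_mult matrix_mul_assoc)
  moreover have "(R ** ?R) \<bullet> P = (?R ** R) \<bullet> P"
    using trace_mul_sym[of R ?R] by (simp add: inner_eq_trace P(1) R R' flip: matrix_mul_assoc)
  ultimately have "norm (R ** ?R - P) ^ 2 = norm (?R ** R - P) ^ 2" unfolding sq by simp
  then show ?thesis by (simp add: power2_eq_iff_nonneg)
qed

lemma orthogonal_projector:
  fixes V :: "'n::{finite,wellorder} flag"
  assumes V: "V \<in> complete_flags"
  obtains P where "conj_transpose P = P" "P ** P = P" "\<And>x. P *v x \<in> V k" "\<And>x. x \<in> V k \<Longrightarrow> P *v x = x"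
proof -
  obtain y where y: "\<And>k. 1 \<le> k \<Longrightarrow> k \<le> CARD('n) \<Longrightarrow> y k \<in> V k \<and> y k \<notin> V (k - 1)"
    and gram: "\<And>i j. i \<in> {1..CARD('n)} \<Longrightarrow> j \<in> {1..CARD('n)} \<Longrightarrow> sip (y i) (y j) = (if i = j then 1 else 0)"
    using orthonormal_frame[OF V] by blast
  have "sip (y (idx a)) (y (idx b)) = (if a = b then 1 else 0)" for a b :: 'n
    using gram[OF idx_range[of a] idx_range[of b]] by simp
  then have uni: "conj_transpose (colmat y) ** colmat y = mat 1" by (rule unitary_colmat)
  have Veq: "V = act (colmat y) std_flag" by (rule flag_of_adapted_basis(2)[OF V]) (use y in blast)
  define A where "A = colmat y"
  define D where "D = ((\<chi> a b. if a = b \<and> idx a \<le> k then 1 else 0) :: 'n cmat)"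
  have D: "D *v x = (\<chi> a. if idx a \<le> k then x $ a else 0)" for x
    unfolding vec_eq_iff by (simp add: diagonal_mult D_def)
  have DD: "D ** D = D" unfolding matrix_eq by (simp add: D vec_eq_iff flip: matrix_vector_mul_assoc)
  have Dt: "conj_transpose D = D" by (auto simp: conj_transpose_def D_def vec_eq_iff)
  have Dstd: "D *v x = x" if "x \<in> std_flag k" for x using that by (auto simp: D vec_eq_iff std_flag_eq)
  have A: "conj_transpose A ** A = mat 1" using uni by (simp add: A_def)
  have A': "conj_transpose A ** (A ** B) = B" for B :: "'n cmat" by (simp add: matrix_mul_assoc A)
  show ?thesis
  proof
    show "conj_transpose (A ** D ** conj_transpose A) = A ** D ** conj_transpose A"
      by (simp add: conj_transpose_mult Dt matrix_mul_assoc)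
    have "D ** (D ** B) = D ** B" for B :: "'n cmat" by (simp add: matrix_mul_assoc DD)
    then show "(A ** D ** conj_transpose A) ** (A ** D ** conj_transpose A) = A ** D ** conj_transpose A"
      by (simp add: A' flip: matrix_mul_assoc)
    have "D *v x \<in> std_flag k" for x by (simp add: D std_flag_eq)
    then show "(A ** D ** conj_transpose A) *v x \<in> V k" for x
      by (simp add: Veq act_def flip: A_def matrix_vector_mul_assoc)
    fix x assume "x \<in> V k"
    then obtain z where z: "z \<in> std_flag k" "x = A *v z" by (auto simp: Veq act_def A_def)
    have "(A ** D ** conj_transpose A) *v x = A *v (D *v ((conj_transpose A ** A) *v z))"
      by (simp add: z(2) flip: matrix_vector_mul_assoc)
    then show "(A ** D ** conj_transpose A) *v x = x" using Dstd[OF z(1)] by (simp add: A z(2))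
  qed
qed

lemma bounded_linear_conj_transpose: "bounded_linear (conj_transpose :: 'n::{finite,wellorder} cmat \<Rightarrow> 'n cmat)"
proof -
  have "linear (conj_transpose :: 'n cmat \<Rightarrow> 'n cmat)"
    by (rule linearI) (simp_all add: conj_transpose_def vec_eq_iff)
  then show ?thesis by (rule linear_conv_bounded_linear[THEN iffD1])
qed

lemma difference_quotient:
  fixes f :: "real \<Rightarrow> 'b::real_normed_vector"
  assumes "(f has_vector_derivative f') (at 0)" "f 0 = 0"
  shows "((\<lambda>s. (1 / s) *\<^sub>R f s) \<longlongrightarrow> f') (at_right 0)"
proof -
  have "((\<lambda>s. (1 / norm s) *\<^sub>R (f s - s *\<^sub>R f')) \<longlongrightarrow> 0) (at_right 0)"
    using has_vector_derivative_at_within[OF assms(1), of "{0<..}"] assms(2)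
    by (simp add: has_vector_derivative_def has_derivative_within divide_inverse)
  then have "((\<lambda>s. (1 / s) *\<^sub>R f s - f') \<longlongrightarrow> 0) (at_right 0)"
    by (rule Lim_transform_eventually) (simp add: eventually_at_right_field scaleR_diff_right exI[of _ 1])
  then show ?thesis by (simp add: LIM_zero_iff)
qed

text \<open>The function \<open>W \<mapsto> tr (P\<^sub>W H)\<close>, where \<open>P\<^sub>W\<close> is the orthogonal projector onto \<open>W\<close>, is invariant
  under unitary matrices commuting with \<open>H\<close>, while its derivative in the direction \<open>H\<close> is
  \<open>2 \<parallel>(1 - P\<^sub>W) H P\<^sub>W\<parallel>\<^sup>2\<close>. The proof replaces the projectors onto the moving subspaces by the Cauchy-Schwarz inequality.\<close>

lemma stable_of_curve:
  fixes V :: "'n::{finite,wellorder} flag" and T :: "real \<Rightarrow> 'n cmat"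
  assumes V: "V \<in> complete_flags" and H: "conj_transpose H = H"
    and T: "(T has_vector_derivative H) (at 0)" "T 0 = mat 1"
    and ev: "\<forall>\<^sub>F s in at_right 0. \<exists>k. conj_transpose k ** k = mat 1 \<and> H ** k = k ** H \<and> act (T s) V = act k V"
    and v: "v \<in> V k"
  shows "H *v v \<in> V k"
proof -
  obtain P where P: "conj_transpose P = P" "P ** P = P" and PV: "\<And>x. P *v x \<in> V k" "\<And>x. x \<in> V k \<Longrightarrow> P *v x = x"
    using orthogonal_projector[OF V, of k] by blast
  \<comment> \<open>\<open>S\<close> is the compression of \<open>H\<close> to \<open>V k\<close>.
    To first order in \<open>s\<close>, \<open>G s\<close> is \<open>2 s S\<close> and
    \<open>K s\<close> is \<open>2 s\<close> times the squared norm of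
    \<open>H ** P\<close>.\<close>
  define S where "S = P ** H ** P"
  define G where "G s = P ** (conj_transpose (T s) ** T s - mat 1) ** P" for s
  define K where "K s = (conj_transpose (T s) ** H ** T s - H) \<bullet> P" for s
  have T': "((\<lambda>s. conj_transpose (T s)) has_vector_derivative H) (at 0)"
    using bounded_linear.has_vector_derivative[OF bounded_linear_conj_transpose T(1)] by (simp add: H)
  have ct1 [simp]: "conj_transpose (mat 1) = (mat 1 :: 'n cmat)" by (auto simp: conj_transpose_def mat_def vec_eq_iff)
  have "((\<lambda>s. conj_transpose (T s) ** T s) has_vector_derivative 2 *\<^sub>R H) (at 0)"
    using matrix_mult.has_vector_derivative[OF T' T(1)] by (simp add: T(2) scaleR_2)
  then have "((\<lambda>s. conj_transpose (T s) ** T s - mat 1) has_vector_derivative 2 *\<^sub>R H) (at 0)"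
    using has_vector_derivative_diff[OF _ has_vector_derivative_const] by fastforce
  then have "(G has_vector_derivative P ** (2 *\<^sub>R H) ** P) (at 0)"
    unfolding G_def
    by (intro bounded_linear.has_vector_derivative[OF matrix_mult.bounded_linear_left]
      bounded_linear.has_vector_derivative[OF matrix_mult.bounded_linear_right])
  then have "(G has_vector_derivative 2 *\<^sub>R S) (at 0)" by (simp add: S_def matrix_mult.scaleR_left matrix_mult.scaleR_right)
  then have limG: "((\<lambda>s. (1 / s) *\<^sub>R G s) \<longlongrightarrow> 2 *\<^sub>R S) (at_right 0)"
    by (rule difference_quotient) (simp add: G_def T(2) matrix_mult.zero_left matrix_mult.zero_right)
  have "((\<lambda>s. conj_transpose (T s) ** H) has_vector_derivative H ** H) (at 0)"
    by (rule bounded_linear.has_vector_derivative[OF matrix_mult.bounded_linear_left T'])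
  from matrix_mult.has_vector_derivative[OF this T(1)]
  have "((\<lambda>s. conj_transpose (T s) ** H ** T s) has_vector_derivative 2 *\<^sub>R (H ** H)) (at 0)"
    by (simp add: T(2) scaleR_2)
  then have "((\<lambda>s. conj_transpose (T s) ** H ** T s - H) has_vector_derivative 2 *\<^sub>R (H ** H)) (at 0)"
    using has_vector_derivative_diff[OF _ has_vector_derivative_const] by fastforce
  then have "(K has_vector_derivative (2 *\<^sub>R (H ** H)) \<bullet> P) (at 0)"
    unfolding K_def by (rule bounded_linear.has_vector_derivative[OF bounded_linear_inner_left])
  moreover have "(H ** H) \<bullet> P = (H ** P) \<bullet> (H ** P)"
    using trace_mul_sym[of H "H ** P"] trace_mul_sym[of "H ** P" H]
    by (simp add: inner_eq_trace conj_transpose_mult P H matrix_mul_assoc)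
      (metis P(2) matrix_mul_assoc trace_mul_sym)
  ultimately have "(K has_vector_derivative 2 * ((H ** P) \<bullet> (H ** P))) (at 0)" by simp
  then have limK: "((\<lambda>s. (1 / s) *\<^sub>R K s) \<longlongrightarrow> 2 * ((H ** P) \<bullet> (H ** P))) (at_right 0)"
    by (rule difference_quotient) (simp add: K_def T(2))
  have "\<forall>\<^sub>F s in at_right 0. K s \<le> norm S * norm (G s)"
    using ev
  proof eventually_elim
    case (elim s)
    then obtain m where m: "conj_transpose m ** m = mat 1" "H ** m = m ** H" "act (T s) V = act m V" by blast
    have m': "m ** conj_transpose m = mat 1" using m(1) matrix_left_right_inverse by blast
    have Hm: "m ** H ** conj_transpose m = H"
      by (simp only: m(2)[symmetric] matrix_mul_assoc[symmetric] m' matrix_mul_rid)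
    \<comment> \<open>Since \<open>m\<close> carries \<open>V\<close> to the same flag as
      \<open>T s\<close>, undoing \<open>m\<close> makes \<open>T s\<close> an endomorphism of
      \<open>V k\<close>. As \<open>m\<close> commutes with \<open>H\<close>, \<open>K s\<close>
      becomes the inner product of \<open>S\<close> with \<open>R R^* - P\<close>.\<close>
    define R where "R = conj_transpose m ** T s ** P"
    have PR: "P ** R = R"
      unfolding matrix_eq
    proof
      fix x
      have "T s *v (P *v x) \<in> act (T s) V k" using PV(1) by (simp add: act_def)
      then obtain z where z: "z \<in> V k" "T s *v (P *v x) = m *v z" unfolding m(3) by (auto simp: act_def)
      have "R *v x = (conj_transpose m ** m) *v z" by (simp add: R_def z(2) flip: matrix_vector_mul_assoc)
      then have "R *v x = z" by (simp add: m(1))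
      then show "(P ** R) *v x = R *v x" using PV(2)[OF z(1)] by (simp flip: matrix_vector_mul_assoc)
    qed
    have RP: "R ** P = R" by (simp add: R_def P flip: matrix_mul_assoc)
    have ctR: "conj_transpose R = P ** conj_transpose (T s) ** m" by (simp add: R_def conj_transpose_mult P(1) matrix_mul_assoc)
    have "conj_transpose R ** R = P ** conj_transpose (T s) ** (m ** conj_transpose m) ** T s ** P"
      unfolding ctR by (simp only: R_def matrix_mul_assoc)
    then have RR: "conj_transpose R ** R - P = G s"
      by (simp add: m' G_def P matrix_mult.diff_left matrix_mult.diff_right matrix_mul_assoc)
    have ctRP: "conj_transpose R ** P = conj_transpose R"
      using arg_cong[OF PR, of conj_transpose] by (simp only: conj_transpose_mult P(1))
    have "conj_transpose R ** S ** R = (conj_transpose R ** P) ** H ** (P ** R)" by (simp only: S_def matrix_mul_assoc)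
    also have "\<dots> = P ** conj_transpose (T s) ** (m ** H ** conj_transpose m) ** T s ** P"
      unfolding PR ctRP unfolding ctR by (simp only: R_def matrix_mul_assoc)
    finally have RSR: "conj_transpose R ** S ** R = P ** (conj_transpose (T s) ** H ** T s ** P)" by (simp only: Hm matrix_mul_assoc)
    have "S \<bullet> (R ** conj_transpose R) = Re (trace (conj_transpose R ** S ** R))"
      using trace_mul_sym[of "S ** R" "conj_transpose R"] by (simp add: inner_eq_trace conj_transpose_mult matrix_mul_assoc)
    also have "\<dots> = (conj_transpose (T s) ** H ** T s) \<bullet> P"
      unfolding RSR trace_mul_sym[of P] by (simp add: inner_eq_trace P flip: matrix_mul_assoc)
    finally have "S \<bullet> (R ** conj_transpose R) = (conj_transpose (T s) ** H ** T s) \<bullet> P" .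
    moreover have "S \<bullet> P = H \<bullet> P"
      using trace_mul_sym[of P "H ** P"] by (simp add: inner_eq_trace S_def P flip: matrix_mul_assoc)
    ultimately have "K s = S \<bullet> (R ** conj_transpose R - P)" by (simp add: K_def inner_diff_left inner_diff_right)
    also have "\<dots> \<le> norm S * norm (R ** conj_transpose R - P)" by (rule norm_cauchy_schwarz)
    finally show ?case unfolding norm_mult_adjoint[OF P PR RP] RR .
  qed
  then have "\<forall>\<^sub>F s in at_right 0. (1 / s) *\<^sub>R K s \<le> norm S * norm ((1 / s) *\<^sub>R G s)"
    using eventually_at_right_less[of 0] by eventually_elim (simp add: divide_simps)
  moreover have "((\<lambda>s. norm S * norm ((1 / s) *\<^sub>R G s)) \<longlongrightarrow> norm S * norm (2 *\<^sub>R S)) (at_right 0)"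
    by (intro tendsto_intros limG)
  ultimately have "2 * ((H ** P) \<bullet> (H ** P)) \<le> norm S * norm (2 *\<^sub>R S)"
    using tendsto_le[OF _ _ limK] by fastforce
  \<comment> \<open>In the limit the norm of \<open>H ** P\<close> is at most that of its orthogonal
    projection \<open>S\<close>, so the two agree: \<open>H\<close> maps \<open>V k\<close> into
    itself.\<close>
  then have le: "(H ** P) \<bullet> (H ** P) \<le> S \<bullet> S" by (simp add: dot_square_norm power2_eq_square)
  have "(H ** P) \<bullet> S = S \<bullet> S"
    using trace_mul_sym[of P "H ** P ** P ** H ** P"]
    by (simp add: inner_eq_trace S_def conj_transpose_mult P H matrix_mul_assoc)
      (metis P(2) matrix_mul_assoc trace_mul_sym)
  then have "(H ** P - S) \<bullet> (H ** P - S) \<le> 0"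
    using le by (simp add: inner_diff_left inner_diff_right inner_commute)
  then have "H ** P = S" by (metis inner_ge_zero inner_eq_zero_iff order_antisym right_minus_eq)
  then have "H *v (P *v v) = P *v (H *v (P *v v))" by (metis S_def matrix_vector_mul_assoc)
  then show ?thesis using PV(1)[of "H *v v"] PV(2)[OF v] by simp
qed

section \<open>Derivatives in the charts of the flag manifold\<close>

lemma mat_comm: "mat c ** A = A ** mat c" for A :: "'n::{finite,wellorder} cmat"
proof -
  have "(A ** mat c) $ i $ j = (\<Sum>k\<in>UNIV. if k = j then c * A $ i $ j else 0)" for i j
    unfolding matrix_matrix_mult_def mat_def vec_lambda_beta by (intro sum.cong) auto
  then show ?thesis by (simp add: vec_eq_iff mat_mult_nth)
qed

lemma mat_mat: "mat a ** mat b = (mat (a * b) :: 'n::{finite,wellorder} cmat)"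
  unfolding vec_eq_iff mat_mult_nth by (simp add: mat_def)

lemma bounded_linear_low_part: "bounded_linear (low_part :: 'n::{finite,wellorder} cmat \<Rightarrow> 'n cmat)"
  and bounded_linear_up_part: "bounded_linear (up_part :: 'n::{finite,wellorder} cmat \<Rightarrow> 'n cmat)"
proof -
  have "linear (low_part :: 'n cmat \<Rightarrow> 'n cmat)" "linear (up_part :: 'n cmat \<Rightarrow> 'n cmat)"
    by (auto intro!: linearI simp: low_part_def up_part_def vec_eq_iff)
  then show "bounded_linear (low_part :: 'n cmat \<Rightarrow> 'n cmat)" "bounded_linear (up_part :: 'n cmat \<Rightarrow> 'n cmat)"
    by (simp_all add: linear_conv_bounded_linear)
qed

lemma strictly_lower_closed:
  assumes "X \<in> strictly_lower" "Y \<in> strictly_lower"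
  shows "X + Y \<in> strictly_lower" "X ** Y \<in> strictly_lower"
proof -
  show "X + Y \<in> strictly_lower" using assms by (auto simp: strictly_lower_def)
  have "X $ i $ k * Y $ k $ j = 0" if "i \<le> j" for i j k
  proof (cases "i \<le> k")
    case False
    then have "k \<le> j" using that by auto
    then show ?thesis using assms by (simp add: strictly_lower_def)
  qed (use assms in \<open>simp add: strictly_lower_def\<close>)
  then show "X ** Y \<in> strictly_lower"
    unfolding strictly_lower_def matrix_matrix_mult_def by (auto intro!: sum.neutral)
qed

lemma mat_1_big_cell: "(mat 1 :: 'n::{finite,wellorder} cmat) \<in> big_cell" "chart_low (mat 1 :: 'n cmat) = 0"
proof -
  have "(0 :: 'n cmat) \<in> strictly_lower" by (simp add: strictly_lower_def)
  from big_cellI[OF this upper_borel_one]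
  show "(mat 1 :: 'n cmat) \<in> big_cell" "chart_low (mat 1 :: 'n cmat) = 0" by simp_all
qed

text \<open>At the identity the derivative of \<open>lu_map\<close> adds the lower and the upper
  part of its argument and is thus the identity; the same then holds for the inverse map, whose
  lower part is the chart.\<close>

lemma has_derivative_chart_low: "((chart_low :: 'n::{finite,wellorder} cmat \<Rightarrow> 'n cmat) has_derivative low_part) (at (mat 1))"
proof -
  have parts: "low_part (mat 1) = (0 :: 'n cmat)" "up_part (mat 1) = (mat 1 :: 'n cmat)"
    by (auto simp: low_part_def up_part_def mat_def vec_eq_iff)
  have lu1: "lu_map (mat 1 :: 'n cmat) = mat 1" by (simp add: lu_map_def parts)
  have "(mat 1 :: 'n cmat) \<in> lu_dom" by (simp add: lu_dom_def parts)
  then have inv1: "lu_inv (mat 1 :: 'n cmat) = mat 1"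
    unfolding lu_inv_def using inv_into_f_f[OF lu_map_inj, of "mat 1 :: 'n cmat"] lu1 by simp
  have "((\<lambda>M :: 'n cmat. mat 1 + low_part M) has_derivative low_part) (at (mat 1))"
    using has_derivative_add[OF has_derivative_const bounded_linear_imp_has_derivative[OF bounded_linear_low_part]] by simp
  from matrix_mult.FDERIV[OF this bounded_linear_imp_has_derivative[OF bounded_linear_up_part]]
  have "((lu_map :: 'n cmat \<Rightarrow> 'n cmat) has_derivative (\<lambda>h. up_part h + low_part h)) (at (mat 1))"
    by (simp add: lu_map_def[abs_def] parts)
  then have "((lu_map :: 'n cmat \<Rightarrow> 'n cmat) has_derivative id) (at (lu_inv (mat 1)))"
    by (simp add: inv1 id_def low_up_sum add.commute[of "up_part _"])
  then have "((lu_inv :: 'n cmat \<Rightarrow> 'n cmat) has_derivative id) (at (mat 1))"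
  proof (rule has_derivative_inverse_basic[OF _ _ _ _ open_big_cell mat_1_big_cell(1)])
    show "continuous (at (mat 1)) (lu_inv :: 'n cmat \<Rightarrow> 'n cmat)"
      using continuous_on_lu_inv continuous_on_eq_continuous_at[OF open_big_cell] mat_1_big_cell(1) by blast
    show "lu_map (lu_inv z) = z" if "z \<in> big_cell" for z :: "'n cmat"
      using f_inv_into_f[of z lu_map lu_dom] that by (simp add: lu_inv_def big_cell_def)
  qed (auto simp: id_def bounded_linear_ident)
  from has_derivative_compose[OF this bounded_linear_imp_has_derivative[OF bounded_linear_low_part]]
  show ?thesis by (simp add: chart_low_def[abs_def])
qed

lemma has_vector_derivative_chain:
  assumes "(f has_vector_derivative f') (at x)" "(F has_derivative F') (at (f x))"
  shows "((\<lambda>t. F (f t)) has_vector_derivative F' f') (at x)"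
  using vector_derivative_diff_chain_within[OF assms(1) has_derivative_at_withinI[OF assms(2)]] by (simp add: o_def)

lemma eventually_in_open:
  assumes "(f has_vector_derivative f') (at (0 :: real))" "open S" "f 0 \<in> S"
  shows "\<forall>\<^sub>F t in at_right 0. f t \<in> S"
proof -
  have "(f \<longlongrightarrow> f 0) (at 0)"
    using has_vector_derivative_continuous[OF assms(1)] by (simp add: continuous_at isCont_def)
  then have "(f \<longlongrightarrow> f 0) (at_right 0)" by (rule filterlim_at_split[THEN iffD1, THEN conjunct2])
  then show ?thesis using topological_tendstoD[OF _ assms(2,3)] by blast
qed

context signature
begin

text \<open>The traceless combination of \<open>Jmat q\<close> and the identity. It has the same
  stable subspaces as \<open>Jmat q\<close>, but generates a circle of determinant one.\<close>

definition Hmat :: "'n cmat" where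
  "Hmat = (\<chi> i j. if i = j then (if idx i \<le> q then - of_nat p else of_nat q) else 0)"

lemma Hmat_eq: "Hmat = mat (of_nat (p + q) / 2) ** Jmat q + mat ((of_nat q - of_nat p) / 2)"
  unfolding vec_eq_iff vector_add_component mat_mult_nth
  by (simp add: Hmat_def Jmat_def mat_def field_simps)

lemma Hmat_conj_transpose: "conj_transpose Hmat = Hmat"
  by (auto simp: conj_transpose_def Hmat_def vec_eq_iff)

lemma Hmat_stable:
  assumes "vec.subspace W" "v \<in> W" "Hmat *v v \<in> W"
  shows "Jmat q *v v \<in> W"
proof -
  define c :: complex where "c = of_nat (p + q)"
  have "p + q \<noteq> 0" using card_n zero_less_card_finite[where 'a='n] by linarith
  then have c: "c \<noteq> 0" unfolding c_def of_nat_eq_0_iff .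
  have "Hmat *v v = (c / 2) *s (Jmat q *v v) + ((of_nat q - of_nat p) / 2) *s v"
    unfolding c_def Hmat_eq matrix_vector_mult_add_rdistrib matrix_vector_mul_assoc[symmetric] mat_mult_vec ..
  then have "Jmat q *v v = (2 / c) *s (Hmat *v v - ((of_nat q - of_nat p) / 2) *s v)"
    using c by (simp add: vector_smult_assoc)
  then show ?thesis
    using vec.subspace_scale[OF assms(1) vec.subspace_diff[OF assms(1,3) vec.subspace_scale[OF assms(1,2)]]] by metis
qed

text \<open>The exponential of \<open>i t Hmat\<close>; the weights \<open>-p\<close>, taken
  \<open>q\<close> times, and \<open>q\<close>, taken \<open>p\<close> times, cancel in the
  determinant.\<close>

definition phase :: "real \<Rightarrow> 'n cmat" where
  "phase t = (\<chi> i j. if i = j then (if idx i \<le> q then cis (- (real p * t)) else cis (real q * t)) else 0)"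

lemma phase_0: "phase 0 = mat 1"
  by (simp add: phase_def mat_def vec_eq_iff)

lemma phase_K0: "phase t \<in> K0 p q"
proof -
  have ph: "phase t *v x = (\<chi> i. (if idx i \<le> q then cis (- (real p * t)) else cis (real q * t)) * x $ i)" for x
    unfolding vec_eq_iff by (simp add: diagonal_mult phase_def)
  have "det (phase t) = (\<Prod>a\<in>UNIV. phase t $ a $ a)" by (rule det_diagonal) (simp add: phase_def)
  also have "\<dots> = (\<Prod>a\<in>(UNIV :: 'n set). (\<lambda>m. if m \<le> q then cis (- (real p * t)) else cis (real q * t)) (idx a))"
    by (simp add: phase_def)
  also have "\<dots> = (\<Prod>m\<in>{1..p + q}. if m \<le> q then cis (- (real p * t)) else cis (real q * t))"
    using prod.reindex_bij_betw[OF idx_bij[where 'n='n], of "\<lambda>m. if m \<le> q then cis (- (real p * t)) else cis (real q * t)"]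
    unfolding card_n .
  also have "{1..p + q} = {1..q} \<union> {q + 1..p + q}" by auto
  also have "(\<Prod>m\<in>{1..q} \<union> {q + 1..p + q}. if m \<le> q then cis (- (real p * t)) else cis (real q * t)) =
      (\<Prod>m\<in>{1..q}. cis (- (real p * t))) * (\<Prod>m\<in>{q + 1..p + q}. cis (real q * t))"
    by (subst prod.union_disjoint) (auto intro!: arg_cong2[of _ _ _ _ "(*)"] prod.cong)
  also have "\<dots> = 1" by (simp add: Complex.DeMoivre cis_mult)
  finally have "det (phase t) = 1" .
  moreover have "conj_transpose (phase t) ** phase t = mat 1"
    unfolding unitary_iff by (auto simp: ph sip_def intro!: sum.cong) (simp_all add: cis_cnj cis_mult mult.left_commute flip: mult.assoc)
  moreover have "Jmat q ** phase t = phase t ** Jmat q"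
    unfolding matrix_eq by (simp add: ph Jmat_mult vec_eq_iff flip: matrix_vector_mul_assoc)
  ultimately show ?thesis by (simp add: K0_iff)
qed

lemma phase_derivative: "(phase has_vector_derivative mat \<i> ** Hmat) (at 0)"
proof -
  define P where "P = ((\<chi> i j. if i = j \<and> idx i \<le> q then 1 else 0) :: 'n cmat)"
  define P' where "P' = ((\<chi> i j. if i = j \<and> \<not> idx i \<le> q then 1 else 0) :: 'n cmat)"
  have bl: "bounded_linear (\<lambda>c. mat c ** B)" for B :: "'n cmat"
  proof -
    have "linear (\<lambda>c. mat c ** B)"
      by (rule linearI) (simp_all add: vec_eq_iff mat_mult_nth algebra_simps)
    then show ?thesis by (rule linear_conv_bounded_linear[THEN iffD1])
  qed
  have dc: "((\<lambda>t. cis (a * t)) has_vector_derivative of_real a * \<i>) (at 0)" for a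
    unfolding has_vector_derivative_def
    by (rule has_derivative_eq_rhs[OF has_derivative_cis[OF has_derivative_mult_right[OF has_derivative_ident]]])
      (simp add: fun_eq_iff scaleR_conv_of_real)
  have eq: "phase = (\<lambda>t. mat (cis (- real p * t)) ** P + mat (cis (real q * t)) ** P')"
    unfolding fun_eq_iff vec_eq_iff vector_add_component mat_mult_nth by (simp add: phase_def P_def P'_def)
  have "(phase has_vector_derivative mat (of_real (- real p) * \<i>) ** P + mat (of_real (real q) * \<i>) ** P') (at 0)"
    unfolding eq by (intro has_vector_derivative_add bounded_linear.has_vector_derivative[OF bl] dc)
  moreover have "mat (of_real (- real p) * \<i>) ** P + mat (of_real (real q) * \<i>) ** P' = mat \<i> ** Hmat"
    unfolding vec_eq_iff vector_add_component mat_mult_nth by (simp add: Hmat_def P_def P'_def)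
  ultimately show ?thesis by simp
qed

text \<open>A complex submanifold that is an orbit of \<open>K0 p q\<close> contains, along with the curve \<open>phase t\<close> applied to \<open>V\<close>,
  a curve whose velocity is the imaginary multiple of the velocity of the former.\<close>

lemma complex_orbit_stable:
  fixes V :: "'n flag"
  assumes V: "V \<in> complete_flags" and sub: "complex_submanifold d (orbit (K0 p q) V)" and v: "v \<in> V k"
  shows "Jmat q *v v \<in> V k"
proof -
  let ?C = "orbit (K0 p q) V"
  have VC: "V \<in> ?C" unfolding orbit_def by (intro CollectI exI[of _ "mat 1"]) (simp add: K0_one)
  obtain g X where gX: "invertible g" "X \<in> strictly_lower" "flag_chart g X = V"
    and ms: "matrix_submanifold_at d {Y \<in> strictly_lower. flag_chart g Y \<in> ?C} X"
    using sub VC unfolding complex_submanifold_def by blast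
  define M where "M = {Y \<in> strictly_lower. flag_chart g Y \<in> ?C}"
  obtain S W \<phi> \<psi> L where XS: "X \<in> S" and bih: "biholomorphic_maps S W \<phi> \<psi>" and L: "subspace L"
    and Lc: "\<And>c A. A \<in> L \<Longrightarrow> mat c ** A \<in> L" and \<phi>M: "\<phi> ` (M \<inter> S) = W \<inter> L"
    using ms unfolding matrix_submanifold_at_def M_def[symmetric] by (elim exE conjE) (rule that; (assumption | blast))
  have bih': "open S" "open W" "homeomorphism S W \<phi> \<psi>" "holomorphic_map \<phi> S" "holomorphic_map \<psi> W"
    using bih by (auto simp: biholomorphic_maps_def)
  have \<phi>W: "\<phi> X \<in> W" and inv_\<phi>: "\<And>x. x \<in> S \<Longrightarrow> \<psi> (\<phi> x) = x" using bih'(3) XS by (auto simp: homeomorphism_def)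
  have XM: "X \<in> M" using gX VC by (simp add: M_def)
  define A where "A = g ** (mat 1 + X)"
  have invA: "invertible A" using gX(1) invertible_unipotent[OF gX(2)] by (simp add: A_def invertible_mult)
  have VA: "V = act A std_flag" using gX(3) by (simp add: flag_chart_def A_def)
  \<comment> \<open>The circle as seen in the frame \<open>A\<close> of \<open>V\<close>; it starts
    at the identity, where the derivative of \<open>chart_low\<close> is known.\<close>
  define Q where "Q t = matrix_inv A ** (phase t ** A)" for t
  define \<eta>\<^sub>0 where "\<eta>\<^sub>0 = matrix_inv A ** (mat \<i> ** Hmat ** A)"
  have Q': "(Q has_vector_derivative \<eta>\<^sub>0) (at 0)"
    unfolding Q_def \<eta>\<^sub>0_def
    by (intro bounded_linear.has_vector_derivative[OF matrix_mult.bounded_linear_right]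
      bounded_linear.has_vector_derivative[OF matrix_mult.bounded_linear_left] phase_derivative)
  have Q0: "Q 0 = mat 1" using invA by (simp add: Q_def phase_0)
  define Z where "Z t = chart_low (Q t)" for t
  have Z': "(Z has_vector_derivative low_part \<eta>\<^sub>0) (at 0)"
    unfolding Z_def by (rule has_vector_derivative_chain[OF Q']) (simp add: Q0 has_derivative_chart_low)
  \<comment> \<open>From the chart at \<open>A\<close> back to the chart at \<open>g\<close>:
    \<open>(1 + X) (1 + Z t) = 1 + Y t\<close>.\<close>
  define Y where "Y t = X + (mat 1 + X) ** Z t" for t
  define \<eta> where "\<eta> = (mat 1 + X) ** low_part \<eta>\<^sub>0"
  have Y': "(Y has_vector_derivative \<eta>) (at 0)"
    using has_vector_derivative_add[OF has_vector_derivative_const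
      bounded_linear.has_vector_derivative[OF matrix_mult.bounded_linear_right Z']] by (simp add: Y_def[abs_def] \<eta>_def)
  have Y0: "Y 0 = X" by (simp add: Y_def Z_def Q0 mat_1_big_cell matrix_mult.zero_right)
  have YM: "Y t \<in> M" if "Q t \<in> big_cell" for t
  proof -
    note Zt = big_cell_decomp(2,5)[OF that, folded Z_def]
    have "Y t = X + (Z t + X ** Z t)" by (simp add: Y_def matrix_mult.add_left)
    then have "Y t \<in> strictly_lower" using gX(2) Zt(1) by (simp add: strictly_lower_closed)
    moreover have "flag_chart g (Y t) = act (phase t) V"
    proof -
      have "g ** (mat 1 + Y t) = A ** (mat 1 + Z t)"
        by (simp add: A_def Y_def matrix_mult.add_left matrix_mult.add_right add.assoc flip: matrix_mul_assoc)
      then have "flag_chart g (Y t) = act A (act (Q t) std_flag)" by (simp add: flag_chart_def act_mult Zt(2))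
      also have "\<dots> = act (phase t) V" using invA by (simp add: VA Q_def flip: act_mult)
      finally show ?thesis .
    qed
    ultimately show ?thesis unfolding M_def orbit_def using phase_K0 by blast
  qed
  have evY: "\<forall>\<^sub>F t in at_right 0. Y t \<in> M \<inter> S"
  proof -
    have "\<forall>\<^sub>F t in at_right 0. Q t \<in> big_cell"
      by (rule eventually_in_open[OF Q' open_big_cell]) (simp add: Q0 mat_1_big_cell)
    moreover have "\<forall>\<^sub>F t in at_right 0. Y t \<in> S"
      by (rule eventually_in_open[OF Y' bih'(1)]) (simp add: Y0 XS)
    ultimately show ?thesis by eventually_elim (simp add: YM)
  qed
  obtain \<phi>' where \<phi>': "(\<phi> has_derivative \<phi>') (at X)" "\<And>c B. \<phi>' (mat c ** B) = mat c ** \<phi>' B"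
    using bih'(4) XS unfolding holomorphic_map_def by blast
  obtain \<psi>' where \<psi>': "(\<psi> has_derivative \<psi>') (at (\<phi> X))"
    using bih'(5) \<phi>W unfolding holomorphic_map_def by blast
  have "((\<lambda>x. \<psi> (\<phi> x)) has_derivative (\<lambda>h. \<psi>' (\<phi>' h))) (at X)" by (rule has_derivative_compose[OF \<phi>'(1) \<psi>'])
  then have "((\<lambda>x. x) has_derivative (\<lambda>h. \<psi>' (\<phi>' h))) (at X)"
    by (rule has_derivative_transform_within_open[OF _ bih'(1) XS]) (simp add: inv_\<phi>)
  then have "(\<lambda>x. x) = (\<lambda>h. \<psi>' (\<phi>' h))" by (rule has_derivative_unique[OF has_derivative_ident])
  then have \<psi>\<phi>: "\<psi>' (\<phi>' h) = h" for h by (rule fun_cong[symmetric])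
  \<comment> \<open>The straightened curve runs inside \<open>L\<close>, and so do its difference
    quotients and, \<open>L\<close> being closed, its velocity.\<close>
  have "\<phi>' \<eta> \<in> L"
  proof (rule Lim_in_closed_set[OF closed_subspace[OF L]])
    have "((\<lambda>t. \<phi> (Y t) - \<phi> X) has_vector_derivative \<phi>' \<eta> - 0) (at 0)"
      by (intro has_vector_derivative_diff has_vector_derivative_const has_vector_derivative_chain[OF Y']) (simp add: Y0 \<phi>'(1))
    then show "((\<lambda>t. (1 / t) *\<^sub>R (\<phi> (Y t) - \<phi> X)) \<longlongrightarrow> \<phi>' \<eta>) (at_right 0)"
      by (intro difference_quotient) (simp_all add: Y0)
    have "\<phi> X \<in> L" using \<phi>M XM XS by blast
    moreover have "\<forall>\<^sub>F t in at_right 0. \<phi> (Y t) \<in> L" using evY by eventually_elim (use \<phi>M in blast)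
    ultimately show "\<forall>\<^sub>F t in at_right 0. (1 / t) *\<^sub>R (\<phi> (Y t) - \<phi> X) \<in> L"
      using L by (auto elim!: eventually_mono intro!: subspace_scale subspace_diff)
  qed simp
  \<comment> \<open>The velocity of the circle comes from \<open>i Hmat\<close>; multiplying by
    \<open>-i\<close>, which \<open>L\<close> allows, gives the direction that belongs to
    \<open>Hmat\<close> itself. The straight line in this direction inside \<open>L\<close> pulls
    back to a curve in the orbit.\<close>
  define \<mu> where "\<mu> = \<phi>' (mat (-\<i>) ** \<eta>)"
  have \<mu>L: "\<mu> \<in> L" unfolding \<mu>_def \<phi>'(2) by (rule Lc) fact
  define \<zeta> where "\<zeta> s = \<psi> (\<phi> X + s *\<^sub>R \<mu>)" for s :: real
  have line: "((\<lambda>s. B + s *\<^sub>R \<mu>') has_vector_derivative \<mu>') (at 0)" for B \<mu>' :: "'n cmat"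
    unfolding has_vector_derivative_def by (auto intro!: derivative_eq_intros)
  have \<zeta>': "(\<zeta> has_vector_derivative mat (-\<i>) ** \<eta>) (at 0)"
    unfolding \<zeta>_def using has_vector_derivative_chain[OF line, of \<psi> \<psi>' "\<phi> X" \<mu>] \<psi>' by (simp add: \<mu>_def \<psi>\<phi>)
  have \<zeta>0: "\<zeta> 0 = X" using inv_\<phi>[OF XS] by (simp add: \<zeta>_def)
  have "\<phi> X \<in> L" using \<phi>M XM XS by blast
  have ev\<zeta>: "\<forall>\<^sub>F s in at_right 0. \<zeta> s \<in> M"
  proof -
    have "\<forall>\<^sub>F s in at_right 0. \<phi> X + s *\<^sub>R \<mu> \<in> W" by (rule eventually_in_open[OF line bih'(2)]) (simp add: \<phi>W)
    then show ?thesis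
    proof eventually_elim
      case (elim s)
      moreover have "\<phi> X + s *\<^sub>R \<mu> \<in> L" using L \<mu>L \<open>\<phi> X \<in> L\<close> by (simp add: subspace_add subspace_scale)
      ultimately obtain m where "m \<in> M" "m \<in> S" "\<phi> X + s *\<^sub>R \<mu> = \<phi> m" using \<phi>M by blast
      then show ?case using inv_\<phi> by (simp add: \<zeta>_def)
    qed
  qed
  \<comment> \<open>The chart sees only the lower part of the velocity. The factor
    \<open>1 + s \<beta>\<close> restores the upper part without moving the flag, so that
    \<open>T\<close> has derivative exactly \<open>Hmat\<close>.\<close>
  define \<beta> where "\<beta> = mat (-\<i>) ** up_part \<eta>\<^sub>0"
  define T where "T s = g ** (mat 1 + \<zeta> s) ** (mat 1 + s *\<^sub>R \<beta>) ** matrix_inv A" for s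
  have T0: "T 0 = mat 1" using invA by (simp add: T_def \<zeta>0 flip: A_def)
  have g\<zeta>: "((\<lambda>s. g ** (mat 1 + \<zeta> s)) has_vector_derivative g ** (mat (-\<i>) ** \<eta>)) (at 0)"
    using bounded_linear.has_vector_derivative[OF matrix_mult.bounded_linear_right
      has_vector_derivative_add[OF has_vector_derivative_const \<zeta>']] by fastforce
  have "(T has_vector_derivative (A ** \<beta> + g ** (mat (-\<i>) ** \<eta>)) ** matrix_inv A) (at 0)"
    using bounded_linear.has_vector_derivative[OF matrix_mult.bounded_linear_left
      matrix_mult.has_vector_derivative[OF g\<zeta> line[of "mat 1" \<beta>]], of "matrix_inv A"]
    by (simp add: T_def[abs_def] \<zeta>0 flip: A_def)
  moreover have "(A ** \<beta> + g ** (mat (-\<i>) ** \<eta>)) ** matrix_inv A = Hmat"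
  proof -
    have "g ** (mat (-\<i>) ** \<eta>) = (g ** mat (-\<i>)) ** ((mat 1 + X) ** low_part \<eta>\<^sub>0)" by (simp only: \<eta>_def matrix_mul_assoc)
    also have "\<dots> = mat (-\<i>) ** (A ** low_part \<eta>\<^sub>0)" by (simp only: A_def matrix_mul_assoc flip: mat_comm)
    finally have 1: "g ** (mat (-\<i>) ** \<eta>) = mat (-\<i>) ** (A ** low_part \<eta>\<^sub>0)" .
    have "A ** \<beta> = (A ** mat (-\<i>)) ** up_part \<eta>\<^sub>0" by (simp only: \<beta>_def matrix_mul_assoc)
    also have "\<dots> = mat (-\<i>) ** (A ** up_part \<eta>\<^sub>0)" by (simp only: matrix_mul_assoc flip: mat_comm)
    finally have "A ** \<beta> + g ** (mat (-\<i>) ** \<eta>) = mat (-\<i>) ** (A ** (up_part \<eta>\<^sub>0 + low_part \<eta>\<^sub>0))"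
      by (simp only: 1 matrix_mult.add_right)
    also have "up_part \<eta>\<^sub>0 + low_part \<eta>\<^sub>0 = \<eta>\<^sub>0" using low_up_sum[of \<eta>\<^sub>0] by (simp add: add.commute)
    also have "A ** \<eta>\<^sub>0 = mat \<i> ** Hmat ** A" using invA by (simp add: \<eta>\<^sub>0_def)
    also have "mat (-\<i>) ** (mat \<i> ** Hmat ** A) = (mat (-\<i>) ** mat \<i>) ** Hmat ** A" by (simp only: matrix_mul_assoc)
    also have "\<dots> = Hmat ** A" by (simp add: mat_mat)
    finally show ?thesis using invA by (simp flip: matrix_mul_assoc)
  qed
  ultimately have T': "(T has_vector_derivative Hmat) (at 0)" by simp
  have ev: "\<forall>\<^sub>F s in at_right 0. \<exists>k. conj_transpose k ** k = mat 1 \<and> Hmat ** k = k ** Hmat \<and> act (T s) V = act k V"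
  proof -
    have "\<forall>\<^sub>F s in at_right 0. mat 1 + s *\<^sub>R \<beta> \<in> {B. invertible B}"
      by (rule eventually_in_open[OF line open_invertible]) simp
    with ev\<zeta> show ?thesis
    proof eventually_elim
      case (elim s)
      have "(mat 1 + s *\<^sub>R \<beta>) $ i $ j = 0" if "j < i" for i j
      proof -
        have "\<beta> $ i $ j = 0" using that unfolding \<beta>_def mat_mult_nth by (simp add: up_part_def)
        then show ?thesis using that by (simp add: mat_def)
      qed
      then have "mat 1 + s *\<^sub>R \<beta> \<in> upper_borel" using elim by (intro upper_borelI_upper) auto
      then have "act (T s ** A) std_flag = act (g ** (mat 1 + \<zeta> s)) std_flag"
        using invA act_upper_borel by (simp add: T_def flip: matrix_mul_assoc) (simp add: matrix_mul_assoc)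
      then have "act (T s) V = flag_chart g (\<zeta> s)" by (simp add: VA act_mult flag_chart_def)
      then have "act (T s) V \<in> ?C" using elim by (simp add: M_def)
      then obtain k where k: "k \<in> K0 p q" "act (T s) V = act k V" by (auto simp: orbit_def)
      have Jk: "Jmat q ** k = k ** Jmat q" using k(1) by (simp add: K0_iff)
      let ?a = "mat (of_nat (p + q) / 2) :: 'n cmat" and ?b = "mat ((of_nat q - of_nat p) / 2) :: 'n cmat"
      have "Hmat ** k = ?a ** (Jmat q ** k) + ?b ** k" by (simp only: Hmat_eq matrix_mult.add_left matrix_mul_assoc)
      also have "\<dots> = (?a ** k) ** Jmat q + ?b ** k" by (simp only: Jk matrix_mul_assoc)
      also have "\<dots> = (k ** ?a) ** Jmat q + k ** ?b" by (simp only: mat_comm[of _ k])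
      also have "\<dots> = k ** Hmat" by (simp only: Hmat_eq matrix_mult.add_right matrix_mul_assoc)
      finally have "Hmat ** k = k ** Hmat" .
      then show ?case using k by (auto simp: K0_iff)
    qed
  qed
  have "Hmat *v v \<in> V k" by (rule stable_of_curve[OF V Hmat_conj_transpose T' T0 ev v])
  then show ?thesis using Hmat_stable complete_flagsD(2)[OF V] v by blast
qed

end

text \<open>Any competing orbit consists of \<open>Jmat q\<close>-stable flags by
  \<open>complex_orbit_stable\<close>. It therefore meets \<open>cycle \<alpha>\<close>, which is a
  single \<open>K0\<close>-orbit.\<close>

lemma (in iwasawa) base_cycle_eq:
  assumes len: "length \<alpha> = p + q" and cnt: "count_list \<alpha> Minus = q"
  shows "base_cycle p q (sign_orbit p q \<alpha>) = cycle \<alpha>"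
  unfolding base_cycle_def
proof (rule the_equality)
  obtain \<epsilon> where \<epsilon>: "bij_betw \<epsilon> {1..p + q} {1..p + q}" "\<And>k. k \<in> {1..p + q} \<Longrightarrow> \<epsilon> k \<le> q \<longleftrightarrow> \<alpha> ! (k - 1) = Minus"
    using exists_coordinate_flag[OF len cnt] by blast
  have inv: "invertible (perm_mat \<epsilon> :: 'n cmat)" using \<epsilon>(1) by (intro invertible_perm_mat) (simp add: card_n)
  have W: "act (perm_mat \<epsilon>) std_flag \<in> cycle \<alpha>"
    using eigenframe_cycle[OF inv _ len] coordinate_eigenframe[OF \<epsilon>] by (simp add: perm_mat_def)
  have "act (perm_mat \<epsilon>) (std_flag :: 'n flag) \<in> complete_flags" using inv by simp
  then show "(\<exists>V\<in>complete_flags. cycle \<alpha> = orbit (K0 p q) V) \<and> cycle \<alpha> \<subseteq> sign_orbit p q \<alpha> \<and> (\<exists>d. complex_submanifold d (cycle \<alpha>))"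
    using cycle_eq_orbit[OF W len] complex_submanifold_cycle[OF len] by (auto simp: cycle_def)
next
  fix C :: "'n flag set" assume "(\<exists>V\<in>complete_flags. C = orbit (K0 p q) V) \<and> C \<subseteq> sign_orbit p q \<alpha> \<and> (\<exists>d. complex_submanifold d C)"
  then obtain V d where V: "V \<in> complete_flags" "C = orbit (K0 p q) V" "C \<subseteq> sign_orbit p q \<alpha>" "complex_submanifold d C" by blast
  have "V \<in> C" unfolding V(2) orbit_def by (intro CollectI exI[of _ "mat 1"]) (simp add: K0_one)
  then have "V \<in> cycle \<alpha>" using V complex_orbit_stable[OF V(1)] by (auto simp: cycle_def)
  then show "C = cycle \<alpha>" using cycle_eq_orbit[OF _ len] V(2) by blast
qed

subsection \<open>Intersection points\<close>

context iwasawa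
begin

lemma perm_list_map:
  assumes "bij_betw f {1..p + q} {1..p + q}"
  shows "map f [1..<p + q + 1] \<in> permutations_of_set {1..p + q}"
proof (rule permutations_of_setI)
  have set: "set [1..<p + q + 1] = {1..p + q}" by auto
  show "set (map f [1..<p + q + 1]) = {1..p + q}" using assms unfolding set_map set by (simp add: bij_betw_def)
  show "distinct (map f [1..<p + q + 1])" using assms unfolding distinct_map set by (simp add: bij_betw_def)
qed

lemma map_nth_list:
  assumes "length xs = p + q" "\<And>k. k \<in> {1..p + q} \<Longrightarrow> xs ! (k - 1) = f k"
  shows "xs = map f [1..<p + q + 1]"
proof (rule nth_equalityI)
  fix i assume "i < length xs"
  then show "xs ! i = map f [1..<p + q + 1] ! i" using assms(1) assms(2)[of "Suc i"] by (simp del: upt_Suc)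
qed (use assms in \<open>simp del: upt_Suc\<close>)

text \<open>An output \<open>(e, w)\<close> of the algorithm encodes a coordinate flag in the base cycle, namely the one of the
  basis \<open>e\<close>, together with its position \<open>w\<close> relative to the Iwasawa flag; these are the coordinate flags of minimal length.\<close>

lemma algorithm_output_iff:
  assumes len: "length \<alpha> = p + q" and cnt: "count_list \<alpha> Minus = q"
  shows "algorithm_output p q \<alpha> e w \<longleftrightarrow>
    (\<exists>\<epsilon>. bij_betw \<epsilon> {1..p + q} {1..p + q} \<and> (\<forall>k\<in>{1..p + q}. \<epsilon> k \<le> q \<longleftrightarrow> \<alpha> ! (k - 1) = Minus) \<and>
      inv_on {1..p + q} (cell_perm p q \<epsilon>) = p * q \<and>
      e = map \<epsilon> [1..<p + q + 1] \<and> w = map (cell_perm p q \<epsilon>) [1..<p + q + 1])"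
proof
  assume out: "algorithm_output p q \<alpha> e w"
  note a = algorithm_coordinate_flag[OF out len q_le_p cnt]
  show "\<exists>\<epsilon>. bij_betw \<epsilon> {1..p + q} {1..p + q} \<and> (\<forall>k\<in>{1..p + q}. \<epsilon> k \<le> q \<longleftrightarrow> \<alpha> ! (k - 1) = Minus) \<and>
      inv_on {1..p + q} (cell_perm p q \<epsilon>) = p * q \<and>
      e = map \<epsilon> [1..<p + q + 1] \<and> w = map (cell_perm p q \<epsilon>) [1..<p + q + 1]"
  proof (intro exI[of _ "\<lambda>k. e ! (k - 1)"] conjI ballI)
    show "e = map (\<lambda>k. e ! (k - 1)) [1..<p + q + 1]" by (rule map_nth_list[OF a(1) refl])
    show "w = map (cell_perm p q (\<lambda>k. e ! (k - 1))) [1..<p + q + 1]" by (rule map_nth_list[OF a(2) a(5)])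
  qed (use a in auto)
next
  assume "\<exists>\<epsilon>. bij_betw \<epsilon> {1..p + q} {1..p + q} \<and> (\<forall>k\<in>{1..p + q}. \<epsilon> k \<le> q \<longleftrightarrow> \<alpha> ! (k - 1) = Minus) \<and>
      inv_on {1..p + q} (cell_perm p q \<epsilon>) = p * q \<and>
      e = map \<epsilon> [1..<p + q + 1] \<and> w = map (cell_perm p q \<epsilon>) [1..<p + q + 1]"
  then show "algorithm_output p q \<alpha> e w" using coordinate_flag_algorithm[OF q_le_p _ len] by blast
qed

lemma basis_flag_e_vec: "basis_flag (map e_vec (map \<epsilon> [1..<p + q + 1])) = act (perm_mat \<epsilon>) (std_flag :: 'n flag)"
proof -
  have "basis_flag (map e_vec (map \<epsilon> [1..<p + q + 1])) =
      act (colmat (\<lambda>k. e_vec (map \<epsilon> [1..<p + q + 1] ! (k - 1)))) (std_flag :: 'n flag)"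
    by (rule basis_flag_map) (simp add: card_n del: upt_Suc)
  also have "colmat (\<lambda>k. e_vec (map \<epsilon> [1..<p + q + 1] ! (k - 1))) = (perm_mat \<epsilon> :: 'n cmat)"
    by (rule mat_eqI) (simp add: card_n del: upt_Suc)
  finally show ?thesis .
qed

lemma coordinate_flag_cycle:
  assumes "length \<alpha> = p + q" "bij_betw \<epsilon> {1..p + q} {1..p + q}" "\<And>k. k \<in> {1..p + q} \<Longrightarrow> \<epsilon> k \<le> q \<longleftrightarrow> \<alpha> ! (k - 1) = Minus"
  shows "act (perm_mat \<epsilon>) (std_flag :: 'n flag) \<in> cycle \<alpha>"
proof -
  have "invertible (perm_mat \<epsilon> :: 'n cmat)" using assms(2) by (intro invertible_perm_mat) (simp add: card_n)
  then show ?thesis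
    using eigenframe_cycle[OF _ _ assms(1)] coordinate_eigenframe[OF assms(2,3)] by (simp add: perm_mat_def)
qed

lemma cell_nth:
  assumes "bij_betw f {1..p + q} {1..p + q}"
  shows "cell U (\<lambda>k. map f [1..<p + q + 1] ! (k - 1)) = (cell U f :: 'n flag set)"
proof -
  have "bruhat (\<lambda>k. map f [1..<p + q + 1] ! (k - 1)) = (bruhat f :: 'n cmat set)"
    by (rule bruhat_cong) (auto simp: card_n simp del: upt_Suc)
  then show ?thesis by (simp add: cell_def)
qed

text \<open>As the orbit of \<open>SU p q\<close> is open, meeting the closure of a cell means
  meeting the cell itself; the Iwasawa decomposition then moves the common point into the base
  cycle.\<close>

lemma meets_orbit_imp_cell:
  assumes w: "w \<in> permutations_of_set {1..p + q}" and len: "length \<alpha> = p + q"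
    and V: "schubert_variety p q w \<inter> sign_orbit p q \<alpha> \<noteq> ({} :: 'n flag set)"
  obtains W where "W \<in> cycle \<alpha>" "W \<in> (cell U (\<lambda>k. w ! (k - 1)) :: 'n flag set)"
proof -
  obtain V :: "'n flag" where "V \<in> flag_topology closure_of cell U (\<lambda>k. w ! (k - 1))" "V \<in> sign_orbit p q \<alpha>"
    using V schubert_variety_eq[OF w] by auto
  then obtain V' where "V' \<in> cell U (\<lambda>k. w ! (k - 1))" "V' \<in> sign_orbit p q \<alpha>"
    using open_sign_orbit[OF len] unfolding in_closure_of by blast
  then show ?thesis using iwasawa_decomposition[OF _ _ len] that by blast
qed

lemma schubert_output:
  assumes len: "length \<alpha> = p + q" and cnt: "count_list \<alpha> Minus = q"
  shows "{w \<in> permutations_of_set {1..p + q}.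
            schubert_variety p q w \<inter> sign_orbit p q \<alpha> \<noteq> ({} :: 'n flag set) \<and>
            has_complex_dim (schubert_variety p q w :: 'n flag set) (p * q)} =
         {w. \<exists>e. algorithm_output p q \<alpha> e w}"
proof (intro equalityI subsetI)
  fix w assume "w \<in> {w \<in> permutations_of_set {1..p + q}.
            schubert_variety p q w \<inter> sign_orbit p q \<alpha> \<noteq> ({} :: 'n flag set) \<and>
            has_complex_dim (schubert_variety p q w :: 'n flag set) (p * q)}"
  then have w: "w \<in> permutations_of_set {1..p + q}"
    and meets: "schubert_variety p q w \<inter> sign_orbit p q \<alpha> \<noteq> ({} :: 'n flag set)"
    and dim: "has_complex_dim (schubert_variety p q w :: 'n flag set) (p * q)" by auto
  let ?w = "\<lambda>k. w ! (k - 1)"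
  note bij = perm_bij[OF w]
  obtain W where W: "W \<in> cycle \<alpha>" "W \<in> (cell U ?w :: 'n flag set)" using meets_orbit_imp_cell[OF w len meets] .
  have inv: "inv_on {1..CARD('n)} ?w = p * q"
    using dim has_complex_dim_closure_cell[OF invertible_U bij] unfolding schubert_variety_eq[OF w] by simp
  obtain \<epsilon> where \<epsilon>: "bij_betw \<epsilon> {1..p + q} {1..p + q}" "\<And>k. k \<in> {1..p + q} \<Longrightarrow> \<epsilon> k \<le> q \<longleftrightarrow> \<alpha> ! (k - 1) = Minus"
    "W = act (perm_mat \<epsilon>) std_flag" using extremal_coordinate_flag[OF W len bij inv] by blast
  have bij': "bij_betw (cell_perm p q \<epsilon>) {1..CARD('n)} {1..CARD('n)}" using cell_perm_bij[OF q_le_p \<epsilon>(1)] by (simp add: card_n)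
  have "W \<in> cell U (cell_perm p q \<epsilon>)" unfolding \<epsilon>(3) by (rule coordinate_flag_cell[OF \<epsilon>(1)])
  then have eq: "?w k = cell_perm p q \<epsilon> k" if "k \<in> {1..p + q}" for k
    using cell_unique[OF bij' bij _ W(2)] that by (simp add: card_n)
  have "length w = p + q" using length_finite_permutations_of_set[OF w] by simp
  then have "w = map (cell_perm p q \<epsilon>) [1..<p + q + 1]" by (rule map_nth_list[OF _ eq])
  moreover have "inv_on {1..p + q} (cell_perm p q \<epsilon>) = p * q"
    using inv inv_on_cong[of "{1..p + q}" ?w "cell_perm p q \<epsilon>"] eq by (simp add: card_n)
  ultimately show "w \<in> {w. \<exists>e. algorithm_output p q \<alpha> e w}"
    using algorithm_output_iff[OF len cnt] \<epsilon>(1,2) by blast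
next
  fix w assume "w \<in> {w. \<exists>e. algorithm_output p q \<alpha> e w}"
  then obtain \<epsilon> where \<epsilon>: "bij_betw \<epsilon> {1..p + q} {1..p + q}" "\<And>k. k \<in> {1..p + q} \<Longrightarrow> \<epsilon> k \<le> q \<longleftrightarrow> \<alpha> ! (k - 1) = Minus"
      "inv_on {1..p + q} (cell_perm p q \<epsilon>) = p * q" "w = map (cell_perm p q \<epsilon>) [1..<p + q + 1]"
    unfolding algorithm_output_iff[OF len cnt] by blast
  note bij = cell_perm_bij[OF q_le_p \<epsilon>(1)]
  have w: "w \<in> permutations_of_set {1..p + q}" unfolding \<epsilon>(4) by (rule perm_list_map[OF bij])
  have S: "schubert_variety p q w = flag_topology closure_of (cell U (cell_perm p q \<epsilon>) :: 'n flag set)"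
    unfolding schubert_variety_eq[OF w] unfolding \<epsilon>(4) cell_nth[OF bij] ..
  have bij': "bij_betw (cell_perm p q \<epsilon>) {1..CARD('n)} {1..CARD('n)}" using bij by (simp add: card_n)
  have "act (perm_mat \<epsilon>) (std_flag :: 'n flag) \<in> flag_topology closure_of (cell U (cell_perm p q \<epsilon>))"
    using coordinate_flag_cell[OF \<epsilon>(1)] closure_of_subset[of "cell U (cell_perm p q \<epsilon>)" flag_topology] cell_complete_flags
    by auto
  moreover have "act (perm_mat \<epsilon>) (std_flag :: 'n flag) \<in> sign_orbit p q \<alpha>"
    using coordinate_flag_cycle[OF len \<epsilon>(1,2)] by (simp add: cycle_def)
  moreover have "has_complex_dim (schubert_variety p q w :: 'n flag set) (p * q)"
    unfolding S has_complex_dim_closure_cell[OF invertible_U bij'] using \<epsilon>(3) by (simp add: card_n)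
  ultimately show "w \<in> {w \<in> permutations_of_set {1..p + q}.
            schubert_variety p q w \<inter> sign_orbit p q \<alpha> \<noteq> ({} :: 'n flag set) \<and>
            has_complex_dim (schubert_variety p q w :: 'n flag set) (p * q)}"
    using w S by blast
qed

text \<open>A boundary point would lie in a cell with fewer than \<open>p * q\<close> inversions,
  which \<open>cycle_cell\<close> excludes for the base cycle. In the open cell the point is a
  coordinate flag, and its permutation together with the signs of \<alpha> determines it by
  \<open>cell_perm_inject\<close>.\<close>

lemma schubert_cycle:
  assumes len: "length \<alpha> = p + q" and cnt: "count_list \<alpha> Minus = q" and out: "algorithm_output p q \<alpha> e w"
  shows "schubert_variety p q w \<inter> base_cycle p q (sign_orbit p q \<alpha>) = {basis_flag (map e_vec e) :: 'n flag}"
proof -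
  obtain \<epsilon> where \<epsilon>: "bij_betw \<epsilon> {1..p + q} {1..p + q}" "\<And>k. k \<in> {1..p + q} \<Longrightarrow> \<epsilon> k \<le> q \<longleftrightarrow> \<alpha> ! (k - 1) = Minus"
      "inv_on {1..p + q} (cell_perm p q \<epsilon>) = p * q" "e = map \<epsilon> [1..<p + q + 1]" "w = map (cell_perm p q \<epsilon>) [1..<p + q + 1]"
    using out unfolding algorithm_output_iff[OF len cnt] by blast
  note bij = cell_perm_bij[OF q_le_p \<epsilon>(1)]
  have w: "w \<in> permutations_of_set {1..p + q}" unfolding \<epsilon>(5) by (rule perm_list_map[OF bij])
  have S: "schubert_variety p q w = flag_topology closure_of (cell U (cell_perm p q \<epsilon>) :: 'n flag set)"
    unfolding schubert_variety_eq[OF w] unfolding \<epsilon>(5) cell_nth[OF bij] ..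
  have bij': "bij_betw (cell_perm p q \<epsilon>) {1..CARD('n)} {1..CARD('n)}" using bij by (simp add: card_n)
  have inv: "inv_on {1..CARD('n)} (cell_perm p q \<epsilon>) = p * q" using \<epsilon>(3) by (simp add: card_n)
  let ?E = "act (perm_mat \<epsilon>) (std_flag :: 'n flag)"
  have "V = ?E" if V: "V \<in> cycle \<alpha>" "V \<in> flag_topology closure_of cell U (cell_perm p q \<epsilon>)" for V
  proof -
    have Vf: "V \<in> complete_flags" using V(1) by (simp add: cycle_def sign_orbit_def)
    obtain x where x: "bij_betw x {1..CARD('n)} {1..CARD('n)}" "V \<in> cell U x" using cell_exists[OF invertible_U Vf] .
    have "p * q \<le> inv_on {1..CARD('n)} x" by (rule cycle_cell(1)[OF V(1) x(2) len x(1)])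
    then have VC: "V \<in> cell U (cell_perm p q \<epsilon>)"
      using closure_cell_inv_on[OF invertible_U bij' V(2) _ x] inv by fastforce
    obtain \<delta> where \<delta>: "bij_betw \<delta> {1..p + q} {1..p + q}" "\<And>k. k \<in> {1..p + q} \<Longrightarrow> \<delta> k \<le> q \<longleftrightarrow> \<alpha> ! (k - 1) = Minus"
      "V = act (perm_mat \<delta>) std_flag" using extremal_coordinate_flag[OF V(1) VC len bij' inv] by blast
    have bij_\<delta>: "bij_betw (cell_perm p q \<delta>) {1..CARD('n)} {1..CARD('n)}" using cell_perm_bij[OF q_le_p \<delta>(1)] by (simp add: card_n)
    have "V \<in> cell U (cell_perm p q \<delta>)" unfolding \<delta>(3) by (rule coordinate_flag_cell[OF \<delta>(1)])
    then have eq: "cell_perm p q \<epsilon> k = cell_perm p q \<delta> k" if "k \<in> {1..p + q}" for k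
      using cell_unique[OF bij_\<delta> bij' _ VC] that by (simp add: card_n)
    have "\<epsilon> k = \<delta> k" if k: "k \<in> {1..p + q}" for k
      by (rule cell_perm_inject[OF q_le_p \<epsilon>(1) \<delta>(1) _ eq[OF k] k]) (simp only: \<epsilon>(2)[OF k] \<delta>(2)[OF k])
    then have "(perm_mat \<epsilon> :: 'n cmat) = perm_mat \<delta>" by (intro mat_eqI) (simp add: card_n)
    then show ?thesis using \<delta>(3) by simp
  qed
  moreover have "?E \<in> flag_topology closure_of cell U (cell_perm p q \<epsilon>)"
    using coordinate_flag_cell[OF \<epsilon>(1)] closure_of_subset[of "cell U (cell_perm p q \<epsilon>)" flag_topology] cell_complete_flags
    by auto
  moreover have "?E \<in> cycle \<alpha>" by (rule coordinate_flag_cycle[OF len \<epsilon>(1,2)])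
  ultimately show ?thesis unfolding S base_cycle_eq[OF len cnt] \<epsilon>(4) basis_flag_e_vec by blast
qed

lemma intersection_points_eq:
  assumes len: "length \<alpha> = p + q" and cnt: "count_list \<alpha> Minus = q"
  shows "intersection_points p q (sign_orbit p q \<alpha>) =
    {basis_flag (map e_vec e) :: 'n flag | e w. algorithm_output p q \<alpha> e w}"
proof -
  have "{w \<in> permutations_of_set {1..p + q}. has_complex_dim (schubert_variety p q w :: 'n flag set) (p * q) \<and>
      schubert_variety p q w \<inter> sign_orbit p q \<alpha> \<noteq> ({} :: 'n flag set)} = {w. \<exists>e. algorithm_output p q \<alpha> e w}"
    unfolding schubert_output[OF len cnt, symmetric] by blast
  then have "intersection_points p q (sign_orbit p q \<alpha>) =
      (\<Union>w\<in>{w. \<exists>e. algorithm_output p q \<alpha> e w}. schubert_variety p q w \<inter> base_cycle p q (sign_orbit p q \<alpha> :: 'n flag set))"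
    unfolding intersection_points_def by simp
  also have "\<dots> = {basis_flag (map e_vec e) :: 'n flag | e w. algorithm_output p q \<alpha> e w}"
    using schubert_cycle[OF len cnt] by blast
  finally show ?thesis .
qed

lemma output_flag:
  assumes len: "length \<alpha> = p + q" and cnt: "count_list \<alpha> Minus = q" and out: "algorithm_output p q \<alpha> e w"
  shows "(basis_flag (map e_vec e) :: 'n flag) \<in> torus_fixed_points \<inter> sign_orbit p q \<alpha>"
proof -
  obtain \<epsilon> where \<epsilon>: "bij_betw \<epsilon> {1..p + q} {1..p + q}" "\<And>k. k \<in> {1..p + q} \<Longrightarrow> \<epsilon> k \<le> q \<longleftrightarrow> \<alpha> ! (k - 1) = Minus"
      "e = map \<epsilon> [1..<p + q + 1]"
    using out unfolding algorithm_output_iff[OF len cnt] by blast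
  let ?E = "act (perm_mat \<epsilon>) (std_flag :: 'n flag)"
  have cyc: "?E \<in> cycle \<alpha>" by (rule coordinate_flag_cycle[OF len \<epsilon>(1,2)])
  then have Ef: "?E \<in> complete_flags" by (simp add: cycle_def sign_orbit_def)
  have "act t ?E = ?E" if t: "t \<in> diagonal_torus" for t
  proof (rule complete_flag_eqI)
    have "det t = 1" using t by (simp add: diagonal_torus_def)
    then have "invertible t" by (simp add: invertible_det_nz)
    then show "act t ?E \<in> complete_flags" using Ef by (rule act_complete_flags)
    show "act t ?E k \<subseteq> ?E k" for k
    proof -
      have sub: "\<epsilon> ` {1..min k CARD('n)} \<subseteq> {1..CARD('n)}" using \<epsilon>(1) by (fastforce simp: bij_betw_def card_n)
      have tx: "(t *v x) $ a = t $ a $ a * x $ a" for x a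
        using t by (intro diagonal_mult) (simp add: diagonal_torus_def)
      show ?thesis unfolding act_def[of t] unfolding act_perm_mat span_e_vec[OF sub] by (auto simp: tx)
    qed
  qed (rule Ef)
  then have "?E \<in> torus_fixed_points" using Ef by (simp add: torus_fixed_points_def)
  then show ?thesis using cyc unfolding \<epsilon>(3) basis_flag_e_vec by (simp add: cycle_def)
qed

end

theorem theorem41:
  fixes p q :: nat and \<alpha> :: "sign list"
  assumes "p \<ge> q" and "q \<ge> 1"
    and "CARD('n::{finite,wellorder}) = p + q"
    and "count_list \<alpha> Minus = q" and "count_list \<alpha> Plus = p"
  shows "{w \<in> permutations_of_set {1..p + q}.
            schubert_variety p q w \<inter> sign_orbit p q \<alpha> \<noteq> ({} :: 'n flag set) \<and>
            has_complex_dim (schubert_variety p q w :: 'n flag set) (p * q)} =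
         {w. \<exists>e. algorithm_output p q \<alpha> e w} \<and>
         (\<forall>e w. algorithm_output p q \<alpha> e w \<longrightarrow>
            schubert_variety p q w \<inter> base_cycle p q (sign_orbit p q \<alpha>) =
              {basis_flag (map e_vec e) :: 'n flag}) \<and>
         intersection_points p q \<in> (open_orbits p q :: 'n flag set set) \<rightarrow> Pow torus_fixed_points \<and>
         inj_on (intersection_points p q) (open_orbits p q :: 'n flag set set)"
proof -
  interpret iwasawa p q "TYPE('n)" using assms by unfold_locales auto
  have "length \<alpha> = count_list \<alpha> Minus + count_list \<alpha> Plus"
  proof (induction \<alpha>)
    case (Cons s \<alpha>)
    then show ?case by (cases s) auto
  qed simp
  then have len: "length \<alpha> = p + q" using assms by simp
  have maps: "intersection_points p q \<in> (open_orbits p q :: 'n flag set set) \<rightarrow> Pow torus_fixed_points"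
  proof
    fix D :: "'n flag set" assume "D \<in> open_orbits p q"
    then obtain \<beta> where \<beta>: "length \<beta> = p + q" "count_list \<beta> Minus = q" "D = sign_orbit p q \<beta>" using open_orbitsE by metis
    show "intersection_points p q D \<in> Pow torus_fixed_points"
      unfolding \<beta>(3) intersection_points_eq[OF \<beta>(1,2)] using output_flag[OF \<beta>(1,2)] by auto
  qed
  have inj: "inj_on (intersection_points p q) (open_orbits p q :: 'n flag set set)"
  proof (rule inj_onI)
    fix D D' :: "'n flag set"
    assume "D \<in> open_orbits p q" "D' \<in> open_orbits p q" and eq: "intersection_points p q D = intersection_points p q D'"
    then obtain \<beta> \<gamma> where \<beta>: "length \<beta> = p + q" "count_list \<beta> Minus = q" "count_list \<beta> Plus = p" "D = sign_orbit p q \<beta>"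
      and \<gamma>: "length \<gamma> = p + q" "count_list \<gamma> Minus = q" "D' = sign_orbit p q \<gamma>" using open_orbitsE by metis
    \<comment> \<open>An intersection point lies in its open orbit and so determines the signs; one
      common point of the two sets is enough.\<close>
    obtain e w where ew: "algorithm_output p q \<beta> e w" using algorithm_exists[OF \<beta>(1-3) q_le_p] by blast
    then have "(basis_flag (map e_vec e) :: 'n flag) \<in> intersection_points p q D"
      unfolding \<beta>(4) intersection_points_eq[OF \<beta>(1,2)] by blast
    then obtain e' w' where ew': "algorithm_output p q \<gamma> e' w'" "(basis_flag (map e_vec e) :: 'n flag) = basis_flag (map e_vec e')"
      unfolding eq \<gamma>(3) intersection_points_eq[OF \<gamma>(1,2)] by blast
    have "(basis_flag (map e_vec e) :: 'n flag) \<in> sign_orbit p q \<beta>" "(basis_flag (map e_vec e) :: 'n flag) \<in> sign_orbit p q \<gamma>"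
      using output_flag[OF \<beta>(1,2) ew] output_flag[OF \<gamma>(1,2) ew'(1)] ew'(2) by auto
    then have "\<beta> = \<gamma>" using sign_orbit_unique \<beta>(1) \<gamma>(1) by blast
    then show "D = D'" using \<beta>(4) \<gamma>(3) by simp
  qed
  show ?thesis using schubert_output[OF len assms(4)] schubert_cycle[OF len assms(4)] maps inj by blast
qed

end
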